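(* Let $((Y_{n,t},X_{n,t})_{t\in\{1,\dots,n\}})_{n\in\mathbb{N}}$ satisfy the asymptotic change point model and multivariate normality assumptions, let $S\subseteq\{1,\dots,d\}$, let $\alpha\in(0,1)$ and let $(\mathcal{E}_n)_{n\in\mathbb{N}}$ be a sequence of collections of pairwise disjoint non-empty environments with the properties (C1), (C2) and (C3,$k$) defined in the context. Assume that for all $n\in\mathbb{N}$ it holds that $(\mathbf{Y}_n,\mathbf{X}_n)\sim P_n\in H^n_{A,S}(a_n,b_n)$, where $a_n$ and $b_n$ satisfy $$\frac{|\mathcal{E}_n|^{1/k}}{\sqrt{r_n}}=o(a_n)\quad\text{or}\quad\frac{|\mathcal{E}_n|^{1/k}}{\sqrt{r_n}}=o(b_n)\qquad(n\to\infty).$$ Then $$\lim_{n\to\infty}\lim_{B\to\infty}\mathbb{P}_{P_n}\left(\varphi_{\mathrm{decoupled},B}(\mathbf{Y}_n,\mathbf{X}^S_n)=1\right)=1 .$$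
   Context: Notation: for each $n$, $\mathbf{Y}_n=(Y_{n,1},\dots,Y_{n,n})^\top\in\mathbb{R}^n$ and $\mathbf{X}_n\in\mathbb{R}^{n\times d}$ has rows $X_{n,t}\in\mathbb{R}^{1\times d}$; the index $n$ is often dropped. For $S\subseteq\{1,\dots,d\}$ a superscript $S$ means restriction to the columns in $S$; for an environment $e\subseteq\{1,\dots,n\}$ a subscript $e$ means restriction to the rows in $e$; $|e|$ is the cardinality. Intercepts are neglected (they may be absorbed by a constant term in $X$). Change points: for $\mathrm{CP}=(t_1,\dots,t_L)\in\{1,\dots,n-1\}^L$ with $t_1<\dots<t_L$ let $e_1(\mathrm{CP})=\{1,\dots,t_1\}$, $e_i(\mathrm{CP})=\{t_{i-1}+1,\dots,t_i\}$ for $1<i\le L$, $e_{L+1}(\mathrm{CP})=\{t_L+1,\dots,n\}$, and $\mathcal{E}(\mathrm{CP})=\{e_1(\mathrm{CP}),\dots,e_{L+1}(\mathrm{CP})\}$. Asymptotic change point model: there exist a fixed $L$, fixed relative change points $\alpha^*_1,\dots,\alpha^*_L\in(0,1)$ and true change points $\mathrm{CP}^*_n=(t^*_{n,1},\dots,t^*_{n,L})$ with $\lim_{n\to\infty}t^*_{n,i}/n=\alpha^*_i$ for all $i$; and for all $i\in\{1,\dots,L+1\}$ the variables $(Y_{n,t},X_{n,t})_{t\in e_i(\mathrm{CP}^*_n)}$ are i.i.d. with some fixed distribution $F_{n,i}$. Multivariate normality: for all $n$ and all $e\in\mathcal{E}(\mathrm{CP}^*_n)$, $(Y_{n,t},X_{n,t})_{t\in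 e}$ is multivariate normal. Consequently for every $S$ and every $e\in\mathcal{E}(\mathrm{CP}^*_n)$ there are unique $\beta_{e,S},\sigma_{e,S}$ with $Y_t=X^S_t\beta_{e,S}+\epsilon_t$ for all $t\in e$, where $\epsilon_t\sim\mathcal{N}(0,\sigma^2_{e,S})$ is independent of $X^S_t$. For $f\subseteq e\in\mathcal{E}(\mathrm{CP}^*_n)$ put $\beta_{f,S}=\beta_{e,S}$, $\sigma_{f,S}=\sigma_{e,S}$. Alternatives: $H^n_{A,S}(a,b)$ is the set of laws $P$ such that for $(\mathbf{Y}_n,\mathbf{X}_n)\sim P$ there exist $i,j\in\{1,\dots,L+1\}$ with $a=|\sigma^2_{e_i(\mathrm{CP}^*_n),S}-\sigma^2_{e_j(\mathrm{CP}^*_n),S}|>0$ and $b=\|\beta_{e_i(\mathrm{CP}^*_n),S}-\beta_{e_j(\mathrm{CP}^*_n),S}\|_2>0$. Conditions on $\mathcal{E}_n\subseteq\mathcal{P}(\{1,\dots,n\})$: (C1) $r_n:=\min_{e\in\mathcal{E}_n}|e|$ satisfies $\lim_{n\to\infty}r_n=\infty$. (C2) For all $i\in\{1,\dots,L+1\}$ there are a sequence $(f_n)$ with $f_n\in\mathcal{E}_n$ and $N\in\mathbb{N}$ such that $f_n\subseteq e_i(\mathrm{CP}^*_n)$ for all $n\ge N$, the sequences $(\sigma^2_{f_n,S})$ and $(\beta_{f_n,S})$ converge, and $\lim_{n\to\infty}\sigma^2_{f_n,S}>0$. (C3,$k$) ($k\in\mathbb{N}$) For all $e_n\in\mathcal{E}_n$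 the matrix $\frac{1}{|e_n|}\mathbf{X}_{e_n}^\top\mathbf{X}_{e_n}$ is a.s. invertible, and there are constants $c,C$ such that for all $n$ and all $e_n\in\mathcal{E}_n$, $0<c\le\mathbb{E}\big(\lambda_{\min}(\tfrac{1}{|e_n|}\mathbf{X}_{e_n}^\top\mathbf{X}_{e_n})^{2k}\big)\le\mathbb{E}\big(\lambda_{\max}(\tfrac{1}{|e_n|}\mathbf{X}_{e_n}^\top\mathbf{X}_{e_n})^{2k}\big)\le C<\infty$. Scaled residuals and test statistics: with $\mathbf{P}^S_{\mathbf{X}}=\mathbf{X}^S((\mathbf{X}^S)^\top\mathbf{X}^S)^{-1}(\mathbf{X}^S)^\top$, $\widetilde{\mathbf{R}}^S=(\mathbf{Id}-\mathbf{P}^S_{\mathbf{X}})\mathbf{Y}/\|(\mathbf{Id}-\mathbf{P}^S_{\mathbf{X}})\mathbf{Y}\|_2$. For $h\subseteq\{1,\dots,n\}$ let $\hat\gamma_{h,S}=((\mathbf{X}^S_h)^\top\mathbf{X}^S_h)^{-1}(\mathbf{X}^S_h)^\top\widetilde{\mathbf{R}}^S_h$ and $\hat s^2_{h,S}=\|\widetilde{\mathbf{R}}^S_h-\mathbf{X}^S_h\hat\gamma_{h,S}\|_2^2/|h|$. Let $T^1_{e,f}(\widetilde{\mathbf{R}}^S)=\|\hat\gamma_{e,S}-\hat\gamma_{f,S}\|_2$ and $T^2_{e,f}(\widetilde{\mathbf{R}}^S)=\hat s^2_{e,S}/\hat s^2_{f,S}-1$. With $\mathcal{F}^1(\mathcal{E}_n)=\{(e,f)\in\mathcal{E}_n\times\mathcal{E}_n: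 e\cap f=\varnothing\}$, let $T_i^{\max,\mathcal{F}^1(\mathcal{E}_n)}(\widetilde{\mathbf{R}}^S)=\max_{(e,f)\in\mathcal{F}^1(\mathcal{E}_n)}|T^i_{e,f}(\widetilde{\mathbf{R}}^S)|$. Resampling tests: for a statistic $T$ of the scaled residuals (which may depend on $\mathbf{X}^S$), $B\in\mathbb{N}$ and level $\alpha'\in(0,1)$: draw i.i.d. $\tilde{\boldsymbol\epsilon}_b\sim\mathcal{N}(\mathbf{0},\mathbf{Id})$, $b=1,\dots,B$, independent of the data, set $\widetilde{\mathbf{R}}^{S}_b=(\mathbf{Id}-\mathbf{P}^S_{\mathbf{X}})\tilde{\boldsymbol\epsilon}_b/\|(\mathbf{Id}-\mathbf{P}^S_{\mathbf{X}})\tilde{\boldsymbol\epsilon}_b\|_2$, let $c_{T,B}$ be the $\lceil B(1-\alpha')\rceil$-th smallest value of $|T(\widetilde{\mathbf{R}}^{S}_1)|,\dots,|T(\widetilde{\mathbf{R}}^{S}_B)|$ and let $\varphi_{T,B}=\mathbf{1}\{|T(\widetilde{\mathbf{R}}^S)|>c_{T,B}\}$. The decoupled test $\varphi_{\mathrm{decoupled},B}$ at level $\alpha$ equals $1$ (rejects) if and only if at least one of $\varphi_{T_1^{\max,\mathcal{F}^1(\mathcal{E}_n)},B}$, $\varphi_{T_2^{\max,\mathcal{F}^1(\mathcal{E}_n)},B}$, each performed at level $\alpha/2$, equals $1$. *)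

theory Defs
  imports
    "HOL-Probability.Probability"
    "HOL-Library.Landau_Symbols"
    "Jordan_Normal_Form.DL_Submatrix"
    "Jordan_Normal_Form.Gauss_Jordan_Elimination"
    "Jordan_Normal_Form.Char_Poly"
begin

unbundle no vec_syntax
unbundle no inner_syntax

text \<open>
  Time points, columns and segments are numbered from 0: the time points of a sample of size \<open>n\<close>
  are \<open>{..<n}\<close>, the columns are \<open>{..<d}\<close> and the segments between \<open>L\<close> change points are
  numbered by \<open>{..L}\<close>. Under this shift a segment with time points \<open>s + 1, ..., t\<close> is the set \<open>{s..<t}\<close>,
  so the change points themselves keep their numerical values.
\<close>

subsection \<open>Vectors and matrices\<close>

definition l2norm :: "real vec \<Rightarrow> real" where
  "l2norm v = sqrt (v \<bullet> v)"

definition subvector :: "'a vec \<Rightarrow> nat set \<Rightarrow> 'a vec" where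
  "subvector v I = vec (card {i. i < dim_vec v \<and> i \<in> I}) (\<lambda>i. v $ pick I i)"

text \<open>The inverse, made total by the value 0 on singular matrices.\<close>

definition inv_mat :: "real mat \<Rightarrow> real mat" where
  "inv_mat A = (case mat_inverse A of Some B \<Rightarrow> B | None \<Rightarrow> 0\<^sub>m (dim_row A) (dim_col A))"

definition lambda_min :: "real mat \<Rightarrow> real" where
  "lambda_min A = Min {l. eigenvalue A l}"

definition lambda_max :: "real mat \<Rightarrow> real" where
  "lambda_max A = Max {l. eigenvalue A l}"

text \<open>\<open>X\<^sup>S\<close> and \<open>X\<^sub>e\<close>.\<close>

definition restrict_cols :: "real mat \<Rightarrow> nat set \<Rightarrow> real mat" where
  "restrict_cols X S = submatrix X UNIV S"

definition restrict_rows :: "real mat \<Rightarrow> nat set \<Rightarrow> real mat" where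
  "restrict_rows X e = submatrix X e UNIV"


subsection \<open>Change points\<close>

definition change_points :: "nat \<Rightarrow> nat list \<Rightarrow> bool" where
  "change_points n cp \<longleftrightarrow> sorted_wrt (<) cp \<and> set cp \<subseteq> {1..n - 1}"

definition seg :: "nat \<Rightarrow> nat list \<Rightarrow> nat \<Rightarrow> nat set" where
  "seg n cp i = {(0 # cp @ [n]) ! i ..< (0 # cp @ [n]) ! Suc i}"

definition segs :: "nat \<Rightarrow> nat list \<Rightarrow> nat set set" where
  "segs n cp = seg n cp ` {..length cp}"


subsection \<open>The data\<close>

text \<open>The pair \<open>(Y\<^sub>t, X\<^sub>t)\<close> as a random variable with values in \<open>\<real> \<times> \<real>\<^sup>d\<close>.\<close>

definition row_space :: "nat \<Rightarrow> (real \<times> (nat \<Rightarrow> real)) measure" where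
  "row_space d = borel \<Otimes>\<^sub>M Pi\<^sub>M {..<d} (\<lambda>_. borel)"

definition obs :: "nat \<Rightarrow> ('a \<Rightarrow> real vec) \<Rightarrow> ('a \<Rightarrow> real mat) \<Rightarrow> nat \<Rightarrow> 'a \<Rightarrow> real \<times> (nat \<Rightarrow> real)" where
  "obs d Y X t \<omega> = (Y \<omega> $ t, \<lambda>j\<in>{..<d}. X \<omega> $$ (t, j))"

definition iid_rows :: "'a measure \<Rightarrow> nat \<Rightarrow> ('a \<Rightarrow> real vec) \<Rightarrow> ('a \<Rightarrow> real mat) \<Rightarrow> nat set \<Rightarrow> bool" where
  "iid_rows M d Y X e \<longleftrightarrow>
     prob_space.indep_vars M (\<lambda>_. row_space d) (obs d Y X) e \<and>
     (\<exists>F. \<forall>t\<in>e. distr M (row_space d) (obs d Y X t) = F)"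

text \<open>Independence of two random variables with values in spaces of possibly different type.\<close>

definition indep_rv ::
    "'a measure \<Rightarrow> 'b measure \<Rightarrow> ('a \<Rightarrow> 'b) \<Rightarrow> 'c measure \<Rightarrow> ('a \<Rightarrow> 'c) \<Rightarrow> bool" where
  "indep_rv M N1 U N2 V \<longleftrightarrow>
     U \<in> measurable M N1 \<and> V \<in> measurable M N2 \<and>
     prob_space.indep_set M {U -` A \<inter> space M |A. A \<in> sets N1} {V -` A \<inter> space M |A. A \<in> sets N2}"

text \<open>The law \<open>\<N>(m, s\<^sup>2)\<close>, which is the point mass at \<open>m\<close> for \<open>s = 0\<close>.\<close>

definition normal_law :: "real \<Rightarrow> real \<Rightarrow> real measure" where
  "normal_law m s = (if s = 0 then return borel m else density lborel (normal_density m s))"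

text \<open>
  Multivariate normality of \<open>(Y\<^sub>t, X\<^sub>t)\<^bsub>t \<in> e\<^esub>\<close>: every linear combination of the coordinates is normal.
  Singular covariance matrices are admitted, so \<open>X\<close> may contain a constant column.
\<close>

definition normal_rows :: "'a measure \<Rightarrow> nat \<Rightarrow> ('a \<Rightarrow> real vec) \<Rightarrow> ('a \<Rightarrow> real mat) \<Rightarrow> nat set \<Rightarrow> bool" where
  "normal_rows M d Y X e \<longleftrightarrow>
     (\<forall>a c. \<exists>m s. 0 \<le> s \<and>
        distr M borel (\<lambda>\<omega>. \<Sum>t\<in>e. a t * (Y \<omega> $ t) + (\<Sum>j<d. c t j * (X \<omega> $$ (t, j)))) = normal_law m s)"

text \<open>
  \<open>Y\<^sub>t = X\<^sub>t\<^sup>S b + \<epsilon>\<^sub>t\<close> for all \<open>t \<in> e\<close>, with \<open>\<epsilon>\<^sub>t \<sim> \<N>(0, s\<^sup>2)\<close> independent of \<open>X\<^sub>t\<^sup>S\<close>.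
\<close>

definition regression ::
    "'a measure \<Rightarrow> ('a \<Rightarrow> real vec) \<Rightarrow> ('a \<Rightarrow> real mat) \<Rightarrow> nat set \<Rightarrow> nat set \<Rightarrow> real vec \<Rightarrow> real \<Rightarrow> bool" where
  "regression M Y X S e b s \<longleftrightarrow> b \<in> carrier_vec (card S) \<and> 0 \<le> s \<and>
     (\<forall>t\<in>e. let eps = (\<lambda>\<omega>. Y \<omega> $ t - row (restrict_cols (X \<omega>) S) t \<bullet> b) in
        distr M borel eps = normal_law 0 s \<and>
        indep_rv M borel eps (Pi\<^sub>M S (\<lambda>_. borel)) (\<lambda>\<omega>. \<lambda>j\<in>S. X \<omega> $$ (t, j)))"

text \<open>
  The parameters \<open>\<beta>\<^bsub>f,S\<^esub>\<close> and \<open>\<sigma>\<^bsub>f,S\<^esub>\<close> for a non-empty \<open>f \<subseteq> e \<in> Es\<close>, where \<open>Es\<close> is the family of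
  segments of the true change points; they are those of the segment \<open>e\<close>.
\<close>

definition reg_params ::
    "'a measure \<Rightarrow> ('a \<Rightarrow> real vec) \<Rightarrow> ('a \<Rightarrow> real mat) \<Rightarrow> nat set \<Rightarrow> nat set set \<Rightarrow> nat set \<Rightarrow> real vec \<times> real" where
  "reg_params M Y X S Es f = (THE p. \<exists>e\<in>Es. f \<subseteq> e \<and> regression M Y X S e (fst p) (snd p))"

definition beta where
  "beta M Y X S Es f = fst (reg_params M Y X S Es f)"

definition sigma where
  "sigma M Y X S Es f = snd (reg_params M Y X S Es f)"

definition change_point_model ::
    "nat \<Rightarrow> nat \<Rightarrow> real list \<Rightarrow> (nat \<Rightarrow> nat list) \<Rightarrow> (nat \<Rightarrow> 'a measure) \<Rightarrow>
     (nat \<Rightarrow> 'a \<Rightarrow> real vec) \<Rightarrow> (nat \<Rightarrow> 'a \<Rightarrow> real mat) \<Rightarrow> nat \<Rightarrow> bool" where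
  "change_point_model d L \<alpha>s cp M Y X n0 \<longleftrightarrow>
     length \<alpha>s = L \<and> set \<alpha>s \<subseteq> {0<..<1} \<and>
     (\<forall>n\<ge>n0. length (cp n) = L \<and> change_points n (cp n)) \<and>
     (\<forall>i<L. (\<lambda>n. real (cp n ! i) / real n) \<longlonglongrightarrow> \<alpha>s ! i) \<and>
     (\<forall>n\<ge>n0. \<forall>i\<le>L. iid_rows (M n) d (Y n) (X n) (seg n (cp n) i))"

text \<open>
  Since intercepts are neglected, the regression representation is part of this condition. It holds
  automatically if the means are zero; otherwise it says that the intercept is accounted for by \<open>X\<^sup>S\<close>.
\<close>

definition multivariate_normality ::
    "nat \<Rightarrow> nat set \<Rightarrow> (nat \<Rightarrow> nat list) \<Rightarrow> (nat \<Rightarrow> 'a measure) \<Rightarrow>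
     (nat \<Rightarrow> 'a \<Rightarrow> real vec) \<Rightarrow> (nat \<Rightarrow> 'a \<Rightarrow> real mat) \<Rightarrow> nat \<Rightarrow> bool" where
  "multivariate_normality d S cp M Y X n0 \<longleftrightarrow>
     (\<forall>n\<ge>n0. \<forall>e\<in>segs n (cp n).
        normal_rows (M n) d (Y n) (X n) e \<and>
        (\<exists>!p. regression (M n) (Y n) (X n) S e (fst p) (snd p)))"

text \<open>The law of the data under \<open>M\<close> belongs to \<open>H\<^bsub>A,S\<^esub>(a, b)\<close>.\<close>

definition H_A ::
    "nat \<Rightarrow> nat list \<Rightarrow> nat set \<Rightarrow> 'a measure \<Rightarrow> ('a \<Rightarrow> real vec) \<Rightarrow> ('a \<Rightarrow> real mat) \<Rightarrow> real \<Rightarrow> real \<Rightarrow> bool" where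
  "H_A n cp S M Y X a b \<longleftrightarrow>
     (\<exists>i\<le>length cp. \<exists>j\<le>length cp.
        a = \<bar>(sigma M Y X S (segs n cp) (seg n cp i))\<^sup>2 - (sigma M Y X S (segs n cp) (seg n cp j))\<^sup>2\<bar> \<and> a > 0 \<and>
        b = l2norm (beta M Y X S (segs n cp) (seg n cp i) - beta M Y X S (segs n cp) (seg n cp j)) \<and> b > 0)"


subsection \<open>Conditions on the environments\<close>

definition min_size :: "nat set set \<Rightarrow> nat" where
  "min_size E = Min (card ` E)"

definition C1 :: "(nat \<Rightarrow> nat set set) \<Rightarrow> bool" where
  "C1 E \<longleftrightarrow> filterlim (\<lambda>n. min_size (E n)) at_top sequentially"

definition C2 ::
    "nat \<Rightarrow> nat set \<Rightarrow> (nat \<Rightarrow> nat list) \<Rightarrow> (nat \<Rightarrow> 'a measure) \<Rightarrow> (nat \<Rightarrow> 'a \<Rightarrow> real vec) \<Rightarrow>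
     (nat \<Rightarrow> 'a \<Rightarrow> real mat) \<Rightarrow> (nat \<Rightarrow> nat set set) \<Rightarrow> bool" where
  "C2 L S cp M Y X E \<longleftrightarrow>
     (\<forall>i\<le>L. \<exists>f N v w.
        (\<forall>n\<ge>N. f n \<in> E n \<and> f n \<subseteq> seg n (cp n) i) \<and>
        (\<lambda>n. (sigma (M n) (Y n) (X n) S (segs n (cp n)) (f n))\<^sup>2) \<longlonglongrightarrow> v \<and> v > 0 \<and>
        (\<forall>j<card S. (\<lambda>n. beta (M n) (Y n) (X n) S (segs n (cp n)) (f n) $ j) \<longlonglongrightarrow> w j))"

definition gram :: "real mat \<Rightarrow> nat set \<Rightarrow> real mat" where
  "gram X e = (1 / real (card e)) \<cdot>\<^sub>m ((restrict_rows X e)\<^sup>T * restrict_rows X e)"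

definition C3 ::
    "nat \<Rightarrow> (nat \<Rightarrow> 'a measure) \<Rightarrow> (nat \<Rightarrow> 'a \<Rightarrow> real mat) \<Rightarrow> (nat \<Rightarrow> nat set set) \<Rightarrow> nat \<Rightarrow> bool" where
  "C3 k M X E n0 \<longleftrightarrow>
     (\<forall>n\<ge>n0. \<forall>e\<in>E n. AE \<omega> in M n. invertible_mat (gram (X n \<omega>) e)) \<and>
     (\<exists>c C::real. 0 < c \<and> (\<forall>n\<ge>n0. \<forall>e\<in>E n.
        ennreal c \<le> (\<integral>\<^sup>+\<omega>. ennreal (lambda_min (gram (X n \<omega>) e) ^ (2 * k)) \<partial>M n) \<and>
        (\<integral>\<^sup>+\<omega>. ennreal (lambda_min (gram (X n \<omega>) e) ^ (2 * k)) \<partial>M n)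
          \<le> (\<integral>\<^sup>+\<omega>. ennreal (lambda_max (gram (X n \<omega>) e) ^ (2 * k)) \<partial>M n) \<and>
        (\<integral>\<^sup>+\<omega>. ennreal (lambda_max (gram (X n \<omega>) e) ^ (2 * k)) \<partial>M n) \<le> ennreal C))"


subsection \<open>Scaled residuals and test statistics\<close>

text \<open>In this and the next subsection \<open>x\<close> is the matrix \<open>X\<^sup>S\<close>.\<close>

definition proj :: "real mat \<Rightarrow> real mat" where
  "proj x = x * inv_mat (x\<^sup>T * x) * x\<^sup>T"

definition scaled_residual :: "real mat \<Rightarrow> real vec \<Rightarrow> real vec" where
  "scaled_residual x y =
     (let r = (1\<^sub>m (dim_row x) - proj x) *\<^sub>v y in (1 / l2norm r) \<cdot>\<^sub>v r)"

definition gamma_hat :: "real mat \<Rightarrow> nat set \<Rightarrow> real vec \<Rightarrow> real vec" where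
  "gamma_hat x h r = (inv_mat ((restrict_rows x h)\<^sup>T * restrict_rows x h) * (restrict_rows x h)\<^sup>T) *\<^sub>v subvector r h"

definition s2_hat :: "real mat \<Rightarrow> nat set \<Rightarrow> real vec \<Rightarrow> real" where
  "s2_hat x h r = (l2norm (subvector r h - restrict_rows x h *\<^sub>v gamma_hat x h r))\<^sup>2 / real (card h)"

definition T1 :: "real mat \<Rightarrow> nat set \<Rightarrow> nat set \<Rightarrow> real vec \<Rightarrow> real" where
  "T1 x e f r = l2norm (gamma_hat x e r - gamma_hat x f r)"

definition T2 :: "real mat \<Rightarrow> nat set \<Rightarrow> nat set \<Rightarrow> real vec \<Rightarrow> real" where
  "T2 x e f r = s2_hat x e r / s2_hat x f r - 1"

definition F1 :: "nat set set \<Rightarrow> (nat set \<times> nat set) set" where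
  "F1 E = {(e, f). e \<in> E \<and> f \<in> E \<and> e \<inter> f = {}}"

definition T1_max :: "nat set set \<Rightarrow> real mat \<Rightarrow> real vec \<Rightarrow> real" where
  "T1_max E x r = Max ((\<lambda>(e, f). \<bar>T1 x e f r\<bar>) ` F1 E)"

definition T2_max :: "nat set set \<Rightarrow> real mat \<Rightarrow> real vec \<Rightarrow> real" where
  "T2_max E x r = Max ((\<lambda>(e, f). \<bar>T2 x e f r\<bar>) ` F1 E)"


subsection \<open>Resampling tests\<close>

text \<open>
  The draws are \<open>eps 0, eps 1, ...\<close>, of which a test with \<open>B\<close> resamples uses the first \<open>B\<close>; list
  positions start at 0, so the \<open>m\<close>-th smallest value is at position \<open>m - 1\<close> of the sorted list.
\<close>

definition critical_value ::
    "(real mat \<Rightarrow> real vec \<Rightarrow> real) \<Rightarrow> real mat \<Rightarrow> (nat \<Rightarrow> real vec) \<Rightarrow> nat \<Rightarrow> real \<Rightarrow> real" where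
  "critical_value T x eps B lev =
     sort (map (\<lambda>b. \<bar>T x (scaled_residual x (eps b))\<bar>) [0..<B]) ! (nat \<lceil>real B * (1 - lev)\<rceil> - 1)"

definition resampling_test ::
    "(real mat \<Rightarrow> real vec \<Rightarrow> real) \<Rightarrow> real \<Rightarrow> nat \<Rightarrow> (nat \<Rightarrow> real vec) \<Rightarrow> real vec \<Rightarrow> real mat \<Rightarrow> nat" where
  "resampling_test T lev B eps y x =
     of_bool (\<bar>T x (scaled_residual x y)\<bar> > critical_value T x eps B lev)"

definition decoupled_test ::
    "nat set set \<Rightarrow> real \<Rightarrow> nat \<Rightarrow> (nat \<Rightarrow> real vec) \<Rightarrow> real vec \<Rightarrow> real mat \<Rightarrow> nat" where
  "decoupled_test E \<alpha> B eps y x =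
     of_bool (resampling_test (T1_max E) (\<alpha> / 2) B eps y x = 1 \<or>
              resampling_test (T2_max E) (\<alpha> / 2) B eps y x = 1)"

text \<open>I.i.d. draws from \<open>\<N>(0, Id)\<close> in dimension \<open>n\<close>, independent of the data.\<close>

definition coords :: "nat \<Rightarrow> real vec \<Rightarrow> nat \<Rightarrow> real" where
  "coords n v = (\<lambda>t\<in>{..<n}. v $ t)"

definition resampling_draws ::
    "'a measure \<Rightarrow> nat \<Rightarrow> nat \<Rightarrow> ('a \<Rightarrow> real vec) \<Rightarrow> ('a \<Rightarrow> real mat) \<Rightarrow> (nat \<Rightarrow> 'a \<Rightarrow> real vec) \<Rightarrow> bool" where
  "resampling_draws M n d Y X eps \<longleftrightarrow>
     (\<forall>b. eps b \<in> space M \<rightarrow> carrier_vec n) \<and>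
     prob_space.indep_vars M (\<lambda>_. Pi\<^sub>M {..<n} (\<lambda>_. borel)) (\<lambda>b \<omega>. coords n (eps b \<omega>)) UNIV \<and>
     (\<forall>b. distr M (Pi\<^sub>M {..<n} (\<lambda>_. borel)) (\<lambda>\<omega>. coords n (eps b \<omega>)) = Pi\<^sub>M {..<n} (\<lambda>_. normal_law 0 1)) \<and>
     indep_rv M (Pi\<^sub>M {..<n} (\<lambda>_. row_space d)) (\<lambda>\<omega>. \<lambda>t\<in>{..<n}. obs d Y X t \<omega>)
       (Pi\<^sub>M UNIV (\<lambda>_. Pi\<^sub>M {..<n} (\<lambda>_. borel))) (\<lambda>\<omega> b. coords n (eps b \<omega>))"

end

theory Submission
  imports Defs
begin

text \<open>
  Write \<open>q = 1 - \<alpha> / 2\<close>. One of the two resampling tests rejects if and only if the fraction of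
  resamples whose statistic lies strictly below the statistic of the data is at least \<open>q\<close>
  (\<open>resampling_test_eq_1_iff\<close>). Given the data, the resamples are i.i.d., so these fractions converge
  to conditional probabilities \<open>below_prob\<close>. The proof has to show that the probability of rejection
  has a limit in \<open>B\<close> for each \<open>n\<close>, and that this limit is close to 1 for large \<open>n\<close>.

  The limit in \<open>B\<close>. The data and the draws are independent, so it is enough to take the limit for
  fixed data and then to integrate by dominated convergence (\<open>rejection_probability\<close>). For fixed
  data the question is whether the probability that one of two empirical frequencies reaches \<open>q\<close>
  converges (\<open>exceedance_converges\<close>). The law of large numbers answers it unless a frequency has
  expectation exactly \<open>q\<close>, which is possible with positive probability because singular normal laws
  are admitted. If both have expectation \<open>q\<close>, convergence is a central limit theorem for pairs
  (\<open>tie_converges\<close>). The limit is 1 for data with \<open>below_prob > q\<close> for one of the two statistics, so it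
  remains to find events of probability tending to 1 on which this holds.

  The statistics. Scaled residuals differ from the vector they come from by a linear function of the
  covariates, common to all rows, and a common factor. Hence both statistics are functions of the
  least squares estimators in the environments, applied to that vector, and of the norm of the
  residual (\<open>T_scaled_residual\<close>). Suppose that all Gram matrices are well conditioned and that a
  noise vector has correlations with the covariates and a mean square that are correct up to \<open>\<eta>\<close>
  (\<open>noise_like\<close>). Then the estimated coefficients are correct up to \<open>O(\<eta>)\<close>, and so are the estimated
  variances (\<open>small_scores\<close>). For resampled noise this makes the first statistic \<open>O(\<eta> / sqrt n)\<close> and
  the second one \<open>O(\<eta>)\<close>, over all pairs of environments (\<open>resampled_statistics_small\<close>). For the data,
  consider the two environments which (C2) provides inside the two segments with different
  parameters: they make the first statistic at least \<open>(b - O(\<eta>)) / O(sqrt n)\<close> and the second one at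
  least \<open>(a - O(\<eta>)) / O(1)\<close> (\<open>data_statistics_large\<close>; for the second, the segment with the larger
  variance comes first). So \<open>\<eta>\<close> equal to a small multiple of \<open>a\<close> or of \<open>b\<close> is precise enough.

  Probabilities. Products of normal variables have exponential moments, so Bernstein's inequality
  and a union bound over the environments show that everything required of the data and of the
  resampled noise holds up to an event of probability \<open>O(|E| exp (- \<kappa> r \<eta>\<^sup>2))\<close> (\<open>good_sample\<close>,
  \<open>resampled_noise_like\<close>). The rate condition says that \<open>r a\<^sup>2\<close> or \<open>r b\<^sup>2\<close> is eventually larger than any
  multiple of \<open>|E| powr (2 / k)\<close>, which makes this bound tend to 0 (\<open>card_times_exp_tendsto_0\<close>).

  Constants that do not depend on \<open>n\<close> come from (C2), by which the parameters of the segments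
  converge, and from (C3). The largest eigenvalue of a Gram matrix dominates its diagonal and so
  bounds the second moments of the covariates. The smallest eigenvalue is a lower bound for the mean
  square of any normalized linear form of the covariates; since the higher moments of a normal
  variable are controlled by its second moment, no such form can have a small second moment
  (\<open>second_moment_lower\<close>). This carries over to environments that meet several segments, because one
  segment contains a fixed fraction of their rows (\<open>large_part\<close>).
\<close>

section \<open>Order statistics\<close>

lemma sorted_nth_less_iff:
  assumes "sorted xs" "m < length xs"
  shows "(xs ! m :: real) < t \<longleftrightarrow> Suc m \<le> length (filter (\<lambda>x. x < t) xs)"
proof -
  have len: "length (filter (\<lambda>x. x < t) xs) = card {i. i < length xs \<and> xs ! i < t}"
    by (simp add: length_filter_conv_card)
  have fin: "finite {i. i < length xs \<and> xs ! i < t}" by simp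
  show ?thesis
  proof
    assume a: "xs ! m < t"
    have "{..m} \<subseteq> {i. i < length xs \<and> xs ! i < t}"
      using a assms by (auto intro: le_less_trans[OF sorted_nth_mono])
    from card_mono[OF fin this] show "Suc m \<le> length (filter (\<lambda>x. x < t) xs)"
      by (simp add: len)
  next
    assume b: "Suc m \<le> length (filter (\<lambda>x. x < t) xs)"
    show "xs ! m < t"
    proof (rule ccontr)
      assume c: "\<not> xs ! m < t"
      have "{i. i < length xs \<and> xs ! i < t} \<subseteq> {..<m}"
      proof
        fix i assume "i \<in> {i. i < length xs \<and> xs ! i < t}"
        then have i: "i < length xs" "xs ! i < t" by auto
        show "i \<in> {..<m}"
        proof (rule ccontr)
          assume "i \<notin> {..<m}"
          then have "xs ! m \<le> xs ! i" using sorted_nth_mono[OF assms(1)] i by auto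
          with c i show False by simp
        qed
      qed
      from card_mono[OF _ this] b len show False by simp
    qed
  qed
qed

lemma sort_nth_less_iff:
  assumes "m < B"
  shows "sort (map f [0..<B]) ! m < (t::real) \<longleftrightarrow> Suc m \<le> card {b. b < B \<and> f b < t}"
proof -
  have "sort (map f [0..<B]) ! m < t \<longleftrightarrow> Suc m \<le> length (filter (\<lambda>x. x < t) (sort (map f [0..<B])))"
    using assms by (intro sorted_nth_less_iff) auto
  also have "length (filter (\<lambda>x. x < t) (sort (map f [0..<B]))) = length (filter (\<lambda>x. x < t) (map f [0..<B]))"
    by (metis filter_sort length_sort)
  also have "\<dots> = card {b. b < B \<and> f b < t}"
    by (simp add: length_filter_conv_card cong: conj_cong)
  finally show ?thesis .
qed

text \<open>
  The order statistic of rank \<open>m\<close> is below a number exactly if \<open>m\<close> of the values are, and an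
  integer reaches the rank \<open>\<lceil>B (1 - lev)\<rceil>\<close> exactly if it reaches \<open>B (1 - lev)\<close>. The assumptions
  place the rank between \<open>1\<close> and \<open>B\<close>, so that the list position of the critical value exists.
\<close>

lemma resampling_test_eq_1_iff:
  assumes "0 < lev" "lev < 1" "0 < B"
  shows "resampling_test T lev B eps y x = 1 \<longleftrightarrow>
    real B * (1 - lev) \<le> real (card {b. b < B \<and> \<bar>T x (scaled_residual x (eps b))\<bar> < \<bar>T x (scaled_residual x y)\<bar>})"
proof -
  define m where "m = nat \<lceil>real B * (1 - lev)\<rceil>"
  have pos: "0 < real B * (1 - lev)" using assms by simp
  have m0: "0 < m" using pos unfolding m_def by simp
  have "real B * (1 - lev) \<le> real B" using assms by (simp add: mult_le_cancel_left1)
  then have mB: "m \<le> B" unfolding m_def by (simp add: ceiling_le_iff nat_le_iff)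
  have "resampling_test T lev B eps y x = 1 \<longleftrightarrow> 
     m \<le> card {b. b < B \<and> \<bar>T x (scaled_residual x (eps b))\<bar> < \<bar>T x (scaled_residual x y)\<bar>}" (is "_ \<longleftrightarrow> m \<le> ?c")
    unfolding resampling_test_def critical_value_def m_def[symmetric]
    using sort_nth_less_iff[of "m - 1" B] m0 mB by simp
  also have "\<dots> \<longleftrightarrow> real B * (1 - lev) \<le> real ?c"
    unfolding m_def by linarith
  finally show ?thesis .
qed

section \<open>Least squares on a set of rows\<close>

lemma bij_betw_pick:
  assumes "finite I"
  shows "bij_betw (pick I) {..<card I} I"
proof (rule bij_betwI[where g = "\<lambda>i. card {a\<in>I. a < i}"])
  show "pick I \<in> {..<card I} \<rightarrow> I" using assms by (auto intro: pick_in_set_le)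
  show "(\<lambda>i. card {a \<in> I. a < i}) \<in> I \<rightarrow> {..<card I}"
    using assms by (auto intro!: psubset_card_mono)
  show "card {a \<in> I. a < pick I x} = x" if "x \<in> {..<card I}" for x
    using that assms card_pick by auto
  show "pick I (card {a \<in> I. a < y}) = y" if "y \<in> I" for y
    using that by (rule pick_card_in_set)
qed

lemma sum_pick:
  assumes "finite I"
  shows "(\<Sum>i<card I. f (pick I i)) = (\<Sum>t\<in>I. f t)"
  by (rule sum.reindex_bij_betw[OF bij_betw_pick[OF assms]])

lemma scalar_prod_sum: "w \<in> carrier_vec s \<Longrightarrow> v \<bullet> w = (\<Sum>i<s. v $ i * w $ i)"
  by (simp add: scalar_prod_def atLeast0LessThan)

lemma row_scalar_prod:
  assumes "x \<in> carrier_mat n s" "u \<in> carrier_vec s" "t < n"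
  shows "row x t \<bullet> u = (\<Sum>j<s. x $$ (t, j) * u $ j)"
  using assms by (simp add: scalar_prod_sum)

lemma l2norm_sq: "(l2norm v)\<^sup>2 = (\<Sum>i<dim_vec v. (v $ i)\<^sup>2)"
  unfolding l2norm_def by (simp add: scalar_prod_def atLeast0LessThan power2_eq_square sum_nonneg)

lemma l2norm_nonneg [simp]: "0 \<le> l2norm v"
  unfolding l2norm_def by (simp add: scalar_prod_def sum_nonneg)

lemma set_Collect_less: "h \<subseteq> {..<n} \<Longrightarrow> {i. i < n \<and> i \<in> h} = h"
  by auto

lemma restrict_rows_carrier:
  assumes "x \<in> carrier_mat n s" "h \<subseteq> {..<n}"
  shows "restrict_rows x h \<in> carrier_mat (card h) s"
  using assms set_Collect_less[OF assms(2)]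
  by (intro carrier_matI) (simp_all add: restrict_rows_def dim_submatrix)

lemma restrict_rows_index:
  assumes "x \<in> carrier_mat n s" "h \<subseteq> {..<n}" "i < card h" "j < s"
  shows "restrict_rows x h $$ (i, j) = x $$ (pick h i, j)"
  using assms set_Collect_less[OF assms(2)]
  by (simp add: restrict_rows_def submatrix_index pick_UNIV)

lemma restrict_cols_carrier:
  assumes "x \<in> carrier_mat n d" "S \<subseteq> {..<d}"
  shows "restrict_cols x S \<in> carrier_mat n (card S)"
  using assms set_Collect_less[OF assms(2)]
  by (intro carrier_matI) (simp_all add: restrict_cols_def dim_submatrix)

lemma restrict_cols_index:
  assumes "x \<in> carrier_mat n d" "S \<subseteq> {..<d}" "t < n" "j < card S"
  shows "restrict_cols x S $$ (t, j) = x $$ (t, pick S j)"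
  using assms set_Collect_less[OF assms(2)]
  by (simp add: restrict_cols_def submatrix_index pick_UNIV)

lemma subvector_carrier:
  assumes "y \<in> carrier_vec n" "h \<subseteq> {..<n}"
  shows "subvector y h \<in> carrier_vec (card h)"
  using assms set_Collect_less[OF assms(2)]
  by (simp add: subvector_def)

lemma subvector_index:
  assumes "y \<in> carrier_vec n" "h \<subseteq> {..<n}" "i < card h"
  shows "subvector y h $ i = y $ pick h i"
  using assms set_Collect_less[OF assms(2)]
  by (simp add: subvector_def)

lemma pick_less: "h \<subseteq> {..<n} \<Longrightarrow> i < card h \<Longrightarrow> pick h i \<in> h \<and> pick h i < n"
  using pick_in_set_le[of i h] by auto

lemma restrict_rows_mult:
  assumes "x \<in> carrier_mat n s" "h \<subseteq> {..<n}" "i < card h" "u \<in> carrier_vec s"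
  shows "(restrict_rows x h *\<^sub>v u) $ i = row x (pick h i) \<bullet> u"
proof -
  have "row (restrict_rows x h) i = row x (pick h i)"
    using assms restrict_rows_carrier[OF assms(1,2)] pick_less[OF assms(2,3)]
    by (intro eq_vecI) (auto simp: restrict_rows_index[OF assms(1,2,3)])
  then show ?thesis using assms restrict_rows_carrier[OF assms(1,2)] by simp
qed

lemma restrict_rows_transpose_mult:
  assumes "x \<in> carrier_mat n s" "h \<subseteq> {..<n}" "v \<in> carrier_vec (card h)" "i < s"
  shows "((restrict_rows x h)\<^sup>T *\<^sub>v v) $ i = (\<Sum>m<card h. x $$ (pick h m, i) * v $ m)"
proof -
  note c = restrict_rows_carrier[OF assms(1,2)]
  have "((restrict_rows x h)\<^sup>T *\<^sub>v v) $ i = col (restrict_rows x h) i \<bullet> v"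
    using c assms by simp
  also have "\<dots> = (\<Sum>m<card h. restrict_rows x h $$ (m, i) * v $ m)"
    using c assms by (subst scalar_prod_sum[of _ "card h"]) (auto intro!: sum.cong)
  also have "\<dots> = (\<Sum>m<card h. x $$ (pick h m, i) * v $ m)"
    using assms by (simp add: restrict_rows_index)
  finally show ?thesis .
qed

lemma inv_mat_right_inverse:
  assumes A: "A \<in> carrier_mat m m" and det: "det A \<noteq> 0"
  shows "inv_mat A \<in> carrier_mat m m" "A * inv_mat A = 1\<^sub>m m"
proof -
  have "A \<in> Units (ring_mat TYPE(real) m ())" using det_non_zero_imp_unit[OF A det] .
  then obtain B where B: "mat_inverse A = Some B"
    using mat_inverse(1)[OF A, of "()"] by (cases "mat_inverse A") auto
  from mat_inverse(2)[OF A this] B show "inv_mat A \<in> carrier_mat m m" "A * inv_mat A = 1\<^sub>m m"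
    by (auto simp: inv_mat_def)
qed

text \<open>
  The Gram matrix of the rows in \<open>h\<close>, divided by their number, is at least \<open>c\<close> times the identity.
  In this form the condition passes from a subset of \<open>h\<close> to \<open>h\<close> with no matrix computation.
\<close>

definition pos_gram :: "real mat \<Rightarrow> nat set \<Rightarrow> real \<Rightarrow> bool" where
  "pos_gram x h c \<longleftrightarrow> (\<forall>u\<in>carrier_vec (dim_col x).
     real (card h) * c * (l2norm u)\<^sup>2 \<le> (\<Sum>t\<in>h. (row x t \<bullet> u)\<^sup>2))"

lemma row_scalar_prod_linear:
  fixes x :: "real mat"
  assumes "x \<in> carrier_mat n s" "t < n" "u \<in> carrier_vec s" "v \<in> carrier_vec s"
  shows "row x t \<bullet> (u + v) = row x t \<bullet> u + row x t \<bullet> v"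
    "row x t \<bullet> (u - v) = row x t \<bullet> u - row x t \<bullet> v"
    "row x t \<bullet> (c \<cdot>\<^sub>v u) = c * (row x t \<bullet> u)"
proof -
  show "row x t \<bullet> (u + v) = row x t \<bullet> u + row x t \<bullet> v"
    using assms by (simp add: row_scalar_prod[OF assms(1)] sum.distrib distrib_left)
  have "row x t \<bullet> (u - v) = (\<Sum>j<s. x $$ (t, j) * (u - v) $ j)"
    using assms by (intro row_scalar_prod) auto
  also have "\<dots> = row x t \<bullet> u - row x t \<bullet> v"
    using assms by (simp add: row_scalar_prod[OF assms(1)] right_diff_distrib flip: sum_subtractf)
  finally show "row x t \<bullet> (u - v) = row x t \<bullet> u - row x t \<bullet> v" .
  show "row x t \<bullet> (c \<cdot>\<^sub>v u) = c * (row x t \<bullet> u)"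
    using assms by (simp add: row_scalar_prod[OF assms(1)] sum_distrib_left algebra_simps)
qed

locale row_set =
  fixes x :: "real mat" and n s :: nat and h :: "nat set" and c :: real
  assumes x: "x \<in> carrier_mat n s"
    and h: "h \<subseteq> {..<n}" "h \<noteq> {}"
    and c: "0 < c"
    and pos: "pos_gram x h c"
begin

lemma finite_h: "finite h" using h finite_subset by blast
lemma card_h: "0 < card h" using h finite_h by (simp add: card_gt_0_iff)
lemma less_n: "t \<in> h \<Longrightarrow> t < n" using h by auto

lemma lower_bound:
  "u \<in> carrier_vec s \<Longrightarrow> real (card h) * c * (l2norm u)\<^sup>2 \<le> (\<Sum>t\<in>h. (row x t \<bullet> u)\<^sup>2)"
  using pos x by (auto simp: pos_gram_def)

lemma zero_if_fitted_zero:
  assumes u: "u \<in> carrier_vec s" and "(\<Sum>t\<in>h. (row x t \<bullet> u)\<^sup>2) \<le> 0"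
  shows "u = 0\<^sub>v s"
proof -
  have "real (card h) * c * (l2norm u)\<^sup>2 \<le> 0" using lower_bound[OF u] assms by linarith
  then have "(l2norm u)\<^sup>2 \<le> 0"
    using card_h c by (simp add: mult_le_0_iff)
  then have "(\<Sum>i<s. (u $ i)\<^sup>2) \<le> 0" using u by (simp add: l2norm_sq)
  then have "(\<Sum>i<s. (u $ i)\<^sup>2) = 0"
    by (meson antisym sum_nonneg zero_le_power2)
  then have "u $ i = 0" if "i < s" for i
    using that by (subst (asm) sum_nonneg_eq_0_iff) auto
  then show ?thesis using u by (intro eq_vecI) auto
qed

text \<open>
  A vector in the kernel of the Gram matrix would have vanishing fitted values, so \<open>inv_mat\<close> is a
  genuine inverse here. The normal equations, as sums over rows, replace the matrix formula of the
  estimator in the estimates below.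
\<close>

lemma gamma_hat_normal_equations:
  assumes r: "r \<in> carrier_vec n"
  shows "gamma_hat x h r \<in> carrier_vec s"
    "i < s \<Longrightarrow> (\<Sum>t\<in>h. x $$ (t, i) * (row x t \<bullet> gamma_hat x h r)) = (\<Sum>t\<in>h. x $$ (t, i) * r $ t)"
proof -
  define R where "R = restrict_rows x h"
  note Rc = restrict_rows_carrier[OF x h(1), folded R_def]
  define K where "K = R\<^sup>T * R"
  have K: "K \<in> carrier_mat s s" using Rc by (simp add: K_def)
  have Ku: "(K *\<^sub>v u) $ i = (\<Sum>t\<in>h. x $$ (t, i) * (row x t \<bullet> u))"
    if u: "u \<in> carrier_vec s" and i: "i < s" for u i
  proof -
    have "K *\<^sub>v u = R\<^sup>T *\<^sub>v (R *\<^sub>v u)" unfolding K_def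
      using Rc u by (intro assoc_mult_mat_vec) auto
    then have "(K *\<^sub>v u) $ i = (\<Sum>m<card h. x $$ (pick h m, i) * (R *\<^sub>v u) $ m)"
      using restrict_rows_transpose_mult[OF x h(1) _ i, folded R_def, of "R *\<^sub>v u"] Rc u by auto
    also have "\<dots> = (\<Sum>m<card h. x $$ (pick h m, i) * (row x (pick h m) \<bullet> u))"
      using restrict_rows_mult[OF x h(1) _ u, folded R_def] by auto
    also have "\<dots> = (\<Sum>t\<in>h. x $$ (t, i) * (row x t \<bullet> u))"
      by (rule sum_pick[OF finite_h])
    finally show ?thesis .
  qed
  have det: "det K \<noteq> 0"
  proof
    assume "det K = 0"
    then obtain v where v: "v \<in> carrier_vec s" "v \<noteq> 0\<^sub>v s" "K *\<^sub>v v = 0\<^sub>v s"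
      using det_0_iff_vec_prod_zero_field[OF K] by auto
    have "(\<Sum>t\<in>h. (row x t \<bullet> v)\<^sup>2) = (\<Sum>t\<in>h. (\<Sum>i<s. x $$ (t, i) * v $ i) * (row x t \<bullet> v))"
      by (intro sum.cong refl) (simp add: power2_eq_square row_scalar_prod[OF x v(1) less_n])
    also have "\<dots> = (\<Sum>i<s. v $ i * (\<Sum>t\<in>h. x $$ (t, i) * (row x t \<bullet> v)))"
      by (simp add: sum_distrib_right sum_distrib_left algebra_simps sum.swap[of _ h])
    also have "\<dots> = (\<Sum>i<s. v $ i * (K *\<^sub>v v) $ i)" by (simp add: Ku[OF v(1)])
    also have "\<dots> = 0" using v by simp
    finally show False using zero_if_fitted_zero[OF v(1)] v by simp
  qed
  note inv = inv_mat_right_inverse[OF K det]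
  define w where "w = R\<^sup>T *\<^sub>v subvector r h"
  have sub: "subvector r h \<in> carrier_vec (card h)" by (rule subvector_carrier[OF r h(1)])
  have w: "w \<in> carrier_vec s" unfolding w_def using Rc sub by auto
  have g: "gamma_hat x h r = inv_mat K *\<^sub>v w"
    unfolding gamma_hat_def R_def[symmetric] K_def[symmetric] w_def
    using inv Rc sub by (intro assoc_mult_mat_vec) auto
  show gc: "gamma_hat x h r \<in> carrier_vec s" unfolding g using inv w by auto
  assume i: "i < s"
  have "K *\<^sub>v gamma_hat x h r = (K * inv_mat K) *\<^sub>v w" unfolding g
    using assoc_mult_mat_vec[OF K inv(1) w] by simp
  also have "\<dots> = w" using inv w by simp
  finally have "(K *\<^sub>v gamma_hat x h r) $ i = w $ i" by simp
  also have "w $ i = (\<Sum>m<card h. x $$ (pick h m, i) * subvector r h $ m)"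
    unfolding w_def R_def by (rule restrict_rows_transpose_mult[OF x h(1) sub i])
  also have "\<dots> = (\<Sum>m<card h. x $$ (pick h m, i) * r $ pick h m)"
    using subvector_index[OF r h(1)] by auto
  also have "\<dots> = (\<Sum>t\<in>h. x $$ (t, i) * r $ t)" by (rule sum_pick[OF finite_h])
  finally show "(\<Sum>t\<in>h. x $$ (t, i) * (row x t \<bullet> gamma_hat x h r)) = (\<Sum>t\<in>h. x $$ (t, i) * r $ t)"
    using Ku[OF gc i] by simp
qed

lemma sum_row_mult:
  assumes "u \<in> carrier_vec s"
  shows "(\<Sum>t\<in>h. (row x t \<bullet> u) * w t) = (\<Sum>i<s. u $ i * (\<Sum>t\<in>h. x $$ (t, i) * w t))"
proof -
  have "(\<Sum>t\<in>h. (row x t \<bullet> u) * w t) = (\<Sum>t\<in>h. \<Sum>i<s. u $ i * (x $$ (t, i) * w t))"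
    by (intro sum.cong refl) (simp add: row_scalar_prod[OF x assms less_n] sum_distrib_right sum_distrib_left mult.commute mult.left_commute)
  also have "\<dots> = (\<Sum>i<s. u $ i * (\<Sum>t\<in>h. x $$ (t, i) * w t))"
    by (subst sum.swap) (simp add: sum_distrib_left)
  finally show ?thesis .
qed

text \<open>
  The difference of two solutions of the normal equations has vanishing fitted values.
\<close>

lemma gamma_hat_unique:
  assumes r: "r \<in> carrier_vec n" and g: "g \<in> carrier_vec s"
    and eq: "\<And>i. i < s \<Longrightarrow> (\<Sum>t\<in>h. x $$ (t, i) * (row x t \<bullet> g)) = (\<Sum>t\<in>h. x $$ (t, i) * r $ t)"
  shows "gamma_hat x h r = g"
proof -
  let ?g = "gamma_hat x h r"
  note gg = gamma_hat_normal_equations[OF r]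
  define u where "u = ?g - g"
  have u: "u \<in> carrier_vec s" using gg g by (simp add: u_def)
  have ru: "row x t \<bullet> u = row x t \<bullet> ?g - row x t \<bullet> g" if "t \<in> h" for t
    unfolding u_def using row_scalar_prod_linear(2)[OF x less_n[OF that] gg(1) g] .
  have "(\<Sum>t\<in>h. (row x t \<bullet> u)\<^sup>2) = (\<Sum>t\<in>h. (row x t \<bullet> u) * (row x t \<bullet> ?g - row x t \<bullet> g))"
    by (intro sum.cong refl) (simp add: ru power2_eq_square)
  also have "\<dots> = (\<Sum>i<s. u $ i * (\<Sum>t\<in>h. x $$ (t, i) * (row x t \<bullet> ?g - row x t \<bullet> g)))"
    by (rule sum_row_mult[OF u])
  also have "\<dots> = 0"
    by (intro sum.neutral) (simp add: right_diff_distrib sum_subtractf gg eq)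
  finally have "u = 0\<^sub>v s" using zero_if_fitted_zero[OF u] by simp
  then have "(?g - g) $ i = 0" if "i < s" for i unfolding u_def using that by simp
  then show ?thesis using gg(1) g by (intro eq_vecI) auto
qed

text \<open>
  Least squares estimators commute with adding a linear function of the covariates and with
  scaling. This is used twice: to pass from scaled residuals to the vector they come from, and to
  pass from the response to the noise.
\<close>

lemma gamma_hat_affine:
  assumes y: "y \<in> carrier_vec n" and e: "e \<in> carrier_vec n" and b: "b \<in> carrier_vec s"
    and eq: "\<And>t. t \<in> h \<Longrightarrow> y $ t = row x t \<bullet> b + a * e $ t"
  shows "gamma_hat x h y = b + a \<cdot>\<^sub>v gamma_hat x h e"
proof (rule gamma_hat_unique[OF y])
  note g = gamma_hat_normal_equations[OF e]
  show "b + a \<cdot>\<^sub>v gamma_hat x h e \<in> carrier_vec s" using b g by simp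
  fix i assume i: "i < s"
  have "(\<Sum>t\<in>h. x $$ (t, i) * (row x t \<bullet> (b + a \<cdot>\<^sub>v gamma_hat x h e)))
     = (\<Sum>t\<in>h. x $$ (t, i) * (row x t \<bullet> b)) + a * (\<Sum>t\<in>h. x $$ (t, i) * (row x t \<bullet> gamma_hat x h e))"
    using b g(1) by (simp add: row_scalar_prod_linear[OF x less_n] sum.distrib distrib_left sum_distrib_left algebra_simps)
  also have "\<dots> = (\<Sum>t\<in>h. x $$ (t, i) * y $ t)"
    using g(2)[OF i] by (simp add: eq sum.distrib distrib_left sum_distrib_left algebra_simps)
  finally show "(\<Sum>t\<in>h. x $$ (t, i) * (row x t \<bullet> (b + a \<cdot>\<^sub>v gamma_hat x h e))) = (\<Sum>t\<in>h. x $$ (t, i) * y $ t)" .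
qed

lemma s2_hat_eq:
  assumes r: "r \<in> carrier_vec n"
  shows "s2_hat x h r = (\<Sum>t\<in>h. (r $ t - row x t \<bullet> gamma_hat x h r)\<^sup>2) / card h"
proof -
  note g = gamma_hat_normal_equations(1)[OF r]
  note Rc = restrict_rows_carrier[OF x h(1)] and sc = subvector_carrier[OF r h(1)]
  have d: "dim_vec (subvector r h - restrict_rows x h *\<^sub>v gamma_hat x h r) = card h" using Rc by simp
  have "(l2norm (subvector r h - restrict_rows x h *\<^sub>v gamma_hat x h r))\<^sup>2
    = (\<Sum>i<card h. (r $ pick h i - row x (pick h i) \<bullet> gamma_hat x h r)\<^sup>2)"
    unfolding l2norm_sq d using Rc 
    by (intro sum.cong refl) (simp add: subvector_index[OF r h(1)] restrict_rows_mult[OF x h(1) _ g] del: index_mult_mat_vec)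
  also have "\<dots> = (\<Sum>t\<in>h. (r $ t - row x t \<bullet> gamma_hat x h r)\<^sup>2)" by (rule sum_pick[OF finite_h])
  finally show ?thesis by (simp add: s2_hat_def)
qed

lemma s2_hat_affine:
  assumes y: "y \<in> carrier_vec n" and e: "e \<in> carrier_vec n" and b: "b \<in> carrier_vec s"
    and eq: "\<And>t. t \<in> h \<Longrightarrow> y $ t = row x t \<bullet> b + a * e $ t"
  shows "s2_hat x h y = a\<^sup>2 * s2_hat x h e"
proof -
  note g = gamma_hat_normal_equations(1)[OF e]
  have "(\<Sum>t\<in>h. (y $ t - row x t \<bullet> gamma_hat x h y)\<^sup>2) = (\<Sum>t\<in>h. a\<^sup>2 * (e $ t - row x t \<bullet> gamma_hat x h e)\<^sup>2)"
  proof (intro sum.cong refl)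
    fix t assume t: "t \<in> h"
    have "gamma_hat x h y = b + a \<cdot>\<^sub>v gamma_hat x h e"
      using eq by (rule gamma_hat_affine[OF y e b])
    moreover have "y $ t - row x t \<bullet> (b + a \<cdot>\<^sub>v gamma_hat x h e) = a * (e $ t - row x t \<bullet> gamma_hat x h e)"
      unfolding eq[OF t]
      using g b less_n[OF t] x by (simp add: row_scalar_prod_linear[OF x less_n[OF t]] right_diff_distrib)
    ultimately show "(y $ t - row x t \<bullet> gamma_hat x h y)\<^sup>2 = a\<^sup>2 * (e $ t - row x t \<bullet> gamma_hat x h e)\<^sup>2"
      by (simp add: power_mult_distrib)
  qed
  then show ?thesis using s2_hat_eq[OF y] s2_hat_eq[OF e] by (simp add: sum_distrib_left)
qed

text \<open>Pythagoras: the fitted values are orthogonal to the residuals.\<close>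

lemma residual_sum_of_squares:
  assumes r: "r \<in> carrier_vec n"
  defines "g \<equiv> gamma_hat x h r"
  shows "(\<Sum>t\<in>h. (r $ t - row x t \<bullet> g)\<^sup>2) = (\<Sum>t\<in>h. (r $ t)\<^sup>2) - (\<Sum>i<s. g $ i * (\<Sum>t\<in>h. x $$ (t, i) * r $ t))"
    "(\<Sum>t\<in>h. (row x t \<bullet> g)\<^sup>2) = (\<Sum>i<s. g $ i * (\<Sum>t\<in>h. x $$ (t, i) * r $ t))"
proof -
  note gg = gamma_hat_normal_equations[OF r, folded g_def]
  have "(\<Sum>t\<in>h. (row x t \<bullet> g)\<^sup>2) = (\<Sum>t\<in>h. (row x t \<bullet> g) * (row x t \<bullet> g))"
    by (simp add: power2_eq_square)
  also have "\<dots> = (\<Sum>i<s. g $ i * (\<Sum>t\<in>h. x $$ (t, i) * r $ t))"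
    unfolding sum_row_mult[OF gg(1)] using gg(2) by simp
  finally show 1: "(\<Sum>t\<in>h. (row x t \<bullet> g)\<^sup>2) = (\<Sum>i<s. g $ i * (\<Sum>t\<in>h. x $$ (t, i) * r $ t))" .
  have "(\<Sum>t\<in>h. (r $ t - row x t \<bullet> g)\<^sup>2)
     = (\<Sum>t\<in>h. (r $ t)\<^sup>2) - 2 * (\<Sum>t\<in>h. (row x t \<bullet> g) * r $ t) + (\<Sum>t\<in>h. (row x t \<bullet> g)\<^sup>2)"
    by (simp add: power2_diff sum.distrib sum_subtractf sum_distrib_left algebra_simps)
  also have "(\<Sum>t\<in>h. (row x t \<bullet> g) * r $ t) = (\<Sum>i<s. g $ i * (\<Sum>t\<in>h. x $$ (t, i) * r $ t))"
    by (rule sum_row_mult[OF gg(1)])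
  finally show "(\<Sum>t\<in>h. (r $ t - row x t \<bullet> g)\<^sup>2) = (\<Sum>t\<in>h. (r $ t)\<^sup>2) - (\<Sum>i<s. g $ i * (\<Sum>t\<in>h. x $$ (t, i) * r $ t))"
    using 1 by simp
qed

lemma s2_hat_le:
  assumes r: "r \<in> carrier_vec n"
  shows "s2_hat x h r \<le> (\<Sum>t\<in>h. (r $ t)\<^sup>2) / card h" "0 \<le> s2_hat x h r"
proof -
  have "0 \<le> (\<Sum>t\<in>h. (row x t \<bullet> gamma_hat x h r)\<^sup>2)" by (simp add: sum_nonneg)
  then show "s2_hat x h r \<le> (\<Sum>t\<in>h. (r $ t)\<^sup>2) / card h"
    unfolding s2_hat_eq[OF r] residual_sum_of_squares[OF r] by (simp add: divide_right_mono)
  show "0 \<le> s2_hat x h r" by (simp add: s2_hat_def)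
qed

text \<open>
  The squared norm of the fitted values is at least \<open>|h| c |g|\<^sup>2\<close>, where \<open>g\<close> is the estimator, and
  it is the inner product of \<open>g\<close> with the scores, hence at most \<open>|g| sqrt s |h| \<eta>\<close>. Dividing by
  \<open>|g|\<close> bounds the estimator; inserting that bound again shows how little of the sum of squares
  the fit removes.
\<close>

lemma small_scores:
  fixes \<eta> :: real
  assumes r: "r \<in> carrier_vec n" and \<eta>: "0 \<le> \<eta>"
    and scores: "\<And>i. i < s \<Longrightarrow> \<bar>\<Sum>t\<in>h. x $$ (t, i) * r $ t\<bar> \<le> real (card h) * \<eta>"
  shows "l2norm (gamma_hat x h r) \<le> sqrt s * \<eta> / c"
    "(\<Sum>t\<in>h. (r $ t)\<^sup>2) / card h - s * \<eta>\<^sup>2 / c \<le> s2_hat x h r"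
proof -
  define g where "g = gamma_hat x h r"
  note gg = gamma_hat_normal_equations(1)[OF r, folded g_def]
  \<comment> \<open>the squared norm of the fitted values\<close>
  define Q where "Q = (\<Sum>i<s. g $ i * (\<Sum>t\<in>h. x $$ (t, i) * r $ t))"
  have "Q \<le> (\<Sum>i<s. \<bar>g $ i\<bar> * \<bar>real (card h) * \<eta>\<bar>)"
    unfolding Q_def
  proof (rule sum_mono)
    fix i assume "i \<in> {..<s}"
    then have "\<bar>g $ i\<bar> * \<bar>\<Sum>t\<in>h. x $$ (t, i) * r $ t\<bar> \<le> \<bar>g $ i\<bar> * (real (card h) * \<eta>)"
      using scores by (intro mult_left_mono) auto
    moreover have "g $ i * (\<Sum>t\<in>h. x $$ (t, i) * r $ t) \<le> \<bar>g $ i\<bar> * \<bar>\<Sum>t\<in>h. x $$ (t, i) * r $ t\<bar>"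
      by (metis abs_ge_self abs_mult)
    ultimately show "g $ i * (\<Sum>t\<in>h. x $$ (t, i) * r $ t) \<le> \<bar>g $ i\<bar> * \<bar>real (card h) * \<eta>\<bar>"
      using \<eta> by simp
  qed
  also have "\<dots> \<le> l2norm g * (sqrt s * (real (card h) * \<eta>))"
  proof -
    have "(\<Sum>i<s. \<bar>g $ i\<bar> * \<bar>real (card h) * \<eta>\<bar>) \<le> L2_set (($) g) {..<s} * L2_set (\<lambda>_. real (card h) * \<eta>) {..<s}"
      by (rule L2_set_mult_ineq)
    also have "L2_set (($) g) {..<s} = l2norm g"
      using gg by (simp add: L2_set_def l2norm_def scalar_prod_sum power2_eq_square)
    also have "L2_set (\<lambda>_. real (card h) * \<eta>) {..<s} = sqrt s * (real (card h) * \<eta>)"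
      using \<eta> by (simp add: L2_set_def real_sqrt_mult)
    finally show ?thesis .
  qed
  finally have Q: "Q \<le> l2norm g * (sqrt s * (real (card h) * \<eta>))" .
  have "real (card h) * c * (l2norm g)\<^sup>2 \<le> Q"
    using lower_bound[OF gg] residual_sum_of_squares(2)[OF r, folded g_def] unfolding Q_def by simp
  then have "real (card h) * c * l2norm g * l2norm g \<le> real (card h) * (sqrt s * \<eta>) * l2norm g"
    using Q by (simp add: power2_eq_square algebra_simps)
  then have le: "(real (card h) * l2norm g) * (c * l2norm g) \<le> (real (card h) * l2norm g) * (sqrt s * \<eta>)"
    by (simp only: mult.commute mult.left_commute mult.assoc)
  have "c * l2norm g \<le> sqrt s * \<eta>"
  proof (cases "l2norm g = 0")
    case True
    then show ?thesis using \<eta> by simp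
  next
    case False
    then have "0 < l2norm g" using l2norm_nonneg[of g] by linarith
    then have "0 < real (card h) * l2norm g" using card_h by simp
    with le show ?thesis by (rule mult_left_le_imp_le)
  qed
  then show bound: "l2norm (gamma_hat x h r) \<le> sqrt s * \<eta> / c"
    using c unfolding g_def by (simp add: field_simps)
  have "Q \<le> (sqrt s * \<eta> / c) * (sqrt s * (real (card h) * \<eta>))"
    by (rule order.trans[OF Q mult_right_mono[OF bound[folded g_def]]]) (use \<eta> in simp)
  also have "\<dots> = real (card h) * (real s * \<eta>\<^sup>2 / c)" by (simp add: power2_eq_square algebra_simps)
  finally have "Q / card h \<le> s * \<eta>\<^sup>2 / c"
    using card_h by (simp add: pos_divide_le_eq mult.commute)
  moreover have "s2_hat x h r = (\<Sum>t\<in>h. (r $ t)\<^sup>2) / card h - Q / card h"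
    unfolding s2_hat_eq[OF r] residual_sum_of_squares(1)[OF r] Q_def g_def by (rule diff_divide_distrib)
  ultimately show "(\<Sum>t\<in>h. (r $ t)\<^sup>2) / card h - s * \<eta>\<^sup>2 / c \<le> s2_hat x h r"
    by linarith
qed

end

text \<open>
  \<open>proj x\<close> maps \<open>y\<close> to the values fitted by least squares on all rows, and \<open>n * s2_hat\<close> is the
  squared norm of the residual. The shift and the factor in this formula are the same for all
  rows, which is the form required by \<open>gamma_hat_affine\<close>.
\<close>

lemma scaled_residual_eq:
  assumes r: "row_set x n s {..<n} c" and y: "y \<in> carrier_vec n"
  defines "a \<equiv> 1 / sqrt (n * s2_hat x {..<n} y)"
  shows "scaled_residual x y \<in> carrier_vec n"
    "t < n \<Longrightarrow> scaled_residual x y $ t = row x t \<bullet> ((- a) \<cdot>\<^sub>v gamma_hat x {..<n} y) + a * y $ t"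
proof -
  interpret row_set x n s "{..<n}" c by (rule r)
  note g = gamma_hat_normal_equations(1)[OF y]
  have pick: "pick {..<n} i = i" if "i < n" for i
    using pick_card_in_set[of i "{..<n}"] that
  proof -
    have "{a \<in> {..<n}. a < i} = {..<i}" using that by auto
    then show ?thesis using pick_card_in_set[of i "{..<n}"] that by simp
  qed
  have R: "restrict_rows x {..<n} = x"
    using x restrict_rows_carrier[OF x h(1)]
    by (intro eq_matI) (auto simp: restrict_rows_index[OF x h(1)] pick)
  have V: "subvector y {..<n} = y"
    using y subvector_carrier[OF y h(1)]
    by (intro eq_vecI) (auto simp: subvector_index[OF y h(1)] pick)
  have gd: "gamma_hat x {..<n} y = (inv_mat (x\<^sup>T * x) * x\<^sup>T) *\<^sub>v y" unfolding gamma_hat_def R V ..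
  have invc: "inv_mat (x\<^sup>T * x) \<in> carrier_mat s s"
  proof -
    have "dim_vec (gamma_hat x {..<n} y) = s" using g by simp
    then have "dim_row (inv_mat (x\<^sup>T * x)) = s" unfolding gd by simp
    moreover have "dim_col (inv_mat (x\<^sup>T * x)) = s"
      using mat_inverse(2)[of "x\<^sup>T * x" s] x
      by (cases "mat_inverse (x\<^sup>T * x)") (auto simp: inv_mat_def)
    ultimately show ?thesis by blast
  qed
  have P: "proj x *\<^sub>v y = x *\<^sub>v gamma_hat x {..<n} y"
  proof -
    have xT: "x\<^sup>T \<in> carrier_mat s n" using x by simp
    have xi: "x * inv_mat (x\<^sup>T * x) \<in> carrier_mat n s" using x invc by simp
    have v: "x\<^sup>T *\<^sub>v y \<in> carrier_vec s" using xT y by simp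
    show ?thesis unfolding proj_def gd assoc_mult_mat_vec[OF xi xT y] assoc_mult_mat_vec[OF invc xT y]
      by (rule assoc_mult_mat_vec[OF x invc v])
  qed
  have Pc: "proj x \<in> carrier_mat n n" unfolding proj_def using x invc
    by (intro mult_carrier_mat[of _ n s]) auto
  define r where "r = (1\<^sub>m (dim_row x) - proj x) *\<^sub>v y"
  have r: "r = y - x *\<^sub>v gamma_hat x {..<n} y" unfolding r_def P[symmetric] using x y Pc
    by (subst minus_mult_distrib_mat_vec[of _ n n]) auto
  have rt: "r $ t = y $ t - row x t \<bullet> gamma_hat x {..<n} y" if "t < n" for t
    using that x y g unfolding r by simp
  have rc: "r \<in> carrier_vec n" unfolding r using x y g by auto
  have "(l2norm r)\<^sup>2 = (\<Sum>t<n. (y $ t - row x t \<bullet> gamma_hat x {..<n} y)\<^sup>2)"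
    using rc by (simp add: l2norm_sq rt)
  also have "\<dots> = n * s2_hat x {..<n} y" using card_h by (simp add: s2_hat_eq[OF y])
  finally have "l2norm r = sqrt (n * s2_hat x {..<n} y)"
    by (metis l2norm_nonneg real_sqrt_abs real_sqrt_power abs_of_nonneg)
  then have sr: "scaled_residual x y = a \<cdot>\<^sub>v r" unfolding scaled_residual_def a_def r_def by simp
  show "scaled_residual x y \<in> carrier_vec n" unfolding sr using rc by simp
  show "scaled_residual x y $ t = row x t \<bullet> ((- a) \<cdot>\<^sub>v gamma_hat x {..<n} y) + a * y $ t" if t: "t < n"
    unfolding sr using rc t by (simp add: rt row_scalar_prod_linear(3)[OF x t g g] algebra_simps)
qed

text \<open>
  The common shift cancels in the difference of two estimators, and the common factor cancels in
  the quotient of two variances. Cancelling the factor requires that it is not 0, which is its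
  value for a vanishing residual by the convention \<open>1 / 0 = 0\<close>.
\<close>

lemma T_scaled_residual:
  assumes n: "row_set x n s {..<n} c" and e: "row_set x n s e ce" and f: "row_set x n s f cf"
    and y: "y \<in> carrier_vec n"
  defines "a \<equiv> 1 / sqrt (n * s2_hat x {..<n} y)"
  shows "T1 x e f (scaled_residual x y) = a * l2norm (gamma_hat x e y - gamma_hat x f y)"
    "s2_hat x {..<n} y > 0 \<Longrightarrow> T2 x e f (scaled_residual x y) = s2_hat x e y / s2_hat x f y - 1"
proof -
  interpret n: row_set x n s "{..<n}" c by (rule n)
  interpret e: row_set x n s e ce by (rule e)
  interpret f: row_set x n s f cf by (rule f)
  note sr = scaled_residual_eq[OF n y, folded a_def]
  define b where "b = (- a) \<cdot>\<^sub>v gamma_hat x {..<n} y"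
  have b: "b \<in> carrier_vec s" using n.gamma_hat_normal_equations(1)[OF y] by (simp add: b_def)
  have eqe: "scaled_residual x y $ t = row x t \<bullet> b + a * y $ t" if "t \<in> e" for t
    using sr(2)[OF e.less_n[OF that]] by (simp add: b_def)
  have eqf: "scaled_residual x y $ t = row x t \<bullet> b + a * y $ t" if "t \<in> f" for t
    using sr(2)[OF f.less_n[OF that]] by (simp add: b_def)
  define ge gf where "ge = gamma_hat x e y" and "gf = gamma_hat x f y"
  have gc: "ge \<in> carrier_vec s" "gf \<in> carrier_vec s"
    unfolding ge_def gf_def using e.gamma_hat_normal_equations(1) f.gamma_hat_normal_equations(1) y by auto
  have a0: "0 \<le> a" unfolding a_def by (simp add: n.s2_hat_le[OF y])
  have ge: "gamma_hat x e (scaled_residual x y) = b + a \<cdot>\<^sub>v ge"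
    unfolding ge_def using eqe by (rule e.gamma_hat_affine[OF sr(1) y b])
  have gf: "gamma_hat x f (scaled_residual x y) = b + a \<cdot>\<^sub>v gf"
    unfolding gf_def using eqf by (rule f.gamma_hat_affine[OF sr(1) y b])
  have "gamma_hat x e (scaled_residual x y) - gamma_hat x f (scaled_residual x y) = a \<cdot>\<^sub>v (ge - gf)"
    unfolding ge gf
    using gc b by (intro eq_vecI) (auto simp: algebra_simps)
  moreover have "l2norm (a \<cdot>\<^sub>v (ge - gf)) = a * l2norm (ge - gf)"
    using gc a0 by (simp add: l2norm_def real_sqrt_mult)
  ultimately show "T1 x e f (scaled_residual x y) = a * l2norm (gamma_hat x e y - gamma_hat x f y)"
    by (simp add: T1_def ge_def gf_def)
  assume "s2_hat x {..<n} y > 0"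
  then have "a \<noteq> 0" using n.card_h unfolding a_def by simp
  moreover have "s2_hat x e (scaled_residual x y) = a\<^sup>2 * s2_hat x e y"
    using eqe by (rule e.s2_hat_affine[OF sr(1) y b])
  moreover have "s2_hat x f (scaled_residual x y) = a\<^sup>2 * s2_hat x f y"
    using eqf by (rule f.s2_hat_affine[OF sr(1) y b])
  ultimately show "T2 x e f (scaled_residual x y) = s2_hat x e y / s2_hat x f y - 1"
    unfolding T2_def by simp
qed

section \<open>Tail bounds\<close>

context prob_space
begin

lemma markov_inequality:
  assumes "integrable M f" "\<And>\<omega>. \<omega> \<in> space M \<Longrightarrow> 0 \<le> f \<omega>" "0 < a"
  shows "prob {\<omega>\<in>space M. a \<le> f \<omega>} \<le> expectation f / a"
proof -
  have "emeasure M {\<omega>\<in>space M. a \<le> f \<omega>} \<le> ennreal (1 / a * expectation f)"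
    using assms by (intro integral_Markov_inequality) (auto simp: AE_I2)
  moreover have "0 \<le> 1 / a * expectation f"
    using assms by (intro mult_nonneg_nonneg integral_nonneg_AE AE_I2) auto
  ultimately show ?thesis
    by (simp add: emeasure_eq_measure)
qed

lemma chernoff_upper:
  assumes ind: "indep_vars (\<lambda>_. borel) V h" and fin: "finite h" and l: "0 < l"
    and int: "\<And>t. t \<in> h \<Longrightarrow> integrable M (\<lambda>\<omega>. exp (l * V t \<omega>))"
    and mgf: "\<And>t. t \<in> h \<Longrightarrow> expectation (\<lambda>\<omega>. exp (l * V t \<omega>)) \<le> exp (c t)"
  shows "prob {\<omega>\<in>space M. K \<le> (\<Sum>t\<in>h. V t \<omega>)} \<le> exp ((\<Sum>t\<in>h. c t) - l * K)"
proof -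
  have ind': "indep_vars (\<lambda>_. borel) (\<lambda>t \<omega>. exp (l * V t \<omega>)) h"
    by (rule indep_vars_compose2[OF ind, where Y = "\<lambda>_ v. exp (l * v)"]) auto
  have I: "integrable M (\<lambda>\<omega>. \<Prod>t\<in>h. exp (l * V t \<omega>))"
    by (rule indep_vars_integrable[OF fin ind' int])
  have "prob {\<omega>\<in>space M. exp (l * K) \<le> (\<Prod>t\<in>h. exp (l * V t \<omega>))}
     \<le> expectation (\<lambda>\<omega>. \<Prod>t\<in>h. exp (l * V t \<omega>)) / exp (l * K)"
    by (rule markov_inequality[OF I]) (auto intro: prod_nonneg)
  also have "expectation (\<lambda>\<omega>. \<Prod>t\<in>h. exp (l * V t \<omega>)) = (\<Prod>t\<in>h. expectation (\<lambda>\<omega>. exp (l * V t \<omega>)))"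
    by (rule indep_vars_lebesgue_integral[OF fin ind' int])
  also have "\<dots> \<le> (\<Prod>t\<in>h. exp (c t))"
    by (rule prod_mono) (auto intro: mgf integral_nonneg_AE)
  finally have "prob {\<omega>\<in>space M. exp (l * K) \<le> (\<Prod>t\<in>h. exp (l * V t \<omega>))} \<le> exp ((\<Sum>t\<in>h. c t) - l * K)"
    by (simp add: exp_diff exp_sum[OF fin] divide_right_mono)
  moreover have "{\<omega>\<in>space M. exp (l * K) \<le> (\<Prod>t\<in>h. exp (l * V t \<omega>))} = {\<omega>\<in>space M. K \<le> (\<Sum>t\<in>h. V t \<omega>)}"
    using l by (simp add: exp_sum[OF fin, symmetric] flip: sum_distrib_left)
  ultimately show ?thesis by simp
qed

lemma chernoff_two_sided:
  assumes ind: "indep_vars (\<lambda>_. borel) V h" and fin: "finite h" and l: "0 < l"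
    and int: "\<And>t. t \<in> h \<Longrightarrow> integrable M (\<lambda>\<omega>. exp (l * V t \<omega>))"
      "\<And>t. t \<in> h \<Longrightarrow> integrable M (\<lambda>\<omega>. exp (- l * V t \<omega>))"
    and mgf: "\<And>t. t \<in> h \<Longrightarrow> expectation (\<lambda>\<omega>. exp (l * V t \<omega>)) \<le> exp (c t)"
      "\<And>t. t \<in> h \<Longrightarrow> expectation (\<lambda>\<omega>. exp (- l * V t \<omega>)) \<le> exp (c t)"
  shows "prob {\<omega>\<in>space M. K \<le> \<bar>\<Sum>t\<in>h. V t \<omega>\<bar>} \<le> 2 * exp ((\<Sum>t\<in>h. c t) - l * K)"
proof -
  have rv: "V t \<in> borel_measurable M" if "t \<in> h" for t using ind that by (auto simp: indep_vars_def)
  have meas: "(\<lambda>\<omega>. \<Sum>t\<in>h. V t \<omega>) \<in> borel_measurable M" using rv by auto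
  have ind': "indep_vars (\<lambda>_. borel) (\<lambda>t \<omega>. - V t \<omega>) h"
    by (rule indep_vars_compose2[OF ind, where Y = "\<lambda>_ v. - v"]) auto
  have "{\<omega>\<in>space M. K \<le> \<bar>\<Sum>t\<in>h. V t \<omega>\<bar>} \<subseteq> {\<omega>\<in>space M. K \<le> (\<Sum>t\<in>h. V t \<omega>)} \<union> {\<omega>\<in>space M. K \<le> (\<Sum>t\<in>h. - V t \<omega>)}"
    by (auto simp: sum_negf)
  moreover have "{\<omega>\<in>space M. K \<le> (\<Sum>t\<in>h. V t \<omega>)} \<in> events" "{\<omega>\<in>space M. K \<le> (\<Sum>t\<in>h. - V t \<omega>)} \<in> events"
    using meas by (auto simp: sum_negf)
  ultimately have "prob {\<omega>\<in>space M. K \<le> \<bar>\<Sum>t\<in>h. V t \<omega>\<bar>}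
     \<le> prob {\<omega>\<in>space M. K \<le> (\<Sum>t\<in>h. V t \<omega>)} + prob {\<omega>\<in>space M. K \<le> (\<Sum>t\<in>h. - V t \<omega>)}"
    by (meson finite_measure_mono measure_Un_le order.trans sets.Un)
  also have "\<dots> \<le> exp ((\<Sum>t\<in>h. c t) - l * K) + exp ((\<Sum>t\<in>h. c t) - l * K)"
    by (intro add_mono chernoff_upper[OF ind fin l] chernoff_upper[OF ind' fin l]) (use int mgf in auto)
  finally show ?thesis by simp
qed

end

text \<open>
  Taylor's formula of order 2. Half of the exponent \<open>\<theta> |u|\<close> absorbs the remainder \<open>exp (l u)\<close>, the
  other half absorbs the factor \<open>u\<^sup>2\<close>.
\<close>

lemma exp_le_quadratic:
  fixes u :: real
  assumes "0 < \<theta>" "\<bar>l\<bar> \<le> \<theta> / 2"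
  shows "exp (l * u) \<le> 1 + l * u + l\<^sup>2 * (4 / \<theta>\<^sup>2) * exp (\<theta> * \<bar>u\<bar>)"
proof -
  obtain t where t: "\<bar>t\<bar> \<le> \<bar>l * u\<bar>" "exp (l * u) = (\<Sum>m<2. (l * u) ^ m / fact m) + exp t / fact 2 * (l * u) ^ 2"
    using Maclaurin_exp_le[of "l * u" 2] by auto
  have e: "exp (l * u) = 1 + l * u + exp t * (l * u)\<^sup>2 / 2" using t(2) by (simp add: numeral_2_eq_2)
  have lu: "\<bar>l * u\<bar> \<le> \<theta> * \<bar>u\<bar> / 2" using assms mult_right_mono[of "\<bar>l\<bar>" "\<theta> / 2" "\<bar>u\<bar>"] by (simp add: abs_mult)
  then have "exp t \<le> exp (\<theta> * \<bar>u\<bar> / 2)" using t(1) by simp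
  moreover have "u\<^sup>2 / 2 \<le> (4 / \<theta>\<^sup>2) * exp (\<theta> * \<bar>u\<bar> / 2)"
  proof -
    have "1 + (\<theta> * \<bar>u\<bar> / 2) + (\<theta> * \<bar>u\<bar> / 2)\<^sup>2 / 2 \<le> exp (\<theta> * \<bar>u\<bar> / 2)"
      using assms by (intro exp_lower_Taylor_quadratic) simp
    then have "\<theta>\<^sup>2 * u\<^sup>2 / 8 \<le> exp (\<theta> * \<bar>u\<bar> / 2)"
    proof -
      have "(\<theta> * \<bar>u\<bar> / 2)\<^sup>2 / 2 = \<theta>\<^sup>2 * u\<^sup>2 / 8" by (simp add: power_mult_distrib power_divide)
      moreover have "0 \<le> \<theta> * \<bar>u\<bar> / 2" using assms by simp
      ultimately show ?thesis using \<open>1 + _ + _ \<le> _\<close> by linarith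
    qed
    then show ?thesis using assms by (simp add: field_simps)
  qed
  ultimately have "exp t * (u\<^sup>2 / 2) \<le> exp (\<theta> * \<bar>u\<bar> / 2) * ((4 / \<theta>\<^sup>2) * exp (\<theta> * \<bar>u\<bar> / 2))"
    by (intro mult_mono) auto
  also have "\<dots> = (4 / \<theta>\<^sup>2) * exp (\<theta> * \<bar>u\<bar>)" by (simp add: exp_add[symmetric] mult.left_commute)
  finally have "l\<^sup>2 * (exp t * (u\<^sup>2 / 2)) \<le> l\<^sup>2 * ((4 / \<theta>\<^sup>2) * exp (\<theta> * \<bar>u\<bar>))"
    by (intro mult_left_mono) auto
  then show ?thesis unfolding e by (simp add: power_mult_distrib algebra_simps)
qed

context prob_space
begin

lemma centered_mgf_bound:
  fixes U :: "'a \<Rightarrow> real"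
  assumes U: "random_variable borel U" and \<theta>: "0 < \<theta>" "\<bar>l\<bar> \<le> \<theta> / 2"
    and intU: "integrable M (\<lambda>\<omega>. exp (\<theta> * \<bar>U \<omega>\<bar>))" and A: "expectation (\<lambda>\<omega>. exp (\<theta> * \<bar>U \<omega>\<bar>)) \<le> A"
    and mean: "expectation U = 0"
  shows "integrable M (\<lambda>\<omega>. exp (l * U \<omega>))" "expectation (\<lambda>\<omega>. exp (l * U \<omega>)) \<le> exp (l\<^sup>2 * (4 * A / \<theta>\<^sup>2))"
proof -
  note [measurable] = U
  have i1: "integrable M U"
  proof (rule Bochner_Integration.integrable_bound[OF integrable_mult_right[OF intU, of "1 / \<theta>"]])
    show "AE \<omega> in M. norm (U \<omega>) \<le> norm (1 / \<theta> * exp (\<theta> * \<bar>U \<omega>\<bar>))"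
    proof (rule AE_I2)
      fix \<omega>
      have "\<theta> * \<bar>U \<omega>\<bar> \<le> exp (\<theta> * \<bar>U \<omega>\<bar>)" using exp_ge_add_one_self[of "\<theta> * \<bar>U \<omega>\<bar>"] by linarith
      then show "norm (U \<omega>) \<le> norm (1 / \<theta> * exp (\<theta> * \<bar>U \<omega>\<bar>))" using \<theta> by (simp add: field_simps)
    qed
  qed simp
  show i2: "integrable M (\<lambda>\<omega>. exp (l * U \<omega>))"
  proof (rule Bochner_Integration.integrable_bound[OF intU])
    show "AE \<omega> in M. norm (exp (l * U \<omega>)) \<le> norm (exp (\<theta> * \<bar>U \<omega>\<bar>))"
    proof (rule AE_I2)
      fix \<omega>
      have "l * U \<omega> \<le> \<bar>l\<bar> * \<bar>U \<omega>\<bar>" by (metis abs_ge_self abs_mult)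
      also have "\<dots> \<le> \<theta> * \<bar>U \<omega>\<bar>" using \<theta> by (intro mult_right_mono) auto
      finally show "norm (exp (l * U \<omega>)) \<le> norm (exp (\<theta> * \<bar>U \<omega>\<bar>))" by simp
    qed
  qed simp
  have "expectation (\<lambda>\<omega>. exp (l * U \<omega>)) \<le> expectation (\<lambda>\<omega>. 1 + l * U \<omega> + l\<^sup>2 * (4 / \<theta>\<^sup>2) * exp (\<theta> * \<bar>U \<omega>\<bar>))"
    using i1 i2 intU by (intro integral_mono exp_le_quadratic[OF \<theta>]) auto
  also have "\<dots> = 1 + l\<^sup>2 * (4 / \<theta>\<^sup>2) * expectation (\<lambda>\<omega>. exp (\<theta> * \<bar>U \<omega>\<bar>))"
    using i1 intU mean by (simp add: prob_space)
  also have "\<dots> \<le> 1 + l\<^sup>2 * (4 / \<theta>\<^sup>2) * A"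
    using A by (intro add_left_mono mult_left_mono) auto
  also have "\<dots> \<le> exp (l\<^sup>2 * (4 * A / \<theta>\<^sup>2))"
    using exp_ge_add_one_self[of "l\<^sup>2 * (4 * A / \<theta>\<^sup>2)"] by (simp add: mult.assoc)
  finally show "expectation (\<lambda>\<omega>. exp (l * U \<omega>)) \<le> exp (l\<^sup>2 * (4 * A / \<theta>\<^sup>2))" .
qed

text \<open>
  The exponent \<open>l\<^sup>2 B - l \<eta>\<close> per summand, with \<open>B = 4 A / \<theta>\<^sup>2\<close> from \<open>centered_mgf_bound\<close>, is
  smallest at \<open>l = \<eta> / (2 B)\<close>. The upper bound on \<open>\<eta>\<close> keeps this \<open>l\<close> in the range \<open>|l| \<le> \<theta> / 2\<close>.
\<close>

lemma bernstein_bound: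
  assumes ind: "indep_vars (\<lambda>_. borel) U h" and fin: "finite h"
    and \<theta>: "0 < \<theta>" and A: "0 < A"
    and intU: "\<And>t. t \<in> h \<Longrightarrow> integrable M (\<lambda>\<omega>. exp (\<theta> * \<bar>U t \<omega>\<bar>))"
    and EA: "\<And>t. t \<in> h \<Longrightarrow> expectation (\<lambda>\<omega>. exp (\<theta> * \<bar>U t \<omega>\<bar>)) \<le> A"
    and mean: "\<And>t. t \<in> h \<Longrightarrow> expectation (U t) = 0"
    and \<eta>: "0 < \<eta>" "\<eta> \<le> 4 * A / \<theta>"
  shows "prob {\<omega>\<in>space M. real (card h) * \<eta> \<le> \<bar>\<Sum>t\<in>h. U t \<omega>\<bar>} \<le> 2 * exp (- (real (card h) * \<eta>\<^sup>2 * (\<theta>\<^sup>2 / (16 * A))))"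
proof -
  define B where "B = 4 * A / \<theta>\<^sup>2"
  define l where "l = \<eta> / (2 * B)"
  have B: "0 < B" using \<theta> A by (simp add: B_def)
  have l: "0 < l" using \<eta> B by (simp add: l_def)
  have "\<eta> / (2 * B) \<le> (4 * A / \<theta>) / (2 * B)" using \<eta> B by (intro divide_right_mono) auto
  also have "\<dots> = \<theta> / 2" using \<theta> A by (simp add: B_def power2_eq_square field_simps)
  finally have l2: "\<bar>l\<bar> \<le> \<theta> / 2" "\<bar>- l\<bar> \<le> \<theta> / 2" using l by (auto simp: l_def)
  have rv: "random_variable borel (U t)" if "t \<in> h" for t using ind that by (auto simp: indep_vars_def)
  have m1: "integrable M (\<lambda>\<omega>. exp (l * U t \<omega>))" "expectation (\<lambda>\<omega>. exp (l * U t \<omega>)) \<le> exp (l\<^sup>2 * B)"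
    and m2: "integrable M (\<lambda>\<omega>. exp (- l * U t \<omega>))" "expectation (\<lambda>\<omega>. exp (- l * U t \<omega>)) \<le> exp (l\<^sup>2 * B)" if "t \<in> h" for t
    using centered_mgf_bound[OF rv \<theta> l2(1) intU EA mean] centered_mgf_bound[OF rv \<theta> l2(2) intU EA mean] that
    by (auto simp: B_def)
  have "prob {\<omega>\<in>space M. real (card h) * \<eta> \<le> \<bar>\<Sum>t\<in>h. U t \<omega>\<bar>} \<le> 2 * exp ((\<Sum>t\<in>h. l\<^sup>2 * B) - l * (real (card h) * \<eta>))"
    by (rule chernoff_two_sided[OF ind fin l]) (use m1 m2 in auto)
  also have "(\<Sum>t\<in>h. l\<^sup>2 * B) - l * (real (card h) * \<eta>) = - (real (card h) * \<eta>\<^sup>2 * (1 / (4 * B)))"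
    using B by (simp add: l_def power2_eq_square field_simps)
  also have "1 / (4 * B) = \<theta>\<^sup>2 / (16 * A)" by (simp add: B_def)
  finally show ?thesis .
qed

end

section \<open>Normal variables\<close>

text \<open>Constants are included, since covariance matrices may be singular.\<close>

definition (in prob_space) gaussian :: "('a \<Rightarrow> real) \<Rightarrow> bool" where
  "gaussian W \<longleftrightarrow> random_variable borel W \<and> (\<exists>m s. 0 \<le> s \<and> distr M borel W = normal_law m s)"

lemma normal_law_square:
  assumes "0 \<le> s"
  shows "integrable (normal_law m s) (\<lambda>x. x\<^sup>2)" "(\<integral>x. x\<^sup>2 \<partial>normal_law m s) = m\<^sup>2 + s\<^sup>2"
proof -
  have "integrable (normal_law m s) (\<lambda>x. x\<^sup>2) \<and> (\<integral>x. x\<^sup>2 \<partial>normal_law m s) = m\<^sup>2 + s\<^sup>2"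
  proof (cases "s = 0")
    case True
    interpret R: prob_space "return borel m" by (rule prob_space_return) simp
    have "has_bochner_integral (return borel m) (\<lambda>x. x\<^sup>2) (m\<^sup>2)"
    proof (rule has_bochner_integral_cong_AE[THEN iffD1])
      show "has_bochner_integral (return borel m) (\<lambda>x. m\<^sup>2) (m\<^sup>2)"
        using R.prob_space by (auto simp: has_bochner_integral_iff)
    qed (auto simp: AE_return)
    then show ?thesis using True by (simp add: normal_law_def has_bochner_integral_iff)
  next
    case False
    with assms have s: "0 < s" by simp
    have sq: "normal_density m s x * x\<^sup>2 = normal_density m s x * (x - m) ^ (2 * 1) + 2 * m * (normal_density m s x * x) - m\<^sup>2 * normal_density m s x" for x
      by (simp add: power2_eq_square algebra_simps)
    have "has_bochner_integral lborel (\<lambda>x. normal_density m s x * (x - m) ^ (2 * 1) + 2 * m * (normal_density m s x * x) - m\<^sup>2 * normal_density m s x)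
       (fact (2 * 1) / ((2 / s\<^sup>2) ^ 1 * fact 1) + 2 * m * m - m\<^sup>2 * 1)"
      using normal_moment_even[OF s, of m 1] normal_moment_nz_1[OF s, of m] s
      by (intro has_bochner_integral_diff has_bochner_integral_add has_bochner_integral_mult_right)
        (auto simp: has_bochner_integral_iff)
    then have "has_bochner_integral lborel (\<lambda>x. normal_density m s x * x\<^sup>2) (m\<^sup>2 + s\<^sup>2)"
      unfolding sq by (simp add: power2_eq_square)
    then show ?thesis using False
      by (simp add: normal_law_def has_bochner_integral_iff integrable_density integral_density normal_density_nonneg)
  qed
  then show "integrable (normal_law m s) (\<lambda>x. x\<^sup>2)" "(\<integral>x. x\<^sup>2 \<partial>normal_law m s) = m\<^sup>2 + s\<^sup>2" by auto
qed

text \<open>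
  By \<open>x\<^sup>2 \<le> 2 m\<^sup>2 + 2 (x - m)\<^sup>2\<close>, the exponent is at most \<open>1 / 4 + (x - m)\<^sup>2 / (4 s\<^sup>2)\<close>. The
  second term uses up half of the exponent of the density, so that the density of \<open>\<N>(m, 2 s\<^sup>2)\<close>
  appears, with the factor \<open>exp (1 / 4) * sqrt 2 \<le> 2\<close>.
\<close>

lemma normal_law_exp_square:
  assumes s: "0 \<le> s" and v: "0 < v" "m\<^sup>2 + s\<^sup>2 \<le> v"
  shows "(\<integral>\<^sup>+x. ennreal (exp (x\<^sup>2 / (8 * v))) \<partial>normal_law m s) \<le> 2"
proof (cases "s = 0")
  case True
  have "m\<^sup>2 / (8 * v) \<le> 1 / 8" using v by (simp add: True divide_le_eq)
  then have "exp (m\<^sup>2 / (8 * v)) \<le> exp (1/8)" by simp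
  also have "exp (1/8) \<le> (2::real)" using exp_bound[of "1/8::real"] by (simp add: power2_eq_square)
  finally have "ennreal (exp (m\<^sup>2 / (8 * v))) \<le> ennreal 2" by (rule ennreal_leI)
  then show ?thesis using True by (simp add: normal_law_def nn_integral_return)
next
  case False
  with s have s: "0 < s" by simp
  have bound: "normal_density m s x * exp (x\<^sup>2 / (8 * v)) \<le> 2 * normal_density m (sqrt 2 * s) x" for x
  proof -
    have "x\<^sup>2 \<le> 2 * m\<^sup>2 + 2 * (x - m)\<^sup>2"
    proof -
      have "0 \<le> (x - 2 * m)\<^sup>2" by simp
      then show ?thesis by (simp add: power2_eq_square algebra_simps)
    qed
    then have "x\<^sup>2 / (8 * v) \<le> (2 * m\<^sup>2 + 2 * (x - m)\<^sup>2) / (8 * v)" using v by (intro divide_right_mono) auto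
    also have "\<dots> = m\<^sup>2 / (4 * v) + (x - m)\<^sup>2 / (4 * v)" using v by (simp add: field_simps)
    also have "\<dots> \<le> 1 / 4 + (x - m)\<^sup>2 / (4 * s\<^sup>2)"
    proof (rule add_mono)
      have "m\<^sup>2 \<le> v" using v by (smt (verit) zero_le_power2)
      then show "m\<^sup>2 / (4 * v) \<le> 1 / 4" using v by (simp add: divide_le_eq)
      have "s\<^sup>2 \<le> v" using v by (smt (verit) zero_le_power2)
      then show "(x - m)\<^sup>2 / (4 * v) \<le> (x - m)\<^sup>2 / (4 * s\<^sup>2)" using s v by (intro divide_left_mono mult_left_mono mult_pos_pos) auto
    qed
    finally have "exp (x\<^sup>2 / (8 * v)) \<le> exp (1 / 4 + (x - m)\<^sup>2 / (4 * s\<^sup>2))" by simp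
    then have "normal_density m s x * exp (x\<^sup>2 / (8 * v)) \<le> normal_density m s x * exp (1 / 4 + (x - m)\<^sup>2 / (4 * s\<^sup>2))"
      by (intro mult_left_mono normal_density_nonneg)
    also have "\<dots> = exp (1/4) * sqrt 2 * normal_density m (sqrt 2 * s) x"
    proof -
      have "exp (- (x - m)\<^sup>2 / (2 * s\<^sup>2)) * exp (1 / 4 + (x - m)\<^sup>2 / (4 * s\<^sup>2)) = exp (1/4) * exp (- (x - m)\<^sup>2 / (2 * (sqrt 2 * s)\<^sup>2))"
        unfolding exp_add[symmetric] using s by (simp add: power_mult_distrib field_simps)
      moreover have "sqrt (2 * pi * (sqrt 2 * s)\<^sup>2) = sqrt 2 * sqrt (2 * pi * s\<^sup>2)"
        by (simp add: power_mult_distrib real_sqrt_mult)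
      ultimately show ?thesis unfolding normal_density_def by (simp add: mult.assoc mult.left_commute)
    qed
    also have "\<dots> \<le> 2 * normal_density m (sqrt 2 * s) x"
    proof (rule mult_right_mono[OF _ normal_density_nonneg])
      have "exp (1/4) \<le> (1 + 1/4 + (1/4)\<^sup>2 :: real)" by (rule exp_bound) auto
      also have "\<dots> \<le> 4/3" by (simp add: power2_eq_square)
      finally have 1: "exp (1/4) \<le> (4/3::real)" .
      have 2: "sqrt 2 \<le> 3/2" by (rule real_le_lsqrt) (auto simp: power2_eq_square)
      have "exp (1/4) * sqrt 2 \<le> (4/3) * (3/2::real)" using 1 2 by (intro mult_mono) auto
      then show "exp (1/4) * sqrt 2 \<le> (2::real)" by simp
    qed
    finally show ?thesis .
  qed
  have "(\<integral>\<^sup>+x. ennreal (exp (x\<^sup>2 / (8 * v))) \<partial>normal_law m s)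
     = (\<integral>\<^sup>+x. ennreal (normal_density m s x) * ennreal (exp (x\<^sup>2 / (8 * v))) \<partial>lborel)"
    using False by (simp add: normal_law_def nn_integral_density)
  also have "\<dots> \<le> (\<integral>\<^sup>+x. ennreal (2 * normal_density m (sqrt 2 * s) x) \<partial>lborel)"
    using bound by (intro nn_integral_mono) (auto simp: ennreal_mult''[symmetric] intro!: ennreal_leI)
  also have "\<dots> = ennreal (\<integral>x. 2 * normal_density m (sqrt 2 * s) x \<partial>lborel)"
    using s by (intro nn_integral_eq_integral) (auto simp: normal_density_nonneg)
  also have "\<dots> = 2" using s by simp
  finally show ?thesis .
qed

context prob_space
begin

lemma gaussian_rv: "gaussian W \<Longrightarrow> random_variable borel W"
  by (simp add: gaussian_def)

lemma gaussian_square_integrable: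
  assumes "gaussian W"
  shows "integrable M (\<lambda>\<omega>. (W \<omega>)\<^sup>2)"
proof -
  obtain m s where s: "0 \<le> s" and W: "distr M borel W = normal_law m s" using assms by (auto simp: gaussian_def)
  note [measurable] = gaussian_rv[OF assms]
  show ?thesis using normal_law_square[OF s, of m] unfolding W[symmetric]
    by (subst (asm) integrable_distr_eq) auto
qed

lemma gaussian_exp_square:
  assumes g: "gaussian W" and v: "0 < v" "expectation (\<lambda>\<omega>. (W \<omega>)\<^sup>2) \<le> v"
  shows "integrable M (\<lambda>\<omega>. exp ((W \<omega>)\<^sup>2 / (8 * v)))" "expectation (\<lambda>\<omega>. exp ((W \<omega>)\<^sup>2 / (8 * v))) \<le> 2"
proof -
  obtain m s where s: "0 \<le> s" and W: "distr M borel W = normal_law m s" using g by (auto simp: gaussian_def)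
  note [measurable] = gaussian_rv[OF g]
  have "expectation (\<lambda>\<omega>. (W \<omega>)\<^sup>2) = (\<integral>x. x\<^sup>2 \<partial>distr M borel W)" by (subst integral_distr) auto
  also have "\<dots> = m\<^sup>2 + s\<^sup>2" unfolding W by (rule normal_law_square[OF s])
  finally have ms: "m\<^sup>2 + s\<^sup>2 \<le> v" using v by simp
  have "(\<integral>\<^sup>+\<omega>. ennreal (exp ((W \<omega>)\<^sup>2 / (8 * v))) \<partial>M) = (\<integral>\<^sup>+x. ennreal (exp (x\<^sup>2 / (8 * v))) \<partial>distr M borel W)"
    by (subst nn_integral_distr) auto
  also have "\<dots> \<le> 2" unfolding W by (rule normal_law_exp_square[OF s v(1) ms])
  finally have le: "(\<integral>\<^sup>+\<omega>. ennreal (exp ((W \<omega>)\<^sup>2 / (8 * v))) \<partial>M) \<le> 2" .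
  show I: "integrable M (\<lambda>\<omega>. exp ((W \<omega>)\<^sup>2 / (8 * v)))"
    using le by (intro integrableI_bounded) (auto intro: le_less_trans simp: less_top[symmetric] top_unique)
  have "ennreal (expectation (\<lambda>\<omega>. exp ((W \<omega>)\<^sup>2 / (8 * v)))) \<le> ennreal 2"
    using le by (subst nn_integral_eq_integral[OF I, symmetric]) auto
  then show "expectation (\<lambda>\<omega>. exp ((W \<omega>)\<^sup>2 / (8 * v))) \<le> 2" by (subst (asm) ennreal_le_iff) auto
qed

text \<open>
  The product is at most the mean of the two squares, and the exponential of a mean is at most the
  mean of the exponentials. So the exponential moments of the squares suffice, and they depend on
  the marginal laws only.
\<close>

lemma gaussian_product:
  assumes W: "gaussian W" "expectation (\<lambda>\<omega>. (W \<omega>)\<^sup>2) \<le> v" and W': "gaussian W'" "expectation (\<lambda>\<omega>. (W' \<omega>)\<^sup>2) \<le> v"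
    and v: "0 < v"
  defines "\<mu> \<equiv> expectation (\<lambda>\<omega>. W \<omega> * W' \<omega>)"
  shows "integrable M (\<lambda>\<omega>. W \<omega> * W' \<omega>)" "\<bar>\<mu>\<bar> \<le> v"
    "integrable M (\<lambda>\<omega>. exp (1 / (8 * v) * \<bar>W \<omega> * W' \<omega> - \<mu>\<bar>))" 
    "expectation (\<lambda>\<omega>. exp (1 / (8 * v) * \<bar>W \<omega> * W' \<omega> - \<mu>\<bar>)) \<le> 3"
proof -
  note [measurable] = gaussian_rv[OF W(1)] gaussian_rv[OF W'(1)]
  note sq = gaussian_square_integrable[OF W(1)] gaussian_square_integrable[OF W'(1)]
  have amgm: "\<bar>a * b\<bar> \<le> (a\<^sup>2 + b\<^sup>2) / 2" for a b :: real
    using sum_squares_bound[of "\<bar>a\<bar>" "\<bar>b\<bar>"] by (simp add: abs_mult)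
  show int: "integrable M (\<lambda>\<omega>. W \<omega> * W' \<omega>)"
    by (rule Bochner_Integration.integrable_bound[where f = "\<lambda>\<omega>. ((W \<omega>)\<^sup>2 + (W' \<omega>)\<^sup>2) / 2"])
      (use sq amgm in auto)
  have "\<bar>\<mu>\<bar> \<le> expectation (\<lambda>\<omega>. \<bar>W \<omega> * W' \<omega>\<bar>)" unfolding \<mu>_def by (rule integral_abs_bound)
  also have "\<dots> \<le> expectation (\<lambda>\<omega>. ((W \<omega>)\<^sup>2 + (W' \<omega>)\<^sup>2) / 2)"
    using int sq amgm by (intro integral_mono) auto
  also have "\<dots> \<le> v" using sq W W' by simp
  finally show \<mu>: "\<bar>\<mu>\<bar> \<le> v" .
  define E where "E = (\<lambda>\<omega>. exp (1/8) * ((exp ((W \<omega>)\<^sup>2 / (8 * v)) + exp ((W' \<omega>)\<^sup>2 / (8 * v))) / 2))"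
  note e1 = gaussian_exp_square[OF W(1) v W(2)] and e2 = gaussian_exp_square[OF W'(1) v W'(2)]
  have iE: "integrable M E" unfolding E_def using e1 e2 by auto
  have le: "exp (1 / (8 * v) * \<bar>W \<omega> * W' \<omega> - \<mu>\<bar>) \<le> E \<omega>" for \<omega>
  proof -
    have "\<bar>W \<omega> * W' \<omega> - \<mu>\<bar> \<le> ((W \<omega>)\<^sup>2 + (W' \<omega>)\<^sup>2) / 2 + v" using amgm[of "W \<omega>" "W' \<omega>"] \<mu> by linarith
    then have "1 / (8 * v) * \<bar>W \<omega> * W' \<omega> - \<mu>\<bar> \<le> 1 / (8 * v) * (((W \<omega>)\<^sup>2 + (W' \<omega>)\<^sup>2) / 2 + v)"
      using v by (intro mult_left_mono) auto
    also have "\<dots> = 1/8 + ((W \<omega>)\<^sup>2 / (8 * v) / 2 + (W' \<omega>)\<^sup>2 / (8 * v) / 2)" using v by (simp add: field_simps)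
    finally have "exp (1 / (8 * v) * \<bar>W \<omega> * W' \<omega> - \<mu>\<bar>) \<le> exp (1/8) * (exp ((W \<omega>)\<^sup>2 / (8 * v) / 2) * exp ((W' \<omega>)\<^sup>2 / (8 * v) / 2))"
      unfolding exp_add[symmetric] by simp
    also have "exp ((W \<omega>)\<^sup>2 / (8 * v) / 2) * exp ((W' \<omega>)\<^sup>2 / (8 * v) / 2) \<le> (exp ((W \<omega>)\<^sup>2 / (8 * v)) + exp ((W' \<omega>)\<^sup>2 / (8 * v))) / 2"
      using sum_squares_bound[of "exp ((W \<omega>)\<^sup>2 / (8 * v) / 2)" "exp ((W' \<omega>)\<^sup>2 / (8 * v) / 2)"]
      by (simp add: exp_double[symmetric])
    finally show ?thesis unfolding E_def by simp
  qed
  show I: "integrable M (\<lambda>\<omega>. exp (1 / (8 * v) * \<bar>W \<omega> * W' \<omega> - \<mu>\<bar>))"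
    by (rule Bochner_Integration.integrable_bound[OF iE]) (use order.trans[OF le abs_ge_self] in \<open>auto intro!: AE_I2\<close>)
  have "expectation (\<lambda>\<omega>. exp (1 / (8 * v) * \<bar>W \<omega> * W' \<omega> - \<mu>\<bar>)) \<le> expectation E"
    using le by (intro integral_mono I iE) auto
  also have "\<dots> \<le> exp (1/8) * 2" unfolding E_def using e1 e2 by simp
  also have "\<dots> \<le> 3"
    using exp_bound[of "1/8::real"] by (simp add: power2_eq_square)
  finally show "expectation (\<lambda>\<omega>. exp (1 / (8 * v) * \<bar>W \<omega> * W' \<omega> - \<mu>\<bar>)) \<le> 3" .
qed

text \<open>
  Bernstein's inequality with \<open>\<theta> = 1 / (8 v)\<close> and \<open>A = 3\<close>, whence \<open>96 = 4 * 3 * 8\<close> and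
  \<open>3072 = 16 * 3 * 8 * 8\<close>.
\<close>

lemma gaussian_product_concentration:
  assumes ind: "indep_vars (\<lambda>_. borel) (\<lambda>t \<omega>. W t \<omega> * W' t \<omega>) h" and fin: "finite h"
    and W: "\<And>t. t \<in> h \<Longrightarrow> gaussian (W t)" "\<And>t. t \<in> h \<Longrightarrow> expectation (\<lambda>\<omega>. (W t \<omega>)\<^sup>2) \<le> v"
    and W': "\<And>t. t \<in> h \<Longrightarrow> gaussian (W' t)" "\<And>t. t \<in> h \<Longrightarrow> expectation (\<lambda>\<omega>. (W' t \<omega>)\<^sup>2) \<le> v"
    and mean: "\<And>t. t \<in> h \<Longrightarrow> expectation (\<lambda>\<omega>. W t \<omega> * W' t \<omega>) = \<mu>"
    and v: "0 < v" and \<eta>: "0 < \<eta>" "\<eta> \<le> 96 * v"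
  shows "prob {\<omega>\<in>space M. real (card h) * \<eta> \<le> \<bar>(\<Sum>t\<in>h. W t \<omega> * W' t \<omega>) - real (card h) * \<mu>\<bar>}
    \<le> 2 * exp (- (real (card h) * \<eta>\<^sup>2 / (3072 * v\<^sup>2)))"
proof -
  have ind': "indep_vars (\<lambda>_. borel) (\<lambda>t \<omega>. W t \<omega> * W' t \<omega> - \<mu>) h"
    by (rule indep_vars_compose2[OF ind, where Y = "\<lambda>_ z. z - \<mu>"]) auto
  note p = gaussian_product[OF W W' v]
  have "prob {\<omega>\<in>space M. real (card h) * \<eta> \<le> \<bar>\<Sum>t\<in>h. W t \<omega> * W' t \<omega> - \<mu>\<bar>}
    \<le> 2 * exp (- (real (card h) * \<eta>\<^sup>2 * ((1 / (8 * v))\<^sup>2 / (16 * 3))))"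
  proof (rule bernstein_bound[OF ind' fin])
    show "integrable M (\<lambda>\<omega>. exp (1 / (8 * v) * \<bar>W t \<omega> * W' t \<omega> - \<mu>\<bar>))"
      "expectation (\<lambda>\<omega>. exp (1 / (8 * v) * \<bar>W t \<omega> * W' t \<omega> - \<mu>\<bar>)) \<le> 3" if "t \<in> h" for t
      using p(3,4)[of t t] that mean[OF that] by auto
    show "expectation (\<lambda>\<omega>. W t \<omega> * W' t \<omega> - \<mu>) = 0" if "t \<in> h" for t
      using p(1)[of t t] that mean[OF that] by (simp add: prob_space)
  qed (use v \<eta> in auto)
  then show ?thesis by (simp add: sum_subtractf power_divide power_mult_distrib)
qed

lemma std_normal_mgf:
  assumes W: "random_variable borel W" and law: "distr M borel W = normal_law 0 1"
  shows "integrable M (\<lambda>\<omega>. exp (l * W \<omega>))" "expectation (\<lambda>\<omega>. exp (l * W \<omega>)) \<le> exp (l\<^sup>2 / 2)"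
proof -
  note [measurable] = W
  have eq: "normal_density 0 1 x * exp (l * x) = exp (l\<^sup>2 / 2) * normal_density l 1 x" for x :: real
  proof -
    have "exp (- (x\<^sup>2) / 2) * exp (l * x) = exp (l\<^sup>2 / 2) * exp (- ((x - l)\<^sup>2) / 2)"
      unfolding exp_add[symmetric] by (simp add: power2_eq_square field_simps)
    then show ?thesis by (simp add: normal_density_def)
  qed
  have "(\<integral>\<^sup>+\<omega>. ennreal (exp (l * W \<omega>)) \<partial>M) = (\<integral>\<^sup>+x. ennreal (exp (l * x)) \<partial>distr M borel W)"
    by (subst nn_integral_distr) auto
  also have "\<dots> = (\<integral>\<^sup>+x. ennreal (normal_density 0 1 x) * ennreal (exp (l * x)) \<partial>lborel)"
    unfolding law by (simp add: normal_law_def nn_integral_density)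
  also have "\<dots> = (\<integral>\<^sup>+x. ennreal (exp (l\<^sup>2 / 2) * normal_density l 1 x) \<partial>lborel)"
    by (simp add: ennreal_mult''[symmetric] eq)
  also have "\<dots> = ennreal (\<integral>x. exp (l\<^sup>2 / 2) * normal_density l 1 x \<partial>lborel)"
    by (intro nn_integral_eq_integral) (auto simp: normal_density_nonneg)
  also have "\<dots> = ennreal (exp (l\<^sup>2 / 2))" by simp
  finally have eq: "(\<integral>\<^sup>+\<omega>. ennreal (exp (l * W \<omega>)) \<partial>M) = ennreal (exp (l\<^sup>2 / 2))" .
  show I: "integrable M (\<lambda>\<omega>. exp (l * W \<omega>))" using eq by (intro integrableI_bounded) auto
  have "ennreal (expectation (\<lambda>\<omega>. exp (l * W \<omega>))) = ennreal (exp (l\<^sup>2 / 2))"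
    using eq by (subst nn_integral_eq_integral[OF I, symmetric]) auto
  then show "expectation (\<lambda>\<omega>. exp (l * W \<omega>)) \<le> exp (l\<^sup>2 / 2)" by (simp add: ennreal_inj integral_nonneg_AE)
qed

lemma std_normal_linear_tail:
  assumes ind: "indep_vars (\<lambda>_. borel) W h" and fin: "finite h"
    and law: "\<And>t. t \<in> h \<Longrightarrow> distr M borel (W t) = normal_law 0 1"
    and V: "0 < V" "(\<Sum>t\<in>h. (a t)\<^sup>2) \<le> V" and K: "0 < K"
  shows "prob {\<omega>\<in>space M. K \<le> \<bar>\<Sum>t\<in>h. a t * W t \<omega>\<bar>} \<le> 2 * exp (- (K\<^sup>2 / (2 * V)))"
proof -
  have rv: "random_variable borel (W t)" if "t \<in> h" for t using ind that by (auto simp: indep_vars_def)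
  have ind': "indep_vars (\<lambda>_. borel) (\<lambda>t \<omega>. a t * W t \<omega>) h"
    by (rule indep_vars_compose2[OF ind, where Y = "\<lambda>t w. a t * w"]) auto
  define l where "l = K / V"
  have l: "0 < l" using K V by (simp add: l_def)
  have "prob {\<omega>\<in>space M. K \<le> \<bar>\<Sum>t\<in>h. a t * W t \<omega>\<bar>} \<le> 2 * exp ((\<Sum>t\<in>h. l\<^sup>2 / 2 * (a t)\<^sup>2) - l * K)"
  proof (rule chernoff_two_sided[OF ind' fin l])
    fix t assume t: "t \<in> h"
    note m1 = std_normal_mgf[OF rv[OF t] law[OF t], of "l * a t"] and m2 = std_normal_mgf[OF rv[OF t] law[OF t], of "- l * a t"]
    show "integrable M (\<lambda>\<omega>. exp (l * (a t * W t \<omega>)))" "integrable M (\<lambda>\<omega>. exp (- l * (a t * W t \<omega>)))"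
      using m1 m2 by (simp_all add: mult.assoc)
    show "expectation (\<lambda>\<omega>. exp (l * (a t * W t \<omega>))) \<le> exp (l\<^sup>2 / 2 * (a t)\<^sup>2)"
      "expectation (\<lambda>\<omega>. exp (- l * (a t * W t \<omega>))) \<le> exp (l\<^sup>2 / 2 * (a t)\<^sup>2)"
      using m1 m2 by (simp_all add: mult.assoc power_mult_distrib)
  qed
  also have "\<dots> \<le> 2 * exp (- (K\<^sup>2 / (2 * V)))"
  proof -
    have "(\<Sum>t\<in>h. l\<^sup>2 / 2 * (a t)\<^sup>2) \<le> l\<^sup>2 / 2 * V" unfolding sum_distrib_left[symmetric] using V by (intro mult_left_mono) auto
    also have "l\<^sup>2 / 2 * V - l * K = - (K\<^sup>2 / (2 * V))" using V by (simp add: l_def power2_eq_square field_simps)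
    finally show ?thesis by simp
  qed
  finally show ?thesis .
qed

end

section \<open>Measurability\<close>

text \<open>
  The types of matrices and vectors carry no sigma-algebra, so measurability is required
  entrywise; fixing the dimensions makes all entries meaningful.
\<close>

definition measurable_mat :: "'a measure \<Rightarrow> nat \<Rightarrow> nat \<Rightarrow> ('a \<Rightarrow> real mat) \<Rightarrow> bool" where
  "measurable_mat M n m A \<longleftrightarrow> (\<forall>\<omega>\<in>space M. A \<omega> \<in> carrier_mat n m) \<and>
     (\<forall>i<n. \<forall>j<m. (\<lambda>\<omega>. A \<omega> $$ (i, j)) \<in> borel_measurable M)"

definition measurable_vec :: "'a measure \<Rightarrow> nat \<Rightarrow> ('a \<Rightarrow> real vec) \<Rightarrow> bool" where
  "measurable_vec M n v \<longleftrightarrow> (\<forall>\<omega>\<in>space M. v \<omega> \<in> carrier_vec n) \<and>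
     (\<forall>i<n. (\<lambda>\<omega>. v \<omega> $ i) \<in> borel_measurable M)"

lemma measurable_mat_carrier: "measurable_mat M n m A \<Longrightarrow> \<omega> \<in> space M \<Longrightarrow> A \<omega> \<in> carrier_mat n m"
  and measurable_mat_entry: "measurable_mat M n m A \<Longrightarrow> i < n \<Longrightarrow> j < m \<Longrightarrow> (\<lambda>\<omega>. A \<omega> $$ (i, j)) \<in> borel_measurable M"
  and measurable_vec_carrier: "measurable_vec M n v \<Longrightarrow> \<omega> \<in> space M \<Longrightarrow> v \<omega> \<in> carrier_vec n"
  and measurable_vec_entry: "measurable_vec M n v \<Longrightarrow> i < n \<Longrightarrow> (\<lambda>\<omega>. v \<omega> $ i) \<in> borel_measurable M"
  by (simp_all add: measurable_mat_def measurable_vec_def)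

lemma measurable_matI:
  assumes "\<And>\<omega>. \<omega> \<in> space M \<Longrightarrow> A \<omega> \<in> carrier_mat n m"
    and "\<And>\<omega> i j. \<omega> \<in> space M \<Longrightarrow> i < n \<Longrightarrow> j < m \<Longrightarrow> A \<omega> $$ (i, j) = f i j \<omega>"
    and "\<And>i j. i < n \<Longrightarrow> j < m \<Longrightarrow> f i j \<in> borel_measurable M"
  shows "measurable_mat M n m A"
  unfolding measurable_mat_def
proof (intro conjI ballI allI impI)
  fix i j assume ij: "i < n" "j < m"
  show "(\<lambda>\<omega>. A \<omega> $$ (i, j)) \<in> borel_measurable M"
    using assms(3)[OF ij] by (rule measurable_cong[THEN iffD1, rotated]) (simp add: assms(2) ij)
qed (rule assms(1))

lemma measurable_vecI:
  assumes "\<And>\<omega>. \<omega> \<in> space M \<Longrightarrow> v \<omega> \<in> carrier_vec n"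
    and "\<And>\<omega> i. \<omega> \<in> space M \<Longrightarrow> i < n \<Longrightarrow> v \<omega> $ i = f i \<omega>"
    and "\<And>i. i < n \<Longrightarrow> f i \<in> borel_measurable M"
  shows "measurable_vec M n v"
  unfolding measurable_vec_def
proof (intro conjI ballI allI impI)
  fix i assume i: "i < n"
  show "(\<lambda>\<omega>. v \<omega> $ i) \<in> borel_measurable M"
    using assms(3)[OF i] by (rule measurable_cong[THEN iffD1, rotated]) (simp add: assms(2) i)
qed (rule assms(1))

lemma measurable_mat_mult:
  assumes A: "measurable_mat M n m A" and B: "measurable_mat M m l B"
  shows "measurable_mat M n l (\<lambda>\<omega>. A \<omega> * B \<omega>)"
proof (rule measurable_matI)
  show "A \<omega> * B \<omega> \<in> carrier_mat n l" if "\<omega> \<in> space M" for \<omega>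
    using measurable_mat_carrier[OF A that] measurable_mat_carrier[OF B that] by simp
  show "(A \<omega> * B \<omega>) $$ (i, j) = (\<Sum>k<m. A \<omega> $$ (i, k) * B \<omega> $$ (k, j))"
    if "\<omega> \<in> space M" "i < n" "j < l" for \<omega> i j
    using measurable_mat_carrier[OF A that(1)] measurable_mat_carrier[OF B that(1)] that
    by (simp add: times_mat_def scalar_prod_def atLeast0LessThan)
  show "(\<lambda>\<omega>. \<Sum>k<m. A \<omega> $$ (i, k) * B \<omega> $$ (k, j)) \<in> borel_measurable M" if "i < n" "j < l" for i j
    using measurable_mat_entry[OF A] measurable_mat_entry[OF B] that by auto
qed

lemma measurable_mat_mult_vec:
  assumes A: "measurable_mat M n m A" and v: "measurable_vec M m v"
  shows "measurable_vec M n (\<lambda>\<omega>. A \<omega> *\<^sub>v v \<omega>)"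
proof (rule measurable_vecI)
  show "A \<omega> *\<^sub>v v \<omega> \<in> carrier_vec n" if "\<omega> \<in> space M" for \<omega>
    using measurable_mat_carrier[OF A that] measurable_vec_carrier[OF v that] by simp
  show "(A \<omega> *\<^sub>v v \<omega>) $ i = (\<Sum>k<m. A \<omega> $$ (i, k) * v \<omega> $ k)"
    if "\<omega> \<in> space M" "i < n" for \<omega> i
    using measurable_mat_carrier[OF A that(1)] measurable_vec_carrier[OF v that(1)] that
    by (simp add: scalar_prod_def atLeast0LessThan)
  show "(\<lambda>\<omega>. \<Sum>k<m. A \<omega> $$ (i, k) * v \<omega> $ k) \<in> borel_measurable M" if "i < n" for i
    using measurable_mat_entry[OF A] measurable_vec_entry[OF v] that by auto
qed

lemma measurable_mat_transpose:
  assumes A: "measurable_mat M n m A"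
  shows "measurable_mat M m n (\<lambda>\<omega>. (A \<omega>)\<^sup>T)"
  by (rule measurable_matI[where f = "\<lambda>i j \<omega>. A \<omega> $$ (j, i)"])
    (use measurable_mat_carrier[OF A] measurable_mat_entry[OF A] in \<open>force+\<close>)

lemma measurable_mat_minus:
  assumes A: "measurable_mat M n m A" and B: "measurable_mat M n m B"
  shows "measurable_mat M n m (\<lambda>\<omega>. A \<omega> - B \<omega>)"
proof (rule measurable_matI)
  show "A \<omega> - B \<omega> \<in> carrier_mat n m" if "\<omega> \<in> space M" for \<omega>
    using measurable_mat_carrier[OF A that] measurable_mat_carrier[OF B that] by (metis minus_carrier_mat)
  show "(A \<omega> - B \<omega>) $$ (i, j) = A \<omega> $$ (i, j) - B \<omega> $$ (i, j)"
    if "\<omega> \<in> space M" "i < n" "j < m" for \<omega> i j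
    using measurable_mat_carrier[OF A that(1)] measurable_mat_carrier[OF B that(1)] that by simp
  show "(\<lambda>\<omega>. A \<omega> $$ (i, j) - B \<omega> $$ (i, j)) \<in> borel_measurable M" if "i < n" "j < m" for i j
    using measurable_mat_entry[OF A] measurable_mat_entry[OF B] that by auto
qed

lemma measurable_vec_minus:
  assumes v: "measurable_vec M n v" and w: "measurable_vec M n w"
  shows "measurable_vec M n (\<lambda>\<omega>. v \<omega> - w \<omega>)"
proof (rule measurable_vecI)
  show "v \<omega> - w \<omega> \<in> carrier_vec n" if "\<omega> \<in> space M" for \<omega>
    using measurable_vec_carrier[OF v that] measurable_vec_carrier[OF w that] by simp
  show "(v \<omega> - w \<omega>) $ i = v \<omega> $ i - w \<omega> $ i" if "\<omega> \<in> space M" "i < n" for \<omega> i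
    using measurable_vec_carrier[OF v that(1)] measurable_vec_carrier[OF w that(1)] that by simp
  show "(\<lambda>\<omega>. v \<omega> $ i - w \<omega> $ i) \<in> borel_measurable M" if "i < n" for i
    using measurable_vec_entry[OF v] measurable_vec_entry[OF w] that by auto
qed

lemma measurable_vec_smult:
  assumes v: "measurable_vec M n v" and f: "f \<in> borel_measurable M"
  shows "measurable_vec M n (\<lambda>\<omega>. f \<omega> \<cdot>\<^sub>v v \<omega>)"
proof (rule measurable_vecI)
  show "f \<omega> \<cdot>\<^sub>v v \<omega> \<in> carrier_vec n" if "\<omega> \<in> space M" for \<omega>
    using measurable_vec_carrier[OF v that] by simp
  show "(f \<omega> \<cdot>\<^sub>v v \<omega>) $ i = f \<omega> * v \<omega> $ i" if "\<omega> \<in> space M" "i < n" for \<omega> i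
    using measurable_vec_carrier[OF v that(1)] that by simp
  show "(\<lambda>\<omega>. f \<omega> * v \<omega> $ i) \<in> borel_measurable M" if "i < n" for i
    using measurable_vec_entry[OF v] f that by auto
qed

lemma measurable_l2norm:
  assumes v: "measurable_vec M n v"
  shows "(\<lambda>\<omega>. l2norm (v \<omega>)) \<in> borel_measurable M"
proof -
  have "(\<lambda>\<omega>. sqrt (\<Sum>i<n. v \<omega> $ i * v \<omega> $ i)) \<in> borel_measurable M"
    using measurable_vec_entry[OF v] by auto
  then show ?thesis
    by (rule measurable_cong[THEN iffD1, rotated]) (simp add: l2norm_def scalar_prod_sum[OF measurable_vec_carrier[OF v]])
qed

lemma measurable_det:
  assumes A: "measurable_mat M n n A"
  shows "(\<lambda>\<omega>. det (A \<omega>)) \<in> borel_measurable M"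
proof -
  have "(\<lambda>\<omega>. \<Sum>p\<in>{p. p permutes {0..<n}}. signof p * (\<Prod>i=0..<n. A \<omega> $$ (i, p i))) \<in> borel_measurable M"
  proof (intro borel_measurable_sum borel_measurable_times borel_measurable_prod borel_measurable_const)
    fix p i assume "p \<in> {p. p permutes {0..<n}}" "i \<in> {0..<n}"
    then have "i < n" "p i < n" using permutes_in_image[of p "{0..<n}" i] by auto
    then show "(\<lambda>\<omega>. A \<omega> $$ (i, p i)) \<in> borel_measurable M" by (rule measurable_mat_entry[OF A])
  qed
  then show ?thesis
    by (rule measurable_cong[THEN iffD1, rotated]) (simp add: det_def'[OF measurable_mat_carrier[OF A]])
qed

lemma measurable_mat_delete:
  assumes A: "measurable_mat M n n A" and ij: "i < n" "j < n"
  shows "measurable_mat M (n - 1) (n - 1) (\<lambda>\<omega>. mat_delete (A \<omega>) i j)"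
proof (rule measurable_matI)
  show "mat_delete (A \<omega>) i j \<in> carrier_mat (n - 1) (n - 1)" if "\<omega> \<in> space M" for \<omega>
    by (rule mat_delete_carrier[OF measurable_mat_carrier[OF A that]])
  show "mat_delete (A \<omega>) i j $$ (k, l) = A \<omega> $$ (if k < i then k else Suc k, if l < j then l else Suc l)"
    if "\<omega> \<in> space M" "k < n - 1" "l < n - 1" for \<omega> k l
    using measurable_mat_carrier[OF A that(1)] that by (simp add: mat_delete_def)
  show "(\<lambda>\<omega>. A \<omega> $$ (if k < i then k else Suc k, if l < j then l else Suc l)) \<in> borel_measurable M"
    if "k < n - 1" "l < n - 1" for k l
    using that by (intro measurable_mat_entry[OF A]) auto
qed

text \<open>
  Cramer's rule, including the value on singular matrices, exhibits the entries of the inverse as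
  measurable functions of the entries of the matrix.
\<close>

lemma inv_mat_eq:
  assumes A: "A \<in> carrier_mat n n"
  shows "inv_mat A = (if det A = 0 then 0\<^sub>m n n else (1 / det A) \<cdot>\<^sub>m adj_mat A)"
proof (cases "det A = 0")
  case True
  have "mat_inverse A = None"
  proof (cases "mat_inverse A")
    case (Some B)
    from mat_inverse(2)[OF A this] have B: "A * B = 1\<^sub>m n" "B \<in> carrier_mat n n" by auto
    have "det A * det B = 1" using det_mult[OF A B(2)] B(1) by simp
    with True show ?thesis by simp
  qed simp
  then show ?thesis using True A by (simp add: inv_mat_def)
next
  case False
  note inv = inv_mat_right_inverse[OF A False]
  note adj = adj_mat[OF A]
  have "det A \<cdot>\<^sub>m inv_mat A = (det A \<cdot>\<^sub>m 1\<^sub>m n) * inv_mat A"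
    using inv by (simp add: mult_smult_assoc_mat[of _ n n _ n])
  also have "\<dots> = adj_mat A * (A * inv_mat A)" unfolding adj(3)[symmetric]
    by (rule assoc_mult_mat[OF adj(1) A inv(1)])
  also have "\<dots> = adj_mat A" using inv adj by simp
  finally have "(1 / det A) \<cdot>\<^sub>m (det A \<cdot>\<^sub>m inv_mat A) = (1 / det A) \<cdot>\<^sub>m adj_mat A" by simp
  moreover have "(1 / det A) \<cdot>\<^sub>m (det A \<cdot>\<^sub>m inv_mat A) = inv_mat A"
    using False inv by (intro eq_matI) auto
  ultimately show ?thesis using False by simp
qed

lemma measurable_inv_mat:
  assumes A: "measurable_mat M n n A"
  shows "measurable_mat M n n (\<lambda>\<omega>. inv_mat (A \<omega>))"
proof (rule measurable_matI)
  note [measurable] = measurable_det[OF A]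
  show "inv_mat (A \<omega>) \<in> carrier_mat n n" if "\<omega> \<in> space M" for \<omega>
    using adj_mat(1)[OF measurable_mat_carrier[OF A that]] inv_mat_eq[OF measurable_mat_carrier[OF A that]] by simp
  show "inv_mat (A \<omega>) $$ (i, j) = (if det (A \<omega>) = 0 then 0 else 1 / det (A \<omega>) * ((-1) ^ (j + i) * det (mat_delete (A \<omega>) j i)))"
    if "\<omega> \<in> space M" "i < n" "j < n" for \<omega> i j
    using inv_mat_eq[OF measurable_mat_carrier[OF A that(1)]] measurable_mat_carrier[OF A that(1)] that
    by (simp add: adj_mat_def cofactor_def)
  show "(\<lambda>\<omega>. if det (A \<omega>) = 0 then 0 else 1 / det (A \<omega>) * ((-1) ^ (j + i) * det (mat_delete (A \<omega>) j i))) \<in> borel_measurable M"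
    if ij: "i < n" "j < n" for i j
  proof -
    note [measurable] = measurable_det[OF measurable_mat_delete[OF A ij(2,1)]]
    show ?thesis by measurable
  qed
qed

lemma measurable_restrict_rows:
  assumes x: "measurable_mat M n s x" and h: "h \<subseteq> {..<n}"
  shows "measurable_mat M (card h) s (\<lambda>\<omega>. restrict_rows (x \<omega>) h)"
  using restrict_rows_carrier[OF measurable_mat_carrier[OF x] h]
    restrict_rows_index[OF measurable_mat_carrier[OF x] h] measurable_mat_entry[OF x] pick_less[OF h]
  by (intro measurable_matI[where f = "\<lambda>i j \<omega>. x \<omega> $$ (pick h i, j)"]) auto

lemma measurable_restrict_cols:
  assumes x: "measurable_mat M n d x" and S: "S \<subseteq> {..<d}"
  shows "measurable_mat M n (card S) (\<lambda>\<omega>. restrict_cols (x \<omega>) S)"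
  using restrict_cols_carrier[OF measurable_mat_carrier[OF x] S]
    restrict_cols_index[OF measurable_mat_carrier[OF x] S] measurable_mat_entry[OF x] pick_less[OF S]
  by (intro measurable_matI[where f = "\<lambda>i j \<omega>. x \<omega> $$ (i, pick S j)"]) auto

lemma measurable_subvector:
  assumes y: "measurable_vec M n y" and h: "h \<subseteq> {..<n}"
  shows "measurable_vec M (card h) (\<lambda>\<omega>. subvector (y \<omega>) h)"
  using subvector_carrier[OF measurable_vec_carrier[OF y] h]
    subvector_index[OF measurable_vec_carrier[OF y] h] measurable_vec_entry[OF y] pick_less[OF h]
  by (intro measurable_vecI[where f = "\<lambda>i \<omega>. y \<omega> $ (pick h i)"]) auto

lemma finite_F1:
  assumes "E \<subseteq> Pow {..<n}"
  shows "finite (F1 E)"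
proof -
  have "finite E" using assms finite_subset by blast
  then have "finite (E \<times> E)" by simp
  moreover have "F1 E \<subseteq> E \<times> E" by (auto simp: F1_def)
  ultimately show ?thesis using finite_subset by blast
qed

lemma measurable_Max_image:
  assumes "finite I" and f: "\<And>i. i \<in> I \<Longrightarrow> (f i :: 'a \<Rightarrow> real) \<in> borel_measurable M"
  shows "(\<lambda>\<omega>. Max ((\<lambda>i. f i \<omega>) ` I)) \<in> borel_measurable M"
proof (cases "I = {}")
  case False
  then show ?thesis using borel_measurable_Max[OF assms(1) f] by simp
qed simp

context
  fixes M :: "'a measure" and x :: "'a \<Rightarrow> real mat" and n s :: nat
  assumes x: "measurable_mat M n s x"
begin

lemma measurable_scaled_residual:
  assumes y: "measurable_vec M n y"
  shows "measurable_vec M n (\<lambda>\<omega>. scaled_residual (x \<omega>) (y \<omega>))"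
proof -
  note xT = measurable_mat_transpose[OF x]
  have one: "measurable_mat M n n (\<lambda>\<omega>. 1\<^sub>m (dim_row (x \<omega>)))"
    by (rule measurable_matI[where f = "\<lambda>i j \<omega>. if i = j then 1 else 0"]) (auto dest!: measurable_mat_carrier[OF x])
  have "measurable_mat M n n (\<lambda>\<omega>. proj (x \<omega>))" unfolding proj_def
    by (intro measurable_mat_mult[OF _ xT] measurable_mat_mult[OF x] measurable_inv_mat measurable_mat_mult[OF xT x])
  then have "measurable_vec M n (\<lambda>\<omega>. (1\<^sub>m (dim_row (x \<omega>)) - proj (x \<omega>)) *\<^sub>v y \<omega>)"
    by (intro measurable_mat_mult_vec[OF measurable_mat_minus[OF one] y])
  then show ?thesis unfolding scaled_residual_def Let_def
    by (intro measurable_vec_smult borel_measurable_divide borel_measurable_const measurable_l2norm)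
qed

lemma measurable_gamma_hat:
  assumes r: "measurable_vec M n r" and h: "h \<subseteq> {..<n}"
  shows "measurable_vec M s (\<lambda>\<omega>. gamma_hat (x \<omega>) h (r \<omega>))"
proof -
  note R = measurable_restrict_rows[OF x h]
  note RT = measurable_mat_transpose[OF R]
  show ?thesis unfolding gamma_hat_def
    by (intro measurable_mat_mult_vec[OF _ measurable_subvector[OF r h]] measurable_mat_mult[OF _ RT]
      measurable_inv_mat measurable_mat_mult[OF RT R])
qed

lemma measurable_s2_hat:
  assumes r: "measurable_vec M n r" and h: "h \<subseteq> {..<n}"
  shows "(\<lambda>\<omega>. s2_hat (x \<omega>) h (r \<omega>)) \<in> borel_measurable M"
  unfolding s2_hat_def
  by (intro borel_measurable_divide borel_measurable_power borel_measurable_const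
    measurable_l2norm[OF measurable_vec_minus[OF measurable_subvector[OF r h] measurable_mat_mult_vec[OF measurable_restrict_rows[OF x h] measurable_gamma_hat[OF r h]]]])

lemma measurable_T_max:
  assumes r: "measurable_vec M n r" and E: "E \<subseteq> Pow {..<n}"
  shows "(\<lambda>\<omega>. T1_max E (x \<omega>) (r \<omega>)) \<in> borel_measurable M"
    "(\<lambda>\<omega>. T2_max E (x \<omega>) (r \<omega>)) \<in> borel_measurable M"
proof -
  have sub: "e \<subseteq> {..<n}" "f \<subseteq> {..<n}" if "(e, f) \<in> F1 E" for e f using that E by (auto simp: F1_def)
  have "(\<lambda>\<omega>. Max ((\<lambda>p. \<bar>T1 (x \<omega>) (fst p) (snd p) (r \<omega>)\<bar>) ` F1 E)) \<in> borel_measurable M"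
  proof (rule measurable_Max_image[OF finite_F1[OF E]])
    fix p assume "p \<in> F1 E"
    then have s: "fst p \<subseteq> {..<n}" "snd p \<subseteq> {..<n}" using sub[of "fst p" "snd p"] by auto
    show "(\<lambda>\<omega>. \<bar>T1 (x \<omega>) (fst p) (snd p) (r \<omega>)\<bar>) \<in> borel_measurable M"
      unfolding T1_def
      by (intro borel_measurable_abs measurable_l2norm[OF measurable_vec_minus[OF measurable_gamma_hat[OF r s(1)] measurable_gamma_hat[OF r s(2)]]])
  qed
  then show "(\<lambda>\<omega>. T1_max E (x \<omega>) (r \<omega>)) \<in> borel_measurable M" by (simp add: T1_max_def case_prod_unfold)
  have "(\<lambda>\<omega>. Max ((\<lambda>p. \<bar>T2 (x \<omega>) (fst p) (snd p) (r \<omega>)\<bar>) ` F1 E)) \<in> borel_measurable M"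
  proof (rule measurable_Max_image[OF finite_F1[OF E]])
    fix p assume "p \<in> F1 E"
    then have s: "fst p \<subseteq> {..<n}" "snd p \<subseteq> {..<n}" using sub[of "fst p" "snd p"] by auto
    note [measurable] = measurable_s2_hat[OF r s(1)] measurable_s2_hat[OF r s(2)]
    show "(\<lambda>\<omega>. \<bar>T2 (x \<omega>) (fst p) (snd p) (r \<omega>)\<bar>) \<in> borel_measurable M"
      unfolding T2_def by measurable
  qed
  then show "(\<lambda>\<omega>. T2_max E (x \<omega>) (r \<omega>)) \<in> borel_measurable M" by (simp add: T2_max_def case_prod_unfold)
qed

end

section \<open>Two empirical frequencies at a threshold\<close>

text \<open>
  The draws that the resampling tests use, for fixed data. The theorems of this part concern the
  number of the first \<open>B\<close> draws that fall into an event.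
\<close>

locale iid_sequence = prob_space M for M :: "'a measure" +
  fixes Z :: "nat \<Rightarrow> 'a \<Rightarrow> 'b" and N D :: "'b measure"
  assumes indep: "indep_vars (\<lambda>_. N) Z UNIV"
    and law: "\<And>b. distr M N (Z b) = D"
begin

lemma Z_measurable [measurable]: "Z b \<in> measurable M N"
  using indep by (simp add: indep_vars_def2)

lemma sets_D: "sets D = sets N" and space_D: "space D = space N"
  using law[of 0] by (metis sets_distr, metis space_distr)

lemma prob_space_D: "prob_space D"
  unfolding law[of 0, symmetric] by (rule prob_space_distr) simp

lemma expectation_Z:
  fixes f :: "'b \<Rightarrow> real"
  assumes [measurable]: "f \<in> borel_measurable N"
  shows "expectation (\<lambda>\<omega>. f (Z b \<omega>)) = integral\<^sup>L D f"
  unfolding law[of b, symmetric] by (subst integral_distr) auto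

definition normalized_sum :: "('b \<Rightarrow> real) \<Rightarrow> nat \<Rightarrow> 'a \<Rightarrow> real" where
  "normalized_sum f B \<omega> = (\<Sum>b<B. f (Z b \<omega>)) / sqrt B"

lemma normalized_sum_measurable [measurable]:
  assumes [measurable]: "f \<in> borel_measurable N"
  shows "normalized_sum f B \<in> borel_measurable M"
  unfolding normalized_sum_def[abs_def] by measurable

lemma bounded_integrable:
  assumes "f \<in> borel_measurable M" "\<And>\<omega>. \<omega> \<in> space M \<Longrightarrow> \<bar>f \<omega>\<bar> \<le> (K::real)"
  shows "integrable M f"
  using assms by (intro integrable_const_bound[of _ K]) auto

lemma normalized_sum_clt:
  assumes f [measurable]: "f \<in> borel_measurable N" and bound: "\<And>z. z \<in> space N \<Longrightarrow> \<bar>f z\<bar> \<le> K"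
    and mean: "integral\<^sup>L D f = 0" and var: "integral\<^sup>L D (\<lambda>z. (f z)\<^sup>2) = \<sigma>\<^sup>2" and \<sigma>: "0 < \<sigma>"
  shows "weak_conv_m (\<lambda>B. distr M borel (\<lambda>\<omega>. normalized_sum f B \<omega> / \<sigma>)) std_normal_distribution"
proof -
  have E: "expectation (\<lambda>\<omega>. f (Z b \<omega>)) = 0" for b using expectation_Z[OF f] mean by simp
  have "weak_conv_m (\<lambda>n. distr M borel (\<lambda>\<omega>. (\<Sum>i<n. f (Z i \<omega>)) / sqrt (real n * \<sigma>\<^sup>2))) std_normal_distribution"
  proof (rule central_limit_theorem_zero_mean[OF _ _ \<sigma>])
    show "indep_vars (\<lambda>i. borel) (\<lambda>i \<omega>. f (Z i \<omega>)) UNIV"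
      by (rule indep_vars_compose2[OF indep]) simp
    show "integrable M (\<lambda>\<omega>. (f (Z n \<omega>))\<^sup>2)" for n
    proof (rule bounded_integrable[of _ "K\<^sup>2"])
      show "\<bar>(f (Z n \<omega>))\<^sup>2\<bar> \<le> K\<^sup>2" if "\<omega> \<in> space M" for \<omega>
        using order.trans[OF bound[OF measurable_space[OF Z_measurable that]] abs_ge_self, of n] by (simp add: abs_le_square_iff[symmetric])
    qed measurable
    show "variance (\<lambda>\<omega>. f (Z n \<omega>)) = \<sigma>\<^sup>2" for n
      using expectation_Z[of "\<lambda>z. (f z)\<^sup>2" n] var by (simp add: E)
    show "distr M borel (\<lambda>\<omega>. f (Z n \<omega>)) = distr D borel f" for n
      unfolding law[of n, symmetric] by (subst distr_distr) (auto simp: comp_def)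
  qed (simp add: E)
  then show ?thesis using \<sigma> unfolding normalized_sum_def by (simp add: real_sqrt_mult field_simps)
qed

text \<open>
  This is the central limit theorem, except when \<open>f\<close> has variance 0: then the normalized sums
  vanish almost surely.
\<close>

lemma cos_normalized_sum_converges:
  assumes f [measurable]: "f \<in> borel_measurable N" and bound: "\<And>z. z \<in> space N \<Longrightarrow> \<bar>f z\<bar> \<le> K"
    and mean: "integral\<^sup>L D f = 0"
  shows "convergent (\<lambda>B. expectation (\<lambda>\<omega>. cos (normalized_sum f B \<omega> + e)))"
proof -
  interpret D: prob_space D by (rule prob_space_D)
  have fD [measurable]: "f \<in> borel_measurable D" using sets_D f by (simp cong: measurable_cong_sets)
  have int: "integrable D (\<lambda>z. (f z)\<^sup>2)"
  proof (rule D.integrable_const_bound[of _ "K\<^sup>2"])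
    show "AE z in D. norm ((f z)\<^sup>2) \<le> K\<^sup>2"
      using order.trans[OF bound abs_ge_self] by (intro AE_I2) (simp add: space_D abs_le_square_iff[symmetric])
  qed simp
  define \<sigma> where "\<sigma> = sqrt (integral\<^sup>L D (\<lambda>z. (f z)\<^sup>2))"
  have \<sigma>2: "integral\<^sup>L D (\<lambda>z. (f z)\<^sup>2) = \<sigma>\<^sup>2" unfolding \<sigma>_def by simp
  show ?thesis
  proof (cases "\<sigma> = 0")
    case True
    then have "AE z in D. (f z)\<^sup>2 = 0" using \<sigma>2 integral_nonneg_eq_0_iff_AE[OF int] by simp
    then have "AE \<omega> in M. f (Z b \<omega>) = 0" for b
      unfolding law[of b, symmetric] by (subst (asm) AE_distr_iff) auto
    then have "AE \<omega> in M. \<forall>b. f (Z b \<omega>) = 0" by (simp add: AE_all_countable)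
    then have "expectation (\<lambda>\<omega>. cos (normalized_sum f B \<omega> + e)) = expectation (\<lambda>\<omega>. cos e)" for B
      by (intro integral_cong_AE) (auto simp: normalized_sum_def)
    then show ?thesis by (simp add: convergent_const)
  next
    case False
    then have \<sigma>: "0 < \<sigma>" by (simp add: \<sigma>_def order_less_le)
    have "(\<lambda>B. integral\<^sup>L (distr M borel (\<lambda>\<omega>. normalized_sum f B \<omega> / \<sigma>)) (\<lambda>x. cos (\<sigma> * x + e)))
       \<longlonglongrightarrow> integral\<^sup>L std_normal_distribution (\<lambda>x. cos (\<sigma> * x + e))"
      by (rule weak_conv_imp_integral_bdd_continuous_conv[OF _ _ normalized_sum_clt[OF f bound mean \<sigma>2 \<sigma>], of _ 1])
        (auto intro!: real_distribution_distr real_dist_normal_dist)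
    moreover have "integral\<^sup>L (distr M borel (\<lambda>\<omega>. normalized_sum f B \<omega> / \<sigma>)) (\<lambda>x. cos (\<sigma> * x + e))
        = expectation (\<lambda>\<omega>. cos (normalized_sum f B \<omega> + e))" for B
      using \<sigma> by (subst integral_distr) auto
    ultimately show ?thesis by (auto simp: convergent_def)
  qed
qed

text \<open>
  Near 0 a step function is not approximated by continuous functions, and far from 0 it is not
  approximated by periodic functions. The central limit theorem shows that normalized sums rarely
  take such values.
\<close>

lemma normalized_sum_exceptional:
  assumes f [measurable]: "f \<in> borel_measurable N" and bound: "\<And>z. z \<in> space N \<Longrightarrow> \<bar>f z\<bar> \<le> K"
    and mean: "integral\<^sup>L D f = 0" and var: "integral\<^sup>L D (\<lambda>z. (f z)\<^sup>2) = \<sigma>\<^sup>2" and \<sigma>: "0 < \<sigma>" 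
    and m: "measure std_normal_distribution {x. \<bar>x\<bar> \<le> 1 / (real m + 1) \<or> real m + 1 \<le> \<bar>x\<bar>} < \<epsilon>"
  shows "\<forall>\<^sub>F B in sequentially. prob {\<omega>\<in>space M. \<bar>normalized_sum f B \<omega>\<bar> \<le> \<sigma> / (real m + 1) \<or> \<sigma> * (real m + 1) \<le> \<bar>normalized_sum f B \<omega>\<bar>} < \<epsilon>"
proof -
  define a b where "a = 1 / (real m + 1)" and "b = real m + 1"
  define F where "F = {x::real. \<bar>x\<bar> \<le> a \<or> b \<le> \<bar>x\<bar>}"
  have F: "closed F" unfolding F_def by (intro closed_Collect_disj closed_Collect_le continuous_intros)
  then have [measurable]: "F \<in> sets borel" by simp
  have "open {x::real. \<bar>x\<bar> < a \<or> b < \<bar>x\<bar>}" by (intro open_Collect_disj open_Collect_less continuous_intros)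
  then have "{x::real. \<bar>x\<bar> < a \<or> b < \<bar>x\<bar>} \<subseteq> interior F" by (intro interior_maximal) (auto simp: F_def)
  then have "frontier F \<subseteq> F - {x. \<bar>x\<bar> < a \<or> b < \<bar>x\<bar>}" using F by (auto simp: frontier_def closure_closed)
  also have "\<dots> \<subseteq> {a, -a, b, -b}" by (auto simp: F_def)
  finally have fr: "frontier F \<subseteq> {a, -a, b, -b}" .
  then have "frontier F \<in> null_sets lborel" by (intro countable_imp_null_set_lborel) (metis countable_subset countable_finite finite.emptyI finite.insertI)
  then have null: "emeasure std_normal_distribution (frontier F) = 0"
    by (auto simp: null_sets_density_iff null_sets_def emeasure_density nn_integral_null_set intro: nn_integral_null_set)
  have "(\<lambda>B. measure (distr M borel (\<lambda>\<omega>. normalized_sum f B \<omega> / \<sigma>)) F) \<longlonglongrightarrow> measure std_normal_distribution F"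
    by (rule weak_conv_imp_continuity_set_conv[OF _ _ normalized_sum_clt[OF f bound mean var \<sigma>]])
      (use null in \<open>auto intro!: real_distribution_distr real_dist_normal_dist\<close>)
  moreover have "measure std_normal_distribution F < \<epsilon>" using m by (simp add: F_def a_def b_def)
  ultimately have "\<forall>\<^sub>F B in sequentially. measure (distr M borel (\<lambda>\<omega>. normalized_sum f B \<omega> / \<sigma>)) F < \<epsilon>"
    by (rule order_tendstoD)
  moreover have "measure (distr M borel (\<lambda>\<omega>. normalized_sum f B \<omega> / \<sigma>)) F
     = prob {\<omega>\<in>space M. \<bar>normalized_sum f B \<omega>\<bar> \<le> \<sigma> / (real m + 1) \<or> \<sigma> * (real m + 1) \<le> \<bar>normalized_sum f B \<omega>\<bar>}" for B
  proof -
    have "measure (distr M borel (\<lambda>\<omega>. normalized_sum f B \<omega> / \<sigma>)) F = prob ((\<lambda>\<omega>. normalized_sum f B \<omega> / \<sigma>) -` F \<inter> space M)"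
      by (subst measure_distr) auto
    also have "(\<lambda>\<omega>. normalized_sum f B \<omega> / \<sigma>) -` F \<inter> space M
      = {\<omega>\<in>space M. \<bar>normalized_sum f B \<omega>\<bar> \<le> \<sigma> / (real m + 1) \<or> \<sigma> * (real m + 1) \<le> \<bar>normalized_sum f B \<omega>\<bar>}"
      using \<sigma> by (auto simp: F_def a_def b_def abs_divide field_simps)
    finally show ?thesis .
  qed
  ultimately show ?thesis by simp
qed

text \<open>
  A product of a sine and a cosine is a mean of two cosines, so the powers of sines can be
  eliminated one factor at a time. What remains are cosines of linear combinations of the two
  normalized sums; these are normalized sums of one function \<open>c f + d g\<close>, so the one-dimensional
  central limit theorem applies to them.
\<close>

lemma trig_moments_converge:
  assumes f [measurable]: "f \<in> borel_measurable N" and bf: "\<And>z. z \<in> space N \<Longrightarrow> \<bar>f z\<bar> \<le> K" and mf: "integral\<^sup>L D f = 0"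
    and g [measurable]: "g \<in> borel_measurable N" and bg: "\<And>z. z \<in> space N \<Longrightarrow> \<bar>g z\<bar> \<le> K" and mg: "integral\<^sup>L D g = 0"
  defines "U \<equiv> normalized_sum f" and "V \<equiv> normalized_sum g"
  shows "convergent (\<lambda>B. expectation (\<lambda>\<omega>. sin (l * U B \<omega>) ^ i * sin (l * V B \<omega>) ^ j * cos (c * U B \<omega> + d * V B \<omega> + e)))"
proof -
  have [measurable]: "U B \<in> borel_measurable M" "V B \<in> borel_measurable M" for B unfolding U_def V_def by measurable
  have pw: "\<bar>sin x ^ n\<bar> \<le> 1" for x :: real and n unfolding power_abs by (rule power_le_one) auto
  have prod_bound: "\<bar>a * b * c'\<bar> \<le> 1" if "\<bar>a\<bar> \<le> 1" "\<bar>b\<bar> \<le> 1" "\<bar>c'\<bar> \<le> 1" for a b c' :: real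
  proof -
    have "\<bar>a\<bar> * \<bar>b\<bar> \<le> 1 * 1" using that by (intro mult_mono) auto
    then have "\<bar>a\<bar> * \<bar>b\<bar> * \<bar>c'\<bar> \<le> 1 * 1" using that by (intro mult_mono) auto
    then show ?thesis by (simp add: abs_mult)
  qed
  have int: "integrable M (\<lambda>\<omega>. sin (l * U B \<omega>) ^ i * sin (l * V B \<omega>) ^ j * cos (c * U B \<omega> + d * V B \<omega> + e))" for i j B c d e
    by (rule bounded_integrable[of _ 1]) (auto intro!: prod_bound pw)
  have trig: "sin x * cos y = (1/2) * cos (x + y - pi/2) + (1/2) * cos (x - y - pi/2)" for x y :: real
  proof -
    have "cos (t - pi/2) = sin t" for t by (simp add: cos_diff)
    then show ?thesis by (simp only: sin_add sin_diff) (simp add: field_simps)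
  qed
  \<comment> \<open>the device of Cramer and Wold\<close>
  have base: "convergent (\<lambda>B. expectation (\<lambda>\<omega>. cos (c * U B \<omega> + d * V B \<omega> + e)))" for c d e
  proof -
    interpret D: prob_space D by (rule prob_space_D)
    have fg [measurable]: "f \<in> borel_measurable D" "g \<in> borel_measurable D" using sets_D f g by (simp_all cong: measurable_cong_sets)
    have i: "integrable D f" "integrable D g"
      using bf bg by (auto intro!: D.integrable_const_bound[of _ K] AE_I2 simp: space_D)
    have "convergent (\<lambda>B. expectation (\<lambda>\<omega>. cos (normalized_sum (\<lambda>z. c * f z + d * g z) B \<omega> + e)))"
    proof (rule cos_normalized_sum_converges[of _ "\<bar>c\<bar> * K + \<bar>d\<bar> * K"])
      show "\<bar>c * f z + d * g z\<bar> \<le> \<bar>c\<bar> * K + \<bar>d\<bar> * K" if "z \<in> space N" for z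
        using bf[OF that] bg[OF that] by (intro order.trans[OF abs_triangle_ineq] add_mono) (auto simp: abs_mult mult_left_mono)
      show "integral\<^sup>L D (\<lambda>z. c * f z + d * g z) = 0" using i mf mg by simp
    qed measurable
    moreover have "normalized_sum (\<lambda>z. c * f z + d * g z) B \<omega> = c * U B \<omega> + d * V B \<omega>" for B \<omega>
      unfolding U_def V_def normalized_sum_def by (simp add: sum.distrib sum_distrib_left add_divide_distrib)
    ultimately show ?thesis by simp
  qed
  have step: "convergent (\<lambda>B. expectation (\<lambda>\<omega>. F B \<omega>))"
    if eq: "\<And>B \<omega>. F B \<omega> = (1/2) * G B \<omega> + (1/2) * H B \<omega>" and I: "\<And>B. integrable M (G B)" "\<And>B. integrable M (H B)"
      and "convergent (\<lambda>B. expectation (G B))" "convergent (\<lambda>B. expectation (H B))" for F G H :: "nat \<Rightarrow> 'a \<Rightarrow> real"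
  proof -
    have "expectation (\<lambda>\<omega>. F B \<omega>) = (1/2) * expectation (G B) + (1/2) * expectation (H B)" for B
      unfolding eq using I by simp
    then show ?thesis using that by (simp only:) (intro convergent_add convergent_mult convergent_const)
  qed
  have vj: "convergent (\<lambda>B. expectation (\<lambda>\<omega>. sin (l * U B \<omega>) ^ 0 * sin (l * V B \<omega>) ^ j * cos (c * U B \<omega> + d * V B \<omega> + e)))" for j c d e
  proof (induction j arbitrary: c d e)
    case 0
    then show ?case using base by simp
  next
    case (Suc j)
    show ?case
    proof (rule step[OF _ int int Suc.IH Suc.IH])
      fix B \<omega>
      have *: "sin (l * V B \<omega>) * cos (c * U B \<omega> + d * V B \<omega> + e)
        = (1/2) * cos (c * U B \<omega> + (d + l) * V B \<omega> + (e - pi/2)) + (1/2) * cos ((- c) * U B \<omega> + (l - d) * V B \<omega> + (- e - pi/2))"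
        unfolding trig by (simp add: algebra_simps)
      have "sin (l * U B \<omega>) ^ 0 * sin (l * V B \<omega>) ^ Suc j * cos (c * U B \<omega> + d * V B \<omega> + e)
        = sin (l * U B \<omega>) ^ 0 * sin (l * V B \<omega>) ^ j * (sin (l * V B \<omega>) * cos (c * U B \<omega> + d * V B \<omega> + e))" by simp
      then show "sin (l * U B \<omega>) ^ 0 * sin (l * V B \<omega>) ^ Suc j * cos (c * U B \<omega> + d * V B \<omega> + e)
        = (1/2) * (sin (l * U B \<omega>) ^ 0 * sin (l * V B \<omega>) ^ j * cos (c * U B \<omega> + (d + l) * V B \<omega> + (e - pi/2)))
         + (1/2) * (sin (l * U B \<omega>) ^ 0 * sin (l * V B \<omega>) ^ j * cos ((- c) * U B \<omega> + (l - d) * V B \<omega> + (- e - pi/2)))"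
        unfolding * by (simp add: distrib_left)
    qed
  qed
  show ?thesis
  proof (induction i arbitrary: c d e)
    case 0
    then show ?case by (rule vj)
  next
    case (Suc i)
    show ?case
    proof (rule step[OF _ int int Suc.IH Suc.IH])
      fix B \<omega>
      have *: "sin (l * U B \<omega>) * cos (c * U B \<omega> + d * V B \<omega> + e)
        = (1/2) * cos ((c + l) * U B \<omega> + d * V B \<omega> + (e - pi/2)) + (1/2) * cos ((l - c) * U B \<omega> + (- d) * V B \<omega> + (- e - pi/2))"
        unfolding trig by (simp add: algebra_simps)
      have "sin (l * U B \<omega>) ^ Suc i * sin (l * V B \<omega>) ^ j * cos (c * U B \<omega> + d * V B \<omega> + e)
        = sin (l * U B \<omega>) ^ i * sin (l * V B \<omega>) ^ j * (sin (l * U B \<omega>) * cos (c * U B \<omega> + d * V B \<omega> + e))" by simp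
      then show "sin (l * U B \<omega>) ^ Suc i * sin (l * V B \<omega>) ^ j * cos (c * U B \<omega> + d * V B \<omega> + e)
        = (1/2) * (sin (l * U B \<omega>) ^ i * sin (l * V B \<omega>) ^ j * cos ((c + l) * U B \<omega> + d * V B \<omega> + (e - pi/2)))
         + (1/2) * (sin (l * U B \<omega>) ^ i * sin (l * V B \<omega>) ^ j * cos ((l - c) * U B \<omega> + (- d) * V B \<omega> + (- e - pi/2)))"
        unfolding * by (simp add: distrib_left)
    qed
  qed
qed

end

text \<open>The sets decrease to \<open>{0}\<close>, which is a null set.\<close>

lemma std_normal_exceptional:
  assumes "0 < \<epsilon>"
  obtains m :: nat where "measure std_normal_distribution {x. \<bar>x\<bar> \<le> 1 / (real m + 1) \<or> real m + 1 \<le> \<bar>x\<bar>} < \<epsilon>"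
proof -
  define F where "F m = {x::real. \<bar>x\<bar> \<le> 1 / (real m + 1) \<or> real m + 1 \<le> \<bar>x\<bar>}" for m :: nat
  interpret S: prob_space std_normal_distribution by (rule prob_space_normal_density) simp
  have "closed (F m)" for m unfolding F_def by (intro closed_Collect_disj closed_Collect_le continuous_intros)
  then have meas: "F m \<in> sets std_normal_distribution" for m by simp
  have dec: "decseq F"
  proof (rule decseq_SucI)
    show "F (Suc m) \<subseteq> F m" for m
      using frac_le[of 1 1 "real m + 1" "real (Suc m) + 1"] by (auto simp: F_def)
  qed
  have "(\<Inter>m. F m) \<subseteq> {0}"
  proof (rule ccontr)
    assume "\<not> (\<Inter>m. F m) \<subseteq> {0}"
    then obtain x where x: "\<And>m. x \<in> F m" "x \<noteq> 0" by auto
    obtain m1 :: nat where m1: "1 / \<bar>x\<bar> < real m1" using reals_Archimedean2 by blast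
    obtain m2 :: nat where m2: "\<bar>x\<bar> < real m2" using reals_Archimedean2 by blast
    have "1 / \<bar>x\<bar> < real (max m1 m2) + 1" using m1 by simp
    then have "1 / (real (max m1 m2) + 1) < \<bar>x\<bar>" using x(2) by (simp add: field_simps)
    moreover have "\<bar>x\<bar> < real (max m1 m2) + 1" using m2 by simp
    ultimately show False using x(1)[of "max m1 m2"] by (simp add: F_def)
  qed
  moreover have "measure std_normal_distribution {0} = 0"
  proof -
    have "{0::real} \<in> null_sets lborel" by (simp add: null_sets_def)
    then show ?thesis by (auto simp: measure_def emeasure_density nn_integral_null_set)
  qed
  ultimately have "measure std_normal_distribution (\<Inter>m. F m) = 0"
    using S.finite_measure_mono[of "\<Inter>m. F m" "{0}"] by (simp add: antisym)
  then have "(\<lambda>m. measure std_normal_distribution (F m)) \<longlonglongrightarrow> 0"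
    using S.finite_Lim_measure_decseq[of F] meas dec by auto
  then have "\<forall>\<^sub>F m in sequentially. measure std_normal_distribution (F m) < \<epsilon>" using assms by (rule order_tendstoD)
  then show ?thesis using that by (auto simp: F_def eventually_sequentially)
qed

context iid_sequence
begin

definition count :: "'b set \<Rightarrow> nat \<Rightarrow> 'a \<Rightarrow> real" where
  "count A B \<omega> = real (card {b. b < B \<and> Z b \<omega> \<in> A})"

lemma count_eq: "count A B \<omega> = (\<Sum>b<B. indicator A (Z b \<omega>))"
proof -
  have "{b. b < B \<and> Z b \<omega> \<in> A} = {b\<in>{..<B}. Z b \<omega> \<in> A}" by auto
  then show ?thesis by (simp add: count_def indicator_def sum.If_cases Int_def)
qed

lemma count_measurable [measurable]:
  assumes [measurable]: "A \<in> sets N"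
  shows "count A B \<in> borel_measurable M"
  unfolding count_eq[abs_def] by measurable

lemma centered_indicator:
  assumes A: "A \<in> sets N"
  defines "f \<equiv> \<lambda>z. indicator A z - measure D A"
  shows "f \<in> borel_measurable N" "\<And>z. \<bar>f z\<bar> \<le> 1" "integral\<^sup>L D f = 0"
    "integral\<^sup>L D (\<lambda>z. (f z)\<^sup>2) = measure D A * (1 - measure D A)"
proof -
  interpret D: prob_space D by (rule prob_space_D)
  have A': "A \<in> sets D" using A sets_D by simp
  show "f \<in> borel_measurable N" unfolding f_def using A by measurable
  show "\<bar>f z\<bar> \<le> 1" for z using D.prob_le_1[of A] measure_nonneg[of D A] by (auto simp: f_def indicator_def)
  have i: "integrable D (indicator A :: 'b \<Rightarrow> real)" using A' by (simp add: D.emeasure_eq_measure)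
  then show "integral\<^sup>L D f = 0" unfolding f_def using A' D.prob_space by simp
  have "(f z)\<^sup>2 = (1 - 2 * measure D A) * indicator A z + (measure D A)\<^sup>2" for z
    by (auto simp: f_def indicator_def power2_eq_square algebra_simps)
  then show "integral\<^sup>L D (\<lambda>z. (f z)\<^sup>2) = measure D A * (1 - measure D A)"
    using i A' D.prob_space by (simp only:) (simp add: power2_eq_square algebra_simps)
qed

text \<open>
  The event is that both normalized sums of the centered indicators are negative. Its indicator is
  a product of two steps. Up to an event of small probability (\<open>normalized_sum_exceptional\<close>), a
  step at 0 is a continuous function of \<open>sin (u / K)\<close>, hence by the theorem of Weierstrass it is
  close to a polynomial in \<open>sin (u / K)\<close>, and the expectation of a product of two such polynomials
  converges by \<open>trig_moments_converge\<close>. So the probabilities form a Cauchy sequence. Their limit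
  depends on the correlation of the two events.
\<close>

lemma tie_converges:
  fixes q :: real
  assumes A: "A \<in> sets N" and C: "C \<in> sets N" and q: "measure D A = q" "measure D C = q" "0 < q" "q < 1"
  shows "convergent (\<lambda>B. prob {\<omega>\<in>space M. count A B \<omega> < B * q \<and> count C B \<omega> < B * q})"
proof -
  define f g where "f = (\<lambda>z. indicator A z - q)" and "g = (\<lambda>z. indicator C z - q)"
  define U V where "U = normalized_sum f" and "V = normalized_sum g"
  note f = centered_indicator[OF A, unfolded q, folded f_def] and g = centered_indicator[OF C, unfolded q, folded g_def]
  have f2: "\<bar>f z\<bar> \<le> 1" and g2: "\<bar>g z\<bar> \<le> 1" for z using f(2) g(2) by (auto simp: f_def g_def)
  define \<sigma> where "\<sigma> = sqrt (q * (1 - q))"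
  have \<sigma>: "0 < \<sigma>" "q * (1 - q) = \<sigma>\<^sup>2" using q by (auto simp: \<sigma>_def)
  have [measurable]: "U B \<in> borel_measurable M" "V B \<in> borel_measurable M" for B
    unfolding U_def V_def using f(1) g(1) by auto
  define P where "P B = prob {\<omega>\<in>space M. U B \<omega> < 0 \<and> V B \<omega> < 0}" for B
  have "Cauchy P"
  proof (rule metric_CauchyI)
    fix \<epsilon> :: real assume \<epsilon>: "0 < \<epsilon>"
    \<comment> \<open>the approximation below costs \<open>13 * \<epsilon>1\<close> at each of two indices, and the Cauchy condition
        for the approximating expectations costs another \<open>\<epsilon>1\<close>\<close>
    define \<epsilon>1 where "\<epsilon>1 = min (\<epsilon> / 30) 1"
    have \<epsilon>1: "0 < \<epsilon>1" "\<epsilon>1 \<le> 1" "30 * \<epsilon>1 \<le> \<epsilon>" using \<epsilon> by (auto simp: \<epsilon>1_def)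
    obtain m :: nat where m: "measure std_normal_distribution {x. \<bar>x\<bar> \<le> 1 / (real m + 1) \<or> real m + 1 \<le> \<bar>x\<bar>} < \<epsilon>1"
      using std_normal_exceptional[OF \<epsilon>1(1)] .
    define \<delta> K where "\<delta> = \<sigma> / (real m + 1)" and "K = \<sigma> * (real m + 1)"
    define bad where "bad u \<longleftrightarrow> \<bar>u\<bar> \<le> \<delta> \<or> K \<le> \<bar>u\<bar>" for u
    have K: "0 < K" and \<delta>: "0 < \<delta>" using \<sigma> by (auto simp: K_def \<delta>_def)
    have "1 * 1 \<le> (real m + 1) * (real m + 1)" by (intro mult_mono) auto
    then have "\<sigma> * 1 \<le> \<sigma> * ((real m + 1) * (real m + 1))" using \<sigma> by (intro mult_left_mono) auto
    then have \<delta>K: "\<delta> \<le> K" unfolding \<delta>_def K_def by (simp add: field_simps)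
    have evU: "\<forall>\<^sub>F B in sequentially. prob {\<omega>\<in>space M. bad (U B \<omega>)} < \<epsilon>1"
      unfolding bad_def U_def \<delta>_def K_def
      by (rule normalized_sum_exceptional[OF f(1) f2 f(3) _ \<sigma>(1) m]) (use f(4) \<sigma> in \<open>simp add: f_def\<close>)
    have evV: "\<forall>\<^sub>F B in sequentially. prob {\<omega>\<in>space M. bad (V B \<omega>)} < \<epsilon>1"
      unfolding bad_def V_def \<delta>_def K_def
      by (rule normalized_sum_exceptional[OF g(1) g2 g(3) _ \<sigma>(1) m]) (use g(4) \<sigma> in \<open>simp add: g_def\<close>)
    have pi: "1 < pi / 2" using pi_gt3 by simp
    \<comment> \<open>if \<open>u\<close> is not exceptional, then \<open>|u / K|\<close> lies between \<open>\<delta> / K\<close> and 1, where the sine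
        increases, so \<open>y0 \<le> |sin (u / K)|\<close>; the ramp \<open>\<phi>\<close> is constant outside \<open>{-y0..0}\<close>\<close>
    define y0 where "y0 = sin (\<delta> / K)"
    have y0: "0 < y0" unfolding y0_def using \<delta> K \<delta>K pi by (intro sin_gt_zero) (auto simp: pos_divide_less_eq intro: order.strict_trans1)
    define \<phi> where "\<phi> y = max 0 (min 1 (- y / y0))" for y
    have \<phi>01: "0 \<le> \<phi> y" "\<phi> y \<le> 1" for y by (auto simp: \<phi>_def)
    have \<phi>: "\<phi> (sin (1 / K * u)) = of_bool (u < 0)" if "\<not> bad u" for u
    proof -
      have u: "\<delta> < \<bar>u\<bar>" "\<bar>u\<bar> < K" using that by (auto simp: bad_def)
      have le1: "\<bar>u\<bar> / K \<le> 1" "\<delta> / K \<le> \<bar>u\<bar> / K" "0 < \<delta> / K" using u K \<delta> by (auto simp: divide_right_mono)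
      have "y0 \<le> sin (\<bar>u\<bar> / K)" unfolding y0_def
        by (intro sin_monotone_2pi_le) (use le1 pi in linarith)+
      then show ?thesis
      proof (cases "u < 0")
        case True
        then have "sin (1 / K * u) = - sin (\<bar>u\<bar> / K)" by (simp flip: sin_minus)
        then have "y0 \<le> - sin (1 / K * u)" using \<open>y0 \<le> _\<close> by linarith
        then have "1 \<le> - sin (1 / K * u) / y0" using y0 by (simp only: pos_le_divide_eq mult_1_left)
        then have "min 1 (- sin (1 / K * u) / y0) = 1" by (rule min_absorb1)
        then show ?thesis using True by (simp only: \<phi>_def) simp
      next
        case False
        then have "sin (1 / K * u) = sin (\<bar>u\<bar> / K)" by simp
        then have "0 \<le> sin (1 / K * u)" using \<open>y0 \<le> _\<close> y0 by linarith
        then have "- sin (1 / K * u) / y0 \<le> 0" using y0 by (intro divide_nonpos_pos) linarith+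
        then have "\<phi> (sin (1 / K * u)) = 0" unfolding \<phi>_def by (intro max_absorb1 min.coboundedI2)
        then show ?thesis using False by simp
      qed
    qed
    have "continuous_on {-1..1} \<phi>" unfolding \<phi>_def using y0 by (intro continuous_intros) auto
    then obtain p where p: "real_polynomial_function p" "\<And>y. y \<in> {-1..1} \<Longrightarrow> \<bar>\<phi> y - p y\<bar> < \<epsilon>1"
      using Stone_Weierstrass_real_polynomial_function[of "{-1..1::real}" \<phi> \<epsilon>1] \<epsilon>1 by auto
    then obtain a n where pa: "p = (\<lambda>x. \<Sum>i\<le>n. a i * x ^ i)" using real_polynomial_function_iff_sum by blast
    have ps: "\<bar>\<phi> (sin x) - p (sin x)\<bar> \<le> \<epsilon>1" for x using p(2)[of "sin x"] by simp
    have p2: "\<bar>p (sin x)\<bar> \<le> 2" for x using ps[of x] \<phi>01[of "sin x"] \<epsilon>1 by linarith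
    define G where "G B = expectation (\<lambda>\<omega>. p (sin (1 / K * U B \<omega>)) * p (sin (1 / K * V B \<omega>)))" for B
    have [measurable]: "p \<in> borel_measurable borel" unfolding pa by measurable
    have "convergent G"
    proof -
      note tm = trig_moments_converge[OF f(1) f2 f(3) g(1) g2 g(3), of "1 / K" _ _ 0 0 0, folded U_def V_def]
      have int: "integrable M (\<lambda>\<omega>. sin (1 / K * U B \<omega>) ^ i * sin (1 / K * V B \<omega>) ^ j)" for B i j
        by (rule bounded_integrable[of _ 1]) (auto simp: abs_mult power_abs intro!: mult_le_one power_le_one)
      have "G B = (\<Sum>i\<le>n. \<Sum>j\<le>n. a i * a j * expectation (\<lambda>\<omega>. sin (1 / K * U B \<omega>) ^ i * sin (1 / K * V B \<omega>) ^ j))" for B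
      proof -
        have "p (sin (1 / K * U B \<omega>)) * p (sin (1 / K * V B \<omega>))
          = (\<Sum>i\<le>n. \<Sum>j\<le>n. a i * a j * (sin (1 / K * U B \<omega>) ^ i * sin (1 / K * V B \<omega>) ^ j))" for \<omega>
          unfolding pa sum_product by (intro sum.cong refl) (simp add: mult_ac)
        then show ?thesis unfolding G_def using int by (simp del: times_divide_eq_left mult_1_left add: integral_sum)
      qed
      then have "G = (\<lambda>B. \<Sum>i\<le>n. \<Sum>j\<le>n. a i * a j * expectation (\<lambda>\<omega>. sin (1 / K * U B \<omega>) ^ i * sin (1 / K * V B \<omega>) ^ j))" by blast
      moreover have "convergent (\<lambda>B. expectation (\<lambda>\<omega>. sin (1 / K * U B \<omega>) ^ i * sin (1 / K * V B \<omega>) ^ j))" for i j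
        using tm[of i j] by simp
      ultimately show ?thesis by (simp only:) (intro convergent_sum convergent_mult convergent_const)
    qed
    then have "Cauchy G" by (rule convergent_Cauchy)
    then obtain N1 where N1: "\<And>k l. N1 \<le> k \<Longrightarrow> N1 \<le> l \<Longrightarrow> \<bar>G k - G l\<bar> < \<epsilon>1"
      using \<epsilon>1 unfolding Cauchy_def dist_real_def by meson
    \<comment> \<open>\<open>3 * \<epsilon>1\<close> where neither sum is exceptional, and at most 5 on each of the two exceptional
        events, whose probabilities are below \<open>\<epsilon>1\<close>\<close>
    have near: "\<bar>P B - G B\<bar> \<le> 13 * \<epsilon>1" if B: "prob {\<omega>\<in>space M. bad (U B \<omega>)} < \<epsilon>1" "prob {\<omega>\<in>space M. bad (V B \<omega>)} < \<epsilon>1" for B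
    proof -
      define h1 where "h1 \<omega> = (of_bool (U B \<omega> < 0) * of_bool (V B \<omega> < 0) :: real)" for \<omega>
      define h2 where "h2 \<omega> = p (sin (1 / K * U B \<omega>)) * p (sin (1 / K * V B \<omega>))" for \<omega>
      have bm [measurable]: "Measurable.pred borel bad" unfolding bad_def by measurable
      have bs: "{\<omega>\<in>space M. bad (U B \<omega>)} \<in> events" "{\<omega>\<in>space M. bad (V B \<omega>)} \<in> events" by measurable
      have i1: "integrable M h1" unfolding h1_def by (rule bounded_integrable[of _ 1]) auto
      have i2: "integrable M h2" unfolding h2_def
        by (rule bounded_integrable[of _ 4]) (use mult_mono[OF p2 p2] in \<open>auto simp: abs_mult\<close>)
      have "P B = expectation h1"
      proof -
        have "expectation h1 = expectation (indicator {\<omega>\<in>space M. U B \<omega> < 0 \<and> V B \<omega> < 0})"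
          by (rule Bochner_Integration.integral_cong) (auto simp: h1_def indicator_def)
        then show ?thesis unfolding P_def by simp
      qed
      moreover have "G B = expectation h2" unfolding G_def h2_def ..
      ultimately have "\<bar>P B - G B\<bar> = \<bar>expectation (\<lambda>\<omega>. h1 \<omega> - h2 \<omega>)\<bar>"
        by (simp only: Bochner_Integration.integral_diff[OF i1 i2])
      also have "\<dots> \<le> expectation (\<lambda>\<omega>. \<bar>h1 \<omega> - h2 \<omega>\<bar>)" by (rule integral_abs_bound)
      also have "\<dots> \<le> expectation (\<lambda>\<omega>. 3 * \<epsilon>1 + 5 * (indicator {\<omega>\<in>space M. bad (U B \<omega>)} \<omega> + indicator {\<omega>\<in>space M. bad (V B \<omega>)} \<omega>))"
      proof (rule integral_mono)
        fix \<omega> assume w: "\<omega> \<in> space M"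
        show "\<bar>h1 \<omega> - h2 \<omega>\<bar> \<le> 3 * \<epsilon>1 + 5 * (indicator {\<omega>\<in>space M. bad (U B \<omega>)} \<omega> + indicator {\<omega>\<in>space M. bad (V B \<omega>)} \<omega>)"
        proof (cases "bad (U B \<omega>) \<or> bad (V B \<omega>)")
          case True
          have "\<bar>h1 \<omega>\<bar> \<le> 1" by (simp add: h1_def)
          moreover have "\<bar>h2 \<omega>\<bar> \<le> 2 * 2" unfolding h2_def abs_mult by (intro mult_mono p2) auto
          ultimately have le5: "\<bar>h1 \<omega> - h2 \<omega>\<bar> \<le> 5" by linarith
          have key: "x \<le> 3 * \<epsilon>1 + 5 * y" if "x \<le> 5" "1 \<le> y" for x y :: real using that \<epsilon>1 by linarith
          have "(1::real) \<le> indicator {\<omega>\<in>space M. bad (U B \<omega>)} \<omega> + indicator {\<omega>\<in>space M. bad (V B \<omega>)} \<omega>"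
            using True w by (auto simp: indicator_def)
          then show ?thesis by (rule key[OF le5])
        next
          case False
          define s t where "s = sin (1 / K * U B \<omega>)" and "t = sin (1 / K * V B \<omega>)"
          have "h1 \<omega> = \<phi> s * \<phi> t" using False \<phi> by (simp add: h1_def s_def t_def)
          moreover have "\<phi> s * \<phi> t - p s * p t = \<phi> s * (\<phi> t - p t) + (\<phi> s - p s) * p t" by (simp add: algebra_simps)
          moreover have "\<bar>\<phi> s * (\<phi> t - p t)\<bar> \<le> 1 * \<epsilon>1" unfolding abs_mult
            using ps \<phi>01 \<epsilon>1 by (intro mult_mono) (auto simp: t_def)
          moreover have "\<bar>(\<phi> s - p s) * p t\<bar> \<le> \<epsilon>1 * 2" unfolding abs_mult
            using ps p2 \<epsilon>1 by (intro mult_mono) (auto simp: t_def s_def)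
          ultimately have "\<bar>h1 \<omega> - h2 \<omega>\<bar> \<le> 3 * \<epsilon>1" unfolding h2_def s_def[symmetric] t_def[symmetric] by linarith
          then show ?thesis by (simp add: indicator_def)
        qed
      qed (use i1 i2 bs in \<open>auto simp: emeasure_eq_measure intro!: Bochner_Integration.integrable_add\<close>)
      also have "\<dots> = 3 * \<epsilon>1 + 5 * (prob {\<omega>\<in>space M. bad (U B \<omega>)} + prob {\<omega>\<in>space M. bad (V B \<omega>)})"
        using bs by (simp add: prob_space emeasure_eq_measure)
      also have "\<dots> \<le> 13 * \<epsilon>1"
      proof -
        have "3 * \<epsilon>1 + 5 * (x + y) \<le> 13 * \<epsilon>1" if "x < \<epsilon>1" "y < \<epsilon>1" for x y :: real using that by argo
        then show ?thesis using B by blast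
      qed
      finally show ?thesis .
    qed
    have "\<forall>\<^sub>F B in sequentially. \<bar>P B - G B\<bar> \<le> 13 * \<epsilon>1"
      using evU evV by eventually_elim (rule near)
    then obtain N2 where N2: "\<And>B. N2 \<le> B \<Longrightarrow> \<bar>P B - G B\<bar> \<le> 13 * \<epsilon>1" unfolding eventually_sequentially by blast
    show "\<exists>k0. \<forall>k\<ge>k0. \<forall>l\<ge>k0. dist (P k) (P l) < \<epsilon>"
    proof (intro exI allI impI)
      fix k l assume "max N1 N2 \<le> k" "max N1 N2 \<le> l"
      then have "\<bar>G k - G l\<bar> < \<epsilon>1" "\<bar>P k - G k\<bar> \<le> 13 * \<epsilon>1" "\<bar>P l - G l\<bar> \<le> 13 * \<epsilon>1" using N1 N2 by auto
      then show "dist (P k) (P l) < \<epsilon>" unfolding dist_real_def using \<epsilon>1 by linarith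
    qed
  qed
  then have conv: "convergent P" by (simp add: Cauchy_convergent_iff)
  have eq: "P B = prob {\<omega>\<in>space M. count A B \<omega> < B * q \<and> count C B \<omega> < B * q}" if "0 < B" for B
  proof -
    have "U B \<omega> < 0 \<longleftrightarrow> count A B \<omega> < B * q" "V B \<omega> < 0 \<longleftrightarrow> count C B \<omega> < B * q" for \<omega>
      using that by (auto simp: U_def V_def normalized_sum_def f_def g_def count_eq sum_subtractf divide_less_0_iff)
    then show ?thesis by (simp add: P_def)
  qed
  have "\<forall>\<^sub>F B in sequentially. P B = prob {\<omega>\<in>space M. count A B \<omega> < B * q \<and> count C B \<omega> < B * q}"
    using eventually_gt_at_top[of 0] by (rule eventually_mono) (rule eq)
  from convergent_cong[THEN iffD1, OF this conv] show ?thesis .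
qed

text \<open>
  Bernstein's inequality with \<open>\<theta> = 1\<close>; the centered indicators are bounded by 1.
\<close>

lemma count_law_of_large_numbers:
  fixes \<eta> :: real
  assumes A: "A \<in> sets N" and \<eta>: "0 < \<eta>"
  shows "(\<lambda>B. prob {\<omega>\<in>space M. B * \<eta> \<le> \<bar>count A B \<omega> - B * measure D A\<bar>}) \<longlonglongrightarrow> 0"
proof -
  define p where "p = measure D A"
  define f where "f = (\<lambda>z. indicator A z - p)"
  note f = centered_indicator[OF A, folded p_def f_def]
  have f1 [measurable]: "f \<in> borel_measurable N" unfolding f_def using A by measurable
  have f2: "\<bar>f z\<bar> \<le> 1" for z using f(2) by (simp add: f_def)
  have f3: "integral\<^sup>L D f = 0" using f(3) by (simp add: f_def)
  define \<eta>' where "\<eta>' = min \<eta> 1"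
  have \<eta>': "0 < \<eta>'" "\<eta>' \<le> 1" "\<eta>' \<le> \<eta>" using \<eta> by (auto simp: \<eta>'_def)
  have e1: "(1::real) \<le> exp 1" by simp
  have bound: "prob {\<omega>\<in>space M. B * \<eta> \<le> \<bar>count A B \<omega> - B * p\<bar>} \<le> 2 * exp (- (real B * \<eta>'\<^sup>2 * (1\<^sup>2 / (16 * exp 1))))" for B
  proof -
    have ind: "indep_vars (\<lambda>_. borel) (\<lambda>b \<omega>. f (Z b \<omega>)) {..<B}"
      by (rule indep_vars_compose2[where Y = "\<lambda>_. f", OF indep_vars_subset[OF indep]]) (auto simp: f1)
    have I: "integrable M (\<lambda>\<omega>. exp (1 * \<bar>f (Z t \<omega>)\<bar>))" for t
      by (rule bounded_integrable[of _ "exp 1"]) (use f2 in auto)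
    have "prob {\<omega>\<in>space M. real (card {..<B}) * \<eta>' \<le> \<bar>\<Sum>b<B. f (Z b \<omega>)\<bar>}
      \<le> 2 * exp (- (real (card {..<B}) * \<eta>'\<^sup>2 * (1\<^sup>2 / (16 * exp 1))))"
    proof (rule bernstein_bound[OF ind])
      show "expectation (\<lambda>\<omega>. exp (1 * \<bar>f (Z t \<omega>)\<bar>)) \<le> exp 1" for t
        using integral_mono[OF I integrable_const[of "exp 1"], of t] f2 by (simp add: prob_space)
      show "expectation (\<lambda>\<omega>. f (Z t \<omega>)) = 0" for t using expectation_Z[OF f1] f3 by simp
      show "\<eta>' \<le> 4 * exp 1 / 1" using \<eta>' e1 by linarith
    qed (use \<eta>' I in auto)
    moreover have "{\<omega>\<in>space M. B * \<eta> \<le> \<bar>count A B \<omega> - B * p\<bar>} \<subseteq> {\<omega>\<in>space M. real (card {..<B}) * \<eta>' \<le> \<bar>\<Sum>b<B. f (Z b \<omega>)\<bar>}"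
      using mult_left_mono[OF \<eta>'(3), of "real B"] by (auto simp: f_def sum_subtractf count_eq)
    moreover have "{\<omega>\<in>space M. real (card {..<B}) * \<eta>' \<le> \<bar>\<Sum>b<B. f (Z b \<omega>)\<bar>} \<in> events" by measurable
    ultimately show ?thesis using finite_measure_mono by (smt (verit) card_lessThan)
  qed
  have lim: "(\<lambda>B. 2 * exp (- (real B * \<eta>'\<^sup>2 * (1\<^sup>2 / (16 * exp 1))))) \<longlonglongrightarrow> 0"
  proof -
    define k where "k = \<eta>'\<^sup>2 * (1\<^sup>2 / (16 * exp (1::real)))"
    have k: "0 < k" using \<eta>' by (simp add: k_def)
    have "filterlim (\<lambda>B. k * real B) at_top sequentially"
      by (rule filterlim_tendsto_pos_mult_at_top[OF tendsto_const k filterlim_real_sequentially])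
    then have "(\<lambda>B. exp (- (k * real B))) \<longlonglongrightarrow> 0"
      by (intro filterlim_compose[OF exp_at_bot]) (simp add: filterlim_uminus_at_bot)
    then have "(\<lambda>B. 2 * exp (- (k * real B))) \<longlonglongrightarrow> 0" by (rule tendsto_mult_right_zero)
    then show ?thesis by (simp add: k_def mult_ac)
  qed
  show ?thesis unfolding p_def[symmetric]
    by (rule tendsto_sandwich[OF always_eventually always_eventually tendsto_const lim]) (use bound in simp_all)
qed

lemma count_below_tendsto:
  fixes q :: real
  assumes A: "A \<in> sets N" and "q < measure D A"
  shows "(\<lambda>B. prob {\<omega>\<in>space M. count A B \<omega> < B * q}) \<longlonglongrightarrow> 0"
proof (rule tendsto_sandwich[OF _ _ tendsto_const count_law_of_large_numbers[OF A, of "measure D A - q"]])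
  note [measurable] = A
  show "\<forall>\<^sub>F B in sequentially. prob {\<omega>\<in>space M. count A B \<omega> < B * q} \<le> prob {\<omega>\<in>space M. B * (measure D A - q) \<le> \<bar>count A B \<omega> - B * measure D A\<bar>}"
    by (intro always_eventually allI finite_measure_mono) (auto simp: algebra_simps)
qed (use assms in auto)

lemma count_above_tendsto:
  fixes q :: real
  assumes A: "A \<in> sets N" and "measure D A < q"
  shows "(\<lambda>B. prob {\<omega>\<in>space M. B * q \<le> count A B \<omega>}) \<longlonglongrightarrow> 0"
proof (rule tendsto_sandwich[OF _ _ tendsto_const count_law_of_large_numbers[OF A, of "q - measure D A"]])
  note [measurable] = A
  show "\<forall>\<^sub>F B in sequentially. prob {\<omega>\<in>space M. B * q \<le> count A B \<omega>} \<le> prob {\<omega>\<in>space M. B * (q - measure D A) \<le> \<bar>count A B \<omega> - B * measure D A\<bar>}"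
    by (intro always_eventually allI finite_measure_mono) (auto simp: algebra_simps)
qed (use assms in auto)

lemma exceedance_tendsto_1:
  fixes q :: real
  assumes A: "A \<in> sets N" and C: "C \<in> sets N" and "q < measure D A \<or> q < measure D C"
  shows "(\<lambda>B. prob {\<omega>\<in>space M. B * q \<le> count A B \<omega> \<or> B * q \<le> count C B \<omega>}) \<longlonglongrightarrow> 1"
proof -
  note [measurable] = A C
  obtain F where F: "F = A \<or> F = C" "q < measure D F" using assms(3) by blast
  have [measurable]: "F \<in> sets N" using F A C by auto
  have eq: "prob {\<omega>\<in>space M. B * q \<le> count F B \<omega>} = 1 - prob {\<omega>\<in>space M. count F B \<omega> < B * q}" for B
    by (subst prob_compl[symmetric]) (auto intro!: arg_cong[where f = prob])
  have "(\<lambda>B. 1 - prob {\<omega>\<in>space M. count F B \<omega> < B * q}) \<longlonglongrightarrow> 1 - 0"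
    by (intro tendsto_diff tendsto_const count_below_tendsto F) measurable
  then have lim: "(\<lambda>B. 1 - prob {\<omega>\<in>space M. count F B \<omega> < B * q}) \<longlonglongrightarrow> 1" by simp
  show ?thesis
  proof (rule tendsto_sandwich[OF _ _ lim tendsto_const])
    show "\<forall>\<^sub>F B in sequentially. 1 - prob {\<omega>\<in>space M. count F B \<omega> < B * q} \<le> prob {\<omega>\<in>space M. B * q \<le> count A B \<omega> \<or> B * q \<le> count C B \<omega>}"
      unfolding eq[symmetric] by (intro always_eventually allI finite_measure_mono) (use F in auto)
  qed auto
qed

text \<open>
  The law of large numbers decides about an event of probability other than \<open>q\<close>: its frequency
  reaches \<open>q\<close> with probability tending to 0 or to 1. A single event of probability \<open>q\<close> is covered
  by \<open>tie_converges\<close> with both events equal.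
\<close>

lemma exceedance_converges:
  fixes q :: real
  assumes A: "A \<in> sets N" and C: "C \<in> sets N" and q: "0 < q" "q < 1"
  shows "convergent (\<lambda>B. prob {\<omega>\<in>space M. B * q \<le> count A B \<omega> \<or> B * q \<le> count C B \<omega>})"
proof -
  note [measurable] = A C
  have tie: "convergent (\<lambda>B. prob {\<omega>\<in>space M. B * q \<le> count F B \<omega> \<or> B * q \<le> count G B \<omega>})"
    if F: "F \<in> sets N" "measure D F = q" and G: "G \<in> sets N" "measure D G = q" for F G
  proof -
    note [measurable] = F(1) G(1)
    have "prob {\<omega>\<in>space M. B * q \<le> count F B \<omega> \<or> B * q \<le> count G B \<omega>} = 1 - prob {\<omega>\<in>space M. count F B \<omega> < B * q \<and> count G B \<omega> < B * q}" for B
      by (subst prob_compl[symmetric]) (auto intro!: arg_cong[where f = prob])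
    then show ?thesis using tie_converges[OF F(1) G(1) F(2) G(2) q] by (simp add: convergent_diff convergent_const)
  qed
  have one: "convergent (\<lambda>B. prob {\<omega>\<in>space M. B * q \<le> count F B \<omega> \<or> B * q \<le> count G B \<omega>})"
    if F: "F \<in> sets N" "measure D F < q" and G: "G \<in> sets N" "measure D G \<le> q" for F G
  proof -
    note [measurable] = F(1) G(1)
    have "convergent (\<lambda>B. prob {\<omega>\<in>space M. B * q \<le> count G B \<omega>})"
    proof (cases "measure D G = q")
      case True
      then show ?thesis using tie[OF G(1) _ G(1)] by simp
    next
      case False
      with G(2) have "measure D G < q" by simp
      then show ?thesis using count_above_tendsto[OF G(1)] by (auto simp: convergent_def)
    qed
    then obtain l where l: "(\<lambda>B. prob {\<omega>\<in>space M. B * q \<le> count G B \<omega>}) \<longlonglongrightarrow> l" by (auto simp: convergent_def)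
    have "(\<lambda>B. prob {\<omega>\<in>space M. B * q \<le> count F B \<omega> \<or> B * q \<le> count G B \<omega>}) \<longlonglongrightarrow> l"
    proof (rule tendsto_sandwich[OF _ _ l])
      show "(\<lambda>B. prob {\<omega>\<in>space M. B * q \<le> count F B \<omega>} + prob {\<omega>\<in>space M. B * q \<le> count G B \<omega>}) \<longlonglongrightarrow> l"
        using tendsto_add[OF count_above_tendsto[OF F] l] by simp
      show "\<forall>\<^sub>F B in sequentially. prob {\<omega>\<in>space M. B * q \<le> count G B \<omega>} \<le> prob {\<omega>\<in>space M. B * q \<le> count F B \<omega> \<or> B * q \<le> count G B \<omega>}"
        by (intro always_eventually allI finite_measure_mono) auto
      show "\<forall>\<^sub>F B in sequentially. prob {\<omega>\<in>space M. B * q \<le> count F B \<omega> \<or> B * q \<le> count G B \<omega>} \<le> prob {\<omega>\<in>space M. B * q \<le> count F B \<omega>} + prob {\<omega>\<in>space M. B * q \<le> count G B \<omega>}"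
      proof (intro always_eventually allI)
        fix B
        have "{\<omega>\<in>space M. B * q \<le> count F B \<omega> \<or> B * q \<le> count G B \<omega>} = {\<omega>\<in>space M. B * q \<le> count F B \<omega>} \<union> {\<omega>\<in>space M. B * q \<le> count G B \<omega>}" by auto
        then show "prob {\<omega>\<in>space M. B * q \<le> count F B \<omega> \<or> B * q \<le> count G B \<omega>} \<le> prob {\<omega>\<in>space M. B * q \<le> count F B \<omega>} + prob {\<omega>\<in>space M. B * q \<le> count G B \<omega>}"
          by (simp only:) (rule measure_Un_le; measurable)
      qed
    qed
    then show ?thesis by (auto simp: convergent_def)
  qed
  consider "q < measure D A \<or> q < measure D C" | "measure D A < q" "measure D C \<le> q" | "measure D C < q" "measure D A \<le> q"
    | "measure D A = q" "measure D C = q" by linarith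
  then show ?thesis
  proof cases
    case 1
    then show ?thesis using exceedance_tendsto_1[OF A C] by (auto simp: convergent_def)
  next
    case 2
    then show ?thesis using one[OF A _ C] by simp
  next
    case 3
    then show ?thesis using one[OF C _ A] by (simp add: disj_commute)
  next
    case 4
    then show ?thesis using tie[OF A _ C] by simp
  qed
qed

end

section \<open>Conditioning on the data\<close>

lemma PiM_coordinates:
  assumes "\<And>i. prob_space (N i)" "I \<noteq> {}"
  shows "prob_space.indep_vars (Pi\<^sub>M I N) N (\<lambda>i \<omega>. \<omega> i) I"
    "i \<in> I \<Longrightarrow> distr (Pi\<^sub>M I N) (N i) (\<lambda>\<omega>. \<omega> i) = N i"
proof -
  interpret N: prob_space "N i" for i by (rule assms(1))
  interpret P: product_prob_space N I ..
  have PP: "prob_space (Pi\<^sub>M I N)" by (intro prob_space_PiM assms)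
  show 1: "distr (Pi\<^sub>M I N) (N i) (\<lambda>\<omega>. \<omega> i) = N i" if "i \<in> I" for i
    using P.PiM_component[OF that] .
  have "distr (Pi\<^sub>M I N) (Pi\<^sub>M I N) (\<lambda>\<omega>. \<lambda>i\<in>I. \<omega> i) = distr (Pi\<^sub>M I N) (Pi\<^sub>M I N) (\<lambda>\<omega>. \<omega>)"
    by (rule distr_cong) (auto simp: space_PiM restrict_def PiE_def extensional_def fun_eq_iff)
  also have "\<dots> = Pi\<^sub>M I (\<lambda>i. distr (Pi\<^sub>M I N) (N i) (\<lambda>\<omega>. \<omega> i))"
    unfolding distr_id by (rule PiM_cong) (simp_all add: 1)
  finally show "prob_space.indep_vars (Pi\<^sub>M I N) N (\<lambda>i \<omega>. \<omega> i) I"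
    by (subst prob_space.indep_vars_iff_distr_eq_PiM'[OF PP assms(2)]) auto
qed

lemma iid_sequence_PiM:
  assumes "prob_space N"
  shows "iid_sequence (Pi\<^sub>M UNIV (\<lambda>_::nat. N)) (\<lambda>b \<omega>. \<omega> b) N N"
  unfolding iid_sequence_def iid_sequence_axioms_def
  using PiM_coordinates[of "\<lambda>_::nat. N" UNIV] assms by (auto intro!: prob_space_PiM)

lemma prob_space_normal_law: "prob_space (normal_law m s)" if "0 \<le> s"
  using that prob_space_normal_density[of s m] by (auto simp: normal_law_def intro: prob_space_return)

lemma sets_normal_law [measurable_cong, simp]: "sets (normal_law m s) = sets borel"
  by (simp add: normal_law_def)

definition std_normal_vec :: "nat \<Rightarrow> (nat \<Rightarrow> real) measure" where
  "std_normal_vec n = Pi\<^sub>M {..<n} (\<lambda>_. normal_law 0 1)"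

lemma prob_space_std_normal_vec: "prob_space (std_normal_vec n)"
  unfolding std_normal_vec_def by (intro prob_space_PiM prob_space_normal_law) simp

lemma sets_std_normal_vec [measurable_cong]: "sets (std_normal_vec n) = sets (Pi\<^sub>M {..<n} (\<lambda>_. borel))"
  unfolding std_normal_vec_def by (intro sets_PiM_cong) simp_all

abbreviation data_space :: "nat \<Rightarrow> nat \<Rightarrow> (nat \<Rightarrow> real \<times> (nat \<Rightarrow> real)) measure" where
  "data_space n d \<equiv> Pi\<^sub>M {..<n} (\<lambda>_. row_space d)"

definition response_vec :: "nat \<Rightarrow> (nat \<Rightarrow> real \<times> (nat \<Rightarrow> real)) \<Rightarrow> real vec" where
  "response_vec n \<delta> = vec n (\<lambda>t. fst (\<delta> t))"

definition covariate_mat :: "nat \<Rightarrow> nat \<Rightarrow> (nat \<Rightarrow> real \<times> (nat \<Rightarrow> real)) \<Rightarrow> real mat" where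
  "covariate_mat n d \<delta> = mat n d (\<lambda>(t, j). snd (\<delta> t) j)"

lemma measurable_response_vec:
  assumes "f \<in> measurable M (data_space n d)"
  shows "measurable_vec M n (\<lambda>\<omega>. response_vec n (f \<omega>))"
proof (rule measurable_vecI[where f = "\<lambda>t \<omega>. fst (f \<omega> t)"])
  fix t assume "t < n"
  then have "(\<lambda>\<omega>. f \<omega> t) \<in> measurable M (row_space d)"
    using measurable_compose[OF assms measurable_component_singleton[of t "{..<n}"]] by simp
  then show "(\<lambda>\<omega>. fst (f \<omega> t)) \<in> borel_measurable M" unfolding row_space_def by (rule measurable_fst')
qed (simp_all add: response_vec_def)

lemma measurable_covariate_mat:
  assumes "f \<in> measurable M (data_space n d)"
  shows "measurable_mat M n d (\<lambda>\<omega>. covariate_mat n d (f \<omega>))"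
proof (rule measurable_matI[where f = "\<lambda>t j \<omega>. snd (f \<omega> t) j"])
  fix t j assume t: "t < n" and j: "j < d"
  then have "(\<lambda>\<omega>. f \<omega> t) \<in> measurable M (row_space d)"
    using measurable_compose[OF assms measurable_component_singleton[of t "{..<n}"]] by simp
  then have "(\<lambda>\<omega>. snd (f \<omega> t)) \<in> measurable M (Pi\<^sub>M {..<d} (\<lambda>_. borel))" unfolding row_space_def by (rule measurable_snd')
  then show "(\<lambda>\<omega>. snd (f \<omega> t) j) \<in> borel_measurable M"
    using measurable_compose[OF _ measurable_component_singleton[of j "{..<d}"]] j by simp
qed (simp_all add: covariate_mat_def)

lemma measurable_vec_PiM:
  assumes "f \<in> measurable M (Pi\<^sub>M {..<n} (\<lambda>_. borel))"
  shows "measurable_vec M n (\<lambda>\<omega>. vec n (f \<omega>))"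
proof (rule measurable_vecI[where f = "\<lambda>t \<omega>. f \<omega> t"])
  fix t assume "t < n"
  then show "(\<lambda>\<omega>. f \<omega> t) \<in> borel_measurable M"
    using measurable_compose[OF assms measurable_component_singleton[of t "{..<n}"]] by simp
qed simp_all

text \<open>
  The limit of the fraction of resamples whose statistic is below the observed one, given the
  data.
\<close>

definition below_prob :: "(real mat \<Rightarrow> real vec \<Rightarrow> real) \<Rightarrow> nat \<Rightarrow> real mat \<Rightarrow> real vec \<Rightarrow> real" where
  "below_prob T n x y = measure (std_normal_vec n)
     {e\<in>space (std_normal_vec n). \<bar>T x (scaled_residual x (vec n e))\<bar> < \<bar>T x (scaled_residual x y)\<bar>}"

text \<open>
  By independence, the law of data and draws is a product, and the probability of rejection is an
  integral over the data of the probabilities treated in \<open>exceedance_converges\<close>. The integrand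
  converges for all data, and to 1 where \<open>below_prob\<close> exceeds \<open>1 - \<alpha> / 2\<close> for one of the
  statistics. The limit of the integrals therefore exists, and it is at least the probability of
  any event \<open>G\<close> of such data.
\<close>

lemma (in prob_space) rejection_probability:
  assumes Y: "Y \<in> space M \<rightarrow> carrier_vec n" and X: "X \<in> space M \<rightarrow> carrier_mat n d"
    and S: "S \<subseteq> {..<d}" and E: "E \<subseteq> Pow {..<n}" and \<alpha>: "0 < \<alpha>" "\<alpha> < 1"
    and draws: "resampling_draws M n d Y X eps"
  shows "\<exists>p. (\<lambda>B. prob {\<omega>\<in>space M. decoupled_test E \<alpha> B (\<lambda>i. eps i \<omega>) (Y \<omega>) (restrict_cols (X \<omega>) S) = 1}) \<longlonglongrightarrow> p
    \<and> (\<forall>G\<in>events. (\<forall>\<omega>\<in>G. 1 - \<alpha> / 2 < below_prob (T1_max E) n (restrict_cols (X \<omega>) S) (Y \<omega>)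
          \<or> 1 - \<alpha> / 2 < below_prob (T2_max E) n (restrict_cols (X \<omega>) S) (Y \<omega>)) \<longrightarrow> prob G \<le> p) \<and> p \<le> 1"
proof -
  define q where "q = 1 - \<alpha> / 2"
  have q: "0 < q" "q < 1" using \<alpha> by (auto simp: q_def)
  let ?NS = "Pi\<^sub>M {..<n} (\<lambda>_. borel :: real measure)"
  let ?DS = "data_space n d"
  let ?PN = "Pi\<^sub>M (UNIV :: nat set) (\<lambda>_. ?NS)"
  let ?EN = "std_normal_vec n"
  let ?PE = "Pi\<^sub>M (UNIV :: nat set) (\<lambda>_. ?EN)"
  define data where "data \<omega> = (\<lambda>t\<in>{..<n}. obs d Y X t \<omega>)" for \<omega>
  define es where "es \<omega> = (\<lambda>b. coords n (eps b \<omega>))" for \<omega>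
  have epsc: "\<And>b \<omega>. \<omega> \<in> space M \<Longrightarrow> eps b \<omega> \<in> carrier_vec n"
    and ind: "indep_vars (\<lambda>_. ?NS) (\<lambda>b \<omega>. coords n (eps b \<omega>)) UNIV"
    and law: "\<And>b. distr M ?NS (\<lambda>\<omega>. coords n (eps b \<omega>)) = ?EN"
    and ind2: "indep_rv M ?DS data ?PN es"
    using draws unfolding resampling_draws_def data_def es_def std_normal_vec_def by (auto simp: Pi_iff)
  have cm: "(\<lambda>\<omega>. coords n (eps b \<omega>)) \<in> measurable M ?NS" for b using ind by (simp add: indep_vars_def2)
  have data_m [measurable]: "data \<in> measurable M ?DS" and es_m [measurable]: "es \<in> measurable M ?PN"
    using ind2 by (auto simp: indep_rv_def)
  define LD where "LD = distr M ?DS data"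
  interpret LD: prob_space LD unfolding LD_def by (rule prob_space_distr) simp
  interpret EN: prob_space ?EN by (rule prob_space_std_normal_vec)
  interpret PE: iid_sequence ?PE "\<lambda>b \<omega>. \<omega> b" ?EN ?EN by (rule iid_sequence_PiM[OF EN.prob_space_axioms])
  have sets_PE [measurable_cong]: "sets ?PE = sets ?PN" by (intro sets_PiM_cong refl sets_std_normal_vec)
  have sets_LD [measurable_cong]: "sets LD = sets ?DS" by (simp add: LD_def)
  have law_es: "distr M ?PN es = ?PE"
  proof -
    have "distr M ?PN (\<lambda>\<omega>. \<lambda>b\<in>UNIV. coords n (eps b \<omega>)) = Pi\<^sub>M UNIV (\<lambda>b. distr M ?NS (\<lambda>\<omega>. coords n (eps b \<omega>)))"
      by (rule indep_vars_iff_distr_eq_PiM[THEN iffD1, OF _ cm ind]) simp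
    then show ?thesis by (simp add: law es_def[abs_def] restrict_UNIV)
  qed
  have pair_law: "distr M (?DS \<Otimes>\<^sub>M ?PN) (\<lambda>\<omega>. (data \<omega>, es \<omega>)) = LD \<Otimes>\<^sub>M ?PE"
  proof (rule pair_measure_eqI[symmetric])
    show "sigma_finite_measure LD" "sigma_finite_measure ?PE" by unfold_locales
    show "sets (LD \<Otimes>\<^sub>M ?PE) = sets (distr M (?DS \<Otimes>\<^sub>M ?PN) (\<lambda>\<omega>. (data \<omega>, es \<omega>)))"
      by (simp add: sets_LD sets_PE cong: sets_pair_measure_cong)
    fix A B assume A: "A \<in> sets LD" and B: "B \<in> sets ?PE"
    then have A': "A \<in> sets ?DS" and B': "B \<in> sets ?PN" by (auto simp: sets_LD sets_PE)
    have "prob ((data -` A \<inter> space M) \<inter> (es -` B \<inter> space M)) = prob (data -` A \<inter> space M) * prob (es -` B \<inter> space M)"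
    proof (rule indep_setD)
      show "indep_set {data -` A \<inter> space M |A. A \<in> sets ?DS} {es -` A \<inter> space M |A. A \<in> sets ?PN}"
        using ind2 by (simp add: indep_rv_def)
    qed (use A' B' in auto)
    moreover have "(\<lambda>\<omega>. (data \<omega>, es \<omega>)) -` (A \<times> B) \<inter> space M = (data -` A \<inter> space M) \<inter> (es -` B \<inter> space M)" by auto
    ultimately show "emeasure LD A * emeasure ?PE B = emeasure (distr M (?DS \<Otimes>\<^sub>M ?PN) (\<lambda>\<omega>. (data \<omega>, es \<omega>))) (A \<times> B)"
      unfolding law_es[symmetric] LD_def using A' B'
      by (subst (1 2 3) emeasure_distr) (auto simp: emeasure_eq_measure ennreal_mult''[symmetric])
  qed
  define xs where "xs \<delta> = restrict_cols (covariate_mat n d \<delta>) S" for \<delta>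
  define F where "F T p = \<bar>T (xs (fst p)) (scaled_residual (xs (fst p)) (vec n (snd p)))\<bar>"
    for T :: "real mat \<Rightarrow> real vec \<Rightarrow> real" and p
  define H where "H T \<delta> = \<bar>T (xs \<delta>) (scaled_residual (xs \<delta>) (response_vec n \<delta>))\<bar>"
    for T :: "real mat \<Rightarrow> real vec \<Rightarrow> real" and \<delta>
  have xs_m: "measurable_mat N n (card S) (\<lambda>\<omega>. xs (f \<omega>))" if "f \<in> measurable N ?DS" for f and N :: "'c measure"
    unfolding xs_def by (rule measurable_restrict_cols[OF measurable_covariate_mat[OF that] S])
  have FH: "F (T1_max E) \<in> borel_measurable (?DS \<Otimes>\<^sub>M ?NS)" "F (T2_max E) \<in> borel_measurable (?DS \<Otimes>\<^sub>M ?NS)"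
     "H (T1_max E) \<in> borel_measurable ?DS" "H (T2_max E) \<in> borel_measurable ?DS"
  proof -
    note x1 = xs_m[OF measurable_fst[of ?DS ?NS]] and x2 = xs_m[OF measurable_ident[of ?DS], unfolded id_def]
    note r1 = measurable_scaled_residual[OF x1 measurable_vec_PiM[OF measurable_snd]]
    note r2 = measurable_scaled_residual[OF x2 measurable_response_vec[OF measurable_ident, unfolded id_def]]
    show "F (T1_max E) \<in> borel_measurable (?DS \<Otimes>\<^sub>M ?NS)" "F (T2_max E) \<in> borel_measurable (?DS \<Otimes>\<^sub>M ?NS)"
      unfolding F_def[abs_def] by (intro borel_measurable_abs measurable_T_max[OF x1 r1 E])+
    show "H (T1_max E) \<in> borel_measurable ?DS" "H (T2_max E) \<in> borel_measurable ?DS"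
      unfolding H_def[abs_def] by (intro borel_measurable_abs measurable_T_max[OF x2 r2 E])+
  qed
  define A where "A T \<delta> = {e\<in>space ?EN. F T (\<delta>, e) < H T \<delta>}" for T \<delta>
  have A_m: "A T \<delta> \<in> sets ?EN" if \<delta>: "\<delta> \<in> space ?DS" and T: "T = T1_max E \<or> T = T2_max E" for T \<delta>
  proof -
    have "F T \<in> borel_measurable (?DS \<Otimes>\<^sub>M ?NS)" using FH T by auto
    then have "(\<lambda>e. F T (\<delta>, e)) \<in> borel_measurable ?NS" using \<delta> by simp
    then have [measurable]: "(\<lambda>e. F T (\<delta>, e)) \<in> borel_measurable ?EN" by (simp cong: measurable_cong_sets add: sets_std_normal_vec)
    show ?thesis unfolding A_def by measurable
  qed
  \<comment> \<open>the rejections, as a set of pairs of data and draws\<close>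
  define R where "R B = {p\<in>space (?DS \<Otimes>\<^sub>M ?PN).
    real B * q \<le> (\<Sum>b<B. of_bool (F (T1_max E) (fst p, snd p b) < H (T1_max E) (fst p))) \<or>
    real B * q \<le> (\<Sum>b<B. of_bool (F (T2_max E) (fst p, snd p b) < H (T2_max E) (fst p)))}" for B
  have R_m [measurable]: "R B \<in> sets (?DS \<Otimes>\<^sub>M ?PN)" for B
  proof -
    have 1: "(\<lambda>p. (fst p, snd p b)) \<in> measurable (?DS \<Otimes>\<^sub>M ?PN) (?DS \<Otimes>\<^sub>M ?NS)" for b
      by (intro measurable_Pair measurable_fst measurable_compose[OF measurable_snd measurable_component_singleton]) simp
    note [measurable] = measurable_compose[OF 1 FH(1)] measurable_compose[OF 1 FH(2)]
      measurable_compose[OF measurable_fst FH(3)] measurable_compose[OF measurable_fst FH(4)]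
    show ?thesis unfolding R_def by measurable
  qed
  \<comment> \<open>the probability of rejection, given the data \<open>\<delta>\<close>\<close>
  define h where "h B \<delta> = measure ?PE (Pair \<delta> -` R B)" for B \<delta>
  have R_m': "R B \<in> sets (LD \<Otimes>\<^sub>M ?PE)" for B using R_m[of B] by (simp add: sets_LD sets_PE cong: sets_pair_measure_cong)
  have h_m: "h B \<in> borel_measurable LD" for B
    unfolding h_def[abs_def] measure_def
    by (rule measurable_compose[OF PE.measurable_emeasure_Pair[OF R_m'], of enn2real]) measurable
  have h_eq: "h B \<delta> = measure ?PE {\<omega>\<in>space ?PE. real B * q \<le> PE.count (A (T1_max E) \<delta>) B \<omega> \<or> real B * q \<le> PE.count (A (T2_max E) \<delta>) B \<omega>}"
    if \<delta>: "\<delta> \<in> space ?DS" for B \<delta>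
  proof -
    have "PE.count (A T \<delta>) B \<omega> = (\<Sum>b<B. of_bool (F T (\<delta>, \<omega> b) < H T \<delta>))" if \<omega>: "\<omega> \<in> space ?PE" for T \<omega>
      unfolding PE.count_eq
    proof (intro sum.cong refl)
      fix b show "indicator (A T \<delta>) (\<omega> b) = (of_bool (F T (\<delta>, \<omega> b) < H T \<delta>) :: real)"
        using \<omega> by (auto simp: A_def indicator_def space_PiM PiE_def)
    qed
    then have "Pair \<delta> -` R B = {\<omega>\<in>space ?PE. real B * q \<le> PE.count (A (T1_max E) \<delta>) B \<omega> \<or> real B * q \<le> PE.count (A (T2_max E) \<delta>) B \<omega>}"
      using \<delta> sets_eq_imp_space_eq[OF sets_PE] by (auto simp: R_def space_pair_measure)
    then show ?thesis by (simp add: h_def)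
  qed
  define g where "g \<delta> = lim (\<lambda>B. h B \<delta>)" for \<delta>
  have g_lim: "(\<lambda>B. h B \<delta>) \<longlonglongrightarrow> g \<delta>" if \<delta>: "\<delta> \<in> space ?DS" for \<delta>
    unfolding g_def convergent_LIMSEQ_iff[symmetric] h_eq[OF \<delta>]
    by (rule PE.exceedance_converges) (use A_m[OF \<delta>] q in auto)
  have g_one: "g \<delta> = 1" if \<delta>: "\<delta> \<in> space ?DS" and "q < measure ?EN (A (T1_max E) \<delta>) \<or> q < measure ?EN (A (T2_max E) \<delta>)" for \<delta>
  proof (rule LIMSEQ_unique[OF g_lim[OF \<delta>]])
    show "(\<lambda>B. h B \<delta>) \<longlonglongrightarrow> 1" unfolding h_eq[OF \<delta>]
      by (rule PE.exceedance_tendsto_1) (use A_m[OF \<delta>] that in auto)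
  qed
  have space_LD: "space LD = space ?DS" by (rule sets_eq_imp_space_eq[OF sets_LD])
  have h01: "0 \<le> h B \<delta>" "h B \<delta> \<le> 1" for B \<delta> by (auto simp: h_def)
  have g0: "0 \<le> g \<delta>" "g \<delta> \<le> 1" if "\<delta> \<in> space ?DS" for \<delta>
    using LIMSEQ_le_const[OF g_lim[OF that]] LIMSEQ_le_const2[OF g_lim[OF that]] h01 by auto
  have g_m: "g \<in> borel_measurable LD"
    by (rule borel_measurable_LIMSEQ_real[where u = h, OF _ h_m]) (simp add: g_lim space_LD)
  have lim: "(\<lambda>B. integral\<^sup>L LD (h B)) \<longlonglongrightarrow> integral\<^sup>L LD g"
    by (rule integral_dominated_convergence[where w = "\<lambda>_. 1"])
      (use g_m h_m h01 g_lim in \<open>auto intro!: AE_I2 simp: space_LD\<close>)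
  have Pr: "prob {\<omega>\<in>space M. (data \<omega>, es \<omega>) \<in> R B} = integral\<^sup>L LD (h B)" for B
  proof -
    have "emeasure M {\<omega>\<in>space M. (data \<omega>, es \<omega>) \<in> R B} = emeasure (distr M (?DS \<Otimes>\<^sub>M ?PN) (\<lambda>\<omega>. (data \<omega>, es \<omega>))) (R B)"
      by (subst emeasure_distr) (auto intro!: arg_cong[where f = "emeasure M"])
    also have "\<dots> = (\<integral>\<^sup>+\<delta>. emeasure ?PE (Pair \<delta> -` R B) \<partial>LD)"
      unfolding pair_law by (rule PE.emeasure_pair_measure_alt[OF R_m'])
    also have "\<dots> = (\<integral>\<^sup>+\<delta>. ennreal (h B \<delta>) \<partial>LD)" by (simp add: h_def PE.emeasure_eq_measure)
    also have "\<dots> = ennreal (integral\<^sup>L LD (h B))"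
      using h_m h01 by (intro nn_integral_eq_integral LD.integrable_const_bound[of _ 1]) auto
    finally show ?thesis using h01 by (simp add: emeasure_eq_measure integral_nonneg_AE)
  qed
  have dec: "xs (data \<omega>) = restrict_cols (X \<omega>) S" "response_vec n (data \<omega>) = Y \<omega>" "vec n (es \<omega> b) = eps b \<omega>" if "\<omega> \<in> space M" for \<omega> b
  proof -
    have Xc: "X \<omega> \<in> carrier_mat n d" and Yc: "Y \<omega> \<in> carrier_vec n" using X Y that by auto
    have "covariate_mat n d (data \<omega>) = X \<omega>"
      using Xc by (intro eq_matI) (simp_all add: covariate_mat_def data_def obs_def)
    then show "xs (data \<omega>) = restrict_cols (X \<omega>) S" by (simp add: xs_def)
    show "response_vec n (data \<omega>) = Y \<omega>"
      using Yc by (intro eq_vecI) (simp_all add: response_vec_def data_def obs_def)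
    show "vec n (es \<omega> b) = eps b \<omega>"
      using epsc[OF that, of b] by (intro eq_vecI) (simp_all add: es_def coords_def)
  qed
  have data_sp: "data \<omega> \<in> space ?DS" "es \<omega> \<in> space ?PN" if "\<omega> \<in> space M" for \<omega>
    using measurable_space[OF data_m that] measurable_space[OF es_m that] by auto
  have reject: "decoupled_test E \<alpha> B (\<lambda>i. eps i \<omega>) (Y \<omega>) (restrict_cols (X \<omega>) S) = 1 \<longleftrightarrow> (data \<omega>, es \<omega>) \<in> R B"
    if \<omega>: "\<omega> \<in> space M" and B: "0 < B" for \<omega> B
  proof -
    have cnt: "real (card {b. b < B \<and> \<bar>T (restrict_cols (X \<omega>) S) (scaled_residual (restrict_cols (X \<omega>) S) (eps b \<omega>))\<bar> < \<bar>T (restrict_cols (X \<omega>) S) (scaled_residual (restrict_cols (X \<omega>) S) (Y \<omega>))\<bar>})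
      = (\<Sum>b<B. of_bool (F T (data \<omega>, es \<omega> b) < H T (data \<omega>)))" for T
    proof -
      have "(\<Sum>b<B. of_bool (F T (data \<omega>, es \<omega> b) < H T (data \<omega>)) :: real) = real (card ({..<B} \<inter> {b. F T (data \<omega>, es \<omega> b) < H T (data \<omega>)}))"
        by (simp add: of_bool_def sum.If_cases)
      also have "{..<B} \<inter> {b. F T (data \<omega>, es \<omega> b) < H T (data \<omega>)} = {b. b < B \<and> \<bar>T (restrict_cols (X \<omega>) S) (scaled_residual (restrict_cols (X \<omega>) S) (eps b \<omega>))\<bar> < \<bar>T (restrict_cols (X \<omega>) S) (scaled_residual (restrict_cols (X \<omega>) S) (Y \<omega>))\<bar>}"
        by (auto simp: F_def H_def dec[OF \<omega>])
      finally show ?thesis by simp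
    qed
    have lev: "0 < \<alpha> / 2" "\<alpha> / 2 < 1" using \<alpha> by auto
    have "(data \<omega>, es \<omega>) \<in> space (?DS \<Otimes>\<^sub>M ?PN)" using data_sp[OF \<omega>] by (simp add: space_pair_measure)
    then show ?thesis
      unfolding decoupled_test_def of_bool_eq_1_iff resampling_test_eq_1_iff[OF lev B] cnt R_def q_def mem_Collect_eq fst_conv snd_conv
      by (simp only: True_implies_equals simp_thms)
  qed
  have "(\<lambda>B. prob {\<omega>\<in>space M. decoupled_test E \<alpha> B (\<lambda>i. eps i \<omega>) (Y \<omega>) (restrict_cols (X \<omega>) S) = 1}) \<longlonglongrightarrow> integral\<^sup>L LD g"
  proof (rule Lim_transform_eventually[OF lim])
    show "\<forall>\<^sub>F B in sequentially. integral\<^sup>L LD (h B) = prob {\<omega>\<in>space M. decoupled_test E \<alpha> B (\<lambda>i. eps i \<omega>) (Y \<omega>) (restrict_cols (X \<omega>) S) = 1}"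
      using eventually_gt_at_top[of 0]
    proof eventually_elim
      case (elim B)
      then show ?case unfolding Pr[symmetric] using reject by (intro arg_cong[where f = prob] Collect_cong conj_cong refl) auto
    qed
  qed
  moreover have "prob G \<le> integral\<^sup>L LD g"
    if G: "G \<in> events" and Gg: "\<forall>\<omega>\<in>G. 1 - \<alpha> / 2 < below_prob (T1_max E) n (restrict_cols (X \<omega>) S) (Y \<omega>)
          \<or> 1 - \<alpha> / 2 < below_prob (T2_max E) n (restrict_cols (X \<omega>) S) (Y \<omega>)" for G
  proof -
    have g_m': "g \<in> borel_measurable ?DS" using g_m by (simp add: sets_LD cong: measurable_cong_sets)
    note [measurable] = measurable_compose[OF data_m g_m']
    have "prob G = expectation (indicator G)" using G by simp
    also have "\<dots> \<le> expectation (\<lambda>\<omega>. g (data \<omega>))"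
    proof (rule integral_mono)
      show "integrable M (\<lambda>\<omega>. g (data \<omega>))"
        using g0 data_sp by (intro integrable_const_bound[of _ 1]) auto
      fix \<omega> assume \<omega>: "\<omega> \<in> space M"
      show "indicator G \<omega> \<le> g (data \<omega>)"
      proof (cases "\<omega> \<in> G")
        case True
        have "below_prob T n (restrict_cols (X \<omega>) S) (Y \<omega>) = measure ?EN (A T (data \<omega>))" for T
          by (simp add: below_prob_def A_def F_def H_def dec[OF \<omega>])
        then show ?thesis using True Gg g_one[OF data_sp(1)[OF \<omega>]] by (auto simp: q_def)
      qed (use g0[OF data_sp(1)[OF \<omega>]] in auto)
    qed (use G in \<open>simp add: emeasure_eq_measure\<close>)
    also have "\<dots> = integral\<^sup>L LD g" unfolding LD_def using g_m' by (subst integral_distr) auto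
    finally show ?thesis .
  qed
  moreover have "integral\<^sup>L LD g \<le> 1"
  proof (rule LIMSEQ_le_const2[OF calculation(1)])
  qed auto
  ultimately show ?thesis by blast
qed

section \<open>Extreme eigenvalues\<close>

text \<open>The first order condition at a minimum.\<close>

lemma linear_term_zero:
  fixes a b :: real
  assumes "\<And>t. 0 \<le> t * a + t\<^sup>2 * b"
  shows "a = 0"
proof (rule ccontr)
  assume a: "a \<noteq> 0"
  define c where "c = \<bar>b\<bar> + 1"
  have c: "0 < c" "b \<le> c" by (auto simp: c_def)
  define t where "t = - a / (2 * c)"
  have "t * a + t\<^sup>2 * b \<le> t * a + t\<^sup>2 * c" using c by (intro add_left_mono mult_left_mono) auto
  also have "\<dots> = - (a\<^sup>2) / (4 * c)" using c by (simp add: t_def power2_eq_square field_simps)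
  also have "\<dots> < 0" using a c by (intro divide_neg_pos) auto
  finally show False using assms[of t] by simp
qed

text \<open>
  The quadratic form attains a minimum \<open>l\<close> on the unit sphere. For a minimizer \<open>u\<close>, the function
  \<open>w \<mapsto> Q w - l N w\<close> is nonnegative and vanishes at \<open>u\<close>; its derivatives at \<open>u\<close> along the
  coordinates vanish, which says that \<open>u\<close> is an eigenvector.
\<close>

lemma symmetric_mat_min_eigenvalue:
  fixes A :: "real mat"
  assumes A: "A \<in> carrier_mat d d" and d: "0 < d" and sym: "\<And>i j. i < d \<Longrightarrow> j < d \<Longrightarrow> A $$ (i, j) = A $$ (j, i)"
  shows "\<exists>l. eigenvalue A l \<and> (\<forall>u. l * (\<Sum>i<d. (u i)\<^sup>2) \<le> (\<Sum>i<d. \<Sum>j<d. A $$ (i, j) * u i * u j))"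
proof -
  define Q where "Q u = (\<Sum>i<d. \<Sum>j<d. A $$ (i, j) * u i * u j)" for u :: "nat \<Rightarrow> real"
  define N where "N u = (\<Sum>i<d. (u i)\<^sup>2)" for u :: "nat \<Rightarrow> real"
  define box where "box = PiE UNIV (\<lambda>i. if i < d then {-1..1::real} else {0})"
  \<comment> \<open>the unit sphere of the first \<open>d\<close> coordinates, a closed subset of a product of compact
      intervals\<close>
  define K where "K = box \<inter> {u. N u = 1}"
  have "compactin (product_topology (\<lambda>_. euclidean) UNIV) box"
    unfolding box_def compactin_PiE by auto
  then have "compact box" by (simp add: euclidean_product_topology)
  moreover have coord: "continuous_on UNIV (\<lambda>u :: nat \<Rightarrow> real. u i)" for i
    by (rule continuous_on_product_coordinates)
  then have contN: "continuous_on UNIV N" and contQ: "continuous_on UNIV Q"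
    unfolding N_def[abs_def] Q_def[abs_def] by (auto intro!: continuous_intros)
  have "closed {u. N u = 1}" using contN by (intro closed_Collect_eq continuous_on_const)
  ultimately have "compact K" unfolding K_def by (rule compact_Int_closed)
  moreover have "(\<lambda>i. if i = 0 then 1 else 0) \<in> K"
    using d by (auto simp: K_def box_def N_def if_distrib[of "\<lambda>x. x\<^sup>2"] cong: if_cong)
  then have "K \<noteq> {}" by blast
  ultimately obtain u where u: "u \<in> K" and min: "\<And>v. v \<in> K \<Longrightarrow> Q u \<le> Q v"
    using continuous_attains_inf[of K Q] continuous_on_subset[OF contQ] by blast
  define l where "l = Q u"
  have Nu: "N u = 1" using u by (simp add: K_def)
  have Q_scale: "Q (\<lambda>i. if i < d then c * w i else 0) = c\<^sup>2 * Q w" and N_scale: "N (\<lambda>i. if i < d then c * w i else 0) = c\<^sup>2 * N w" for c w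
    unfolding Q_def N_def sum_distrib_left by (intro sum.cong refl; simp add: power2_eq_square mult_ac)+
  have low: "l * N w \<le> Q w" for w
  proof (cases "N w = 0")
    case True
    then have "w i = 0" if "i < d" for i
      using that unfolding N_def by (subst (asm) sum_nonneg_eq_0_iff) auto
    then have "Q w = 0" unfolding Q_def by (intro sum.neutral ballI) auto
    then show ?thesis using True by simp
  next
    case False
    have N0: "0 \<le> N w" unfolding N_def by (intro sum_nonneg) auto
    define c where "c = 1 / sqrt (N w)"
    define v where "v = (\<lambda>i. if i < d then c * w i else 0)"
    have c2: "c\<^sup>2 = 1 / N w" using N0 by (simp add: c_def power_divide)
    have Nv: "N v = 1" unfolding v_def N_scale c2 using False by simp
    have "v \<in> box"
    proof -
      have "\<bar>v i\<bar> \<le> 1" if "i < d" for i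
      proof -
        have "(v i)\<^sup>2 \<le> N v" unfolding N_def using that by (intro member_le_sum) auto
        then show ?thesis using Nv by (simp add: abs_square_le_1)
      qed
      then show ?thesis by (auto simp: box_def abs_le_iff) (auto simp: v_def)
    qed
    then have "l \<le> Q v" unfolding l_def using Nv by (intro min) (simp add: K_def)
    then have "l \<le> Q w / N w" unfolding v_def Q_scale c2 by simp
    then show ?thesis using False N0 by (simp add: pos_le_divide_eq)
  qed
  define c where "c j = (\<Sum>i<d. A $$ (j, i) * u i)" for j
  have eig: "c j = l * u j" if j: "j < d" for j
  proof -
    define w where "w t = (\<lambda>i. u i + (if i = j then t else 0))" for t
    have Qw: "Q (w t) = Q u + 2 * t * c j + t\<^sup>2 * A $$ (j, j)" for t
    proof -
      have "Q (w t) = (\<Sum>i<d. \<Sum>k<d. A $$ (i, k) * u i * u k) + (\<Sum>i<d. \<Sum>k<d. A $$ (i, k) * u i * (if k = j then t else 0))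
        + (\<Sum>i<d. \<Sum>k<d. A $$ (i, k) * (if i = j then t else 0) * u k) + (\<Sum>i<d. \<Sum>k<d. A $$ (i, k) * (if i = j then t else 0) * (if k = j then t else 0))"
        unfolding Q_def w_def by (simp add: sum.distrib[symmetric] algebra_simps)
      also have "(\<Sum>i<d. \<Sum>k<d. A $$ (i, k) * u i * (if k = j then t else 0)) = t * c j"
        using j sym by (simp add: if_distrib[of "\<lambda>x. _ * x"] c_def sum_distrib_left cong: if_cong) (intro sum.cong refl, auto)
      also have "(\<Sum>i<d. \<Sum>k<d. A $$ (i, k) * (if i = j then t else 0) * u k) = t * c j"
        unfolding c_def sum_distrib_left using j
        by (subst sum.swap) (simp add: if_distrib[of "\<lambda>x. _ * x"] if_distrib[of "\<lambda>x. x * _"] mult_ac cong: if_cong)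
      also have "(\<Sum>i<d. \<Sum>k<d. A $$ (i, k) * (if i = j then t else 0) * (if k = j then t else 0)) = t\<^sup>2 * A $$ (j, j)"
      proof -
        have "(\<Sum>k<d. A $$ (i, k) * (if i = j then t else 0) * (if k = j then t else 0)) = (if i = j then t\<^sup>2 * A $$ (j, j) else 0)" for i
          using j by (simp add: if_distrib[of "\<lambda>x. _ * x"] power2_eq_square mult_ac cong: if_cong)
        then show ?thesis using j by simp
      qed
      finally show ?thesis by (simp add: Q_def)
    qed
    have Nw: "N (w t) = N u + 2 * t * u j + t\<^sup>2" for t
    proof -
      have "N (w t) = (\<Sum>i<d. (u i)\<^sup>2 + (if i = j then 2 * t * u i + t\<^sup>2 else 0))"
        unfolding N_def w_def by (intro sum.cong refl) (auto simp: power2_eq_square algebra_simps)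
      then show ?thesis using j by (simp add: sum.distrib N_def)
    qed
    have "2 * (c j - l * u j) = 0"
    proof (rule linear_term_zero)
      show "0 \<le> t * (2 * (c j - l * u j)) + t\<^sup>2 * (A $$ (j, j) - l)" for t
        using low[of "w t"] unfolding Qw Nw Nu by (simp add: l_def[symmetric] algebra_simps)
    qed
    then show ?thesis by simp
  qed
  have "eigenvector A (vec d u) l"
    unfolding eigenvector_def
  proof (intro conjI)
    show "vec d u \<in> carrier_vec (dim_row A)" using A by simp
    show "vec d u \<noteq> 0\<^sub>v (dim_row A)"
    proof
      assume "vec d u = 0\<^sub>v (dim_row A)"
      then have "u i = 0" if "i < d" for i using that A by (metis carrier_matD(1) index_vec index_zero_vec(1))
      then show False using Nu by (simp add: N_def)
    qed
    show "A *\<^sub>v vec d u = l \<cdot>\<^sub>v vec d u"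
      using A by (intro eq_vecI) (auto simp: scalar_prod_def atLeast0LessThan c_def[symmetric] eig)
  qed
  then show ?thesis using low unfolding eigenvalue_def Q_def N_def by blast
qed

lemma finite_eigenvalues:
  fixes A :: "real mat"
  assumes A: "A \<in> carrier_mat d d"
  shows "finite {l. eigenvalue A l}"
proof -
  have "char_poly A \<noteq> 0" using degree_monic_char_poly[OF A] by auto
  then show ?thesis unfolding eigenvalue_root_char_poly[OF A] by (rule poly_roots_finite)
qed

text \<open>The upper bound is the lower bound for \<open>- A\<close>.\<close>

lemma lambda_min_max_quadratic_form:
  fixes A :: "real mat"
  assumes A: "A \<in> carrier_mat d d" and d: "0 < d" and sym: "\<And>i j. i < d \<Longrightarrow> j < d \<Longrightarrow> A $$ (i, j) = A $$ (j, i)"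
  shows "lambda_min A * (\<Sum>i<d. (u i)\<^sup>2) \<le> (\<Sum>i<d. \<Sum>j<d. A $$ (i, j) * u i * u j)"
    "(\<Sum>i<d. \<Sum>j<d. A $$ (i, j) * u i * u j) \<le> lambda_max A * (\<Sum>i<d. (u i)\<^sup>2)"
    "eigenvalue A (lambda_min A)"
proof -
  note fin = finite_eigenvalues[OF A]
  have n0: "0 \<le> (\<Sum>i<d. (u i)\<^sup>2)" by (intro sum_nonneg) auto
  obtain l where l: "eigenvalue A l" "l * (\<Sum>i<d. (u i)\<^sup>2) \<le> (\<Sum>i<d. \<Sum>j<d. A $$ (i, j) * u i * u j)"
    using symmetric_mat_min_eigenvalue[OF A d sym] by blast
  show "eigenvalue A (lambda_min A)" unfolding lambda_min_def using Min_in[OF fin] l by auto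
  have "lambda_min A \<le> l" unfolding lambda_min_def using fin l by (intro Min_le) auto
  then show "lambda_min A * (\<Sum>i<d. (u i)\<^sup>2) \<le> (\<Sum>i<d. \<Sum>j<d. A $$ (i, j) * u i * u j)"
    by (intro order.trans[OF mult_right_mono[OF _ n0] l(2)])
  have A': "- A \<in> carrier_mat d d" using A by simp
  have entry: "(- A) $$ (i, j) = - (A $$ (i, j))" if "i < d" "j < d" for i j using A that by simp
  obtain m where m: "eigenvalue (- A) m" "m * (\<Sum>i<d. (u i)\<^sup>2) \<le> (\<Sum>i<d. \<Sum>j<d. (- A) $$ (i, j) * u i * u j)"
    using symmetric_mat_min_eigenvalue[OF A' d] sym entry by (metis (no_types, lifting))
  obtain v where v: "v \<in> carrier_vec d" "v \<noteq> 0\<^sub>v d" "(- A) *\<^sub>v v = m \<cdot>\<^sub>v v"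
    using m(1) A' A by (auto simp: eigenvalue_def eigenvector_def)
  have "A *\<^sub>v v = (- m) \<cdot>\<^sub>v v"
  proof (rule eq_vecI)
    fix i assume "i < dim_vec ((- m) \<cdot>\<^sub>v v)"
    then have i: "i < d" using v by simp
    have "((- A) *\<^sub>v v) $ i = - ((A *\<^sub>v v) $ i)"
      using A v(1) i by (simp add: scalar_prod_def sum_negf)
    then have "(A *\<^sub>v v) $ i = - ((m \<cdot>\<^sub>v v) $ i)" unfolding v(3) by simp
    then show "(A *\<^sub>v v) $ i = ((- m) \<cdot>\<^sub>v v) $ i" using v(1) i by simp
  qed (use A v in auto)
  then have "eigenvalue A (- m)" using v A by (auto simp: eigenvalue_def eigenvector_def)
  then have "- m \<le> lambda_max A" unfolding lambda_max_def using fin by (intro Max_ge) auto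
  moreover have "(\<Sum>i<d. \<Sum>j<d. (- A) $$ (i, j) * u i * u j) = - (\<Sum>i<d. \<Sum>j<d. A $$ (i, j) * u i * u j)"
    unfolding sum_negf[symmetric] by (intro sum.cong refl) (simp add: entry)
  ultimately show "(\<Sum>i<d. \<Sum>j<d. A $$ (i, j) * u i * u j) \<le> lambda_max A * (\<Sum>i<d. (u i)\<^sup>2)"
    using m(2) mult_right_mono[OF _ n0, of "- m" "lambda_max A"] by simp
qed

lemma gram_carrier:
  assumes x: "x \<in> carrier_mat n d" and e: "e \<subseteq> {..<n}"
  shows "gram x e \<in> carrier_mat d d"
  using restrict_rows_carrier[OF x e] by (simp add: gram_def)

lemma gram_index:
  assumes x: "x \<in> carrier_mat n d" and e: "e \<subseteq> {..<n}" and ij: "i < d" "j < d"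
  shows "gram x e $$ (i, j) = (\<Sum>t\<in>e. x $$ (t, i) * x $$ (t, j)) / real (card e)"
proof -
  have fin: "finite e" using e finite_subset by blast
  note R = restrict_rows_carrier[OF x e]
  have "gram x e $$ (i, j) = (1 / real (card e)) * (\<Sum>m<card e. restrict_rows x e $$ (m, i) * restrict_rows x e $$ (m, j))"
    using R ij by (simp add: gram_def times_mat_def scalar_prod_def atLeast0LessThan)
  also have "(\<Sum>m<card e. restrict_rows x e $$ (m, i) * restrict_rows x e $$ (m, j)) = (\<Sum>m<card e. x $$ (pick e m, i) * x $$ (pick e m, j))"
    using ij by (simp add: restrict_rows_index[OF x e])
  also have "\<dots> = (\<Sum>t\<in>e. x $$ (t, i) * x $$ (t, j))" by (rule sum_pick[OF fin])
  finally show ?thesis by simp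
qed

lemma gram_quadratic_form:
  assumes x: "x \<in> carrier_mat n d" and e: "e \<subseteq> {..<n}"
  shows "(\<Sum>i<d. \<Sum>j<d. gram x e $$ (i, j) * u i * u j) = (\<Sum>t\<in>e. (\<Sum>i<d. x $$ (t, i) * u i)\<^sup>2) / real (card e)"
proof -
  have "(\<Sum>t\<in>e. (\<Sum>i<d. x $$ (t, i) * u i)\<^sup>2) = (\<Sum>t\<in>e. \<Sum>i<d. \<Sum>j<d. x $$ (t, i) * x $$ (t, j) * u i * u j)"
    unfolding power2_eq_square sum_product by (intro sum.cong refl) (simp add: mult_ac)
  also have "\<dots> = (\<Sum>i<d. \<Sum>j<d. (\<Sum>t\<in>e. x $$ (t, i) * x $$ (t, j)) * u i * u j)"
  proof -
    have "(\<Sum>t\<in>e. \<Sum>i<d. \<Sum>j<d. x $$ (t, i) * x $$ (t, j) * u i * u j) = (\<Sum>i<d. \<Sum>t\<in>e. \<Sum>j<d. x $$ (t, i) * x $$ (t, j) * u i * u j)"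
      by (rule sum.swap)
    also have "\<dots> = (\<Sum>i<d. \<Sum>j<d. \<Sum>t\<in>e. x $$ (t, i) * x $$ (t, j) * u i * u j)"
      by (intro sum.cong refl sum.swap)
    finally show ?thesis by (simp add: sum_distrib_right)
  qed
  finally have eq: "(\<Sum>t\<in>e. (\<Sum>i<d. x $$ (t, i) * u i)\<^sup>2) = (\<Sum>i<d. \<Sum>j<d. (\<Sum>t\<in>e. x $$ (t, i) * x $$ (t, j)) * u i * u j)" .
  have "(\<Sum>i<d. \<Sum>j<d. gram x e $$ (i, j) * u i * u j) = (\<Sum>i<d. \<Sum>j<d. (\<Sum>t\<in>e. x $$ (t, i) * x $$ (t, j)) * u i * u j / real (card e))"
    by (intro sum.cong refl) (simp add: gram_index[OF x e])
  then show ?thesis unfolding eq by (simp only: sum_divide_distrib)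
qed

text \<open>
  The values of the quadratic form of a Gram matrix are mean squares; a unit vector gives the
  diagonal entries.
\<close>

lemma gram_eigenvalue_bounds:
  assumes x: "x \<in> carrier_mat n d" and e: "e \<subseteq> {..<n}" and d: "0 < d"
  shows "0 \<le> lambda_min (gram x e)"
    "lambda_min (gram x e) * (\<Sum>i<d. (u i)\<^sup>2) \<le> (\<Sum>t\<in>e. (\<Sum>i<d. x $$ (t, i) * u i)\<^sup>2) / real (card e)"
    "j < d \<Longrightarrow> (\<Sum>t\<in>e. (x $$ (t, j))\<^sup>2) / real (card e) \<le> lambda_max (gram x e)"
proof -
  let ?G = "gram x e"
  note G = gram_carrier[OF x e]
  have sym: "?G $$ (i, j) = ?G $$ (j, i)" if "i < d" "j < d" for i j
    using that by (simp add: gram_index[OF x e] mult.commute)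
  note L = lambda_min_max_quadratic_form[OF G d sym]
  show "lambda_min ?G * (\<Sum>i<d. (u i)\<^sup>2) \<le> (\<Sum>t\<in>e. (\<Sum>i<d. x $$ (t, i) * u i)\<^sup>2) / real (card e)"
    using L(1)[of u] by (simp add: gram_quadratic_form[OF x e])
  obtain v where v: "v \<in> carrier_vec d" "v \<noteq> 0\<^sub>v d" "?G *\<^sub>v v = lambda_min ?G \<cdot>\<^sub>v v"
    using L(3) G by (auto simp: eigenvalue_def eigenvector_def)
  have "(\<Sum>i<d. v $ i * (?G *\<^sub>v v) $ i) = (\<Sum>i<d. \<Sum>j<d. ?G $$ (i, j) * v $ i * v $ j)"
    using G v(1) by (intro sum.cong refl) (simp add: scalar_prod_def atLeast0LessThan sum_distrib_left mult_ac)
  also have "\<dots> = (\<Sum>t\<in>e. (\<Sum>i<d. x $$ (t, i) * v $ i)\<^sup>2) / real (card e)" by (rule gram_quadratic_form[OF x e])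
  also have "0 \<le> \<dots>" by (intro divide_nonneg_nonneg sum_nonneg) auto
  finally have "0 \<le> (\<Sum>i<d. v $ i * (?G *\<^sub>v v) $ i)" .
  also have "\<dots> = lambda_min ?G * (\<Sum>i<d. (v $ i)\<^sup>2)"
    using v by (simp add: sum_distrib_left power2_eq_square mult_ac)
  finally have 0: "0 \<le> lambda_min ?G * (\<Sum>i<d. (v $ i)\<^sup>2)" .
  have "0 < (\<Sum>i<d. (v $ i)\<^sup>2)"
  proof (rule ccontr)
    assume "\<not> 0 < (\<Sum>i<d. (v $ i)\<^sup>2)"
    then have "(\<Sum>i<d. (v $ i)\<^sup>2) = 0" by (meson antisym not_less sum_nonneg zero_le_power2)
    then have "v $ i = 0" if "i < d" for i using that by (subst (asm) sum_nonneg_eq_0_iff) auto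
    then show False using v by auto
  qed
  with 0 show "0 \<le> lambda_min ?G" by (simp add: zero_le_mult_iff)
  show "(\<Sum>t\<in>e. (x $$ (t, j))\<^sup>2) / real (card e) \<le> lambda_max ?G" if j: "j < d"
    using L(2)[of "\<lambda>i. if i = j then 1 else 0"] j
    by (simp add: gram_index[OF x e] power2_eq_square if_distrib[of "\<lambda>y. _ * y"] if_distrib[of "\<lambda>y. y * y"] cong: if_cong)
qed

section \<open>Statistics of noise and of data with changes\<close>

text \<open>
  A response that is fitted exactly on all rows is fitted exactly in each environment, by the same
  coefficients. So the residual, by whose norm the statistics are divided, does not vanish if
  estimated coefficients differ or an estimated variance is positive.
\<close>

lemma row_set_exact_fit:
  assumes n: "row_set x n s {..<n} c" and e: "row_set x n s e ce" and y: "y \<in> carrier_vec n"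
    and 0: "s2_hat x {..<n} y = 0"
  shows "gamma_hat x e y = gamma_hat x {..<n} y" "s2_hat x e y = 0"
proof -
  interpret n: row_set x n s "{..<n}" c by (rule n)
  interpret e: row_set x n s e ce by (rule e)
  define g where "g = gamma_hat x {..<n} y"
  note g = n.gamma_hat_normal_equations(1)[OF y, folded g_def]
  have "(\<Sum>t<n. (y $ t - row x t \<bullet> g)\<^sup>2) = 0"
    using 0 n.card_h unfolding n.s2_hat_eq[OF y] g_def by simp
  then have fit: "y $ t = row x t \<bullet> g" if "t < n" for t
    using that by (subst (asm) sum_nonneg_eq_0_iff) auto
  have eq: "y $ t = row x t \<bullet> g + 0 * y $ t" if "t \<in> e" for t using fit e.less_n[OF that] by simp
  have eqg: "gamma_hat x e y = g + 0 \<cdot>\<^sub>v gamma_hat x e y"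
    using eq by (rule e.gamma_hat_affine[OF y y g])
  moreover have "g + 0 \<cdot>\<^sub>v gamma_hat x e y = g"
    using g e.gamma_hat_normal_equations(1)[OF y] by (intro eq_vecI) auto
  ultimately show "gamma_hat x e y = gamma_hat x {..<n} y"
    unfolding g_def[symmetric] by (rule trans)
  show "s2_hat x e y = 0" using e.s2_hat_affine[OF y y g eq] by simp
qed

lemma l2norm_triangle:
  assumes u: "u \<in> carrier_vec s" and v: "v \<in> carrier_vec s"
  shows "l2norm (u + v) \<le> l2norm u + l2norm v" "l2norm (u - v) \<le> l2norm u + l2norm v"
proof -
  have L: "l2norm w = L2_set (($) w) {..<s}" if "w \<in> carrier_vec s" for w
    using that by (simp add: L2_set_def l2norm_def scalar_prod_sum power2_eq_square)
  have "l2norm (u + v) = L2_set (\<lambda>i. u $ i + v $ i) {..<s}"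
    using u v by (subst L) (auto intro!: L2_set_cong)
  also have "\<dots> \<le> l2norm u + l2norm v" unfolding L[OF u] L[OF v] by (rule L2_set_triangle_ineq)
  finally show "l2norm (u + v) \<le> l2norm u + l2norm v" .
  have "l2norm (u - v) = L2_set (\<lambda>i. u $ i + - v $ i) {..<s}"
    using u v by (subst L) (auto intro!: L2_set_cong)
  also have "\<dots> \<le> L2_set (($) u) {..<s} + L2_set (\<lambda>i. - v $ i) {..<s}" by (rule L2_set_triangle_ineq)
  also have "L2_set (\<lambda>i. - v $ i) {..<s} = l2norm v" unfolding L[OF v] by (simp add: L2_set_def)
  finally show "l2norm (u - v) \<le> l2norm u + l2norm v" unfolding L[OF u] .
qed

text \<open>
  Up to the precision \<open>\<eta>\<close>, the vector \<open>e\<close> looks on the rows in \<open>h\<close> like noise of variance \<open>v\<close> that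
  is uncorrelated with the covariates. The inequalities are strict because they are the negations
  of the events in the tail bounds.
\<close>

definition noise_like :: "real mat \<Rightarrow> nat set \<Rightarrow> real \<Rightarrow> real \<Rightarrow> (nat \<Rightarrow> real) \<Rightarrow> bool" where
  "noise_like x h \<eta> v e \<longleftrightarrow> (\<forall>i<dim_col x. \<bar>\<Sum>t\<in>h. x $$ (t, i) * e t\<bar> < real (card h) * \<eta>) \<and>
     \<bar>(\<Sum>t\<in>h. (e t)\<^sup>2) - real (card h) * v\<bar> < real (card h) * \<eta>"

lemma noise_like_estimates:
  assumes h: "row_set x n s h c" and e: "noise_like x h \<eta> v e" and \<eta>: "0 < \<eta>" and ec: "\<And>t. t \<in> h \<Longrightarrow> w $ t = e t" "w \<in> carrier_vec n"
  shows "l2norm (gamma_hat x h w) \<le> sqrt s * \<eta> / c"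
    "\<bar>s2_hat x h w - v\<bar> \<le> \<eta> + s * \<eta>\<^sup>2 / c"
proof -
  interpret row_set x n s h c by (rule h)
  have sc: "\<bar>\<Sum>t\<in>h. x $$ (t, i) * w $ t\<bar> \<le> real (card h) * \<eta>" if "i < s" for i
    using e x that ec by (auto simp: noise_like_def intro: less_imp_le)
  note B = small_scores[OF ec(2) less_imp_le[OF \<eta>] sc]
  show "l2norm (gamma_hat x h w) \<le> sqrt s * \<eta> / c" by (rule B(1))
  have "\<bar>(\<Sum>t\<in>h. (w $ t)\<^sup>2) - real (card h) * v\<bar> < real (card h) * \<eta>"
    using e ec by (simp add: noise_like_def)
  then have "\<bar>((\<Sum>t\<in>h. (w $ t)\<^sup>2) - real (card h) * v) / card h\<bar> < \<eta>"
    using card_h by (simp add: abs_divide pos_divide_less_eq mult.commute)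
  then have "\<bar>(\<Sum>t\<in>h. (w $ t)\<^sup>2) / card h - v\<bar> < \<eta>" using card_h by (simp add: diff_divide_distrib)
  moreover have "0 \<le> s * \<eta>\<^sup>2 / c" using c by simp
  ultimately show "\<bar>s2_hat x h w - v\<bar> \<le> \<eta> + s * \<eta>\<^sup>2 / c"
    using B(2) s2_hat_le(1)[OF ec(2)] by linarith
qed

text \<open>
  The estimated variances are within \<open>1 / 2\<close> of 1, so the denominators in the second statistic are
  at least \<open>1 / 2\<close>, and the norm of the residual, by which the first one is divided, is at least
  \<open>sqrt (n / 2)\<close>.
\<close>

lemma resampled_statistics_small:
  assumes E: "E \<subseteq> Pow {..<n}" "F1 E \<noteq> {}"
    and rs: "\<And>h. h \<in> insert {..<n} E \<Longrightarrow> row_set x n s h c"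
    and e: "\<And>h. h \<in> insert {..<n} E \<Longrightarrow> noise_like x h \<eta> 1 e" and \<eta>: "0 < \<eta>"
    and small: "\<eta> + s * \<eta>\<^sup>2 / c \<le> 1 / 2"
  shows "\<bar>T1_max E x (scaled_residual x (vec n e))\<bar> \<le> 2 * sqrt 2 * sqrt s * \<eta> / (c * sqrt n)"
    "\<bar>T2_max E x (scaled_residual x (vec n e))\<bar> \<le> 4 * (\<eta> + s * \<eta>\<^sup>2 / c)"
proof -
  define \<rho> where "\<rho> = \<eta> + s * \<eta>\<^sup>2 / c"
  define w where "w = vec n e"
  have w: "w \<in> carrier_vec n" by (simp add: w_def)
  have wt: "w $ t = e t" if "t \<in> h" "h \<in> insert {..<n} E" for t h
  proof -
    have "h \<subseteq> {..<n}" using that E(1) by auto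
    then show ?thesis using that by (auto simp: w_def)
  qed
  note N = rs[of "{..<n}", simplified]
  interpret n: row_set x n s "{..<n}" c by (rule N)
  have n0: "0 < n" using n.card_h by simp
  have c: "0 < c" by (rule n.c)
  have est: "l2norm (gamma_hat x h w) \<le> sqrt s * \<eta> / c" "\<bar>s2_hat x h w - 1\<bar> \<le> \<rho>" if "h \<in> insert {..<n} E" for h
    using noise_like_estimates[OF rs[OF that] e[OF that] \<eta> wt[OF _ that] w] by (auto simp: \<rho>_def)
  have half: "1 / 2 \<le> s2_hat x h w" if "h \<in> insert {..<n} E" for h using est(2)[OF that] small[folded \<rho>_def] by linarith
  define a where "a = 1 / sqrt (n * s2_hat x {..<n} w)"
  have a: "0 \<le> a" "a \<le> sqrt 2 / sqrt n"
  proof -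
    have "sqrt n / sqrt 2 = sqrt (n * (1 / 2))" by (simp add: real_sqrt_divide[symmetric])
    also have "\<dots> \<le> sqrt (n * s2_hat x {..<n} w)" using half[of "{..<n}"] by (intro real_sqrt_le_mono mult_left_mono) auto
    finally have le: "sqrt n / sqrt 2 \<le> sqrt (n * s2_hat x {..<n} w)" .
    have "0 < sqrt n / sqrt 2" using n0 by simp
    then have "a \<le> 1 / (sqrt n / sqrt 2)" unfolding a_def
      using le by (intro divide_left_mono mult_pos_pos) linarith+
    then show "a \<le> sqrt 2 / sqrt n" by simp
    show "0 \<le> a" unfolding a_def using half[of "{..<n}"] by simp
  qed
  have T: "\<bar>T1 x h1 h2 (scaled_residual x w)\<bar> \<le> 2 * sqrt 2 * sqrt s * \<eta> / (c * sqrt n)"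
    "\<bar>T2 x h1 h2 (scaled_residual x w)\<bar> \<le> 4 * \<rho>" if "(h1, h2) \<in> F1 E" for h1 h2
  proof -
    have h: "h1 \<in> insert {..<n} E" "h2 \<in> insert {..<n} E" using that by (auto simp: F1_def)
    interpret h1: row_set x n s h1 c by (rule rs[OF h(1)])
    interpret h2: row_set x n s h2 c by (rule rs[OF h(2)])
    note TS = T_scaled_residual[OF N rs[OF h(1)] rs[OF h(2)] w, folded a_def]
    have "l2norm (gamma_hat x h1 w - gamma_hat x h2 w) \<le> sqrt s * \<eta> / c + sqrt s * \<eta> / c"
      using l2norm_triangle(2)[OF h1.gamma_hat_normal_equations(1)[OF w] h2.gamma_hat_normal_equations(1)[OF w]] est(1)[OF h(1)] est(1)[OF h(2)] by linarith
    then have "a * l2norm (gamma_hat x h1 w - gamma_hat x h2 w) \<le> sqrt 2 / sqrt n * (sqrt s * \<eta> / c + sqrt s * \<eta> / c)"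
      using a by (intro mult_mono) auto
    also have "\<dots> = 2 * sqrt 2 * sqrt s * \<eta> / (c * sqrt n)" by (simp add: field_simps)
    finally show "\<bar>T1 x h1 h2 (scaled_residual x w)\<bar> \<le> 2 * sqrt 2 * sqrt s * \<eta> / (c * sqrt n)"
      using a TS(1) by simp
    have pos: "0 < s2_hat x {..<n} w" using half[of "{..<n}"] by simp
    have "\<bar>s2_hat x h1 w / s2_hat x h2 w - 1\<bar> = \<bar>s2_hat x h1 w - s2_hat x h2 w\<bar> / s2_hat x h2 w"
    proof -
      have "0 < s2_hat x h2 w" using half[OF h(2)] by linarith
      then have "s2_hat x h1 w / s2_hat x h2 w - 1 = (s2_hat x h1 w - s2_hat x h2 w) / s2_hat x h2 w" "\<bar>s2_hat x h2 w\<bar> = s2_hat x h2 w"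
        by (simp_all add: diff_divide_distrib)
      then show ?thesis by (simp only: abs_divide)
    qed
    also have "\<dots> \<le> (2 * \<rho>) / (1 / 2)"
      using est(2)[OF h(1)] est(2)[OF h(2)] half[OF h(2)] by (intro frac_le) auto
    finally show "\<bar>T2 x h1 h2 (scaled_residual x w)\<bar> \<le> 4 * \<rho>" using TS(2)[OF pos] by simp
  qed
  have fin: "finite (F1 E)" by (rule finite_F1[OF E(1)])
  have mx: "\<bar>Max ((\<lambda>(e, f). \<bar>F e f\<bar>) ` F1 E)\<bar> \<le> b" if "\<And>h1 h2. (h1, h2) \<in> F1 E \<Longrightarrow> \<bar>F h1 h2\<bar> \<le> b" for F :: "nat set \<Rightarrow> nat set \<Rightarrow> real" and b
  proof -
    have "Max ((\<lambda>(e, f). \<bar>F e f\<bar>) ` F1 E) \<in> (\<lambda>(e, f). \<bar>F e f\<bar>) ` F1 E" using fin E(2) by (intro Max_in) auto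
    then show ?thesis using that by auto
  qed
  show "\<bar>T1_max E x (scaled_residual x (vec n e))\<bar> \<le> 2 * sqrt 2 * sqrt s * \<eta> / (c * sqrt n)"
    unfolding T1_max_def w_def[symmetric] by (rule mx[OF T(1)])
  show "\<bar>T2_max E x (scaled_residual x (vec n e))\<bar> \<le> 4 * (\<eta> + s * \<eta>\<^sup>2 / c)"
    unfolding T2_max_def w_def[symmetric] \<rho>_def[symmetric] by (rule mx[OF T(2)])
qed

text \<open>
  By \<open>gamma_hat_affine\<close>, the response on \<open>h1\<close> and \<open>h2\<close> has the estimated coefficients \<open>b1\<close> and
  \<open>b2\<close>, up to those of the noise, and the estimated variances of the noise. The norm of the
  residual is at most that of the response, hence at most \<open>sqrt (n K)\<close>.
\<close>

lemma data_statistics_large: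
  assumes E: "E \<subseteq> Pow {..<n}" and ef: "(h1, h2) \<in> F1 E"
    and rs: "row_set x n s {..<n} c" "row_set x n s h1 c" "row_set x n s h2 c"
    and y: "y \<in> carrier_vec n" and K: "0 < K" "(\<Sum>t<n. (y $ t)\<^sup>2) \<le> n * K"
    and b: "b1 \<in> carrier_vec s" "b2 \<in> carrier_vec s"
    and n1: "noise_like x h1 \<eta> v1 (\<lambda>t. y $ t - row x t \<bullet> b1)"
    and n2: "noise_like x h2 \<eta> v2 (\<lambda>t. y $ t - row x t \<bullet> b2)" and \<eta>: "0 < \<eta>"
  shows "0 < l2norm (b1 - b2) - 2 * sqrt s * \<eta> / c \<Longrightarrow>
      (l2norm (b1 - b2) - 2 * sqrt s * \<eta> / c) / sqrt (n * K) \<le> \<bar>T1_max E x (scaled_residual x y)\<bar>"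
    "\<eta> + s * \<eta>\<^sup>2 / c < v2 \<Longrightarrow> \<eta> + s * \<eta>\<^sup>2 / c < v1 \<Longrightarrow>
      (v1 - v2 - 2 * (\<eta> + s * \<eta>\<^sup>2 / c)) / (v2 + (\<eta> + s * \<eta>\<^sup>2 / c)) \<le> \<bar>T2_max E x (scaled_residual x y)\<bar>"
proof -
  define \<rho> where "\<rho> = \<eta> + s * \<eta>\<^sup>2 / c"
  interpret n: row_set x n s "{..<n}" c by (rule rs)
  interpret h1: row_set x n s h1 c by (rule rs)
  interpret h2: row_set x n s h2 c by (rule rs)
  have n0: "0 < n" using n.card_h by simp
  define e1 where "e1 = vec n (\<lambda>t. y $ t - row x t \<bullet> b1)"
  define e2 where "e2 = vec n (\<lambda>t. y $ t - row x t \<bullet> b2)"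
  have ec: "e1 \<in> carrier_vec n" "e2 \<in> carrier_vec n" by (auto simp: e1_def e2_def)
  have e1t: "e1 $ t = y $ t - row x t \<bullet> b1" if "t \<in> h1" for t using h1.less_n[OF that] by (simp add: e1_def)
  have e2t: "e2 $ t = y $ t - row x t \<bullet> b2" if "t \<in> h2" for t using h2.less_n[OF that] by (simp add: e2_def)
  have est1: "l2norm (gamma_hat x h1 e1) \<le> sqrt s * \<eta> / c" "\<bar>s2_hat x h1 e1 - v1\<bar> \<le> \<eta> + s * \<eta>\<^sup>2 / c"
    using noise_like_estimates[OF rs(2) n1 \<eta> _ ec(1)] e1t by auto
  have est2: "l2norm (gamma_hat x h2 e2) \<le> sqrt s * \<eta> / c" "\<bar>s2_hat x h2 e2 - v2\<bar> \<le> \<eta> + s * \<eta>\<^sup>2 / c"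
    using noise_like_estimates[OF rs(3) n2 \<eta> _ ec(2)] e2t by auto
  have y1: "y $ t = row x t \<bullet> b1 + 1 * e1 $ t" if "t \<in> h1" for t using e1t[OF that] by simp
  have y2: "y $ t = row x t \<bullet> b2 + 1 * e2 $ t" if "t \<in> h2" for t using e2t[OF that] by simp
  have g1: "gamma_hat x h1 y = b1 + 1 \<cdot>\<^sub>v gamma_hat x h1 e1" using y1 by (rule h1.gamma_hat_affine[OF y ec(1) b(1)])
  have g2: "gamma_hat x h2 y = b2 + 1 \<cdot>\<^sub>v gamma_hat x h2 e2" using y2 by (rule h2.gamma_hat_affine[OF y ec(2) b(2)])
  have s1: "s2_hat x h1 y = 1\<^sup>2 * s2_hat x h1 e1" using y1 by (rule h1.s2_hat_affine[OF y ec(1) b(1)])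
  have s2: "s2_hat x h2 y = 1\<^sup>2 * s2_hat x h2 e2" using y2 by (rule h2.s2_hat_affine[OF y ec(2) b(2)])
  note gc = h1.gamma_hat_normal_equations(1)[OF ec(1)] h2.gamma_hat_normal_equations(1)[OF ec(2)]
  have fin: "finite (F1 E)" by (rule finite_F1[OF E])
  have mx: "\<bar>F h1 h2\<bar> \<le> \<bar>Max ((\<lambda>(e, f). \<bar>F e f\<bar>) ` F1 E)\<bar>" for F :: "nat set \<Rightarrow> nat set \<Rightarrow> real"
  proof -
    have "\<bar>F h1 h2\<bar> \<le> Max ((\<lambda>(e, f). \<bar>F e f\<bar>) ` F1 E)"
      using fin ef by (intro Max_ge finite_imageI) (auto intro!: image_eqI[of _ _ "(h1, h2)"])
    then show ?thesis by linarith
  qed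
  note TS = T_scaled_residual[OF rs y]
  have s2n: "0 \<le> s2_hat x {..<n} y" "s2_hat x {..<n} y \<le> K"
    using n.s2_hat_le[OF y] K n0 by (auto intro: order.trans simp: divide_le_eq mult.commute)
  show "(l2norm (b1 - b2) - 2 * sqrt s * \<eta> / c) / sqrt (n * K) \<le> \<bar>T1_max E x (scaled_residual x y)\<bar>"
    if pos: "0 < l2norm (b1 - b2) - 2 * sqrt s * \<eta> / c"
  proof -
    have "b1 - b2 = (gamma_hat x h1 y - gamma_hat x h2 y) + (gamma_hat x h2 e2 - gamma_hat x h1 e1)"
      unfolding g1 g2 using b gc by (intro eq_vecI) auto
    then have "l2norm (b1 - b2) \<le> l2norm (gamma_hat x h1 y - gamma_hat x h2 y) + l2norm (gamma_hat x h2 e2 - gamma_hat x h1 e1)"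
      using l2norm_triangle(1)[of "gamma_hat x h1 y - gamma_hat x h2 y" s "gamma_hat x h2 e2 - gamma_hat x h1 e1"] gc
        h1.gamma_hat_normal_equations(1)[OF y] h2.gamma_hat_normal_equations(1)[OF y] by simp
    also have "l2norm (gamma_hat x h2 e2 - gamma_hat x h1 e1) \<le> 2 * sqrt s * \<eta> / c"
    proof -
      have "2 * sqrt s * \<eta> / c = sqrt s * \<eta> / c + sqrt s * \<eta> / c" by simp
      then show ?thesis using order.trans[OF l2norm_triangle(2)[OF gc(2) gc(1)] add_mono[OF est2(1) est1(1)]] by (simp only:)
    qed
    finally have D: "l2norm (b1 - b2) - 2 * sqrt s * \<eta> / c \<le> l2norm (gamma_hat x h1 y - gamma_hat x h2 y)" by simp
    have "s2_hat x {..<n} y \<noteq> 0"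
    proof
      assume 0: "s2_hat x {..<n} y = 0"
      have "gamma_hat x h1 y - gamma_hat x h2 y = 0\<^sub>v s"
        unfolding row_set_exact_fit[OF rs(1,2) y 0] row_set_exact_fit[OF rs(1,3) y 0] using n.gamma_hat_normal_equations(1)[OF y] by simp
      then have "l2norm (gamma_hat x h1 y - gamma_hat x h2 y) = 0" by (simp add: l2norm_def)
      with D pos show False by simp
    qed
    with s2n have s2p: "0 < s2_hat x {..<n} y" by simp
    have "(l2norm (b1 - b2) - 2 * sqrt s * \<eta> / c) / sqrt (n * K) \<le> l2norm (gamma_hat x h1 y - gamma_hat x h2 y) / sqrt (n * s2_hat x {..<n} y)"
      using D pos s2p s2n n0 by (intro frac_le) (auto intro!: mult_left_mono)
    also have "\<dots> = T1 x h1 h2 (scaled_residual x y)" using TS(1) by simp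
    also have "\<dots> \<le> \<bar>T1_max E x (scaled_residual x y)\<bar>"
      unfolding T1_max_def by (rule order.trans[OF abs_ge_self mx])
    finally show ?thesis .
  qed
  show "(v1 - v2 - 2 * (\<eta> + s * \<eta>\<^sup>2 / c)) / (v2 + (\<eta> + s * \<eta>\<^sup>2 / c)) \<le> \<bar>T2_max E x (scaled_residual x y)\<bar>"
    if v: "\<eta> + s * \<eta>\<^sup>2 / c < v2" "\<eta> + s * \<eta>\<^sup>2 / c < v1"
  proof -
    have A: "v1 - \<rho> \<le> s2_hat x h1 y" and B: "s2_hat x h2 y \<le> v2 + \<rho>" "0 < s2_hat x h2 y"
      using est1(2) est2(2) v unfolding s1 s2 \<rho>_def[symmetric] by auto
    have "s2_hat x {..<n} y \<noteq> 0" using row_set_exact_fit(2)[OF rs(1,3) y] B by auto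
    with s2n have s2p: "0 < s2_hat x {..<n} y" by simp
    have v\<rho>: "0 < v2 + \<rho>" using B by linarith
    have "(v1 - v2 - 2 * \<rho>) / (v2 + \<rho>) = (v1 - \<rho>) / (v2 + \<rho>) - 1" using v\<rho> by (simp add: field_simps)
    also have "\<dots> \<le> s2_hat x h1 y / s2_hat x h2 y - 1"
      using A B v unfolding \<rho>_def[symmetric] by (intro diff_right_mono frac_le) auto
    also have "\<dots> = T2 x h1 h2 (scaled_residual x y)" using TS(2)[OF s2p] by simp
    also have "\<dots> \<le> \<bar>T2_max E x (scaled_residual x y)\<bar>"
      unfolding T2_max_def by (rule order.trans[OF abs_ge_self mx])
    finally show ?thesis by (simp add: \<rho>_def)
  qed
qed

section \<open>Resampled noise\<close>

context prob_space
begin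

lemma union_bound:
  assumes I: "finite I" and meas: "\<And>i. i \<in> I \<Longrightarrow> {\<omega>\<in>space M. P i \<omega>} \<in> events"
    and bound: "\<And>i. i \<in> I \<Longrightarrow> prob {\<omega>\<in>space M. P i \<omega>} \<le> b"
  shows "{\<omega>\<in>space M. \<forall>i\<in>I. \<not> P i \<omega>} \<in> events \<and>
    1 - real (card I) * b \<le> prob {\<omega>\<in>space M. \<forall>i\<in>I. \<not> P i \<omega>}"
proof (rule conjI)
  have U: "(\<Union>i\<in>I. {\<omega>\<in>space M. P i \<omega>}) \<in> events" using I meas by (intro sets.finite_UN) auto
  have eq: "{\<omega>\<in>space M. \<forall>i\<in>I. \<not> P i \<omega>} = space M - (\<Union>i\<in>I. {\<omega>\<in>space M. P i \<omega>})" by auto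
  show "{\<omega>\<in>space M. \<forall>i\<in>I. \<not> P i \<omega>} \<in> events" unfolding eq using U by auto
  have "prob (\<Union>i\<in>I. {\<omega>\<in>space M. P i \<omega>}) \<le> (\<Sum>i\<in>I. prob {\<omega>\<in>space M. P i \<omega>})"
    using I meas by (intro finite_measure_subadditive_finite) auto
  also have "\<dots> \<le> real (card I) * b" using sum_bounded_above[of I, OF bound] by simp
  finally show "1 - real (card I) * b \<le> prob {\<omega>\<in>space M. \<forall>i\<in>I. \<not> P i \<omega>}"
    unfolding eq prob_compl[OF U] by simp
qed

lemma prob_Int_ge:
  assumes "A \<in> events" "B \<in> events" "1 - a \<le> prob A" "1 - b \<le> prob B"
  shows "A \<inter> B \<in> events" "1 - (a + b) \<le> prob (A \<inter> B)"
proof -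
  show "A \<inter> B \<in> events" using assms by auto
  have "prob A + prob B = prob (A \<union> B) + prob (A \<inter> B)" using assms measure_Un3[of A M B] by (simp add: fmeasurable_eq_sets)
  then show "1 - (a + b) \<le> prob (A \<inter> B)" using assms prob_le_1[of "A \<union> B"] by linarith
qed

end

lemma std_normal_vec_coordinates:
  shows "prob_space.indep_vars (std_normal_vec n) (\<lambda>_. borel) (\<lambda>t e. e t) {..<n}"
    "t < n \<Longrightarrow> (\<lambda>e. e t) \<in> borel_measurable (std_normal_vec n)"
    "t < n \<Longrightarrow> distr (std_normal_vec n) borel (\<lambda>e. e t) = normal_law 0 1"
proof -
  interpret EN: prob_space "std_normal_vec n" by (rule prob_space_std_normal_vec)
  have meas: "(\<lambda>e. e t) \<in> borel_measurable (std_normal_vec n)" if "t < n" for t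
    using that measurable_component_singleton[of t "{..<n}" "\<lambda>_. borel :: real measure"] 
    by (simp cong: measurable_cong_sets add: sets_std_normal_vec)
  then show "t < n \<Longrightarrow> (\<lambda>e. e t) \<in> borel_measurable (std_normal_vec n)" .
  show "EN.indep_vars (\<lambda>_. borel) (\<lambda>t e. e t) {..<n}"
  proof (cases "n = 0")
    case True
    show ?thesis unfolding EN.indep_vars_def EN.indep_sets_def by (simp add: True)
  next
    case False
    then have "EN.indep_vars (\<lambda>_. normal_law 0 1) (\<lambda>t e. e t) {..<n}"
      unfolding std_normal_vec_def by (intro PiM_coordinates(1) prob_space_normal_law) auto
    then show ?thesis
      using EN.indep_vars_compose2[of "\<lambda>_. normal_law 0 1" "\<lambda>t e. e t" "{..<n}" "\<lambda>_ x. x" "\<lambda>_. borel"]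
      by (simp add: measurable_ident_sets)
  qed
  show "distr (std_normal_vec n) borel (\<lambda>e. e t) = normal_law 0 1" if "t < n"
  proof -
    have "distr (std_normal_vec n) borel (\<lambda>e. e t) = distr (std_normal_vec n) (normal_law 0 1) (\<lambda>e. e t)"
      by (rule distr_cong) simp_all
    also have "\<dots> = normal_law 0 1" unfolding std_normal_vec_def
      using that by (intro PiM_coordinates(2)[of "\<lambda>_. normal_law 0 1"] prob_space_normal_law) auto
    finally show ?thesis .
  qed
qed

text \<open>
  For each row set there are \<open>s\<close> scores, which are Gaussian linear forms, and one mean square,
  which is a sum of products of normal variables.
\<close>

lemma resampled_noise_like:
  fixes r V :: real
  assumes x: "x \<in> carrier_mat n s" and H: "finite H" and h: "\<And>h. h \<in> H \<Longrightarrow> h \<subseteq> {..<n} \<and> h \<noteq> {} \<and> r \<le> card h"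
    and V: "0 < V" "\<And>h i. h \<in> H \<Longrightarrow> i < s \<Longrightarrow> (\<Sum>t\<in>h. (x $$ (t, i))\<^sup>2) \<le> card h * V"
    and \<eta>: "0 < \<eta>" "\<eta> \<le> 1" and \<kappa>: "\<kappa> \<le> 1 / (2 * V)" "\<kappa> \<le> 1 / 3072" "0 \<le> \<kappa>"
  shows "1 - real (card H * Suc s) * (2 * exp (- (\<kappa> * r * \<eta>\<^sup>2)))
    \<le> measure (std_normal_vec n) {e\<in>space (std_normal_vec n). \<forall>h\<in>H. noise_like x h \<eta> 1 e}"
    "{e\<in>space (std_normal_vec n). \<forall>h\<in>H. noise_like x h \<eta> 1 e} \<in> sets (std_normal_vec n)"
proof -
  let ?N = "std_normal_vec n"
  interpret EN: prob_space ?N by (rule prob_space_std_normal_vec)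
  note C = std_normal_vec_coordinates
  \<comment> \<open>the bad events, numbered by \<open>i < s\<close> for the scores and by \<open>i = s\<close> for the mean square\<close>
  define P where "P = (\<lambda>(h, i) e. if i < s then real (card h) * \<eta> \<le> \<bar>\<Sum>t\<in>h. x $$ (t, i) * e t\<bar>
    else real (card h) * \<eta> \<le> \<bar>(\<Sum>t\<in>h. (e t)\<^sup>2) - real (card h)\<bar>)"
  have iff: "(\<forall>h\<in>H. noise_like x h \<eta> 1 e) \<longleftrightarrow> (\<forall>p\<in>H \<times> {..s}. \<not> P p e)" for e
  proof
    assume a: "\<forall>h\<in>H. noise_like x h \<eta> 1 e"
    show "\<forall>p\<in>H \<times> {..s}. \<not> P p e"
    proof
      fix p assume "p \<in> H \<times> {..s}"
      then obtain h i where p: "p = (h, i)" "h \<in> H" by auto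
      have "noise_like x h \<eta> 1 e" using a p(2) by blast
      then show "\<not> P p e" using x by (cases "i < s") (simp_all add: p(1) P_def noise_like_def not_le)
    qed
  next
    assume a: "\<forall>p\<in>H \<times> {..s}. \<not> P p e"
    show "\<forall>h\<in>H. noise_like x h \<eta> 1 e"
    proof
      fix h assume h: "h \<in> H"
      have nP: "\<not> P (h, i) e" if "i \<le> s" for i using a h that by auto
      have "\<bar>\<Sum>t\<in>h. x $$ (t, i) * e t\<bar> < real (card h) * \<eta>" if "i < s" for i
        using nP[of i] that by (simp add: P_def not_le)
      moreover have "\<bar>(\<Sum>t\<in>h. (e t)\<^sup>2) - real (card h)\<bar> < real (card h) * \<eta>"
        using nP[of s] by (simp add: P_def not_le)
      ultimately show "noise_like x h \<eta> 1 e" using x by (simp add: noise_like_def)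
    qed
  qed
  have meas: "(\<lambda>e. e t) \<in> borel_measurable ?N" if "t \<in> h" "h \<in> H" for t h
    using C(2)[of t n] h[OF that(2)] that by auto
  have m1: "(\<lambda>e. \<bar>\<Sum>t\<in>h. x $$ (t, i) * e t\<bar>) \<in> borel_measurable ?N"
    "(\<lambda>e. \<bar>(\<Sum>t\<in>h. (e t)\<^sup>2) - real (card h)\<bar>) \<in> borel_measurable ?N" if "h \<in> H" for h i
    using meas[OF _ that] by (auto intro!: borel_measurable_sum)
  have ev: "{e\<in>space ?N. P p e} \<in> EN.events" if "p \<in> H \<times> {..s}" for p
    using m1 that by (cases p) (auto simp: P_def)
  have bound: "EN.prob {e\<in>space ?N. P p e} \<le> 2 * exp (- (\<kappa> * r * \<eta>\<^sup>2))" if p: "p \<in> H \<times> {..s}" for p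
  proof -
    obtain h' i where pi: "p = (h', i)" "h' \<in> H" "i \<le> s" using p by auto
    have h': "h' \<subseteq> {..<n}" "h' \<noteq> {}" "r \<le> card h'" using h[OF pi(2)] by auto
    have fin: "finite h'" using h' finite_subset by blast
    have ch: "0 < card h'" using fin h' by (simp add: card_gt_0_iff)
    have ind: "EN.indep_vars (\<lambda>_. borel) (\<lambda>t e. e t) h'" by (rule EN.indep_vars_subset[OF C(1) h'(1)])
    have law: "distr ?N borel (\<lambda>e. e t) = normal_law 0 1" if "t \<in> h'" for t using C(3)[of t n] that h' by auto
    have expo: "2 * exp (- (real (card h') * \<eta>\<^sup>2 * k)) \<le> 2 * exp (- (\<kappa> * r * \<eta>\<^sup>2))" if "\<kappa> \<le> k" for k
    proof -
      have "\<kappa> * (r * \<eta>\<^sup>2) \<le> \<kappa> * (card h' * \<eta>\<^sup>2)" using h' \<kappa> by (intro mult_left_mono mult_right_mono) auto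
      also have "\<dots> \<le> k * (card h' * \<eta>\<^sup>2)" using that by (intro mult_right_mono) auto
      finally show ?thesis by (simp add: mult_ac)
    qed
    show ?thesis
    proof (cases "i < s")
      case True
      have "EN.prob {e\<in>space ?N. real (card h') * \<eta> \<le> \<bar>\<Sum>t\<in>h'. x $$ (t, i) * e t\<bar>}
         \<le> 2 * exp (- ((real (card h') * \<eta>)\<^sup>2 / (2 * (card h' * V))))"
        using V ch True pi(2) \<eta> by (intro EN.std_normal_linear_tail[OF ind fin law]) auto
      also have "(real (card h') * \<eta>)\<^sup>2 / (2 * (card h' * V)) = real (card h') * \<eta>\<^sup>2 * (1 / (2 * V))"
        using ch V by (simp add: power2_eq_square)
      also have "2 * exp (- (real (card h') * \<eta>\<^sup>2 * (1 / (2 * V)))) \<le> 2 * exp (- (\<kappa> * r * \<eta>\<^sup>2))"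
        by (rule expo[OF \<kappa>(1)])
      finally show ?thesis using True by (simp add: pi P_def)
    next
      case False
      have g: "EN.gaussian (\<lambda>e. e t)" if "t \<in> h'" for t
        unfolding EN.gaussian_def law[OF that]
        by (intro conjI meas[OF that pi(2)] exI[of _ 0] exI[of _ 1]) simp_all
      have E2: "EN.expectation (\<lambda>e. (e t)\<^sup>2) = 1" if "t \<in> h'" for t
      proof -
        have "EN.expectation (\<lambda>e. (e t)\<^sup>2) = (\<integral>y. y\<^sup>2 \<partial>distr ?N borel (\<lambda>e. e t))"
          using meas[OF that pi(2)] by (subst integral_distr) auto
        also have "\<dots> = 1" unfolding law[OF that] by (subst normal_law_square) auto
        finally show ?thesis .
      qed
      have ind': "EN.indep_vars (\<lambda>_. borel) (\<lambda>t e. e t * e t) h'"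
        by (rule EN.indep_vars_compose2[OF ind, where Y = "\<lambda>_ y. y * y"]) auto
      have "EN.prob {e\<in>space ?N. real (card h') * \<eta> \<le> \<bar>(\<Sum>t\<in>h'. e t * e t) - real (card h') * 1\<bar>}
        \<le> 2 * exp (- (real (card h') * \<eta>\<^sup>2 / (3072 * 1\<^sup>2)))"
        by (rule EN.gaussian_product_concentration[OF ind' fin g _ g])
          (use E2 \<eta> in \<open>auto simp: power2_eq_square\<close>)
      also have "\<dots> \<le> 2 * exp (- (\<kappa> * r * \<eta>\<^sup>2))" using expo[OF \<kappa>(2)] by simp
      finally show ?thesis using False by (simp add: pi P_def power2_eq_square)
    qed
  qed
  note U = EN.union_bound[OF finite_cartesian_product[OF H finite_atMost[of s]] ev bound]
  show "1 - real (card H * Suc s) * (2 * exp (- (\<kappa> * r * \<eta>\<^sup>2))) \<le> EN.prob {e\<in>space ?N. \<forall>h\<in>H. noise_like x h \<eta> 1 e}"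
    using U[THEN conjunct2] unfolding iff by (simp add: card_cartesian_product)
  show "{e\<in>space ?N. \<forall>h\<in>H. noise_like x h \<eta> 1 e} \<in> EN.events" using U[THEN conjunct1] unfolding iff .
qed

section \<open>A segmented normal sample\<close>

definition lin_form :: "nat \<Rightarrow> real \<Rightarrow> (nat \<Rightarrow> real) \<Rightarrow> real \<times> (nat \<Rightarrow> real) \<Rightarrow> real" where
  "lin_form d a c z = a * fst z + (\<Sum>j<d. c j * snd z j)"

lemma lin_form_measurable [measurable]: "lin_form d a c \<in> borel_measurable (row_space d)"
proof -
  have f: "fst \<in> borel_measurable (row_space d)" and g: "snd \<in> measurable (row_space d) (Pi\<^sub>M {..<d} (\<lambda>_. borel))"
    unfolding row_space_def by (rule measurable_fst, rule measurable_snd)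
  have "(\<lambda>z. snd z j) \<in> borel_measurable (row_space d)" if "j < d" for j
    using measurable_compose[OF g measurable_component_singleton[of j "{..<d}"]] that by simp
  then show ?thesis unfolding lin_form_def[abs_def] using f by auto
qed

text \<open>
  Coefficients on the columns in \<open>S\<close>, which a vector of length \<open>card S\<close> numbers by their rank in
  \<open>S\<close>, as coefficients on all columns.
\<close>

definition extend_coeffs :: "nat set \<Rightarrow> real vec \<Rightarrow> nat \<Rightarrow> real" where
  "extend_coeffs S u j = (if j \<in> S then u $ card {a\<in>S. a < j} else 0)"

lemma extend_coeffs_sums:
  assumes S: "S \<subseteq> {..<d}" and u: "u \<in> carrier_vec (card S)"
  shows "(\<Sum>j<d. extend_coeffs S u j * w j) = (\<Sum>i<card S. u $ i * w (pick S i))"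
    "(\<Sum>j<d. (extend_coeffs S u j)\<^sup>2) = (l2norm u)\<^sup>2"
proof -
  have fin: "finite S" using S finite_subset by blast
  have e: "extend_coeffs S u (pick S i) = u $ i" if "i < card S" for i
    using that pick_in_set_le[of i S] card_pick[of i S] fin by (auto simp: extend_coeffs_def)
  have "(\<Sum>j<d. extend_coeffs S u j * w j) = (\<Sum>j\<in>S. extend_coeffs S u j * w j)"
    using S by (intro sum.mono_neutral_right) (auto simp: extend_coeffs_def)
  also have "\<dots> = (\<Sum>i<card S. extend_coeffs S u (pick S i) * w (pick S i))" by (rule sum_pick[OF fin, symmetric])
  also have "\<dots> = (\<Sum>i<card S. u $ i * w (pick S i))" by (simp add: e)
  finally show "(\<Sum>j<d. extend_coeffs S u j * w j) = (\<Sum>i<card S. u $ i * w (pick S i))" .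
  have "(\<Sum>j<d. (extend_coeffs S u j)\<^sup>2) = (\<Sum>j\<in>S. (extend_coeffs S u j)\<^sup>2)"
    using S by (intro sum.mono_neutral_right) (auto simp: extend_coeffs_def)
  also have "\<dots> = (\<Sum>i<card S. (extend_coeffs S u (pick S i))\<^sup>2)" by (rule sum_pick[OF fin, symmetric])
  also have "\<dots> = (l2norm u)\<^sup>2" using u by (simp add: e l2norm_sq)
  finally show "(\<Sum>j<d. (extend_coeffs S u j)\<^sup>2) = (l2norm u)\<^sup>2" .
qed

text \<open>
  The model at one sample size. Everything used about the data concerns linear forms of the rows:
  within a segment they are normal, i.i.d. over time, and the noise of the segment is one of them.
\<close>

locale segmented_sample = prob_space M for M :: "'a measure" +
  fixes n d L :: nat and Y :: "'a \<Rightarrow> real vec" and X :: "'a \<Rightarrow> real mat" and S :: "nat set"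
    and sg :: "nat \<Rightarrow> nat set" and \<beta> :: "nat \<Rightarrow> real vec" and \<sigma> :: "nat \<Rightarrow> real"
  assumes Y_carrier: "\<And>\<omega>. \<omega> \<in> space M \<Longrightarrow> Y \<omega> \<in> carrier_vec n"
    and X_carrier: "\<And>\<omega>. \<omega> \<in> space M \<Longrightarrow> X \<omega> \<in> carrier_mat n d"
    and S: "S \<subseteq> {..<d}"
    and iid: "\<And>i. i \<le> L \<Longrightarrow> iid_rows M d Y X (sg i)"
    and normal: "\<And>i. i \<le> L \<Longrightarrow> normal_rows M d Y X (sg i)"
    and reg: "\<And>i. i \<le> L \<Longrightarrow> regression M Y X S (sg i) (\<beta> i) (\<sigma> i)"
    and disj: "disjoint_family_on sg {..L}"
    and cover: "(\<Union>i\<le>L. sg i) = {..<n}"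
begin

abbreviation "s \<equiv> card S"
abbreviation "xs \<omega> \<equiv> restrict_cols (X \<omega>) S"

definition form :: "real \<Rightarrow> (nat \<Rightarrow> real) \<Rightarrow> nat \<Rightarrow> 'a \<Rightarrow> real" where
  "form a c t \<omega> = a * Y \<omega> $ t + (\<Sum>j<d. c j * X \<omega> $$ (t, j))"

lemma form_obs: "form a c t \<omega> = lin_form d a c (obs d Y X t \<omega>)"
  by (simp add: form_def lin_form_def obs_def)

lemma seg_less: "i \<le> L \<Longrightarrow> t \<in> sg i \<Longrightarrow> t < n"
  using cover by auto

lemma finite_seg: "i \<le> L \<Longrightarrow> finite (sg i)"
  using seg_less by (metis finite_nat_iff_bounded lessThan_iff subsetI)

lemma beta_carrier: "i \<le> L \<Longrightarrow> \<beta> i \<in> carrier_vec s"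
  using reg by (auto simp: regression_def)

lemma obs_indep: "i \<le> L \<Longrightarrow> h \<subseteq> sg i \<Longrightarrow> indep_vars (\<lambda>_. row_space d) (obs d Y X) h"
  using iid[of i] indep_vars_subset[of _ _ "sg i" h] by (auto simp: iid_rows_def)

lemma obs_measurable: "i \<le> L \<Longrightarrow> t \<in> sg i \<Longrightarrow> obs d Y X t \<in> measurable M (row_space d)"
  using obs_indep[of i "sg i"] by (auto simp: indep_vars_def)

lemma obs_measurable': "t < n \<Longrightarrow> obs d Y X t \<in> measurable M (row_space d)"
  using cover obs_measurable by blast

lemma form_measurable: "t < n \<Longrightarrow> form a c t \<in> borel_measurable M"
  unfolding form_obs[abs_def] by (rule measurable_compose[OF obs_measurable' lin_form_measurable])

lemma expectation_same:
  fixes g :: "real \<times> (nat \<Rightarrow> real) \<Rightarrow> real"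
  assumes "i \<le> L" "t \<in> sg i" "t' \<in> sg i" and g: "g \<in> borel_measurable (row_space d)"
  shows "expectation (\<lambda>\<omega>. g (obs d Y X t \<omega>)) = expectation (\<lambda>\<omega>. g (obs d Y X t' \<omega>))"
proof -
  have "distr M (row_space d) (obs d Y X t) = distr M (row_space d) (obs d Y X t')"
    using iid[OF assms(1)] assms(2,3) by (auto simp: iid_rows_def)
  then have "integral\<^sup>L (distr M (row_space d) (obs d Y X t)) g = integral\<^sup>L (distr M (row_space d) (obs d Y X t')) g" by simp
  then show ?thesis
    using integral_distr[OF obs_measurable[OF assms(1,2)] g] integral_distr[OF obs_measurable[OF assms(1,3)] g] by simp
qed

lemma expectation_form_same:
  assumes "i \<le> L" "t \<in> sg i" "t' \<in> sg i"
  shows "expectation (\<lambda>\<omega>. form a c t \<omega> * form a' c' t \<omega>) = expectation (\<lambda>\<omega>. form a c t' \<omega> * form a' c' t' \<omega>)"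
  unfolding form_obs by (rule expectation_same[OF assms, of "\<lambda>z. lin_form d a c z * lin_form d a' c' z"]) measurable

lemma form_gaussian:
  assumes i: "i \<le> L" and t: "t \<in> sg i"
  shows "gaussian (form a c t)"
proof -
  have fin: "finite (sg i)" by (rule finite_seg[OF i])
  obtain m s' where s': "0 \<le> s'" and law: "distr M borel (\<lambda>\<omega>. \<Sum>t'\<in>sg i. (if t' = t then a else 0) * (Y \<omega> $ t') +
      (\<Sum>j<d. (if t' = t then c j else 0) * (X \<omega> $$ (t', j)))) = normal_law m s'"
    using normal[OF i, unfolded normal_rows_def, THEN spec[of _ "\<lambda>t'. if t' = t then a else 0"],
      THEN spec[of _ "\<lambda>t' j. if t' = t then c j else 0"]] by blast
  have "(\<Sum>t'\<in>sg i. (if t' = t then a else 0) * (Y \<omega> $ t') + (\<Sum>j<d. (if t' = t then c j else 0) * (X \<omega> $$ (t', j)))) = form a c t \<omega>" for \<omega>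
  proof -
    have "(\<Sum>t'\<in>sg i. (if t' = t then a else 0) * (Y \<omega> $ t') + (\<Sum>j<d. (if t' = t then c j else 0) * (X \<omega> $$ (t', j))))
      = (\<Sum>t'\<in>sg i. if t' = t then form a c t \<omega> else 0)"
      by (intro sum.cong refl) (auto simp: form_def)
    then show ?thesis using fin t by simp
  qed
  then have "distr M borel (form a c t) = normal_law m s'" using law by simp
  then show ?thesis using s' form_measurable[OF seg_less[OF i t]] by (auto simp: gaussian_def)
qed

lemma form_concentration:
  assumes i: "i \<le> L" and h: "h \<subseteq> sg i"
    and v: "0 < v" "\<And>t. t \<in> h \<Longrightarrow> expectation (\<lambda>\<omega>. (form a c t \<omega>)\<^sup>2) \<le> v" "\<And>t. t \<in> h \<Longrightarrow> expectation (\<lambda>\<omega>. (form a' c' t \<omega>)\<^sup>2) \<le> v"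
    and \<mu>: "\<And>t. t \<in> h \<Longrightarrow> expectation (\<lambda>\<omega>. form a c t \<omega> * form a' c' t \<omega>) = \<mu>"
    and \<eta>: "0 < \<eta>" "\<eta> \<le> 96 * v"
  shows "prob {\<omega>\<in>space M. real (card h) * \<eta> \<le> \<bar>(\<Sum>t\<in>h. form a c t \<omega> * form a' c' t \<omega>) - real (card h) * \<mu>\<bar>}
    \<le> 2 * exp (- (real (card h) * \<eta>\<^sup>2 / (3072 * v\<^sup>2)))"
proof (rule gaussian_product_concentration[OF _ _ _ _ _ _ \<mu> v(1) \<eta>])
  show "indep_vars (\<lambda>_. borel) (\<lambda>t \<omega>. form a c t \<omega> * form a' c' t \<omega>) h"
    unfolding form_obs by (rule indep_vars_compose2[OF obs_indep[OF i h], where Y = "\<lambda>_ z. lin_form d a c z * lin_form d a' c' z"]) measurable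
  show "finite h" using h finite_seg[OF i] finite_subset by blast
  show "gaussian (form a c t)" "gaussian (form a' c' t)" if "t \<in> h" for t using that h form_gaussian[OF i] by auto
qed (use v in auto)

definition unit_coeff :: "nat \<Rightarrow> nat \<Rightarrow> real" where
  "unit_coeff k j = (if j = k then 1 else 0)"

lemma form_covariate: "k < d \<Longrightarrow> form 0 (unit_coeff k) t \<omega> = X \<omega> $$ (t, k)"
  by (simp add: form_def unit_coeff_def if_distrib[of "\<lambda>x. x * _"] cong: if_cong)

lemma form_response: "form 1 (\<lambda>_. 0) t \<omega> = Y \<omega> $ t"
  by (simp add: form_def)

lemma xs_entry: "\<omega> \<in> space M \<Longrightarrow> t < n \<Longrightarrow> i < s \<Longrightarrow> xs \<omega> $$ (t, i) = form 0 (unit_coeff (pick S i)) t \<omega>"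
  using pick_less[OF S] by (simp add: form_covariate restrict_cols_index[OF X_carrier S])

lemma xs_carrier: "\<omega> \<in> space M \<Longrightarrow> xs \<omega> \<in> carrier_mat n s"
  by (rule restrict_cols_carrier[OF X_carrier S])

lemma row_xs:
  assumes "\<omega> \<in> space M" "t < n" "u \<in> carrier_vec s"
  shows "row (xs \<omega>) t \<bullet> u = form 0 (extend_coeffs S u) t \<omega>"
proof -
  have "row (xs \<omega>) t \<bullet> u = (\<Sum>i<s. xs \<omega> $$ (t, i) * u $ i)"
    by (rule row_scalar_prod[OF xs_carrier[OF assms(1)] assms(3,2)])
  also have "\<dots> = (\<Sum>i<s. u $ i * X \<omega> $$ (t, pick S i))"
    using assms by (intro sum.cong refl) (simp add: restrict_cols_index[OF X_carrier S])
  also have "\<dots> = form 0 (extend_coeffs S u) t \<omega>" unfolding form_def extend_coeffs_sums(1)[OF S assms(3)] by simp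
  finally show ?thesis .
qed

definition noise :: "nat \<Rightarrow> nat \<Rightarrow> 'a \<Rightarrow> real" where
  "noise i = form 1 (\<lambda>j. - extend_coeffs S (\<beta> i) j)"

lemma noise_eq:
  assumes "\<omega> \<in> space M" "t < n" "i \<le> L"
  shows "noise i t \<omega> = Y \<omega> $ t - row (xs \<omega>) t \<bullet> \<beta> i"
  unfolding row_xs[OF assms(1,2) beta_carrier[OF assms(3)]] noise_def form_def by (simp add: sum_negf)

text \<open>
  The covariance with a covariate vanishes because the noise has mean 0 and is independent of
  \<open>X\<^sup>S\<close>, hence of each of its columns.
\<close>

lemma noise_law:
  assumes i: "i \<le> L" and t: "t \<in> sg i"
  shows "distr M borel (noise i t) = normal_law 0 (\<sigma> i)" "0 \<le> \<sigma> i"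
    "expectation (\<lambda>\<omega>. (noise i t \<omega>)\<^sup>2) = (\<sigma> i)\<^sup>2" "k \<in> S \<Longrightarrow> expectation (\<lambda>\<omega>. form 0 (unit_coeff k) t \<omega> * noise i t \<omega>) = 0"
proof -
  have tn: "t < n" by (rule seg_less[OF i t])
  note r = reg[OF i, unfolded regression_def Let_def]
  show \<sigma>: "0 \<le> \<sigma> i" using r by simp
  have ns: "(\<lambda>\<omega>. Y \<omega> $ t - row (xs \<omega>) t \<bullet> \<beta> i) \<omega> = noise i t \<omega>" if "\<omega> \<in> space M" for \<omega>
    using noise_eq[OF that tn i] by simp
  have "distr M borel (\<lambda>\<omega>. Y \<omega> $ t - row (xs \<omega>) t \<bullet> \<beta> i) = normal_law 0 (\<sigma> i)" using r t by blast
  moreover have "distr M borel (\<lambda>\<omega>. Y \<omega> $ t - row (xs \<omega>) t \<bullet> \<beta> i) = distr M borel (noise i t)"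
    by (rule distr_cong) (use ns in auto)
  ultimately show law: "distr M borel (noise i t) = normal_law 0 (\<sigma> i)" by simp
  have nm [measurable]: "noise i t \<in> borel_measurable M" unfolding noise_def by (rule form_measurable[OF tn])
  have "expectation (\<lambda>\<omega>. (noise i t \<omega>)\<^sup>2) = (\<integral>y. y\<^sup>2 \<partial>distr M borel (noise i t))"
    by (subst integral_distr) auto
  then show "expectation (\<lambda>\<omega>. (noise i t \<omega>)\<^sup>2) = (\<sigma> i)\<^sup>2"
    unfolding law using normal_law_square(2)[OF \<sigma>, of 0] by simp
  show "expectation (\<lambda>\<omega>. form 0 (unit_coeff k) t \<omega> * noise i t \<omega>) = 0" if k: "k \<in> S"
  proof -
    have kd: "k < d" using k S by auto
    define W where "W = form 0 (unit_coeff k) t"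
    have Wm [measurable]: "W \<in> borel_measurable M" unfolding W_def by (rule form_measurable[OF tn])
    define V where "V = (\<lambda>\<omega>. \<lambda>j\<in>S. X \<omega> $$ (t, j))"
    have "indep_rv M borel (\<lambda>\<omega>. Y \<omega> $ t - row (xs \<omega>) t \<bullet> \<beta> i) (Pi\<^sub>M S (\<lambda>_. borel)) V"
      using r t unfolding V_def by blast
    then have ind: "indep_set {(\<lambda>\<omega>. Y \<omega> $ t - row (xs \<omega>) t \<bullet> \<beta> i) -` A \<inter> space M |A. A \<in> sets borel} {V -` A \<inter> space M |A. A \<in> sets (Pi\<^sub>M S (\<lambda>_. borel))}"
      and Vm: "V \<in> measurable M (Pi\<^sub>M S (\<lambda>_. borel))"
      by (auto simp: indep_rv_def)
    define FA where "FA = {noise i t -` A \<inter> space M |A. A \<in> sets borel}"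
    define FB where "FB = {W -` A \<inter> space M |A. A \<in> sets borel}"
    have "indep_set FA FB"
      unfolding indep_set_def
    proof (rule indep_sets_mono_sets[OF ind[unfolded indep_set_def]])
      fix b :: bool
      have "FA \<subseteq> {(\<lambda>\<omega>. Y \<omega> $ t - row (xs \<omega>) t \<bullet> \<beta> i) -` A \<inter> space M |A. A \<in> sets borel}"
        unfolding FA_def using ns by (auto simp: set_eq_iff)
      moreover have "FB \<subseteq> {V -` A \<inter> space M |A. A \<in> sets (Pi\<^sub>M S (\<lambda>_. borel))}"
      proof
        fix F assume "F \<in> FB"
        then obtain A where A: "A \<in> sets borel" "F = W -` A \<inter> space M" by (auto simp: FB_def)
        have "V -` ((\<lambda>z. z k) -` A \<inter> space (Pi\<^sub>M S (\<lambda>_. borel))) \<inter> space M = F"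
          using measurable_space[OF Vm] k by (auto simp: A(2) V_def W_def form_covariate[OF kd])
        moreover have "(\<lambda>z. z k) -` A \<inter> space (Pi\<^sub>M S (\<lambda>_. borel)) \<in> sets (Pi\<^sub>M S (\<lambda>_. borel :: real measure))"
          using k A by (intro measurable_sets[OF measurable_component_singleton]) auto
        ultimately show "F \<in> {V -` A \<inter> space M |A. A \<in> sets (Pi\<^sub>M S (\<lambda>_. borel))}" by blast
      qed
      ultimately show "(case b of True \<Rightarrow> FA | False \<Rightarrow> FB) \<subseteq> (case b of True \<Rightarrow> {(\<lambda>\<omega>. Y \<omega> $ t - row (xs \<omega>) t \<bullet> \<beta> i) -` A \<inter> space M |A. A \<in> sets borel}
         | False \<Rightarrow> {V -` A \<inter> space M |A. A \<in> sets (Pi\<^sub>M S (\<lambda>_. borel))})"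
        by (cases b) auto
    qed
    moreover have "Int_stable {f -` A \<inter> space M |A. A \<in> sets borel}" for f :: "'a \<Rightarrow> real"
    proof (rule Int_stableI)
      fix a b assume "a \<in> {f -` A \<inter> space M |A. A \<in> sets borel}" "b \<in> {f -` A \<inter> space M |A. A \<in> sets borel}"
      then obtain A B where "A \<in> sets borel" "B \<in> sets borel" "a = f -` A \<inter> space M" "b = f -` B \<inter> space M" by auto
      then show "a \<inter> b \<in> {f -` A \<inter> space M |A. A \<in> sets borel}" by (auto intro!: exI[of _ "A \<inter> B"])
    qed
    ultimately have "indep_set (sigma_sets (space M) FA) (sigma_sets (space M) FB)"
      unfolding FA_def FB_def by (intro indep_set_sigma_sets)
    then have iv: "indep_var borel (noise i t) borel W" unfolding indep_var_eq FA_def FB_def by simp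
    have g1: "integrable M W" "integrable M (noise i t)"
      unfolding W_def noise_def using gaussian_square_integrable[OF form_gaussian[OF i t]] form_measurable[OF tn]
      by (auto intro: square_integrable_imp_integrable)
    have "expectation (noise i t) = (\<integral>y. y \<partial>distr M borel (noise i t))" by (subst integral_distr) auto
    also have "\<dots> = 0"
    proof (cases "\<sigma> i = 0")
      case True
      interpret R: prob_space "return borel (0::real)" by (rule prob_space_return) simp
      have "(\<integral>y. y \<partial>return borel (0::real)) = (\<integral>y. 0 \<partial>return borel (0::real))"
        by (rule integral_cong_AE) (auto simp: AE_return)
      then show ?thesis unfolding law using True by (simp add: normal_law_def)
    next
      case False
      with \<sigma> have "0 < \<sigma> i" by simp
      then show ?thesis unfolding law using integral_normal_moment_nz_1[of "\<sigma> i" 0] False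
        by (simp add: normal_law_def integral_density normal_density_nonneg)
    qed
    finally have m0: "expectation (noise i t) = 0" .
    have "expectation (\<lambda>\<omega>. noise i t \<omega> * W \<omega>) = expectation (noise i t) * expectation W"
      by (rule indep_var_lebesgue_integral[OF iv g1(2,1)])
    then show ?thesis unfolding W_def[symmetric] by (simp add: m0 mult.commute)
  qed
qed

end

section \<open>Moment bounds\<close>

lemma power_le_fact_exp:
  fixes x :: real
  assumes "0 \<le> x"
  shows "x ^ m \<le> fact m * exp x"
proof -
  have "x ^ m / fact m = (\<Sum>n\<in>{m}. x ^ n /\<^sub>R fact n)" by (simp add: divide_inverse mult.commute)
  also have "\<dots> \<le> (\<Sum>n. x ^ n /\<^sub>R fact n)"
    using assms by (intro sum_le_suminf summable_exp_generic) auto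
  also have "\<dots> = exp x" by (simp add: exp_def)
  finally show ?thesis by (simp add: divide_le_eq mult.commute)
qed

context segmented_sample
begin

text \<open>
  The diagonal entries of the Gram matrix have the second moments of the covariates as
  expectations. They are at most its largest eigenvalue, and \<open>y \<le> 1 + y ^ (2 * k)\<close> for \<open>y \<ge> 0\<close>.
\<close>

lemma second_moment_upper:
  assumes i: "i \<le> L" and e: "e \<subseteq> sg i" "e \<noteq> {}" and k: "1 \<le> k" and C: "0 \<le> C"
    and up: "(\<integral>\<^sup>+\<omega>. ennreal (lambda_max (gram (X \<omega>) e) ^ (2 * k)) \<partial>M) \<le> ennreal C"
    and j: "j < d" and t: "t \<in> sg i"
  shows "expectation (\<lambda>\<omega>. (form 0 (unit_coeff j) t \<omega>)\<^sup>2) \<le> 1 + C"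
proof -
  define W where "W = form 0 (unit_coeff j)"
  have fin: "finite e" using e finite_seg[OF i] finite_subset by blast
  have ce: "0 < card e" using fin e by (simp add: card_gt_0_iff)
  have en: "e \<subseteq> {..<n}" using e seg_less[OF i] by auto
  have int: "integrable M (\<lambda>\<omega>. (W t' \<omega>)\<^sup>2)" if "t' \<in> e" for t'
    unfolding W_def using gaussian_square_integrable[OF form_gaussian[OF i]] that e by auto
  define g where "g \<omega> = (\<Sum>t'\<in>e. (W t' \<omega>)\<^sup>2) / real (card e)" for \<omega>
  have g0: "0 \<le> g \<omega>" for \<omega> unfolding g_def by (intro divide_nonneg_nonneg sum_nonneg) auto
  have ig: "integrable M g" unfolding g_def using int by auto
  then have gm [measurable]: "g \<in> borel_measurable M" by auto
  have same: "expectation (\<lambda>\<omega>. (W t' \<omega>)\<^sup>2) = expectation (\<lambda>\<omega>. (W t \<omega>)\<^sup>2)" if "t' \<in> e" for t'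
    unfolding W_def power2_eq_square using that e t by (intro expectation_form_same[OF i]) auto
  have "expectation g = (\<Sum>t'\<in>e. expectation (\<lambda>\<omega>. (W t' \<omega>)\<^sup>2)) / real (card e)"
    unfolding g_def using int by simp
  also have "\<dots> = expectation (\<lambda>\<omega>. (W t \<omega>)\<^sup>2)" using same ce by simp
  finally have Eg: "expectation g = expectation (\<lambda>\<omega>. (W t \<omega>)\<^sup>2)" .
  have le: "g \<omega> \<le> lambda_max (gram (X \<omega>) e)" if "\<omega> \<in> space M" for \<omega>
    using gram_eigenvalue_bounds(3)[OF X_carrier[OF that] en _ j] j by (simp add: g_def W_def form_covariate[OF j])
  have "ennreal (expectation g) = (\<integral>\<^sup>+\<omega>. ennreal (g \<omega>) \<partial>M)" using ig g0 by (simp add: nn_integral_eq_integral)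
  also have "\<dots> \<le> (\<integral>\<^sup>+\<omega>. 1 + ennreal (g \<omega> ^ (2 * k)) \<partial>M)"
  proof (rule nn_integral_mono)
    fix \<omega>
    have "g \<omega> \<le> 1 + g \<omega> ^ (2 * k)"
    proof (cases "g \<omega> \<le> 1")
      case True
      then show ?thesis using g0[of \<omega>] by (simp add: add_increasing2)
    next
      case False
      then have "g \<omega> ^ 1 \<le> g \<omega> ^ (2 * k)" using k by (intro power_increasing) auto
      then show ?thesis by simp
    qed
    then have "ennreal (g \<omega>) \<le> ennreal (1 + g \<omega> ^ (2 * k))" by (rule ennreal_leI)
    also have "\<dots> = 1 + ennreal (g \<omega> ^ (2 * k))" using g0[of \<omega>] by (simp add: ennreal_plus)
    finally show "ennreal (g \<omega>) \<le> 1 + ennreal (g \<omega> ^ (2 * k))" .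
  qed
  also have "\<dots> = 1 + (\<integral>\<^sup>+\<omega>. ennreal (g \<omega> ^ (2 * k)) \<partial>M)"
    by (subst nn_integral_add) (auto simp: emeasure_space_1)
  also have "\<dots> \<le> 1 + (\<integral>\<^sup>+\<omega>. ennreal (lambda_max (gram (X \<omega>) e) ^ (2 * k)) \<partial>M)"
    using le g0 by (intro add_left_mono nn_integral_mono ennreal_leI power_mono) auto
  also have "\<dots> \<le> 1 + ennreal C" by (rule add_left_mono[OF up])
  also have "\<dots> = ennreal (1 + C)" using C by (simp add: ennreal_plus)
  finally have "expectation g \<le> 1 + C" using C by (subst (asm) ennreal_le_iff) auto
  then show ?thesis unfolding Eg W_def .
qed

text \<open>
  Suppose that the form \<open>W\<close> with coefficients \<open>u\<close> has a second moment below \<open>v = c1 |u|\<^sup>2\<close>. The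
  smallest eigenvalue times \<open>|u|\<^sup>2\<close> is at most the mean of the squares of \<open>W\<close> over the rows in
  \<open>e\<close>. By convexity its power is at most the mean of the powers, and a power \<open>y ^ m\<close> of
  \<open>y = W\<^sup>2 / (8 v)\<close> is at most \<open>m! exp y\<close>, whose expectation is at most \<open>2 m!\<close> for a normal
  variable. So the moment of the smallest eigenvalue would be at most \<open>2 m! (8 c1) ^ m\<close> with
  \<open>m = 2 k\<close>, which is less than \<open>c\<close>.
\<close>

lemma second_moment_lower:
  assumes i: "i \<le> L" and e: "e \<subseteq> sg i" "e \<noteq> {}" and d: "0 < d"
    and low: "ennreal c \<le> (\<integral>\<^sup>+\<omega>. ennreal (lambda_min (gram (X \<omega>) e) ^ (2 * k)) \<partial>M)"
    and c1: "0 < c1" "2 * fact (2 * k) * (8 * c1) ^ (2 * k) < c" and t: "t \<in> sg i"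
  shows "c1 * (\<Sum>j<d. (u j)\<^sup>2) \<le> expectation (\<lambda>\<omega>. (form 0 u t \<omega>)\<^sup>2)"
proof (rule ccontr)
  assume neg: "\<not> c1 * (\<Sum>j<d. (u j)\<^sup>2) \<le> expectation (\<lambda>\<omega>. (form 0 u t \<omega>)\<^sup>2)"
  define W where "W = form 0 u"
  define N where "N = (\<Sum>j<d. (u j)\<^sup>2)"
  define v where "v = c1 * N"
  have less: "expectation (\<lambda>\<omega>. (W t \<omega>)\<^sup>2) < v" using neg by (simp add: W_def N_def v_def)
  moreover have "0 \<le> expectation (\<lambda>\<omega>. (W t \<omega>)\<^sup>2)" by simp
  ultimately have v: "0 < v" by linarith
  then have N: "0 < N" using c1 by (simp add: v_def zero_less_mult_iff)
  have fin: "finite e" using e finite_seg[OF i] finite_subset by blast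
  have ce: "0 < card e" using fin e by (simp add: card_gt_0_iff)
  have en: "e \<subseteq> {..<n}" using e seg_less[OF i] by auto
  define m where "m = 2 * k"
  define B where "B = (fact m * (8 * v) ^ m :: real)"
  have B0: "0 \<le> B" using v by (simp add: B_def)
  have exps: "integrable M (\<lambda>\<omega>. exp ((W t' \<omega>)\<^sup>2 / (8 * v)))" "expectation (\<lambda>\<omega>. exp ((W t' \<omega>)\<^sup>2 / (8 * v))) \<le> 2" if "t' \<in> e" for t'
  proof -
    have t': "t' \<in> sg i" using that e by auto
    have "expectation (\<lambda>\<omega>. (W t' \<omega>)\<^sup>2) = expectation (\<lambda>\<omega>. (W t \<omega>)\<^sup>2)"
      unfolding W_def power2_eq_square by (rule expectation_form_same[OF i t' t])
    then have "expectation (\<lambda>\<omega>. (W t' \<omega>)\<^sup>2) \<le> v" using less by simp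
    then show "integrable M (\<lambda>\<omega>. exp ((W t' \<omega>)\<^sup>2 / (8 * v)))" "expectation (\<lambda>\<omega>. exp ((W t' \<omega>)\<^sup>2 / (8 * v))) \<le> 2"
      unfolding W_def using gaussian_exp_square[OF form_gaussian[OF i t'] v] by auto
  qed
  \<comment> \<open>an integrable upper bound of the power of the smallest eigenvalue\<close>
  define F where "F \<omega> = (\<Sum>t'\<in>e. B * exp ((W t' \<omega>)\<^sup>2 / (8 * v))) / real (card e) / N ^ m" for \<omega>
  have F0: "0 \<le> F \<omega>" for \<omega> unfolding F_def using B0 N by (intro divide_nonneg_nonneg sum_nonneg) auto
  have iF: "integrable M F" unfolding F_def using exps by auto
  have EF: "expectation F \<le> 2 * B / N ^ m"
  proof -
    have "expectation F = (\<Sum>t'\<in>e. B * expectation (\<lambda>\<omega>. exp ((W t' \<omega>)\<^sup>2 / (8 * v)))) / real (card e) / N ^ m"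
      unfolding F_def using exps by simp
    also have "\<dots> \<le> (\<Sum>t'\<in>e. B * 2) / real (card e) / N ^ m"
      using exps B0 N by (intro divide_right_mono sum_mono mult_left_mono) auto
    also have "\<dots> = 2 * B / N ^ m" using ce by simp
    finally show ?thesis .
  qed
  have le: "lambda_min (gram (X \<omega>) e) ^ m \<le> F \<omega>" if \<omega>: "\<omega> \<in> space M" for \<omega>
  proof -
    note G = gram_eigenvalue_bounds(1,2)[OF X_carrier[OF \<omega>] en d]
    define z where "z t' = (W t' \<omega>)\<^sup>2" for t'
    have "(\<Sum>t'\<in>e. (\<Sum>j<d. X \<omega> $$ (t', j) * u j)\<^sup>2) = (\<Sum>t'\<in>e. z t')"
      unfolding z_def W_def form_def by (intro sum.cong refl) (simp add: mult.commute)
    then have 1: "lambda_min (gram (X \<omega>) e) * N \<le> (\<Sum>t'\<in>e. z t') / real (card e)"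
      using G(2)[of u] by (simp add: N_def)
    have "(lambda_min (gram (X \<omega>) e) * N) ^ m \<le> ((\<Sum>t'\<in>e. z t') / real (card e)) ^ m"
      using 1 G(1) N by (intro power_mono) auto
    also have "(\<Sum>t'\<in>e. z t') / real (card e) = (\<Sum>t'\<in>e. (1 / real (card e)) *\<^sub>R z t')"
      by (simp add: sum_divide_distrib)
    also have "\<dots> ^ m \<le> (\<Sum>t'\<in>e. (1 / real (card e)) * z t' ^ m)"
      by (rule convex_on_sum[OF fin e(2) convex_power_even]) (use ce in \<open>auto simp: m_def\<close>)
    also have "\<dots> = (\<Sum>t'\<in>e. z t' ^ m) / real (card e)" by (simp add: sum_divide_distrib)
    also have "\<dots> \<le> (\<Sum>t'\<in>e. B * exp ((W t' \<omega>)\<^sup>2 / (8 * v))) / real (card e)"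
    proof (intro divide_right_mono sum_mono)
      fix t' assume "t' \<in> e"
      have "z t' ^ m = (8 * v) ^ m * (z t' / (8 * v)) ^ m" using v by (simp add: power_divide)
      also have "\<dots> \<le> (8 * v) ^ m * (fact m * exp (z t' / (8 * v)))"
        using v by (intro mult_left_mono power_le_fact_exp) (auto simp: z_def)
      also have "\<dots> = B * exp ((W t' \<omega>)\<^sup>2 / (8 * v))" by (simp add: B_def z_def)
      finally show "z t' ^ m \<le> B * exp ((W t' \<omega>)\<^sup>2 / (8 * v))" .
    qed simp
    finally show ?thesis unfolding F_def power_mult_distrib pos_le_divide_eq[OF zero_less_power[OF N]] .
  qed
  have "ennreal c \<le> (\<integral>\<^sup>+\<omega>. ennreal (F \<omega>) \<partial>M)"
    using low unfolding m_def[symmetric] by (rule order.trans) (intro nn_integral_mono ennreal_leI le)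
  also have "\<dots> = ennreal (expectation F)" using iF F0 by (simp add: nn_integral_eq_integral)
  finally have "c \<le> expectation F" using F0 by (subst (asm) ennreal_le_iff) auto
  also have "\<dots> \<le> 2 * B / N ^ m" by (rule EF)
  also have "\<dots> = 2 * fact (2 * k) * (8 * c1) ^ (2 * k)"
    using N by (simp add: B_def v_def m_def power_mult_distrib)
  finally show False using c1 by simp
qed

text \<open>
  The response is the sum of the noise and the fitted value, and the latter is controlled by the
  inequality of Cauchy and Schwarz.
\<close>

lemma response_second_moment:
  fixes b v :: real
  assumes i: "i \<le> L" and t: "t \<in> sg i" and v: "\<And>k. k \<in> S \<Longrightarrow> expectation (\<lambda>\<omega>. (form 0 (unit_coeff k) t \<omega>)\<^sup>2) \<le> v"
    and b: "(l2norm (\<beta> i))\<^sup>2 \<le> b" "(\<sigma> i)\<^sup>2 \<le> v"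
  shows "expectation (\<lambda>\<omega>. (form 1 (\<lambda>_. 0) t \<omega>)\<^sup>2) \<le> 2 * v + 2 * b * (s * v)"
proof -
  define x where "x k = form 0 (unit_coeff (pick S k)) t" for k
  note tn = seg_less[OF i t]
  have bc: "\<beta> i \<in> carrier_vec s" by (rule beta_carrier[OF i])
  have ix: "integrable M (\<lambda>\<omega>. (x k \<omega>)\<^sup>2)" for k
    unfolding x_def by (rule gaussian_square_integrable[OF form_gaussian[OF i t]])
  have ie: "integrable M (\<lambda>\<omega>. (noise i t \<omega>)\<^sup>2)"
    unfolding noise_def by (rule gaussian_square_integrable[OF form_gaussian[OF i t]])
  have iy: "integrable M (\<lambda>\<omega>. (form 1 (\<lambda>_. 0) t \<omega>)\<^sup>2)"
    by (rule gaussian_square_integrable[OF form_gaussian[OF i t]])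
  have le: "(form 1 (\<lambda>_. 0) t \<omega>)\<^sup>2 \<le> 2 * (noise i t \<omega>)\<^sup>2 + 2 * b * (\<Sum>k<s. (x k \<omega>)\<^sup>2)" if \<omega>: "\<omega> \<in> space M" for \<omega>
  proof -
    have "row (xs \<omega>) t \<bullet> \<beta> i = (\<Sum>k<s. \<beta> i $ k * x k \<omega>)"
      unfolding row_scalar_prod[OF xs_carrier[OF \<omega>] bc tn] x_def
      by (intro sum.cong refl) (simp add: xs_entry[OF \<omega> tn])
    then have y: "form 1 (\<lambda>_. 0) t \<omega> = noise i t \<omega> + (\<Sum>k<s. \<beta> i $ k * x k \<omega>)"
      using noise_eq[OF \<omega> tn i] by (simp add: form_response)
    have "(\<Sum>k<s. \<beta> i $ k * x k \<omega>)\<^sup>2 \<le> (\<Sum>k<s. (\<beta> i $ k)\<^sup>2) * (\<Sum>k<s. (x k \<omega>)\<^sup>2)"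
      by (rule Cauchy_Schwarz_ineq_sum)
    also have "(\<Sum>k<s. (\<beta> i $ k)\<^sup>2) = (l2norm (\<beta> i))\<^sup>2" using bc by (simp add: l2norm_sq)
    also have "(l2norm (\<beta> i))\<^sup>2 * (\<Sum>k<s. (x k \<omega>)\<^sup>2) \<le> b * (\<Sum>k<s. (x k \<omega>)\<^sup>2)"
      using b by (intro mult_right_mono sum_nonneg) auto
    finally have 1: "(\<Sum>k<s. \<beta> i $ k * x k \<omega>)\<^sup>2 \<le> b * (\<Sum>k<s. (x k \<omega>)\<^sup>2)" .
    have "(p + q)\<^sup>2 \<le> 2 * p\<^sup>2 + 2 * q\<^sup>2" for p q :: real
    proof -
      have "0 \<le> (p - q)\<^sup>2" by simp
      then show ?thesis by (simp add: power2_eq_square algebra_simps)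
    qed
    from this[of "noise i t \<omega>" "\<Sum>k<s. \<beta> i $ k * x k \<omega>"] 1 show ?thesis unfolding y by linarith
  qed
  have "expectation (\<lambda>\<omega>. (form 1 (\<lambda>_. 0) t \<omega>)\<^sup>2) \<le> expectation (\<lambda>\<omega>. 2 * (noise i t \<omega>)\<^sup>2 + 2 * b * (\<Sum>k<s. (x k \<omega>)\<^sup>2))"
    using le ix ie iy by (intro integral_mono) auto
  also have "\<dots> = 2 * (\<sigma> i)\<^sup>2 + 2 * b * (\<Sum>k<s. expectation (\<lambda>\<omega>. (x k \<omega>)\<^sup>2))"
    using ix ie noise_law(3)[OF i t] by simp
  also have "\<dots> \<le> 2 * v + 2 * b * (s * v)"
  proof (intro add_mono mult_left_mono)
    show "(\<Sum>k<s. expectation (\<lambda>\<omega>. (x k \<omega>)\<^sup>2)) \<le> s * v"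
      using sum_bounded_above[of "{..<s}" "\<lambda>k. expectation (\<lambda>\<omega>. (x k \<omega>)\<^sup>2)" v] v pick_less[OF S] by (auto simp: x_def)
    show "0 \<le> 2 * b" using b(1) by (smt (verit) zero_le_power2)
  qed (use b in auto)
  finally show ?thesis .
qed

text \<open>
  Environments may meet several segments, whereas rows are identically distributed only within
  one. Since the Gram matrix of a set of rows dominates that of a subset, a proportional part of
  the environment in one segment is enough for lower bounds.
\<close>

lemma large_part:
  assumes h: "h \<subseteq> {..<n}"
  shows "\<exists>i\<le>L. card h \<le> Suc L * card (h \<inter> sg i)"
proof -
  have fin: "finite h" using h finite_subset by blast
  obtain i where i: "i \<in> {..L}" "\<And>j. j \<in> {..L} \<Longrightarrow> card (h \<inter> sg j) \<le> card (h \<inter> sg i)"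
  proof -
    let ?I = "(\<lambda>j. card (h \<inter> sg j)) ` {..L}"
    have "Max ?I \<in> ?I" by (intro Max_in) auto
    then obtain i where "Max ?I = card (h \<inter> sg i)" "i \<in> {..L}" by (rule imageE)
    moreover have "card (h \<inter> sg j) \<le> Max ?I" if "j \<in> {..L}" for j using that by (intro Max_ge) auto
    ultimately show ?thesis using that by metis
  qed
  have "card h \<le> (\<Sum>j\<le>L. card (h \<inter> sg j))"
  proof -
    have "h = (\<Union>j\<le>L. h \<inter> sg j)" using h cover by auto
    then have "card h = card (\<Union>j\<le>L. h \<inter> sg j)" by simp
    also have "\<dots> \<le> (\<Sum>j\<le>L. card (h \<inter> sg j))" by (rule card_UN_le) simp
    finally show ?thesis .
  qed
  also have "\<dots> \<le> (\<Sum>j\<le>L. card (h \<inter> sg i))" by (intro sum_mono i(2))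
  finally show ?thesis using i(1) by auto
qed

lemma sum_over_segments:
  assumes "h \<subseteq> {..<n}"
  shows "(\<Sum>t\<in>h. w t) = (\<Sum>i\<le>L. \<Sum>t\<in>h \<inter> sg i. (w t :: real))"
proof -
  have "h = (\<Union>i\<le>L. h \<inter> sg i)" using assms cover by auto
  moreover have "(\<Sum>t\<in>(\<Union>i\<le>L. h \<inter> sg i). w t) = (\<Sum>i\<le>L. \<Sum>t\<in>h \<inter> sg i. w t)"
  proof (rule sum.UNION_disjoint)
    show "\<forall>i\<in>{..L}. finite (h \<inter> sg i)" using finite_seg by auto
    show "\<forall>i\<in>{..L}. \<forall>j\<in>{..L}. i \<noteq> j \<longrightarrow> h \<inter> sg i \<inter> (h \<inter> sg j) = {}"
      using disj unfolding disjoint_family_on_def by blast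
  qed simp
  ultimately show ?thesis by simp
qed

text \<open>
  Chernoff's inequality at \<open>1 / (8 v)\<close>, where the exponential moment of each square is at most
  \<open>2 \<le> exp 1\<close>; the exponent is then at most \<open>m - 2 m\<close>.
\<close>

lemma square_sum_upper:
  assumes i: "i \<le> L" and h: "h \<subseteq> sg i" and v: "0 < v" "\<And>t. t \<in> h \<Longrightarrow> expectation (\<lambda>\<omega>. (form a c t \<omega>)\<^sup>2) \<le> v"
    and m: "real (card h) \<le> m"
  shows "prob {\<omega>\<in>space M. 16 * v * m \<le> (\<Sum>t\<in>h. (form a c t \<omega>)\<^sup>2)} \<le> exp (- m)"
proof -
  have e1: "2 \<le> exp (1::real)" using exp_ge_add_one_self[of "1::real"] by simp
  have "prob {\<omega>\<in>space M. 16 * v * m \<le> (\<Sum>t\<in>h. (form a c t \<omega>)\<^sup>2)} \<le> exp ((\<Sum>t\<in>h. 1) - 1 / (8 * v) * (16 * v * m))"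
  proof (rule chernoff_upper)
    show "indep_vars (\<lambda>_. borel) (\<lambda>t \<omega>. (form a c t \<omega>)\<^sup>2) h"
      unfolding form_obs by (rule indep_vars_compose2[OF obs_indep[OF i h], where Y = "\<lambda>_ z. (lin_form d a c z)\<^sup>2"]) measurable
    show "finite h" using h finite_seg[OF i] finite_subset by blast
    fix t assume t: "t \<in> h"
    then have "gaussian (form a c t)" using h by (intro form_gaussian[OF i]) auto
    from gaussian_exp_square[OF this v(1) v(2)[OF t]] e1
    show "integrable M (\<lambda>\<omega>. exp (1 / (8 * v) * (form a c t \<omega>)\<^sup>2))" "expectation (\<lambda>\<omega>. exp (1 / (8 * v) * (form a c t \<omega>)\<^sup>2)) \<le> exp 1"
      by (auto simp: mult.commute)
  qed (use v in auto)
  also have "\<dots> \<le> exp (- m)" using v m by simp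
  finally show ?thesis .
qed

section \<open>Good samples\<close>

definition covariate :: "nat \<Rightarrow> nat \<Rightarrow> 'a \<Rightarrow> real" where
  "covariate p = form 0 (unit_coeff (pick S p))"

lemma covariate_eq: "\<omega> \<in> space M \<Longrightarrow> t < n \<Longrightarrow> p < s \<Longrightarrow> xs \<omega> $$ (t, p) = covariate p t \<omega>"
  by (simp add: covariate_def xs_entry)

text \<open>
  There are four kinds of bad events: \<open>PA\<close>, the empirical covariances of the covariates in the
  large part of a row set are off by \<open>\<zeta>\<close>; \<open>PB\<close>, a sum of squares of a covariate is too large;
  \<open>PC\<close>, the noise in one of the environments \<open>f i\<close> is not noise-like; \<open>PD\<close>, the sum of squares of
  the response in a segment is too large. The number \<open>C0\<close> bounds how many of them there are per
  row set, and \<open>2 * exp (- (\<kappa> * r * \<eta>\<^sup>2))\<close> bounds the probability of each one; the weakest bound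
  is that of \<open>PA\<close>, which has the precision \<open>\<zeta>\<close> and only the part of the rows that lies in one
  segment. The row set of all time points is included because the residuals are formed there.
\<close>

lemma good_sample:
  fixes v c1 r \<eta> :: real
  assumes E: "finite E" "\<And>h. h \<in> E \<Longrightarrow> h \<subseteq> {..<n} \<and> h \<noteq> {} \<and> r \<le> real (card h)"
    and f: "\<And>i. i \<le> L \<Longrightarrow> f i \<in> E \<and> f i \<subseteq> sg i"
    and v: "1 \<le> v" and mx: "\<And>i t k. i \<le> L \<Longrightarrow> t \<in> sg i \<Longrightarrow> k \<in> S \<Longrightarrow> expectation (\<lambda>\<omega>. (form 0 (unit_coeff k) t \<omega>)\<^sup>2) \<le> v"
    and my: "\<And>i t. i \<le> L \<Longrightarrow> t \<in> sg i \<Longrightarrow> expectation (\<lambda>\<omega>. (form 1 (\<lambda>_. 0) t \<omega>)\<^sup>2) \<le> v"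
    and ms: "\<And>i. i \<le> L \<Longrightarrow> (\<sigma> i)\<^sup>2 \<le> v"
    and c1: "0 < c1" "c1 \<le> 1" and low: "\<And>i t u. i \<le> L \<Longrightarrow> t \<in> sg i \<Longrightarrow> u \<in> carrier_vec s \<Longrightarrow>
      c1 * (l2norm u)\<^sup>2 \<le> expectation (\<lambda>\<omega>. (form 0 (extend_coeffs S u) t \<omega>)\<^sup>2)"
    and \<eta>: "0 < \<eta>" "\<eta> \<le> 1" and r: "0 \<le> r" and s: "0 < s"
  defines "\<kappa> \<equiv> (c1 / (2 * s))\<^sup>2 / (real (Suc L) * (3072 * v\<^sup>2))"
    and "H \<equiv> insert {..<n} E" and "C0 \<equiv> s * s + Suc L * s + Suc L * Suc s + Suc L"
  shows "\<exists>G\<in>events. 1 - real (card H * C0) * (2 * exp (- (\<kappa> * r * \<eta>\<^sup>2))) \<le> prob G \<and>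
    (\<forall>\<omega>\<in>G. (\<forall>h\<in>H. row_set (xs \<omega>) n s h (c1 / (2 * real (Suc L)))) \<and>
       (\<forall>h\<in>H. \<forall>p<s. (\<Sum>t\<in>h. (xs \<omega> $$ (t, p))\<^sup>2) \<le> card h * (16 * v * real (Suc L))) \<and>
       (\<forall>i\<le>L. noise_like (xs \<omega>) (f i) \<eta> ((\<sigma> i)\<^sup>2) (\<lambda>t. Y \<omega> $ t - row (xs \<omega>) t \<bullet> \<beta> i)) \<and>
       (\<Sum>t<n. (Y \<omega> $ t)\<^sup>2) \<le> n * (2 * v))"
proof -
  define b where "b = 2 * exp (- (\<kappa> * r * \<eta>\<^sup>2))"
  \<comment> \<open>an error of \<open>\<zeta>\<close> in each covariance changes the quadratic form at \<open>u\<close> by at most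
      \<open>\<zeta> (\<Sum>p<s. |u $ p|)\<^sup>2 \<le> \<zeta> s |u|\<^sup>2\<close>, which is half of its lower bound \<open>c1 |u|\<^sup>2\<close>\<close>
  define \<zeta> where "\<zeta> = c1 / (2 * s)"
  have \<zeta>: "0 < \<zeta>" "\<zeta> \<le> 1" using c1 s by (auto simp: \<zeta>_def divide_le_eq)
  have v0: "0 < v" using v by simp
  have H: "h \<subseteq> {..<n}" "h \<noteq> {}" "r \<le> real (card h)" "finite h" if "h \<in> H" for h
  proof -
    have f0: "f 0 \<in> E" using f by simp
    show sub: "h \<subseteq> {..<n}" using that E by (auto simp: H_def)
    then show "finite h" using finite_subset by blast
    have "f 0 \<subseteq> {..<n}" "f 0 \<noteq> {}" "r \<le> real (card (f 0))" using E(2)[OF f0] by auto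
    moreover have "card (f 0) \<le> n" using card_mono[OF _ calculation(1)] by simp
    ultimately show "h \<noteq> {}" "r \<le> real (card h)" using that E(2)[of h] by (auto simp: H_def)
  qed
  have finH: "finite H" using E by (simp add: H_def)
  have cardH: "1 \<le> card H" using finH by (simp add: H_def card_gt_0_iff Suc_le_eq)
  have \<eta>2: "0 \<le> \<eta>\<^sup>2" "\<eta>\<^sup>2 \<le> 1" using \<eta> by (auto simp: power_le_one)
  have \<zeta>2: "\<zeta>\<^sup>2 \<le> 1" using \<zeta> by (simp add: power_le_one)
  have v2: "1 \<le> v\<^sup>2" using v by (simp add: one_le_power)
  have k_eq: "\<kappa> = \<zeta>\<^sup>2 / (real (Suc L) * (3072 * v\<^sup>2))" by (simp add: \<kappa>_def \<zeta>_def)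
  have k0: "0 \<le> \<kappa>" unfolding k_eq by simp
  have k1: "\<kappa> \<le> 1 / (3072 * v\<^sup>2)"
  proof -
    have "\<kappa> \<le> 1 / (1 * (3072 * v\<^sup>2))" unfolding k_eq using \<zeta>2 v2 by (intro frac_le mult_right_mono) auto
    then show ?thesis by simp
  qed
  have k2: "\<kappa> \<le> 1"
  proof -
    have "1 / (3072 * v\<^sup>2) \<le> 1 / 1" using v2 by (intro divide_left_mono) auto
    then show ?thesis using k1 by simp
  qed
  have expo: "2 * exp (- x) \<le> b" if "\<kappa> * r * \<eta>\<^sup>2 \<le> x" for x using that by (simp add: b_def)
  have tn: "t < n" if "i \<le> L" "t \<in> sg i" for i t using seg_less[OF that] .
  have sgne: "sg i \<noteq> {}" if "i \<le> L" for i using f[OF that] E(2)[of "f i"] by auto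
  \<comment> \<open>expectations are taken at a representative row of each segment\<close>
  define t0 where "t0 i = (SOME t. t \<in> sg i)" for i
  have t0: "t0 i \<in> sg i" if "i \<le> L" for i unfolding t0_def some_in_eq by (rule sgne[OF that])
  have pS: "pick S p \<in> S" if "p < s" for p using pick_less[OF S that] by simp
  have mc: "expectation (\<lambda>\<omega>. (covariate p t \<omega>)\<^sup>2) \<le> v" if "i \<le> L" "t \<in> sg i" "p < s" for i t p
    unfolding covariate_def by (rule mx[OF that(1,2) pS[OF that(3)]])
  have meas: "covariate p t \<in> borel_measurable M" "form a c t \<in> borel_measurable M" "noise i t \<in> borel_measurable M" if "t < n" for p t a c i
    unfolding covariate_def noise_def using form_measurable[OF that] by auto
  define Q where "Q i p q = expectation (\<lambda>\<omega>. covariate p (t0 i) \<omega> * covariate q (t0 i) \<omega>)" for i p q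
  define part where "part h = (SOME i. i \<le> L \<and> card h \<le> Suc L * card (h \<inter> sg i))" for h
  have part: "part h \<le> L" "card h \<le> Suc L * card (h \<inter> sg (part h))" if "h \<in> H" for h
    using someI_ex[OF large_part[OF H(1)[OF that]]] unfolding part_def by auto
  define hp where "hp h = h \<inter> sg (part h)" for h
  have hp: "hp h \<subseteq> sg (part h)" "hp h \<subseteq> h" "real (card h) \<le> real (Suc L) * real (card (hp h))" if "h \<in> H" for h
  proof -
    show "real (card h) \<le> real (Suc L) * real (card (hp h))"
      using part(2)[OF that] unfolding hp_def of_nat_mult[symmetric] of_nat_le_iff .
  qed (auto simp: hp_def)

  define PA where "PA = (\<lambda>(h, p, q) \<omega>. real (card (hp h)) * \<zeta> \<le> \<bar>(\<Sum>t\<in>hp h. covariate p t \<omega> * covariate q t \<omega>) - real (card (hp h)) * Q (part h) p q\<bar>)"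
  define PB where "PB = (\<lambda>(h, i, p) \<omega>. 16 * v * real (card h) \<le> (\<Sum>t\<in>h \<inter> sg i. (covariate p t \<omega>)\<^sup>2))"
  define PC where "PC = (\<lambda>(i, p) \<omega>. if p < s then real (card (f i)) * \<eta> \<le> \<bar>(\<Sum>t\<in>f i. covariate p t \<omega> * noise i t \<omega>) - real (card (f i)) * 0\<bar>
     else real (card (f i)) * \<eta> \<le> \<bar>(\<Sum>t\<in>f i. noise i t \<omega> * noise i t \<omega>) - real (card (f i)) * (\<sigma> i)\<^sup>2\<bar>)"
  define \<mu> where "\<mu> i = expectation (\<lambda>\<omega>. form 1 (\<lambda>_. 0) (t0 i) \<omega> * form 1 (\<lambda>_. 0) (t0 i) \<omega>)" for i
  define PD where "PD i \<omega> \<longleftrightarrow> real (card (sg i)) * 1 \<le> \<bar>(\<Sum>t\<in>sg i. form 1 (\<lambda>_. 0) t \<omega> * form 1 (\<lambda>_. 0) t \<omega>) - real (card (sg i)) * \<mu> i\<bar>" for i \<omega>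

  have "{\<omega>\<in>space M. \<forall>z\<in>H \<times> ({..<s} \<times> {..<s}). \<not> PA z \<omega>} \<in> events \<and>
     1 - real (card (H \<times> ({..<s} \<times> {..<s}))) * b \<le> prob {\<omega>\<in>space M. \<forall>z\<in>H \<times> ({..<s} \<times> {..<s}). \<not> PA z \<omega>}"
  proof (rule union_bound)
    fix z assume z: "z \<in> H \<times> ({..<s} \<times> {..<s})"
    obtain h p q where zz: "z = (h, p, q)" "h \<in> H" "p < s" "q < s" using z by auto
    have tn': "t < n" if "t \<in> hp h" for t using that hp(1)[OF zz(2)] tn[OF part(1)[OF zz(2)]] by auto
    show "{\<omega>\<in>space M. PA z \<omega>} \<in> events" unfolding zz PA_def using meas[OF tn'] by auto
    have "prob {\<omega>\<in>space M. PA z \<omega>} \<le> 2 * exp (- (real (card (hp h)) * \<zeta>\<^sup>2 / (3072 * v\<^sup>2)))"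
      unfolding zz PA_def prod.case covariate_def
    proof (rule form_concentration[OF part(1)[OF zz(2)] hp(1)[OF zz(2)] v0])
      fix t assume t: "t \<in> hp h"
      then have t': "t \<in> sg (part h)" using hp(1)[OF zz(2)] by auto
      show "expectation (\<lambda>\<omega>. (form 0 (unit_coeff (pick S p)) t \<omega>)\<^sup>2) \<le> v" "expectation (\<lambda>\<omega>. (form 0 (unit_coeff (pick S q)) t \<omega>)\<^sup>2) \<le> v"
        using mx[OF part(1)[OF zz(2)] t'] pS zz by auto
      show "expectation (\<lambda>\<omega>. form 0 (unit_coeff (pick S p)) t \<omega> * form 0 (unit_coeff (pick S q)) t \<omega>) = Q (part h) p q"
        unfolding Q_def covariate_def by (rule expectation_form_same[OF part(1)[OF zz(2)] t' t0[OF part(1)[OF zz(2)]]])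
    qed (use \<zeta> v in auto)
    also have "\<dots> \<le> b"
    proof (rule expo)
      have "\<kappa> * r * \<eta>\<^sup>2 \<le> \<kappa> * r * 1" using \<eta>2 k0 r by (intro mult_left_mono) auto
      also have "\<dots> \<le> \<kappa> * (real (Suc L) * real (card (hp h)))"
        using k0 H(3)[OF zz(2)] hp(3)[OF zz(2)] by (simp only: mult_1_right) (intro mult_left_mono, auto)
      also have "\<dots> = real (card (hp h)) * \<zeta>\<^sup>2 / (3072 * v\<^sup>2)"
        unfolding k_eq using v0 by (simp add: field_simps del: of_nat_Suc)
      finally show "\<kappa> * r * \<eta>\<^sup>2 \<le> real (card (hp h)) * \<zeta>\<^sup>2 / (3072 * v\<^sup>2)" .
    qed
    finally show "prob {\<omega>\<in>space M. PA z \<omega>} \<le> b" .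
  qed (use finH in auto)
  note A = this[THEN conjunct1] this[THEN conjunct2]

  have "{\<omega>\<in>space M. \<forall>z\<in>H \<times> ({..L} \<times> {..<s}). \<not> PB z \<omega>} \<in> events \<and>
     1 - real (card (H \<times> ({..L} \<times> {..<s}))) * b \<le> prob {\<omega>\<in>space M. \<forall>z\<in>H \<times> ({..L} \<times> {..<s}). \<not> PB z \<omega>}"
  proof (rule union_bound)
    fix z assume z: "z \<in> H \<times> ({..L} \<times> {..<s})"
    obtain h i p where zz: "z = (h, i, p)" "h \<in> H" "i \<le> L" "p < s" using z by auto
    have tn': "t < n" if "t \<in> h \<inter> sg i" for t using that tn[OF zz(3)] by auto
    show "{\<omega>\<in>space M. PB z \<omega>} \<in> events" unfolding zz PB_def using meas[OF tn'] by auto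
    have "prob {\<omega>\<in>space M. PB z \<omega>} \<le> exp (- real (card h))"
      unfolding zz PB_def prod.case covariate_def
      by (rule square_sum_upper[OF zz(3) _ v0]) (use mx[OF zz(3) _ pS[OF zz(4)]] H(4)[OF zz(2)] in \<open>auto intro: card_mono\<close>)
    also have "\<dots> \<le> 2 * exp (- real (card h))" by simp
    also have "\<dots> \<le> b"
    proof (rule expo)
      have "\<kappa> * (r * \<eta>\<^sup>2) \<le> 1 * (r * 1)" using \<eta>2 k0 k2 r by (intro mult_mono mult_left_mono) auto
      then show "\<kappa> * r * \<eta>\<^sup>2 \<le> real (card h)" using H(3)[OF zz(2)] by (simp add: mult.assoc)
    qed
    finally show "prob {\<omega>\<in>space M. PB z \<omega>} \<le> b" .
  qed (use finH in auto)
  note B = this[THEN conjunct1] this[THEN conjunct2]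

  have fexp: "2 * exp (- (real (card (f i)) * \<eta>\<^sup>2 / (3072 * v\<^sup>2))) \<le> b" if i: "i \<le> L" for i
  proof (rule expo)
    have "\<kappa> * (r * \<eta>\<^sup>2) \<le> 1 / (3072 * v\<^sup>2) * (real (card (f i)) * \<eta>\<^sup>2)"
      using k1 k0 E(2)[of "f i"] f[OF i] r \<eta>2 by (intro mult_mono mult_right_mono) auto
    then show "\<kappa> * r * \<eta>\<^sup>2 \<le> real (card (f i)) * \<eta>\<^sup>2 / (3072 * v\<^sup>2)" by (simp add: mult.assoc)
  qed
  have \<eta>v: "\<eta> \<le> 96 * v" "1 \<le> 96 * v" using \<eta> v by auto
  have "{\<omega>\<in>space M. \<forall>z\<in>{..L} \<times> {..s}. \<not> PC z \<omega>} \<in> events \<and>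
     1 - real (card ({..L} \<times> {..s})) * b \<le> prob {\<omega>\<in>space M. \<forall>z\<in>{..L} \<times> {..s}. \<not> PC z \<omega>}"
  proof (rule union_bound)
    fix z assume z: "z \<in> {..L} \<times> {..s}"
    obtain i p where zz: "z = (i, p)" "i \<le> L" "p \<le> s" using z by auto
    have fi: "f i \<subseteq> sg i" using f[OF zz(2)] by simp
    have tn': "t < n" if "t \<in> f i" for t using that fi tn[OF zz(2)] by auto
    show "{\<omega>\<in>space M. PC z \<omega>} \<in> events"
    proof (cases "p < s")
      case True
      have "{\<omega>\<in>space M. real (card (f i)) * \<eta> \<le> \<bar>(\<Sum>t\<in>f i. covariate p t \<omega> * noise i t \<omega>) - real (card (f i)) * 0\<bar>} \<in> events"
        using meas[OF tn'] by auto
      then show ?thesis using True by (simp add: zz PC_def)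
    next
      case False
      have "{\<omega>\<in>space M. real (card (f i)) * \<eta> \<le> \<bar>(\<Sum>t\<in>f i. noise i t \<omega> * noise i t \<omega>) - real (card (f i)) * (\<sigma> i)\<^sup>2\<bar>} \<in> events"
        using meas[OF tn'] by auto
      then show ?thesis using False by (simp add: zz PC_def)
    qed
    have n2: "expectation (\<lambda>\<omega>. (form 1 (\<lambda>j. - extend_coeffs S (\<beta> i) j) t \<omega>)\<^sup>2) = (\<sigma> i)\<^sup>2" if "t \<in> f i" for t
      using noise_law(3)[OF zz(2), of t] that fi unfolding noise_def by auto
    have "prob {\<omega>\<in>space M. PC z \<omega>} \<le> 2 * exp (- (real (card (f i)) * \<eta>\<^sup>2 / (3072 * v\<^sup>2)))"
    proof (cases "p < s")
      case True
      have "prob {\<omega>\<in>space M. real (card (f i)) * \<eta> \<le> \<bar>(\<Sum>t\<in>f i. covariate p t \<omega> * noise i t \<omega>) - real (card (f i)) * 0\<bar>}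
        \<le> 2 * exp (- (real (card (f i)) * \<eta>\<^sup>2 / (3072 * v\<^sup>2)))"
        unfolding covariate_def noise_def
      proof (rule form_concentration[OF zz(2) fi v0])
        fix t assume t: "t \<in> f i"
        then have t': "t \<in> sg i" using fi by auto
        show "expectation (\<lambda>\<omega>. (form 0 (unit_coeff (pick S p)) t \<omega>)\<^sup>2) \<le> v" by (rule mx[OF zz(2) t' pS[OF True]])
        show "expectation (\<lambda>\<omega>. (form 1 (\<lambda>j. - extend_coeffs S (\<beta> i) j) t \<omega>)\<^sup>2) \<le> v" using n2[OF t] ms[OF zz(2)] by simp
        show "expectation (\<lambda>\<omega>. form 0 (unit_coeff (pick S p)) t \<omega> * form 1 (\<lambda>j. - extend_coeffs S (\<beta> i) j) t \<omega>) = 0"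
          using noise_law(4)[OF zz(2) t' pS[OF True]] unfolding noise_def .
      qed (use \<eta> \<eta>v in auto)
      then show ?thesis using True by (simp add: zz PC_def)
    next
      case False
      have "prob {\<omega>\<in>space M. real (card (f i)) * \<eta> \<le> \<bar>(\<Sum>t\<in>f i. noise i t \<omega> * noise i t \<omega>) - real (card (f i)) * (\<sigma> i)\<^sup>2\<bar>}
        \<le> 2 * exp (- (real (card (f i)) * \<eta>\<^sup>2 / (3072 * v\<^sup>2)))"
        unfolding noise_def
        by (rule form_concentration[OF zz(2) fi v0]) (use n2 ms[OF zz(2)] \<eta> \<eta>v in \<open>auto simp: power2_eq_square\<close>)
      then show ?thesis using False by (simp add: zz PC_def)
    qed
    also have "\<dots> \<le> b" by (rule fexp[OF zz(2)])
    finally show "prob {\<omega>\<in>space M. PC z \<omega>} \<le> b" .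
  qed auto
  note C = this[THEN conjunct1] this[THEN conjunct2]

  have "{\<omega>\<in>space M. \<forall>i\<in>{..L}. \<not> PD i \<omega>} \<in> events \<and>
     1 - real (card {..L}) * b \<le> prob {\<omega>\<in>space M. \<forall>i\<in>{..L}. \<not> PD i \<omega>}"
  proof (rule union_bound)
    fix i assume "i \<in> {..L}"
    then have i: "i \<le> L" by simp
    show "{\<omega>\<in>space M. PD i \<omega>} \<in> events" unfolding PD_def using meas[OF tn[OF i]] by auto
    have "prob {\<omega>\<in>space M. PD i \<omega>} \<le> 2 * exp (- (real (card (sg i)) * 1\<^sup>2 / (3072 * v\<^sup>2)))"
      unfolding PD_def \<mu>_def
      by (rule form_concentration[OF i order.refl v0]) (use my[OF i] expectation_form_same[OF i _ t0[OF i]] \<eta>v in auto)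
    also have "\<dots> \<le> 2 * exp (- (real (card (f i)) * \<eta>\<^sup>2 / (3072 * v\<^sup>2)))"
    proof -
      have "real (card (f i)) * \<eta>\<^sup>2 \<le> real (card (sg i)) * 1\<^sup>2"
        using \<eta>2 f[OF i] finite_seg[OF i] by (intro mult_mono) (auto intro: card_mono)
      then show ?thesis using v0 by (simp add: divide_right_mono)
    qed
    also have "\<dots> \<le> b" by (rule fexp[OF i])
    finally show "prob {\<omega>\<in>space M. PD i \<omega>} \<le> b" .
  qed auto
  note D = this[THEN conjunct1] this[THEN conjunct2]

  define G where "G = ({\<omega>\<in>space M. \<forall>z\<in>H \<times> ({..<s} \<times> {..<s}). \<not> PA z \<omega>} \<inter> {\<omega>\<in>space M. \<forall>z\<in>H \<times> ({..L} \<times> {..<s}). \<not> PB z \<omega>})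
    \<inter> ({\<omega>\<in>space M. \<forall>z\<in>{..L} \<times> {..s}. \<not> PC z \<omega>} \<inter> {\<omega>\<in>space M. \<forall>i\<in>{..L}. \<not> PD i \<omega>})"
  note AB = prob_Int_ge[OF A(1) B(1) A(2) B(2)] and CD = prob_Int_ge[OF C(1) D(1) C(2) D(2)]
  note ABCD = prob_Int_ge[OF AB(1) CD(1) AB(2) CD(2), folded G_def]
  have b0: "0 \<le> b" by (simp add: b_def)
  have "prob G \<ge> 1 - real (card H * C0) * b"
  proof -
    have "real (card (H \<times> ({..<s} \<times> {..<s}))) + real (card (H \<times> ({..L} \<times> {..<s}))) + (real (card ({..L} \<times> {..s})) + real (card {..L}))
      \<le> real (card H * C0)"
    proof -
      have "Suc L * Suc s + Suc L \<le> card H * (Suc L * Suc s + Suc L)" using cardH by (metis mult_le_mono1 nat_mult_1)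
      then have "card H * (s * s) + card H * (Suc L * s) + (Suc L * Suc s + Suc L) \<le> card H * C0"
        unfolding C0_def by (simp add: distrib_left)
      then show ?thesis by (simp only: card_cartesian_product card_lessThan card_atMost of_nat_le_iff flip: of_nat_add)
    qed
    from mult_right_mono[OF this b0] show ?thesis using ABCD(2) by (simp only: distrib_right)
  qed
  moreover have "(\<forall>h\<in>H. row_set (xs \<omega>) n s h (c1 / (2 * real (Suc L)))) \<and>
       (\<forall>h\<in>H. \<forall>p<s. (\<Sum>t\<in>h. (xs \<omega> $$ (t, p))\<^sup>2) \<le> card h * (16 * v * real (Suc L))) \<and>
       (\<forall>i\<le>L. noise_like (xs \<omega>) (f i) \<eta> ((\<sigma> i)\<^sup>2) (\<lambda>t. Y \<omega> $ t - row (xs \<omega>) t \<bullet> \<beta> i)) \<and>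
       (\<Sum>t<n. (Y \<omega> $ t)\<^sup>2) \<le> n * (2 * v)" if G: "\<omega> \<in> G" for \<omega>
  proof (intro conjI ballI allI impI)
    have \<omega>: "\<omega> \<in> space M" and nA: "\<And>z. z \<in> H \<times> ({..<s} \<times> {..<s}) \<Longrightarrow> \<not> PA z \<omega>" and nB: "\<And>z. z \<in> H \<times> ({..L} \<times> {..<s}) \<Longrightarrow> \<not> PB z \<omega>"
      and nC: "\<And>z. z \<in> {..L} \<times> {..s} \<Longrightarrow> \<not> PC z \<omega>" and nD: "\<And>i. i \<in> {..L} \<Longrightarrow> \<not> PD i \<omega>"
      using G by (auto simp only: G_def Int_iff mem_Collect_eq)
    fix h assume h: "h \<in> H"
    have "pos_gram (xs \<omega>) h (c1 / (2 * real (Suc L)))"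
      unfolding pos_gram_def
    proof
      fix u :: "real vec" assume "u \<in> carrier_vec (dim_col (xs \<omega>))"
      then have u: "u \<in> carrier_vec s" using xs_carrier[OF \<omega>] by simp
      define m where "m = real (card (hp h))"
      define i where "i = part h"
      have iL: "i \<le> L" unfolding i_def by (rule part(1)[OF h])
      define U where "U p q = (\<Sum>t\<in>hp h. covariate p t \<omega> * covariate q t \<omega>)" for p q
      have dev: "\<bar>U p q - m * Q i p q\<bar> \<le> m * \<zeta>" if "p < s" "q < s" for p q
        using nA[of "(h, p, q)"] h that by (simp add: PA_def U_def m_def i_def)
      have rowu: "row (xs \<omega>) t \<bullet> u = (\<Sum>p<s. u $ p * covariate p t \<omega>)" if "t < n" for t
        unfolding row_scalar_prod[OF xs_carrier[OF \<omega>] u that] by (intro sum.cong refl) (simp add: covariate_eq[OF \<omega> that])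
      have hn: "t < n" if "t \<in> hp h" for t using that hp(2)[OF h] H(1)[OF h] by auto
      have "(\<Sum>t\<in>hp h. (row (xs \<omega>) t \<bullet> u)\<^sup>2) = (\<Sum>t\<in>hp h. \<Sum>p<s. \<Sum>q<s. u $ p * u $ q * (covariate p t \<omega> * covariate q t \<omega>))"
        by (intro sum.cong refl) (simp add: rowu[OF hn] power2_eq_square sum_product mult_ac)
      also have "\<dots> = (\<Sum>p<s. \<Sum>t\<in>hp h. \<Sum>q<s. u $ p * u $ q * (covariate p t \<omega> * covariate q t \<omega>))" by (rule sum.swap)
      also have "\<dots> = (\<Sum>p<s. \<Sum>q<s. \<Sum>t\<in>hp h. u $ p * u $ q * (covariate p t \<omega> * covariate q t \<omega>))" by (intro sum.cong refl sum.swap)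
      also have "\<dots> = (\<Sum>p<s. \<Sum>q<s. u $ p * u $ q * U p q)" by (simp add: U_def sum_distrib_left)
      finally have S1: "(\<Sum>t\<in>hp h. (row (xs \<omega>) t \<bullet> u)\<^sup>2) = (\<Sum>p<s. \<Sum>q<s. u $ p * u $ q * U p q)" .
      have "(\<Sum>p<s. \<Sum>q<s. u $ p * u $ q * Q i p q) = expectation (\<lambda>\<omega>'. (form 0 (extend_coeffs S u) (t0 i) \<omega>')\<^sup>2)"
      proof -
        have int: "integrable M (\<lambda>\<omega>'. covariate p (t0 i) \<omega>' * covariate q (t0 i) \<omega>')" if "p < s" "q < s" for p q
          by (rule gaussian_product(1)[OF _ mc[OF iL t0[OF iL] that(1)] _ mc[OF iL t0[OF iL] that(2)] v0])
            (auto simp: covariate_def intro: form_gaussian[OF iL t0[OF iL]])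
        have "(form 0 (extend_coeffs S u) (t0 i) \<omega>')\<^sup>2 = (\<Sum>p<s. \<Sum>q<s. u $ p * u $ q * (covariate p (t0 i) \<omega>' * covariate q (t0 i) \<omega>'))" for \<omega>'
        proof -
          have "form 0 (extend_coeffs S u) (t0 i) \<omega>' = (\<Sum>p<s. u $ p * X \<omega>' $$ (t0 i, pick S p))"
            unfolding form_def extend_coeffs_sums(1)[OF S u] by simp
          also have "\<dots> = (\<Sum>p<s. u $ p * covariate p (t0 i) \<omega>')"
            using pick_less[OF S] by (intro sum.cong refl) (simp add: covariate_def form_covariate)
          finally show ?thesis by (simp add: power2_eq_square sum_product mult_ac)
        qed
        then have "expectation (\<lambda>\<omega>'. (form 0 (extend_coeffs S u) (t0 i) \<omega>')\<^sup>2)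
          = expectation (\<lambda>\<omega>'. \<Sum>p<s. \<Sum>q<s. u $ p * u $ q * (covariate p (t0 i) \<omega>' * covariate q (t0 i) \<omega>'))" by simp
        also have "\<dots> = (\<Sum>p<s. expectation (\<lambda>\<omega>'. \<Sum>q<s. u $ p * u $ q * (covariate p (t0 i) \<omega>' * covariate q (t0 i) \<omega>')))"
          by (rule Bochner_Integration.integral_sum) (auto intro!: Bochner_Integration.integrable_sum integrable_mult_right int)
        also have "\<dots> = (\<Sum>p<s. \<Sum>q<s. expectation (\<lambda>\<omega>'. u $ p * u $ q * (covariate p (t0 i) \<omega>' * covariate q (t0 i) \<omega>')))"
          by (intro sum.cong refl Bochner_Integration.integral_sum integrable_mult_right int) auto
        finally show ?thesis by (simp add: Q_def)
      qed
      with low[OF iL t0[OF iL] u] have Qlow: "c1 * (l2norm u)\<^sup>2 \<le> (\<Sum>p<s. \<Sum>q<s. u $ p * u $ q * Q i p q)" by simp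
      define a where "a p = \<bar>u $ p\<bar>" for p
      have trm: "m * (u $ p * u $ q * Q i p q) - m * \<zeta> * (a p * a q) \<le> u $ p * u $ q * U p q" if "p < s" "q < s" for p q
      proof -
        have "\<bar>(u $ p * u $ q) * (U p q - m * Q i p q)\<bar> \<le> (a p * a q) * (m * \<zeta>)"
          unfolding abs_mult a_def using dev[OF that] by (intro mult_left_mono) auto
        then have "- ((a p * a q) * (m * \<zeta>)) \<le> (u $ p * u $ q) * (U p q - m * Q i p q)" by linarith
        then show ?thesis by (simp add: algebra_simps)
      qed
      have "(\<Sum>p<s. \<Sum>q<s. m * (u $ p * u $ q * Q i p q) - m * \<zeta> * (a p * a q)) \<le> (\<Sum>p<s. \<Sum>q<s. u $ p * u $ q * U p q)"
        by (intro sum_mono trm) auto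
      moreover have "(\<Sum>p<s. \<Sum>q<s. m * (u $ p * u $ q * Q i p q) - m * \<zeta> * (a p * a q)) = m * (\<Sum>p<s. \<Sum>q<s. u $ p * u $ q * Q i p q) - m * \<zeta> * (\<Sum>p<s. a p)\<^sup>2"
      proof -
        have "(\<Sum>p<s. a p)\<^sup>2 = (\<Sum>p<s. \<Sum>q<s. a p * a q)" by (simp only: power2_eq_square sum_product)
        then show ?thesis by (simp only: sum_subtractf sum_distrib_left)
      qed
      moreover have "(\<Sum>p<s. a p)\<^sup>2 \<le> s * (l2norm u)\<^sup>2"
        using Cauchy_Schwarz_ineq_sum[of "\<lambda>_. 1" a "{..<s}"] u by (simp add: l2norm_sq a_def)
      ultimately have "m * (\<Sum>p<s. \<Sum>q<s. u $ p * u $ q * Q i p q) - m * \<zeta> * (s * (l2norm u)\<^sup>2) \<le> (\<Sum>t\<in>hp h. (row (xs \<omega>) t \<bullet> u)\<^sup>2)"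
        unfolding S1 using mult_left_mono[of "(\<Sum>p<s. a p)\<^sup>2" "s * (l2norm u)\<^sup>2" "m * \<zeta>"] \<zeta> by (simp add: m_def)
      moreover have "m * (c1 * (l2norm u)\<^sup>2) \<le> m * (\<Sum>p<s. \<Sum>q<s. u $ p * u $ q * Q i p q)" using Qlow by (intro mult_left_mono) (auto simp: m_def)
      moreover have "m * \<zeta> * (s * (l2norm u)\<^sup>2) = m * (c1 / 2) * (l2norm u)\<^sup>2" using s by (simp add: \<zeta>_def)
      moreover have "m * (c1 * (l2norm u)\<^sup>2) = m * (c1 / 2) * (l2norm u)\<^sup>2 + m * (c1 / 2) * (l2norm u)\<^sup>2" by (simp add: algebra_simps)
      ultimately have "m * (c1 / 2) * (l2norm u)\<^sup>2 \<le> (\<Sum>t\<in>hp h. (row (xs \<omega>) t \<bullet> u)\<^sup>2)" by linarith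
      also have "\<dots> \<le> (\<Sum>t\<in>h. (row (xs \<omega>) t \<bullet> u)\<^sup>2)"
        using hp(2)[OF h] H(4)[OF h] by (intro sum_mono2) auto
      finally have "m * (c1 / 2) * (l2norm u)\<^sup>2 \<le> (\<Sum>t\<in>h. (row (xs \<omega>) t \<bullet> u)\<^sup>2)" .
      moreover have "real (card h) * (c1 / (2 * real (Suc L))) * (l2norm u)\<^sup>2 \<le> m * (c1 / 2) * (l2norm u)\<^sup>2"
      proof (rule mult_right_mono)
        have "real (card h) * (c1 / (2 * real (Suc L))) \<le> (real (Suc L) * m) * (c1 / (2 * real (Suc L)))"
          using hp(3)[OF h] c1 by (intro mult_right_mono) (auto simp: m_def)
        also have "\<dots> = m * (c1 / 2)" by (simp del: of_nat_Suc)
        finally show "real (card h) * (c1 / (2 * real (Suc L))) \<le> m * (c1 / 2)" .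
      qed simp
      ultimately show "real (card h) * (c1 / (2 * real (Suc L))) * (l2norm u)\<^sup>2 \<le> (\<Sum>t\<in>h. (row (xs \<omega>) t \<bullet> u)\<^sup>2)" by linarith
    qed
    then show "row_set (xs \<omega>) n s h (c1 / (2 * real (Suc L)))"
      using xs_carrier[OF \<omega>] H[OF h] c1 by unfold_locales auto
    fix p assume p: "p < s"
    have hn: "t < n" if "t \<in> h" for t using that H(1)[OF h] by auto
    have "(\<Sum>t\<in>h. (xs \<omega> $$ (t, p))\<^sup>2) = (\<Sum>t\<in>h. (covariate p t \<omega>)\<^sup>2)" by (intro sum.cong refl) (simp add: covariate_eq[OF \<omega> hn p])
    also have "\<dots> = (\<Sum>i\<le>L. \<Sum>t\<in>h \<inter> sg i. (covariate p t \<omega>)\<^sup>2)" by (rule sum_over_segments[OF H(1)[OF h]])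
    also have "\<dots> \<le> (\<Sum>i\<le>L. 16 * v * real (card h))"
    proof (rule sum_mono)
      fix i assume "i \<in> {..L}"
      then show "(\<Sum>t\<in>h \<inter> sg i. (covariate p t \<omega>)\<^sup>2) \<le> 16 * v * real (card h)" using nB[of "(h, i, p)"] h p by (simp add: PB_def)
    qed
    also have "\<dots> = card h * (16 * v * real (Suc L))" by simp
    finally show "(\<Sum>t\<in>h. (xs \<omega> $$ (t, p))\<^sup>2) \<le> card h * (16 * v * real (Suc L))" .
  next
    have \<omega>: "\<omega> \<in> space M" and nC: "\<And>z. z \<in> {..L} \<times> {..s} \<Longrightarrow> \<not> PC z \<omega>"
      using G by (auto simp only: G_def Int_iff mem_Collect_eq)
    fix i assume i: "i \<le> L"
    have fi: "t < n" if "t \<in> f i" for t using that f[OF i] tn[OF i] by auto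
    have nz: "Y \<omega> $ t - row (xs \<omega>) t \<bullet> \<beta> i = noise i t \<omega>" if "t \<in> f i" for t using noise_eq[OF \<omega> fi[OF that] i] by simp
    have "\<bar>\<Sum>t\<in>f i. xs \<omega> $$ (t, p) * (Y \<omega> $ t - row (xs \<omega>) t \<bullet> \<beta> i)\<bar> < real (card (f i)) * \<eta>" if p: "p < s" for p
    proof -
      have "(\<Sum>t\<in>f i. xs \<omega> $$ (t, p) * (Y \<omega> $ t - row (xs \<omega>) t \<bullet> \<beta> i)) = (\<Sum>t\<in>f i. covariate p t \<omega> * noise i t \<omega>)"
        by (intro sum.cong refl) (simp add: nz covariate_eq[OF \<omega> fi p])
      then show ?thesis using nC[of "(i, p)"] i p by (simp add: PC_def not_le)
    qed
    moreover have "(\<Sum>t\<in>f i. (Y \<omega> $ t - row (xs \<omega>) t \<bullet> \<beta> i)\<^sup>2) = (\<Sum>t\<in>f i. noise i t \<omega> * noise i t \<omega>)"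
      by (intro sum.cong refl) (simp add: nz power2_eq_square)
    then have "\<bar>(\<Sum>t\<in>f i. (Y \<omega> $ t - row (xs \<omega>) t \<bullet> \<beta> i)\<^sup>2) - real (card (f i)) * (\<sigma> i)\<^sup>2\<bar> < real (card (f i)) * \<eta>"
      using nC[of "(i, s)"] i by (simp add: PC_def not_le)
    ultimately show "noise_like (xs \<omega>) (f i) \<eta> ((\<sigma> i)\<^sup>2) (\<lambda>t. Y \<omega> $ t - row (xs \<omega>) t \<bullet> \<beta> i)"
      using xs_carrier[OF \<omega>] by (simp add: noise_like_def)
  next
    have nD: "\<And>i. i \<in> {..L} \<Longrightarrow> \<not> PD i \<omega>" using G by (auto simp only: G_def Int_iff mem_Collect_eq)
    have "(\<Sum>t<n. (Y \<omega> $ t)\<^sup>2) = (\<Sum>i\<le>L. \<Sum>t\<in>{..<n} \<inter> sg i. (Y \<omega> $ t)\<^sup>2)" by (rule sum_over_segments) simp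
    also have "\<dots> \<le> (\<Sum>i\<le>L. \<Sum>t\<in>{..<n} \<inter> sg i. 2 * v)"
    proof (rule sum_mono)
      fix i assume i: "i \<in> {..L}"
      then have iL: "i \<le> L" by simp
      have eq: "{..<n} \<inter> sg i = sg i" using seg_less[OF iL] by auto
      have "\<mu> i \<le> v" using my[OF iL t0[OF iL]] by (simp add: \<mu>_def power2_eq_square)
      then have "real (card (sg i)) * \<mu> i \<le> real (card (sg i)) * v" by (rule mult_left_mono) simp
      moreover have "real (card (sg i)) * 1 \<le> real (card (sg i)) * v" using v by (rule mult_left_mono) simp
      moreover have "\<bar>(\<Sum>t\<in>sg i. Y \<omega> $ t * Y \<omega> $ t) - real (card (sg i)) * \<mu> i\<bar> < real (card (sg i)) * 1"
        using nD[OF i] by (simp add: PD_def form_response not_le)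
      ultimately have "(\<Sum>t\<in>sg i. Y \<omega> $ t * Y \<omega> $ t) \<le> real (card (sg i)) * v + real (card (sg i)) * v" by linarith
      then show "(\<Sum>t\<in>{..<n} \<inter> sg i. (Y \<omega> $ t)\<^sup>2) \<le> (\<Sum>t\<in>{..<n} \<inter> sg i. 2 * v)"
        unfolding eq by (simp add: power2_eq_square mult_ac)
    qed
    also have "\<dots> = (\<Sum>t<n. 2 * v)" by (rule sum_over_segments[symmetric]) simp
    also have "\<dots> = n * (2 * v)" by simp
    finally show "(\<Sum>t<n. (Y \<omega> $ t)\<^sup>2) \<le> n * (2 * v)" .
  qed
  ultimately show ?thesis using ABCD(1) unfolding b_def by blast
qed

end

section \<open>Power at a fixed sample size\<close>

lemma below_prob_ge:
  assumes x: "x \<in> carrier_mat n s" and E: "E \<subseteq> Pow {..<n}" and T: "T = T1_max E \<or> T = T2_max E"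
    and A: "A \<in> sets (std_normal_vec n)" and less: "\<And>e. e \<in> A \<Longrightarrow> \<bar>T x (scaled_residual x (vec n e))\<bar> < \<bar>T x (scaled_residual x y)\<bar>"
  shows "measure (std_normal_vec n) A \<le> below_prob T n x y"
proof -
  let ?N = "std_normal_vec n"
  interpret EN: prob_space ?N by (rule prob_space_std_normal_vec)
  have xm: "measurable_mat ?N n s (\<lambda>_. x)" using x by (auto simp: measurable_mat_def)
  have id: "(\<lambda>e. e) \<in> measurable ?N (Pi\<^sub>M {..<n} (\<lambda>_. borel))"
    by (rule measurable_ident_sets[OF sets_std_normal_vec])
  have ym: "measurable_vec ?N n (\<lambda>e. scaled_residual x (vec n e))"
    by (rule measurable_scaled_residual[OF xm measurable_vec_PiM[OF id]])
  have [measurable]: "(\<lambda>e. T x (scaled_residual x (vec n e))) \<in> borel_measurable ?N"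
    using measurable_T_max[OF xm ym E] T by auto
  have "A \<subseteq> {e\<in>space ?N. \<bar>T x (scaled_residual x (vec n e))\<bar> < \<bar>T x (scaled_residual x y)\<bar>}"
    using less sets.sets_into_space[OF A] by auto
  then show ?thesis unfolding below_prob_def by (intro EN.finite_measure_mono) auto
qed

context segmented_sample
begin

text \<open>
  On a good sample, all resampled noise vectors that are noise-like on every row set have smaller
  statistics than the data, by the assumption \<open>gap\<close>, which compares the upper bound for resampled
  noise with the lower bound for the data for one of the two statistics. By the assumption
  \<open>small\<close>, such vectors have probability more than \<open>1 - \<alpha> / 2\<close>.
\<close>

lemma power_lower_bound:
  fixes v c1 r \<eta> p :: real
  assumes E: "E \<subseteq> Pow {..<n}" "{} \<notin> E" "\<And>h. h \<in> E \<Longrightarrow> r \<le> real (card h)"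
    and f: "\<And>i. i \<le> L \<Longrightarrow> f i \<in> E \<and> f i \<subseteq> sg i"
    and v: "1 \<le> v" and mx: "\<And>i t k. i \<le> L \<Longrightarrow> t \<in> sg i \<Longrightarrow> k \<in> S \<Longrightarrow> expectation (\<lambda>\<omega>. (form 0 (unit_coeff k) t \<omega>)\<^sup>2) \<le> v"
    and my: "\<And>i t. i \<le> L \<Longrightarrow> t \<in> sg i \<Longrightarrow> expectation (\<lambda>\<omega>. (form 1 (\<lambda>_. 0) t \<omega>)\<^sup>2) \<le> v"
    and ms: "\<And>i. i \<le> L \<Longrightarrow> (\<sigma> i)\<^sup>2 \<le> v"
    and c1: "0 < c1" "c1 \<le> 1" and low: "\<And>i t u. i \<le> L \<Longrightarrow> t \<in> sg i \<Longrightarrow> u \<in> carrier_vec s \<Longrightarrow>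
      c1 * (l2norm u)\<^sup>2 \<le> expectation (\<lambda>\<omega>. (form 0 (extend_coeffs S u) t \<omega>)\<^sup>2)"
    and \<eta>: "0 < \<eta>" "\<eta> \<le> 1" and r: "0 \<le> r" and s: "0 < s"
    and \<kappa>: "0 \<le> \<kappa>" "\<kappa> \<le> (c1 / (2 * s))\<^sup>2 / (real (Suc L) * (3072 * v\<^sup>2))" "\<kappa> \<le> 1 / (2 * (16 * v * real (Suc L)))" "\<kappa> \<le> 1 / 3072"
    and c2: "c2 = c1 / (2 * real (Suc L))" and \<rho>: "\<rho> = \<eta> + s * \<eta>\<^sup>2 / c2" "\<rho> \<le> 1 / 2"
    and ij: "i \<le> L" "j \<le> L" "i \<noteq> j"
    and gap: "2 * sqrt 2 * sqrt s * \<eta> / (c2 * sqrt n) < (l2norm (\<beta> i - \<beta> j) - 2 * sqrt s * \<eta> / c2) / sqrt (n * (2 * v))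
      \<or> \<rho> < (\<sigma> j)\<^sup>2 \<and> \<rho> < (\<sigma> i)\<^sup>2 \<and> 4 * \<rho> < ((\<sigma> i)\<^sup>2 - (\<sigma> j)\<^sup>2 - 2 * \<rho>) / ((\<sigma> j)\<^sup>2 + \<rho>)"
    and small: "real (card (insert {..<n} E) * Suc s) * (2 * exp (- (\<kappa> * r * \<eta>\<^sup>2))) < \<alpha> / 2"
    and p: "\<forall>G\<in>events. (\<forall>\<omega>\<in>G. 1 - \<alpha> / 2 < below_prob (T1_max E) n (xs \<omega>) (Y \<omega>)
          \<or> 1 - \<alpha> / 2 < below_prob (T2_max E) n (xs \<omega>) (Y \<omega>)) \<longrightarrow> prob G \<le> p"
  shows "1 - real (card (insert {..<n} E) * (s * s + Suc L * s + Suc L * Suc s + Suc L)) * (2 * exp (- (\<kappa> * r * \<eta>\<^sup>2))) \<le> p"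
proof -
  define H where "H = insert {..<n} E"
  define V where "V = 16 * v * real (Suc L)"
  define C0 where "C0 = s * s + Suc L * s + Suc L * Suc s + Suc L"
  define \<kappa>1 where "\<kappa>1 = (c1 / (2 * s))\<^sup>2 / (real (Suc L) * (3072 * v\<^sup>2))"
  have finE: "finite E" using E(1) by (rule finite_subset) simp
  then have finH: "finite H" by (simp add: H_def)
  have Eh: "h \<subseteq> {..<n} \<and> h \<noteq> {} \<and> r \<le> real (card h)" if "h \<in> E" for h using E that by auto
  have V0: "0 < V" using v by (simp add: V_def)
  have c20: "0 < c2" using c1 by (simp add: c2)
  have f0: "f 0 \<in> E" using f by simp
  have Hh: "h \<subseteq> {..<n} \<and> h \<noteq> {} \<and> r \<le> real (card h)" if "h \<in> H" for h
  proof -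
    have "card (f 0) \<le> n" using card_mono[of "{..<n}" "f 0"] Eh[OF f0] by simp
    then show ?thesis using that Eh[OF f0] Eh[of h] by (auto simp: H_def)
  qed
  have fin_f: "finite (f i)" if "i \<le> L" for i using f[OF that] Eh[of "f i"] finite_subset by blast
  have F1: "(f i, f j) \<in> F1 E" if "i \<le> L" "j \<le> L" "i \<noteq> j" for i j
  proof -
    have "sg i \<inter> sg j = {}" using disj that by (auto simp: disjoint_family_on_def)
    then show ?thesis using f[OF that(1)] f[OF that(2)] by (auto simp: F1_def)
  qed
  have "\<exists>G\<in>events. 1 - real (card H * C0) * (2 * exp (- (\<kappa>1 * r * \<eta>\<^sup>2))) \<le> prob G \<and>
    (\<forall>\<omega>\<in>G. (\<forall>h\<in>H. row_set (xs \<omega>) n s h c2) \<and>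
       (\<forall>h\<in>H. \<forall>p<s. (\<Sum>t\<in>h. (xs \<omega> $$ (t, p))\<^sup>2) \<le> card h * V) \<and>
       (\<forall>i\<le>L. noise_like (xs \<omega>) (f i) \<eta> ((\<sigma> i)\<^sup>2) (\<lambda>t. Y \<omega> $ t - row (xs \<omega>) t \<bullet> \<beta> i)) \<and>
       (\<Sum>t<n. (Y \<omega> $ t)\<^sup>2) \<le> n * (2 * v))"
    unfolding H_def V_def C0_def \<kappa>1_def c2
    by (rule good_sample) (assumption | rule finE Eh f v mx my ms c1 low \<eta> r s)+
  then obtain G where G: "G \<in> events" "1 - real (card H * C0) * (2 * exp (- (\<kappa>1 * r * \<eta>\<^sup>2))) \<le> prob G"
    and good: "\<forall>\<omega>\<in>G. (\<forall>h\<in>H. row_set (xs \<omega>) n s h c2) \<and>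
       (\<forall>h\<in>H. \<forall>p<s. (\<Sum>t\<in>h. (xs \<omega> $$ (t, p))\<^sup>2) \<le> card h * V) \<and>
       (\<forall>i\<le>L. noise_like (xs \<omega>) (f i) \<eta> ((\<sigma> i)\<^sup>2) (\<lambda>t. Y \<omega> $ t - row (xs \<omega>) t \<bullet> \<beta> i)) \<and>
       (\<Sum>t<n. (Y \<omega> $ t)\<^sup>2) \<le> n * (2 * v)"
    by (elim bexE conjE) 
  have "1 - \<alpha> / 2 < below_prob (T1_max E) n (xs \<omega>) (Y \<omega>) \<or> 1 - \<alpha> / 2 < below_prob (T2_max E) n (xs \<omega>) (Y \<omega>)"
    if \<omega>G: "\<omega> \<in> G" for \<omega>
  proof -
    have \<omega>: "\<omega> \<in> space M" using \<omega>G sets.sets_into_space[OF G(1)] by auto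
    define x where "x = xs \<omega>"
    have xc: "x \<in> carrier_mat n s" unfolding x_def by (rule xs_carrier[OF \<omega>])
    have rs: "\<And>h. h \<in> H \<Longrightarrow> row_set x n s h c2" and sq: "\<And>h p. h \<in> H \<Longrightarrow> p < s \<Longrightarrow> (\<Sum>t\<in>h. (x $$ (t, p))\<^sup>2) \<le> card h * V"
      and nz: "\<And>i. i \<le> L \<Longrightarrow> noise_like x (f i) \<eta> ((\<sigma> i)\<^sup>2) (\<lambda>t. Y \<omega> $ t - row x t \<bullet> \<beta> i)"
      and Ysq: "(\<Sum>t<n. (Y \<omega> $ t)\<^sup>2) \<le> n * (2 * v)"
      using bspec[OF good \<omega>G] unfolding x_def by blast+
    define A where "A = {e\<in>space (std_normal_vec n). \<forall>h\<in>H. noise_like x h \<eta> 1 e}"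
    note R = resampled_noise_like[OF xc finH Hh V0 sq \<eta> \<kappa>(3)[folded V_def] \<kappa>(4) \<kappa>(1), folded A_def]
    have A1: "1 - \<alpha> / 2 < measure (std_normal_vec n) A"
      using R(1) small unfolding H_def[symmetric] by linarith
    have HE: "insert {..<n} E = H" by (simp add: H_def)
    have F1ne: "F1 E \<noteq> {}" using F1[OF ij] by blast
    have small_e: "\<bar>T1_max E x (scaled_residual x (vec n e))\<bar> \<le> 2 * sqrt 2 * sqrt s * \<eta> / (c2 * sqrt n)"
      "\<bar>T2_max E x (scaled_residual x (vec n e))\<bar> \<le> 4 * \<rho>" if "e \<in> A" for e
      using resampled_statistics_small[OF E(1) F1ne, of x s c2 \<eta> e, unfolded HE, OF rs _ \<eta>(1)] that \<rho> by (auto simp: A_def)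
    have fH: "f i \<in> H" "f j \<in> H" "{..<n} \<in> H" using f ij by (auto simp: H_def)
    have v2: "0 < 2 * v" using v by simp
    note DL = data_statistics_large[OF E(1) F1[OF ij] rs[OF fH(3)] rs[OF fH(1)] rs[OF fH(2)] Y_carrier[OF \<omega>] v2 Ysq
        beta_carrier[OF ij(1)] beta_carrier[OF ij(2)] nz[OF ij(1)] nz[OF ij(2)] \<eta>(1), folded \<rho>(1)]
    interpret N: row_set x n s "{..<n}" c2 by (rule rs[OF fH(3)])
    have n0: "0 < n" using N.card_h by simp
    from gap show ?thesis
    proof
      assume g: "2 * sqrt 2 * sqrt s * \<eta> / (c2 * sqrt n) < (l2norm (\<beta> i - \<beta> j) - 2 * sqrt s * \<eta> / c2) / sqrt (n * (2 * v))"
      have "0 \<le> 2 * sqrt 2 * sqrt s * \<eta> / (c2 * sqrt n)" using c20 \<eta> by simp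
      with g have "0 < (l2norm (\<beta> i - \<beta> j) - 2 * sqrt s * \<eta> / c2) / sqrt (n * (2 * v))" by linarith
      moreover have "0 < sqrt (n * (2 * v))" using n0 v by simp
      ultimately have "0 < l2norm (\<beta> i - \<beta> j) - 2 * sqrt s * \<eta> / c2" by (simp only: zero_less_divide_iff) linarith
      from DL(1)[OF this] have "\<bar>T1_max E x (scaled_residual x (vec n e))\<bar> < \<bar>T1_max E x (scaled_residual x (Y \<omega>))\<bar>" if "e \<in> A" for e
        using small_e(1)[OF that] g by linarith
      then have "measure (std_normal_vec n) A \<le> below_prob (T1_max E) n x (Y \<omega>)"
        by (intro below_prob_ge[OF xc E(1) _ R(2)]) auto
      then show ?thesis using A1 by (simp add: x_def)
    next
      assume g: "\<rho> < (\<sigma> j)\<^sup>2 \<and> \<rho> < (\<sigma> i)\<^sup>2 \<and> 4 * \<rho> < ((\<sigma> i)\<^sup>2 - (\<sigma> j)\<^sup>2 - 2 * \<rho>) / ((\<sigma> j)\<^sup>2 + \<rho>)"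
      have "\<bar>T2_max E x (scaled_residual x (vec n e))\<bar> < \<bar>T2_max E x (scaled_residual x (Y \<omega>))\<bar>" if "e \<in> A" for e
        using small_e(2)[OF that] g DL(2) by linarith
      then have "measure (std_normal_vec n) A \<le> below_prob (T2_max E) n x (Y \<omega>)"
        by (intro below_prob_ge[OF xc E(1) _ R(2)]) auto
      then show ?thesis using A1 by (simp add: x_def)
    qed
  qed
  then have "prob G \<le> p" using p G(1) by blast
  moreover have "real (card H * C0) * (2 * exp (- (\<kappa>1 * r * \<eta>\<^sup>2))) \<le> real (card H * C0) * (2 * exp (- (\<kappa> * r * \<eta>\<^sup>2)))"
  proof -
    have "\<kappa> * r * \<eta>\<^sup>2 \<le> \<kappa>1 * r * \<eta>\<^sup>2" using \<kappa>(2) r unfolding \<kappa>1_def by (intro mult_right_mono) auto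
    then show ?thesis by (intro mult_left_mono) auto
  qed
  ultimately show ?thesis using G(2) unfolding H_def C0_def by linarith
qed

end

section \<open>Rates\<close>

text \<open>
  For any \<open>M\<close>, eventually \<open>M\<^sup>2 N powr (2 / k) \<le> r g\<^sup>2\<close>. With \<open>z = \<kappa> M\<^sup>2\<close> and \<open>x = N powr (1 / k)\<close>
  the exponent is at least \<open>y = z x\<^sup>2\<close>, and \<open>exp y \<ge> y ^ k / k! \<ge> z N / k!\<close>. So the product is at
  most \<open>k! / z\<close>, and \<open>z\<close> is arbitrary.
\<close>

lemma card_times_exp_tendsto_0:
  fixes N :: "nat \<Rightarrow> nat" and r :: "nat \<Rightarrow> nat" and g :: "nat \<Rightarrow> real"
  assumes k: "1 \<le> k" and \<kappa>: "0 < \<kappa>" and N: "\<forall>\<^sub>F n in sequentially. 1 \<le> N n" and r: "\<forall>\<^sub>F n in sequentially. 1 \<le> r n"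
    and rate: "(\<lambda>n. real (N n) powr (1 / real k) / sqrt (real (r n))) \<in> o(g)"
  shows "(\<lambda>n. real (N n) * exp (- (\<kappa> * real (r n) * (g n)\<^sup>2))) \<longlonglongrightarrow> 0"
proof (rule LIMSEQ_I)
  fix \<epsilon> :: real assume \<epsilon>: "0 < \<epsilon>"
  define z where "z = fact k / \<epsilon> + 1"
  have z: "1 \<le> z" "fact k / \<epsilon> < z" using \<epsilon> by (auto simp: z_def)
  define M where "M = sqrt (z / \<kappa>)"
  have M: "0 < M" "\<kappa> * M\<^sup>2 = z" using z \<kappa> by (auto simp: M_def)
  have "\<forall>\<^sub>F n in sequentially. norm (real (N n) powr (1 / real k) / sqrt (real (r n))) \<le> (1 / M) * norm (g n)"
    using landau_o.smallD[OF rate, of "1 / M"] M by simp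
  then have "\<forall>\<^sub>F n in sequentially. norm (real (N n) * exp (- (\<kappa> * real (r n) * (g n)\<^sup>2)) - 0) < \<epsilon>"
    using N r
  proof eventually_elim
    case (elim n)
    define x where "x = real (N n) powr (1 / real k)"
    have x1: "1 \<le> x" using elim(2) unfolding x_def by (intro ge_one_powr_ge_zero) auto
    have xk: "x ^ k = real (N n)" using elim(2) k by (simp add: x_def powr_realpow[symmetric] powr_powr)
    have r0: "0 < sqrt (real (r n))" using elim(3) by simp
    have "x / sqrt (real (r n)) \<le> \<bar>g n\<bar> / M" using elim(1) x1 r0 by (simp add: x_def)
    then have "M * x \<le> \<bar>g n\<bar> * sqrt (real (r n))" using M r0 by (simp add: field_simps)
    then have "(M * x)\<^sup>2 \<le> (\<bar>g n\<bar> * sqrt (real (r n)))\<^sup>2" using M x1 by (intro power_mono) auto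
    then have le: "M\<^sup>2 * x\<^sup>2 \<le> real (r n) * (g n)\<^sup>2" by (simp add: power_mult_distrib mult.commute)
    define y where "y = z * x\<^sup>2"
    have y0: "0 \<le> y" using z by (simp add: y_def)
    have yle: "y \<le> \<kappa> * real (r n) * (g n)\<^sup>2"
      using mult_left_mono[OF le, of \<kappa>] \<kappa> M(2) by (simp add: y_def mult.assoc[symmetric])
    have "z * x ^ k \<le> z ^ k * (x\<^sup>2) ^ k"
    proof (rule mult_mono)
      show "z \<le> z ^ k" using power_increasing[of 1 k z] k z by simp
      have "x ^ k * 1 \<le> x ^ k * x ^ k" using x1 by (intro mult_left_mono one_le_power) auto
      then show "x ^ k \<le> (x\<^sup>2) ^ k" by (simp add: power2_eq_square power_mult_distrib)
    qed (use z x1 in auto)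
    also have "\<dots> = y ^ k" by (simp add: y_def power_mult_distrib)
    also have "\<dots> \<le> fact k * exp y" by (rule power_le_fact_exp[OF y0])
    finally have "x ^ k \<le> fact k / z * exp y" using z by (simp add: field_simps)
    then have "x ^ k * exp (- y) \<le> fact k / z * exp y * exp (- y)" by (intro mult_right_mono) auto
    also have "\<dots> = fact k / z" by (simp add: mult.assoc flip: exp_add)
    also have "\<dots> < \<epsilon>" using z \<epsilon> by (simp add: field_simps)
    finally have "x ^ k * exp (- y) < \<epsilon>" .
    moreover have "x ^ k * exp (- (\<kappa> * real (r n) * (g n)\<^sup>2)) \<le> x ^ k * exp (- y)"
      using yle x1 by (intro mult_left_mono) auto
    ultimately show ?case by (simp add: xk)
  qed
  then show "\<exists>no. \<forall>n\<ge>no. norm (real (N n) * exp (- (\<kappa> * real (r n) * (g n)\<^sup>2)) - 0) < \<epsilon>"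
    unfolding eventually_sequentially .
qed

section \<open>Segments and their parameters\<close>

lemma UN_consecutive_intervals:
  fixes x :: "nat \<Rightarrow> nat"
  assumes "\<And>i. i < k \<Longrightarrow> x i \<le> x (Suc i)"
  shows "(\<Union>i<k. {x i..<x (Suc i)}) = {x 0..<x k}"
  using assms
proof (induction k)
  case (Suc k)
  have mono: "x 0 \<le> x k" using Suc.prems by (induction k) (auto intro: order.trans)
  have "(\<Union>i<Suc k. {x i..<x (Suc i)}) = (\<Union>i<k. {x i..<x (Suc i)}) \<union> {x k..<x (Suc k)}"
    by (auto simp: lessThan_Suc)
  also have "(\<Union>i<k. {x i..<x (Suc i)}) = {x 0..<x k}" using Suc by simp
  also have "{x 0..<x k} \<union> {x k..<x (Suc k)} = {x 0..<x (Suc k)}"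
    using mono Suc.prems[of k] by (intro ivl_disj_un_two(3)) auto
  finally show ?case .
qed simp

lemma seg_properties:
  assumes cp: "change_points n cp" and L: "length cp = L" and n: "0 < n"
  shows "disjoint_family_on (seg n cp) {..L}" "(\<Union>i\<le>L. seg n cp i) = {..<n}" "i \<le> L \<Longrightarrow> seg n cp i \<noteq> {}"
proof -
  define x where "x i = (0 # cp @ [n]) ! i" for i
  have sorted: "sorted_wrt (<) (0 # cp @ [n])"
  proof -
    have "0 < t \<and> t < n" if "t \<in> set cp" for t
      using cp n that by (fastforce simp: change_points_def)
    then show ?thesis using cp n by (auto simp: change_points_def sorted_wrt_append)
  qed
  have less: "x i < x j" if "i < j" "j \<le> Suc L" for i j
    using sorted_wrt_nth_less[OF sorted that(1)] that L by (simp add: x_def)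
  have seg: "seg n cp i = {x i..<x (Suc i)}" for i by (simp add: seg_def x_def)
  show "seg n cp i \<noteq> {}" if "i \<le> L" using less[of i "Suc i"] that by (simp add: seg)
  have "(\<Union>i\<le>L. seg n cp i) = (\<Union>i<Suc L. {x i..<x (Suc i)})" by (simp add: seg lessThan_Suc_atMost)
  also have "\<dots> = {x 0..<x (Suc L)}" by (rule UN_consecutive_intervals) (simp add: less less_imp_le)
  also have "\<dots> = {..<n}" using L by (auto simp: x_def nth_append)
  finally show "(\<Union>i\<le>L. seg n cp i) = {..<n}" .
  have dj: "seg n cp i \<inter> seg n cp j = {}" if "i < j" "j \<le> L" for i j
  proof -
    have "x (Suc i) \<le> x j"
    proof (cases "Suc i = j")
      case False
      then show ?thesis using less[of "Suc i" j] that by simp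
    qed simp
    then show ?thesis by (auto simp: seg)
  qed
  show "disjoint_family_on (seg n cp) {..L}"
    unfolding disjoint_family_on_def
  proof (intro ballI impI)
    fix i j assume "i \<in> {..L}" "j \<in> {..L}" "i \<noteq> j"
    then show "seg n cp i \<inter> seg n cp j = {}" using dj[of i j] dj[of j i] by (cases i j rule: linorder_cases) auto
  qed
qed

text \<open>
  A non-empty set of time points is contained in at most one segment, so the definite description,
  which ranges over all segments, is about that segment only.
\<close>

lemma reg_params_segment:
  assumes disj: "disjoint_family_on sg {..L}" and Es: "Es = sg ` {..L}" and i: "i \<le> L" and f: "f \<subseteq> sg i" "f \<noteq> {}"
    and uniq: "\<exists>!p. regression M Y X S (sg i) (fst p) (snd p)"
  shows "regression M Y X S (sg i) (beta M Y X S Es f) (sigma M Y X S Es f)"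
    "beta M Y X S Es f = beta M Y X S Es (sg i)" "sigma M Y X S Es f = sigma M Y X S Es (sg i)"
proof -
  have eq: "(\<exists>e\<in>Es. h \<subseteq> e \<and> regression M Y X S e (fst p) (snd p)) \<longleftrightarrow> regression M Y X S (sg i) (fst p) (snd p)"
    if h: "h \<subseteq> sg i" "h \<noteq> {}" for h p
  proof
    assume "\<exists>e\<in>Es. h \<subseteq> e \<and> regression M Y X S e (fst p) (snd p)"
    then obtain j where j: "j \<le> L" "h \<subseteq> sg j" "regression M Y X S (sg j) (fst p) (snd p)" by (auto simp: Es)
    have "i = j"
    proof (rule ccontr)
      assume "i \<noteq> j"
      then have "sg i \<inter> sg j = {}" using disj i j(1) unfolding disjoint_family_on_def by blast
      then show False using h j(2) by blast
    qed
    then show "regression M Y X S (sg i) (fst p) (snd p)" using j by simp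
  next
    assume "regression M Y X S (sg i) (fst p) (snd p)"
    then show "\<exists>e\<in>Es. h \<subseteq> e \<and> regression M Y X S e (fst p) (snd p)" using h i by (auto simp: Es)
  qed
  have par: "reg_params M Y X S Es h = (THE p. regression M Y X S (sg i) (fst p) (snd p))" if "h \<subseteq> sg i" "h \<noteq> {}" for h
    unfolding reg_params_def eq[OF that] ..
  show "regression M Y X S (sg i) (beta M Y X S Es f) (sigma M Y X S Es f)"
    unfolding beta_def sigma_def par[OF f] by (rule theI'[OF uniq])
  have ne: "sg i \<noteq> {}" using f by auto
  show "beta M Y X S Es f = beta M Y X S Es (sg i)" "sigma M Y X S Es f = sigma M Y X S Es (sg i)"
    unfolding beta_def sigma_def par[OF f] par[OF order.refl ne] by simp_all
qed

section \<open>Signal against noise\<close>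

text \<open>
  Both sides contain the factor \<open>g / sqrt n\<close>. Without it the claim is \<open>sqrt 2 * \<theta> * w < 1 - \<theta>\<close> for
  \<open>w = sqrt (2 * v)\<close> and \<open>\<theta> = 2 * sqrt s * \<kappa> / c2\<close>, which holds for small \<open>\<kappa>\<close>.
\<close>

lemma coefficient_gap:
  fixes g c2 v \<eta> \<kappa> :: real and s n :: nat
  assumes g: "0 < g" and c2: "0 < c2" and v: "1 \<le> v" and n: "0 < n" and \<eta>: "\<eta> = \<kappa> * g"
    and \<kappa>: "0 < \<kappa>" "\<kappa> * (2 * sqrt s / c2 * (2 * (2 * sqrt (2 * v) + 1))) \<le> 1"
  shows "2 * sqrt 2 * sqrt s * \<eta> / (c2 * sqrt n) < (g - 2 * sqrt s * \<eta> / c2) / sqrt (n * (2 * v))"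
proof -
  define w where "w = sqrt (2 * v)"
  define \<theta> where "\<theta> = 2 * sqrt s * \<kappa> / c2"
  have w: "0 < w" using v by (simp add: w_def)
  have \<theta>0: "0 \<le> \<theta>" using \<kappa> c2 by (simp add: \<theta>_def)
  have "\<theta> * (2 * (2 * w + 1)) \<le> 1" using \<kappa>(2) by (simp add: \<theta>_def w_def mult_ac)
  then have \<theta>: "\<theta> * w * 2 + \<theta> \<le> 1 / 2" by (simp add: algebra_simps)
  have s2: "sqrt 2 \<le> 2" using real_le_lsqrt[of 2 2] by simp
  have "sqrt 2 * (\<theta> * w) \<le> 2 * (\<theta> * w)" using s2 \<theta>0 w by (intro mult_right_mono) auto
  then have lt: "sqrt 2 * \<theta> * w < 1 - \<theta>" using \<theta> by (simp add: mult.assoc)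
  have sn: "0 < sqrt n" using n by simp
  have "2 * sqrt 2 * sqrt s * \<eta> / (c2 * sqrt n) = (sqrt 2 * \<theta> * w) * (g / (sqrt n * w))"
    using w by (simp add: \<eta> \<theta>_def field_simps)
  also have "\<dots> < (1 - \<theta>) * (g / (sqrt n * w))"
    using lt g sn w by (intro mult_strict_right_mono) auto
  also have "\<dots> = (g - 2 * sqrt s * \<eta> / c2) / sqrt (n * (2 * v))"
    unfolding real_sqrt_mult[of "real n"] w_def[symmetric] by (simp add: \<eta> \<theta>_def field_simps)
  finally show ?thesis .
qed

text \<open>
  After multiplication by the denominator, which is at most \<open>v + 1\<close>, the left hand side is at most
  \<open>8 \<kappa> g (v + 1) \<le> g / 2\<close>, while the right hand side is at least \<open>g - g / 4\<close>.
\<close>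

lemma variance_gap:
  fixes g v vi vj \<eta> \<kappa> \<rho> :: real
  assumes g: "0 < g" "g = vi - vj" and \<eta>: "\<eta> = \<kappa> * g" and \<kappa>: "\<kappa> * (16 * (v + 1)) \<le> 1" "0 < \<kappa>"
    and \<rho>: "\<rho> \<le> 2 * \<eta>" "0 < \<rho>" "\<rho> \<le> 1" and vj: "0 \<le> vj" "vj \<le> v"
  shows "4 * \<rho> < (vi - vj - 2 * \<rho>) / (vj + \<rho>)"
proof -
  have pos: "0 < vj + \<rho>" using \<rho> vj by simp
  have "4 * \<rho> * (vj + \<rho>) \<le> 4 * (2 * \<eta>) * (v + 1)" using \<rho> vj pos by (intro mult_mono) auto
  also have "\<dots> = (\<kappa> * (16 * (v + 1))) * (g / 2)" by (simp add: \<eta>)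
  also have "\<dots> \<le> 1 * (g / 2)" using \<kappa> g by (intro mult_right_mono) auto
  finally have 1: "4 * \<rho> * (vj + \<rho>) \<le> g / 2" by simp
  have "\<kappa> * 16 \<le> \<kappa> * (16 * (v + 1))" using \<kappa>(2) vj by (intro mult_left_mono) auto
  with \<kappa>(1) have "\<kappa> * 16 \<le> 1" by linarith
  then have "\<kappa> * 16 * g \<le> 1 * g" using g by (intro mult_right_mono) auto
  then have "16 * \<eta> \<le> g" by (simp add: \<eta> mult_ac)
  with \<rho>(1) have "2 * \<rho> \<le> g / 4" by linarith
  with 1 g have "4 * \<rho> * (vj + \<rho>) < vi - vj - 2 * \<rho>" by linarith
  then show ?thesis using pos by (simp add: pos_less_divide_eq)
qed

section \<open>Consistency of the decoupled test\<close>

theorem theorem4p1: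
  fixes M :: "nat \<Rightarrow> 'a measure"
    and Y :: "nat \<Rightarrow> 'a \<Rightarrow> real vec"
    and X :: "nat \<Rightarrow> 'a \<Rightarrow> real mat"
    and eps :: "nat \<Rightarrow> nat \<Rightarrow> 'a \<Rightarrow> real vec"
    and cp :: "nat \<Rightarrow> nat list"
    and \<alpha>s :: "real list"
    and E :: "nat \<Rightarrow> nat set set"
    and S :: "nat set"
    and a b :: "nat \<Rightarrow> real"
    and \<alpha> :: real
    and d L k n0 :: nat
  assumes prob: "\<And>n. n \<ge> n0 \<Longrightarrow> prob_space (M n)"
    and dims: "\<And>n. n \<ge> n0 \<Longrightarrow> Y n \<in> space (M n) \<rightarrow> carrier_vec n"
              "\<And>n. n \<ge> n0 \<Longrightarrow> X n \<in> space (M n) \<rightarrow> carrier_mat n d"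
    and model: "change_point_model d L \<alpha>s cp M Y X n0"
    and S: "S \<subseteq> {..<d}"
    and normal: "multivariate_normality d S cp M Y X n0"
    and \<alpha>: "0 < \<alpha>" "\<alpha> < 1"
    and k: "k \<ge> 1"
    and environments: "\<And>n. n \<ge> n0 \<Longrightarrow> E n \<subseteq> Pow {..<n} \<and> {} \<notin> E n \<and> disjoint (E n)"
    and C1: "C1 E"
    and C2: "C2 L S cp M Y X E"
    and C3: "C3 k M X E n0"
    and alternative: "\<And>n. n \<ge> n0 \<Longrightarrow> H_A n (cp n) S (M n) (Y n) (X n) (a n) (b n)"
    and rate:
      "(\<lambda>n. real (card (E n)) powr (1 / real k) / sqrt (real (min_size (E n)))) \<in> o(a) \<or>
       (\<lambda>n. real (card (E n)) powr (1 / real k) / sqrt (real (min_size (E n)))) \<in> o(b)"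
    and draws: "\<And>n. n \<ge> n0 \<Longrightarrow> resampling_draws (M n) n d (Y n) (X n) (eps n)"
  shows "\<exists>p. (\<forall>n\<ge>n0. (\<lambda>B. measure (M n)
                {\<omega> \<in> space (M n).
                   decoupled_test (E n) \<alpha> B (\<lambda>i. eps n i \<omega>) (Y n \<omega>) (restrict_cols (X n \<omega>) S) = 1})
              \<longlonglongrightarrow> p n)
           \<and> p \<longlonglongrightarrow> 1"
proof -
  define sg where "sg n = seg n (cp n)" for n
  define \<beta> where "\<beta> n i = beta (M n) (Y n) (X n) S (segs n (cp n)) (sg n i)" for n i
  define \<sigma> where "\<sigma> n i = sigma (M n) (Y n) (X n) S (segs n (cp n)) (sg n i)" for n i
  define s where "s = card S"
  have "\<forall>n. \<exists>p. n \<ge> n0 \<longrightarrow> (\<lambda>B. measure (M n) {\<omega> \<in> space (M n).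
      decoupled_test (E n) \<alpha> B (\<lambda>i. eps n i \<omega>) (Y n \<omega>) (restrict_cols (X n \<omega>) S) = 1}) \<longlonglongrightarrow> p
    \<and> (\<forall>G\<in>sets (M n). (\<forall>\<omega>\<in>G. 1 - \<alpha> / 2 < below_prob (T1_max (E n)) n (restrict_cols (X n \<omega>) S) (Y n \<omega>)
          \<or> 1 - \<alpha> / 2 < below_prob (T2_max (E n)) n (restrict_cols (X n \<omega>) S) (Y n \<omega>)) \<longrightarrow> measure (M n) G \<le> p) \<and> p \<le> 1"
    using prob_space.rejection_probability[OF prob dims S _ \<alpha> draws] environments by blast
  from choice[OF this] obtain p where "\<forall>n. n \<ge> n0 \<longrightarrow> (\<lambda>B. measure (M n) {\<omega> \<in> space (M n).
      decoupled_test (E n) \<alpha> B (\<lambda>i. eps n i \<omega>) (Y n \<omega>) (restrict_cols (X n \<omega>) S) = 1}) \<longlonglongrightarrow> p n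
    \<and> (\<forall>G\<in>sets (M n). (\<forall>\<omega>\<in>G. 1 - \<alpha> / 2 < below_prob (T1_max (E n)) n (restrict_cols (X n \<omega>) S) (Y n \<omega>)
          \<or> 1 - \<alpha> / 2 < below_prob (T2_max (E n)) n (restrict_cols (X n \<omega>) S) (Y n \<omega>)) \<longrightarrow> measure (M n) G \<le> p n) \<and> p n \<le> 1"
    by blast
  then have p_lim: "\<And>n. n \<ge> n0 \<Longrightarrow> (\<lambda>B. measure (M n) {\<omega> \<in> space (M n).
      decoupled_test (E n) \<alpha> B (\<lambda>i. eps n i \<omega>) (Y n \<omega>) (restrict_cols (X n \<omega>) S) = 1}) \<longlonglongrightarrow> p n"
    and p_low: "\<And>n. n \<ge> n0 \<Longrightarrow> \<forall>G\<in>sets (M n). (\<forall>\<omega>\<in>G. 1 - \<alpha> / 2 < below_prob (T1_max (E n)) n (restrict_cols (X n \<omega>) S) (Y n \<omega>)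
          \<or> 1 - \<alpha> / 2 < below_prob (T2_max (E n)) n (restrict_cols (X n \<omega>) S) (Y n \<omega>)) \<longrightarrow> measure (M n) G \<le> p n"
    and p_le: "\<And>n. n \<ge> n0 \<Longrightarrow> p n \<le> 1" by blast+

  have segs: "length (cp n) = L" "change_points n (cp n)" if "n0 \<le> n" for n
    using model that by (auto simp: change_point_model_def)
  have Es: "segs n (cp n) = sg n ` {..L}" if "n0 \<le> n" for n
    using segs(1)[OF that] by (simp add: segs_def sg_def)
  note sp = seg_properties[OF segs(2,1), folded sg_def]
  have uniq: "\<exists>!q. regression (M n) (Y n) (X n) S (sg n i) (fst q) (snd q)"
    and nrows: "normal_rows (M n) d (Y n) (X n) (sg n i)"
    and iidr: "iid_rows (M n) d (Y n) (X n) (sg n i)" if "n0 \<le> n" "i \<le> L" for n i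
    using normal model that Es[OF that(1)] by (auto simp: multivariate_normality_def change_point_model_def sg_def)
  have sample: "segmented_sample (M n) n d L (Y n) (X n) S (sg n) (\<beta> n) (\<sigma> n)" if n: "n0 \<le> n" "0 < n" for n
  proof -
    have "regression (M n) (Y n) (X n) S (sg n i) (\<beta> n i) (\<sigma> n i)" if i: "i \<le> L" for i
      unfolding \<beta>_def \<sigma>_def
      by (rule reg_params_segment(1)[OF sp(1)[OF n(1) n(1) n(2)] Es[OF n(1)] i order.refl sp(3)[OF n(1) n(1) n(2) i] uniq[OF n(1) i]])
    then show ?thesis
      unfolding segmented_sample_def segmented_sample_axioms_def
      using prob[OF n(1)] dims[OF n(1)] S iidr[OF n(1)] nrows[OF n(1)] sp(1,2)[OF n(1) n(1) n(2)] by auto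
  qed

  define Q where "Q i F N v w \<longleftrightarrow> (\<forall>n\<ge>N. F n \<in> E n \<and> F n \<subseteq> seg n (cp n) i) \<and>
        (\<lambda>n. (sigma (M n) (Y n) (X n) S (segs n (cp n)) (F n))\<^sup>2) \<longlonglongrightarrow> v \<and> v > 0 \<and>
        (\<forall>j<card S. (\<lambda>n. beta (M n) (Y n) (X n) S (segs n (cp n)) (F n) $ j) \<longlonglongrightarrow> w j)"
    for i :: nat and F N v and w :: "nat \<Rightarrow> real"
  have "\<forall>i. \<exists>F N v w. i \<le> L \<longrightarrow> Q i F N v w" using C2 unfolding C2_def Q_def by blast
  then obtain F N vv ww where Q: "\<And>i. i \<le> L \<Longrightarrow> Q i (F i) (N i) (vv i) (ww i)" by metis
  define N1 where "N1 = Max (insert n0 (insert 1 (N ` {..L})))"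
  have N1: "n0 \<le> N1" "1 \<le> N1" "\<And>i. i \<le> L \<Longrightarrow> N i \<le> N1"
  proof -
    have ge: "m \<le> N1" if "m \<in> insert n0 (insert 1 (N ` {..L}))" for m
      unfolding N1_def using that by (intro Max_ge) simp_all
    show "n0 \<le> N1" "1 \<le> N1" "\<And>i. i \<le> L \<Longrightarrow> N i \<le> N1" by (rule ge; simp)+
  qed
  have FE: "F i n \<in> E n" "F i n \<subseteq> sg n i" if "i \<le> L" "N1 \<le> n" for i n
    using Q[OF that(1)] N1(3)[OF that(1)] that(2) by (auto simp: Q_def sg_def)
  have params: "beta (M n) (Y n) (X n) S (segs n (cp n)) (F i n) = \<beta> n i" "sigma (M n) (Y n) (X n) S (segs n (cp n)) (F i n) = \<sigma> n i"
    if "i \<le> L" "N1 \<le> n" for i n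
  proof -
    have n: "n0 \<le> n" "0 < n" using that N1 by auto
    have ne: "F i n \<noteq> {}" using FE(1)[OF that] environments[OF n(1)] by auto
    note R = reg_params_segment[OF sp(1)[OF n(1) n(1) n(2)] Es[OF n(1)] that(1) FE(2)[OF that] ne uniq[OF n(1) that(1)]]
    show "beta (M n) (Y n) (X n) S (segs n (cp n)) (F i n) = \<beta> n i" "sigma (M n) (Y n) (X n) S (segs n (cp n)) (F i n) = \<sigma> n i"
      unfolding \<beta>_def \<sigma>_def using R(2,3) by auto
  qed
  have ev: "\<forall>\<^sub>F n in sequentially. N1 \<le> n" by (rule eventually_ge_at_top)
  have \<sigma>_lim: "(\<lambda>n. (\<sigma> n i)\<^sup>2) \<longlonglongrightarrow> vv i" and vv: "0 < vv i" if i: "i \<le> L" for i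
  proof -
    have "(\<lambda>n. (sigma (M n) (Y n) (X n) S (segs n (cp n)) (F i n))\<^sup>2) \<longlonglongrightarrow> vv i" using Q[OF i] by (simp add: Q_def)
    then show "(\<lambda>n. (\<sigma> n i)\<^sup>2) \<longlonglongrightarrow> vv i"
      by (rule Lim_transform_eventually) (use ev in eventually_elim, simp add: params(2)[OF i])
    show "0 < vv i" using Q[OF i] by (simp add: Q_def)
  qed
  have \<beta>_lim: "(\<lambda>n. \<beta> n i $ j) \<longlonglongrightarrow> ww i j" if i: "i \<le> L" and j: "j < s" for i j
  proof -
    have "(\<lambda>n. beta (M n) (Y n) (X n) S (segs n (cp n)) (F i n) $ j) \<longlonglongrightarrow> ww i j" using Q[OF i] j by (simp add: Q_def s_def)
    then show ?thesis
      by (rule Lim_transform_eventually) (use ev in eventually_elim, simp add: params(1)[OF i])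
  qed

  \<comment> \<open>bounds for the parameters of all segments, valid for large \<open>n\<close> because the parameters
      converge\<close>
  define smin where "smin = Min (vv ` {..L}) / 2"
  define VV where "VV = Max (vv ` {..L}) + 1"
  define Bb where "Bb = Max ((\<lambda>i. \<Sum>j<s. (ww i j)\<^sup>2) ` {..L}) + 1"
  have vvb: "2 * smin \<le> vv i" "vv i < VV" "(\<Sum>j<s. (ww i j)\<^sup>2) < Bb" if "i \<le> L" for i
  proof -
    show "2 * smin \<le> vv i" using that by (simp add: smin_def)
    have "vv i \<le> Max (vv ` {..L})" using that by (intro Max_ge) auto
    then show "vv i < VV" by (simp add: VV_def)
    have "(\<Sum>j<s. (ww i j)\<^sup>2) \<le> Max ((\<lambda>i. \<Sum>j<s. (ww i j)\<^sup>2) ` {..L})" using that by (intro Max_ge) auto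
    then show "(\<Sum>j<s. (ww i j)\<^sup>2) < Bb" by (simp add: Bb_def)
  qed
  have smin: "0 < smin" using vv by (simp add: smin_def)
  have VV: "0 < VV" using vvb(2)[of 0] vv[of 0] by simp
  have Bb: "0 < Bb" using vvb(3)[of 0] sum_nonneg[of "{..<s}" "\<lambda>j. (ww 0 j)\<^sup>2"] by simp
  have ev\<sigma>: "\<forall>\<^sub>F n in sequentially. \<forall>i\<in>{..L}. smin < (\<sigma> n i)\<^sup>2 \<and> (\<sigma> n i)\<^sup>2 < VV"
  proof (intro eventually_ball_finite ballI)
    fix i assume "i \<in> {..L}"
    then have i: "i \<le> L" by simp
    have "smin < vv i" using vvb(1)[OF i] smin by simp
    from order_tendstoD(1)[OF \<sigma>_lim[OF i] this] order_tendstoD(2)[OF \<sigma>_lim[OF i] vvb(2)[OF i]]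
    show "\<forall>\<^sub>F n in sequentially. smin < (\<sigma> n i)\<^sup>2 \<and> (\<sigma> n i)\<^sup>2 < VV" by eventually_elim simp
  qed simp
  have ev\<beta>: "\<forall>\<^sub>F n in sequentially. \<forall>i\<in>{..L}. (\<Sum>j<s. (\<beta> n i $ j)\<^sup>2) < Bb"
  proof (intro eventually_ball_finite ballI)
    fix i assume "i \<in> {..L}"
    then have i: "i \<le> L" by simp
    have "(\<lambda>n. \<Sum>j<s. (\<beta> n i $ j)\<^sup>2) \<longlonglongrightarrow> (\<Sum>j<s. (ww i j)\<^sup>2)"
      by (intro tendsto_sum tendsto_power \<beta>_lim[OF i]) simp
    from order_tendstoD(2)[OF this vvb(3)[OF i]] show "\<forall>\<^sub>F n in sequentially. (\<Sum>j<s. (\<beta> n i $ j)\<^sup>2) < Bb" .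
  qed simp

  have \<beta>c: "\<beta> n i \<in> carrier_vec s" if "i \<le> L" "N1 \<le> n" for n i
  proof -
    have n: "n0 \<le> n" "0 < n" using that N1 by auto
    show ?thesis unfolding s_def by (rule segmented_sample.beta_carrier[OF sample[OF n] that(1)])
  qed
  have alt: "\<exists>i\<le>L. \<exists>j\<le>L. a n = \<bar>(\<sigma> n i)\<^sup>2 - (\<sigma> n j)\<^sup>2\<bar> \<and> a n > 0 \<and> b n = l2norm (\<beta> n i - \<beta> n j) \<and> b n > 0"
    if "N1 \<le> n" for n
    using alternative[of n] segs(1)[of n] that N1(1) by (auto simp: H_A_def \<sigma>_def \<beta>_def sg_def)
  \<comment> \<open>coefficient vectors of length 0 cannot differ\<close>
  have s: "0 < s"
  proof (rule ccontr)
    assume "\<not> 0 < s"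
    obtain i j where "i \<le> L" "j \<le> L" "b N1 = l2norm (\<beta> N1 i - \<beta> N1 j)" "b N1 > 0" using alt[of N1] by auto
    then show False using \<open>\<not> 0 < s\<close> \<beta>c[of j N1] by (simp add: l2norm_def scalar_prod_def)
  qed
  have d: "0 < d" using s S by (cases d) (auto simp: s_def)

  obtain c C where c: "0 < c" and C3': "\<And>n e. n0 \<le> n \<Longrightarrow> e \<in> E n \<Longrightarrow>
        ennreal c \<le> (\<integral>\<^sup>+\<omega>. ennreal (lambda_min (gram (X n \<omega>) e) ^ (2 * k)) \<partial>M n) \<and>
        (\<integral>\<^sup>+\<omega>. ennreal (lambda_max (gram (X n \<omega>) e) ^ (2 * k)) \<partial>M n) \<le> ennreal C"
    using C3 unfolding C3_def by blast
  define C' where "C' = max C 0"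
  have C': "0 \<le> C'" "ennreal C \<le> ennreal C'" by (auto simp: C'_def intro: ennreal_leI)
  \<comment> \<open>small enough for \<open>second_moment_lower\<close>; as \<open>8 * c1 \<le> 1\<close>, the power of \<open>8 * c1\<close> is at most
      \<open>8 * c1\<close> itself\<close>
  define c1 where "c1 = min 1 (c / (4 * fact (2 * k))) / 8"
  have c1: "0 < c1" "c1 \<le> 1" "2 * fact (2 * k) * (8 * c1) ^ (2 * k) < c"
  proof -
    show c10: "0 < c1" "c1 \<le> 1" using c by (auto simp: c1_def)
    have "(8 * c1) ^ (2 * k) \<le> (8 * c1) ^ 1" using c10 k by (intro power_decreasing) (auto simp: c1_def)
    also have "\<dots> \<le> c / (4 * fact (2 * k))" by (simp add: c1_def)
    finally have "2 * fact (2 * k) * (8 * c1) ^ (2 * k) \<le> 2 * fact (2 * k) * (c / (4 * fact (2 * k)))"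
      by (intro mult_left_mono) auto
    also have "\<dots> = c / 2" by simp
    finally show "2 * fact (2 * k) * (8 * c1) ^ (2 * k) < c" using c by simp
  qed
  \<comment> \<open>\<open>v0\<close> bounds the second moments of the covariates and of the noise, and \<open>v\<close> also those of
      the response (\<open>response_second_moment\<close>)\<close>
  define v0 where "v0 = 1 + C' + VV"
  define v where "v = 2 * v0 + 2 * Bb * (s * v0)"
  have v0: "1 \<le> v0" "1 + C' \<le> v0" "VV \<le> v0" using C' VV by (auto simp: v0_def)
  have "0 \<le> 2 * Bb * (s * v0)" using Bb v0 by (intro mult_nonneg_nonneg) auto
  then have v: "v0 \<le> v" "1 \<le> v" using v0 unfolding v_def by linarith+
  define c2 where "c2 = c1 / (2 * real (Suc L))"
  have c2: "0 < c2" using c1 by (simp add: c2_def)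
  define \<kappa> where "\<kappa> = min ((c1 / (2 * s))\<^sup>2 / (real (Suc L) * (3072 * v\<^sup>2))) (min (1 / (2 * (16 * v * real (Suc L)))) (1 / 3072))"
  have \<kappa>: "0 < \<kappa>" "\<kappa> \<le> (c1 / (2 * s))\<^sup>2 / (real (Suc L) * (3072 * v\<^sup>2))" "\<kappa> \<le> 1 / (2 * (16 * v * real (Suc L)))" "\<kappa> \<le> 1 / 3072"
  proof -
    have "0 < (c1 / (2 * s))\<^sup>2 / (real (Suc L) * (3072 * v\<^sup>2))" "0 < 1 / (2 * (16 * v * real (Suc L)))"
      using c1 s v by auto
    then show "0 < \<kappa>" by (simp only: \<kappa>_def min_less_iff_conj) simp
    show "\<kappa> \<le> (c1 / (2 * s))\<^sup>2 / (real (Suc L) * (3072 * v\<^sup>2))" unfolding \<kappa>_def by (rule min.cobounded1)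
    show "\<kappa> \<le> 1 / (2 * (16 * v * real (Suc L)))" unfolding \<kappa>_def by (rule order.trans[OF min.cobounded2 min.cobounded1])
    show "\<kappa> \<le> 1 / 3072" unfolding \<kappa>_def by (rule order.trans[OF min.cobounded2 min.cobounded2])
  qed
  \<comment> \<open>The precision is \<open>\<eta> = \<kappa>g * g\<close>, where the signal \<open>g\<close> is \<open>a\<close> or \<open>b\<close>, which is at most \<open>Gm\<close>.
      The summands of \<open>Dn\<close> are the requirements on \<open>\<kappa>g\<close>: \<open>\<eta> \<le> 1 / 4\<close>, \<open>s * \<eta>\<^sup>2 / c2 \<le> \<eta>\<close>,
      \<open>2 * \<eta> \<le> smin\<close>, and the hypotheses of \<open>coefficient_gap\<close> and \<open>variance_gap\<close>.\<close>
  define Gm where "Gm = VV + 2 * sqrt Bb"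
  have Gm: "0 < Gm" using VV Bb by (simp add: Gm_def add_pos_nonneg)
  define w1 where "w1 = 2 * sqrt s / c2 * (2 * (2 * sqrt (2 * v) + 1))"
  define Dn where "Dn = 4 * Gm + s / c2 * Gm + 2 / smin * Gm + w1 + 16 * (v + 1) + 1"
  have Dn_parts: "0 \<le> 4 * Gm" "0 \<le> s / c2 * Gm" "0 \<le> 2 / smin * Gm" "0 \<le> w1" "0 \<le> 16 * (v + 1)"
    using Gm c2 smin v by (auto simp: w1_def)
  then have Dn: "0 < Dn" "4 * Gm \<le> Dn" "s / c2 * Gm \<le> Dn" "2 / smin * Gm \<le> Dn" "w1 \<le> Dn" "16 * (v + 1) \<le> Dn"
    unfolding Dn_def by linarith+
  define \<kappa>g where "\<kappa>g = 1 / Dn"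
  have \<kappa>g: "0 < \<kappa>g" "\<kappa>g * w1 \<le> 1" "\<kappa>g * (16 * (v + 1)) \<le> 1" using Dn by (auto simp: \<kappa>g_def)

  define C0 where "C0 = s * s + Suc L * s + Suc L * Suc s + Suc L"
  define r where "r n = min_size (E n)" for n
  have finE: "finite (E n)" if "n0 \<le> n" for n using environments[OF that] finite_subset by blast
  have r_le: "r n \<le> card h" if "n0 \<le> n" "h \<in> E n" for n h
    unfolding r_def min_size_def using finE[OF that(1)] that(2) by (intro Min_le) auto
  have cardE: "1 \<le> card (E n)" "1 \<le> r n" if "N1 \<le> n" for n
  proof -
    have n: "n0 \<le> n" using that N1 by simp
    have F0: "F 0 n \<in> E n" using FE(1)[of 0 n] that by simp
    then show "1 \<le> card (E n)" using finE[OF n] by (auto simp: Suc_le_eq card_gt_0_iff)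
    have "r n \<in> card ` E n" unfolding r_def min_size_def using finE[OF n] F0 by (intro Min_in) auto
    then obtain h where h: "h \<in> E n" "r n = card h" by auto
    then have "finite h" "h \<noteq> {}" using environments[OF n] finite_subset by auto
    then show "1 \<le> r n" using h by (simp add: Suc_le_eq card_gt_0_iff)
  qed

  \<comment> \<open>The signal \<open>g\<close> is \<open>a\<close> or \<open>b\<close>. The segments \<open>i\<close> and \<open>j\<close> may depend on \<open>n\<close>, and for a signal
      in the variances they are ordered such that \<open>i\<close> has the larger variance.\<close>
  have main: "p \<longlonglongrightarrow> 1"
    if rate_g: "(\<lambda>n. real (card (E n)) powr (1 / real k) / sqrt (real (r n))) \<in> o(g)"
      and g: "\<And>n. N1 \<le> n \<Longrightarrow> (\<exists>i\<le>L. \<exists>j\<le>L. 0 < g n \<and> i \<noteq> j \<and> (g n = l2norm (\<beta> n i - \<beta> n j) \<or> g n = (\<sigma> n i)\<^sup>2 - (\<sigma> n j)\<^sup>2))"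
    for g
  proof -
    define \<eta> where "\<eta> n = \<kappa>g * g n" for n
    \<comment> \<open>up to a constant, the probability of bad data and that of bad resampled noise\<close>
    define D where "D n = real (card (E n)) * exp (- (\<kappa> * real (r n) * (\<eta> n)\<^sup>2))" for n
    have "(\<lambda>n. real (card (E n)) * exp (- ((\<kappa> * \<kappa>g\<^sup>2) * real (r n) * (g n)\<^sup>2))) \<longlonglongrightarrow> 0"
    proof (rule card_times_exp_tendsto_0[OF k _ _ _ rate_g])
      show "0 < \<kappa> * \<kappa>g\<^sup>2" using \<kappa> \<kappa>g by simp
      show "\<forall>\<^sub>F n in sequentially. 1 \<le> card (E n)" "\<forall>\<^sub>F n in sequentially. 1 \<le> r n"
        by (rule eventually_mono[OF ev], erule cardE)+
    qed
    then have D_lim: "D \<longlonglongrightarrow> 0" unfolding D_def[abs_def] \<eta>_def by (simp add: power_mult_distrib mult_ac)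
    have "(\<lambda>n. 4 * real (Suc s) * D n) \<longlonglongrightarrow> 0" by (rule tendsto_mult_right_zero[OF D_lim])
    then have evD: "\<forall>\<^sub>F n in sequentially. 4 * real (Suc s) * D n < \<alpha> / 2"
      by (rule order_tendstoD) (use \<alpha> in simp)
    have ev_low: "\<forall>\<^sub>F n in sequentially. 1 - 4 * real C0 * D n \<le> p n"
      using ev evD ev\<sigma> ev\<beta>
    proof eventually_elim
      case (elim n)
      have n: "n0 \<le> n" "0 < n" using elim(1) N1 by auto
      interpret Z: segmented_sample "M n" n d L "Y n" "X n" S "sg n" "\<beta> n" "\<sigma> n" by (rule sample[OF n])
      have \<sigma>b: "smin < (\<sigma> n i)\<^sup>2" "(\<sigma> n i)\<^sup>2 < VV" if "i \<le> L" for i using elim(3) that by auto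
      have \<beta>b: "(l2norm (\<beta> n i))\<^sup>2 \<le> Bb" if "i \<le> L" for i
        using elim(4) that \<beta>c[OF that elim(1)] by (auto simp: l2norm_sq intro: less_imp_le)
      have Fi: "F i n \<in> E n" "F i n \<subseteq> sg n i" "F i n \<noteq> {}" if "i \<le> L" for i
        using FE[OF that elim(1)] environments[OF n(1)] by auto
      note C3n = C3'[OF n(1) Fi(1)]
      have mx0: "Z.expectation (\<lambda>\<omega>. (Z.form 0 (Z.unit_coeff j) t \<omega>)\<^sup>2) \<le> v0" if "i \<le> L" "t \<in> sg n i" "j \<in> S" for i t j
      proof -
        have "Z.expectation (\<lambda>\<omega>. (Z.form 0 (Z.unit_coeff j) t \<omega>)\<^sup>2) \<le> 1 + C'"
          by (rule Z.second_moment_upper[OF that(1) Fi(2,3)[OF that(1)] k C'(1) _ _ that(2)])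
            (use C3n[OF that(1)] C' that S in \<open>auto intro: order.trans\<close>)
        then show ?thesis using v0 by simp
      qed
      have mx: "Z.expectation (\<lambda>\<omega>. (Z.form 0 (Z.unit_coeff j) t \<omega>)\<^sup>2) \<le> v" if "i \<le> L" "t \<in> sg n i" "j \<in> S" for i t j
        using mx0[OF that] v by simp
      have ms: "(\<sigma> n i)\<^sup>2 \<le> v" "(\<sigma> n i)\<^sup>2 \<le> v0" if "i \<le> L" for i using \<sigma>b(2)[OF that] v v0 by auto
      have my: "Z.expectation (\<lambda>\<omega>. (Z.form 1 (\<lambda>_. 0) t \<omega>)\<^sup>2) \<le> v" if "i \<le> L" "t \<in> sg n i" for i t
        unfolding v_def s_def by (rule Z.response_second_moment[OF that mx0[OF that] \<beta>b[OF that(1)] ms(2)[OF that(1)]])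
      have low: "c1 * (l2norm u)\<^sup>2 \<le> Z.expectation (\<lambda>\<omega>. (Z.form 0 (extend_coeffs S u) t \<omega>)\<^sup>2)"
        if "i \<le> L" "t \<in> sg n i" "u \<in> carrier_vec (card S)" for i t u
        using Z.second_moment_lower[OF that(1) Fi(2,3)[OF that(1)] d _ c1(1,3) that(2), of "extend_coeffs S u"] C3n[OF that(1)]
        unfolding extend_coeffs_sums(2)[OF S that(3)] by blast
      obtain i j where ij: "i \<le> L" "j \<le> L" "i \<noteq> j" and g0: "0 < g n"
        and gd: "g n = l2norm (\<beta> n i - \<beta> n j) \<or> g n = (\<sigma> n i)\<^sup>2 - (\<sigma> n j)\<^sup>2" using g[OF elim(1)] by blast
      have gG: "g n \<le> Gm"
        using gd
      proof
        assume "g n = l2norm (\<beta> n i - \<beta> n j)"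
        also have "\<dots> \<le> l2norm (\<beta> n i) + l2norm (\<beta> n j)" by (rule l2norm_triangle(2)[OF \<beta>c[OF ij(1) elim(1)] \<beta>c[OF ij(2) elim(1)]])
        also have "\<dots> \<le> sqrt Bb + sqrt Bb" using \<beta>b[OF ij(1)] \<beta>b[OF ij(2)] by (intro add_mono real_le_rsqrt)
        finally show ?thesis using VV by (simp add: Gm_def)
      next
        assume "g n = (\<sigma> n i)\<^sup>2 - (\<sigma> n j)\<^sup>2"
        also have "\<dots> \<le> VV" using \<sigma>b(2)[OF ij(1)] zero_le_power2[of "\<sigma> n j"] by linarith
        finally show ?thesis using Bb by (simp add: Gm_def add_increasing2)
      qed
      have \<eta>0: "0 < \<eta> n" using \<kappa>g g0 by (simp add: \<eta>_def)
      have \<eta>y: "y * \<eta> n \<le> 1" if "0 \<le> y" "y * Gm \<le> Dn" for y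
      proof -
        have "y * g n \<le> y * Gm" using gG that by (intro mult_left_mono)
        then have "y * g n \<le> Dn" using that by linarith
        then show ?thesis using Dn(1) by (simp add: \<eta>_def \<kappa>g_def divide_le_eq)
      qed
      have e1: "4 * \<eta> n \<le> 1" by (rule \<eta>y) (use Dn in auto)
      have e2: "s / c2 * \<eta> n \<le> 1" by (rule \<eta>y) (use Dn c2 in auto)
      have e3: "2 / smin * \<eta> n \<le> 1" by (rule \<eta>y) (use Dn smin in auto)
      have e3': "2 * \<eta> n \<le> smin" using e3 smin by (simp add: field_simps)
      define \<rho> where "\<rho> = \<eta> n + s * (\<eta> n)\<^sup>2 / c2"
      have \<rho>0: "0 < \<rho>" unfolding \<rho>_def using \<eta>0 c2 by (intro add_pos_nonneg) auto
      have \<rho>2: "\<rho> \<le> 2 * \<eta> n"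
      proof -
        have "s * (\<eta> n)\<^sup>2 / c2 = (s / c2 * \<eta> n) * \<eta> n" by (simp add: power2_eq_square)
        also have "\<dots> \<le> 1 * \<eta> n" using e2 \<eta>0 by (intro mult_right_mono) auto
        finally show ?thesis by (simp add: \<rho>_def)
      qed
      \<comment> \<open>a signal in the coefficients shows in the first statistic, one in the variances shows
          in the second\<close>
      have gap: "2 * sqrt 2 * sqrt s * \<eta> n / (c2 * sqrt n) < (l2norm (\<beta> n i - \<beta> n j) - 2 * sqrt s * \<eta> n / c2) / sqrt (n * (2 * v))
        \<or> \<rho> < (\<sigma> n j)\<^sup>2 \<and> \<rho> < (\<sigma> n i)\<^sup>2 \<and> 4 * \<rho> < ((\<sigma> n i)\<^sup>2 - (\<sigma> n j)\<^sup>2 - 2 * \<rho>) / ((\<sigma> n j)\<^sup>2 + \<rho>)"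
        using gd
      proof
        assume gl: "g n = l2norm (\<beta> n i - \<beta> n j)"
        have "2 * sqrt 2 * sqrt s * \<eta> n / (c2 * sqrt n) < (g n - 2 * sqrt s * \<eta> n / c2) / sqrt (n * (2 * v))"
          by (rule coefficient_gap[OF g0 c2 v(2) n(2) \<eta>_def \<kappa>g(1)]) (use \<kappa>g(2) in \<open>simp add: w1_def\<close>)
        then show ?thesis unfolding gl by blast
      next
        assume gl: "g n = (\<sigma> n i)\<^sup>2 - (\<sigma> n j)\<^sup>2"
        have "4 * \<rho> < ((\<sigma> n i)\<^sup>2 - (\<sigma> n j)\<^sup>2 - 2 * \<rho>) / ((\<sigma> n j)\<^sup>2 + \<rho>)"
          by (rule variance_gap[OF g0 gl \<eta>_def \<kappa>g(3,1) \<rho>2 \<rho>0]) (use \<rho>2 e1 ms[OF ij(2)] in auto)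
        then show ?thesis using \<rho>2 e3' \<sigma>b(1)[OF ij(1)] \<sigma>b(1)[OF ij(2)] by auto
      qed
      have cardH: "real (card (insert {..<n} (E n))) \<le> 2 * real (card (E n))"
        using card_insert_le_m1[of "Suc (card (E n))" "E n" "{..<n}"] cardE(1)[OF elim(1)] by simp
      have dom: "real (card (insert {..<n} (E n)) * q) * (2 * exp (- (\<kappa> * real (r n) * (\<eta> n)\<^sup>2))) \<le> 4 * real q * D n" for q
      proof -
        have "real (card (insert {..<n} (E n)) * q) * (2 * exp (- (\<kappa> * real (r n) * (\<eta> n)\<^sup>2)))
          = real (card (insert {..<n} (E n))) * (real q * (2 * exp (- (\<kappa> * real (r n) * (\<eta> n)\<^sup>2))))" by simp
        also have "\<dots> \<le> (2 * real (card (E n))) * (real q * (2 * exp (- (\<kappa> * real (r n) * (\<eta> n)\<^sup>2))))"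
          using cardH by (intro mult_right_mono) auto
        also have "\<dots> = 4 * real q * D n" by (simp add: D_def)
        finally show ?thesis .
      qed
      have "1 - real (card (insert {..<n} (E n)) * (card S * card S + Suc L * card S + Suc L * Suc (card S) + Suc L)) * (2 * exp (- (\<kappa> * real (r n) * (\<eta> n)\<^sup>2))) \<le> p n"
      proof (rule Z.power_lower_bound[where f = "\<lambda>i. F i n" and v = v and ?c1.0 = c1 and ?c2.0 = c2 and \<rho> = \<rho> and i = i and j = j and \<alpha> = \<alpha>])
        show "E n \<subseteq> Pow {..<n}" "{} \<notin> E n" using environments[OF n(1)] by auto
        show "real (r n) \<le> real (card h)" if "h \<in> E n" for h using r_le[OF n(1) that] by simp
        show "F i n \<in> E n \<and> F i n \<subseteq> sg n i" if "i \<le> L" for i using Fi[OF that] by simp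
        show "\<eta> n \<le> 1" "\<rho> \<le> 1 / 2" using e1 \<rho>2 by linarith+
        show "real (card (insert {..<n} (E n)) * Suc (card S)) * (2 * exp (- (\<kappa> * real (r n) * (\<eta> n)\<^sup>2))) < \<alpha> / 2"
          using dom[of "Suc s"] elim(2) unfolding s_def by linarith
        show "\<rho> = \<eta> n + real (card S) * (\<eta> n)\<^sup>2 / c2" by (simp add: \<rho>_def s_def)
        show "\<kappa> \<le> (c1 / (2 * card S))\<^sup>2 / (real (Suc L) * (3072 * v\<^sup>2))" using \<kappa>(2) by (simp add: s_def)
        show "2 * sqrt 2 * sqrt (card S) * \<eta> n / (c2 * sqrt n) < (l2norm (\<beta> n i - \<beta> n j) - 2 * sqrt (card S) * \<eta> n / c2) / sqrt (n * (2 * v))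
          \<or> \<rho> < (\<sigma> n j)\<^sup>2 \<and> \<rho> < (\<sigma> n i)\<^sup>2 \<and> 4 * \<rho> < ((\<sigma> n i)\<^sup>2 - (\<sigma> n j)\<^sup>2 - 2 * \<rho>) / ((\<sigma> n j)\<^sup>2 + \<rho>)"
          using gap by (simp add: s_def)
        show "\<forall>G\<in>Z.events. (\<forall>\<omega>\<in>G. 1 - \<alpha> / 2 < below_prob (T1_max (E n)) n (Z.xs \<omega>) (Y n \<omega>)
          \<or> 1 - \<alpha> / 2 < below_prob (T2_max (E n)) n (Z.xs \<omega>) (Y n \<omega>)) \<longrightarrow> Z.prob G \<le> p n" by (rule p_low[OF n(1)])
      qed (use v mx my ms low c1 \<eta>0 s \<kappa> ij in \<open>auto simp: c2_def s_def intro: less_imp_le\<close>)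
      then show "1 - 4 * real C0 * D n \<le> p n"
        using dom[of C0] unfolding C0_def s_def by linarith
    qed
    have lim_low: "(\<lambda>n. 1 - 4 * real C0 * D n) \<longlonglongrightarrow> 1"
      using tendsto_diff[OF tendsto_const tendsto_mult_right_zero[OF D_lim, of "4 * real C0"], of 1] by simp
    have ev_up: "\<forall>\<^sub>F n in sequentially. p n \<le> 1" using ev by eventually_elim (use p_le N1(1) in auto)
    show "p \<longlonglongrightarrow> 1" by (rule tendsto_sandwich[OF ev_low ev_up lim_low tendsto_const])
  qed
  have "p \<longlonglongrightarrow> 1"
    using rate
  proof
    assume "(\<lambda>n. real (card (E n)) powr (1 / real k) / sqrt (real (min_size (E n)))) \<in> o(a)"
    then show ?thesis
    proof (rule main[unfolded r_def])
      fix n assume n: "N1 \<le> n"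
      obtain i j where ij: "i \<le> L" "j \<le> L" "a n = \<bar>(\<sigma> n i)\<^sup>2 - (\<sigma> n j)\<^sup>2\<bar>" "a n > 0" using alt[OF n] by blast
      then have "i \<noteq> j" by auto
      then show "\<exists>i\<le>L. \<exists>j\<le>L. 0 < a n \<and> i \<noteq> j \<and> (a n = l2norm (\<beta> n i - \<beta> n j) \<or> a n = (\<sigma> n i)\<^sup>2 - (\<sigma> n j)\<^sup>2)"
        using ij by (cases "0 \<le> (\<sigma> n i)\<^sup>2 - (\<sigma> n j)\<^sup>2") (force simp: abs_if)+
    qed
  next
    assume "(\<lambda>n. real (card (E n)) powr (1 / real k) / sqrt (real (min_size (E n)))) \<in> o(b)"
    then show ?thesis
    proof (rule main[unfolded r_def])
      fix n assume n: "N1 \<le> n"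
      obtain i j where ij: "i \<le> L" "j \<le> L" "b n = l2norm (\<beta> n i - \<beta> n j)" "b n > 0" using alt[OF n] by blast
      have "i \<noteq> j"
      proof
        assume "i = j"
        then have "\<beta> n i - \<beta> n j = 0\<^sub>v s" using \<beta>c[OF ij(1) n] by simp
        then show False using ij(3,4) by (simp add: l2norm_def)
      qed
      then show "\<exists>i\<le>L. \<exists>j\<le>L. 0 < b n \<and> i \<noteq> j \<and> (b n = l2norm (\<beta> n i - \<beta> n j) \<or> b n = (\<sigma> n i)\<^sup>2 - (\<sigma> n j)\<^sup>2)"
        using ij by blast
    qed
  qed
  with p_lim show ?thesis by blast
qed

end
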